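(* Let $\Gamma\subset \mathrm{PSL}_2(\mathbb{R})$ be discrete and cocompact, let $\mu>1$ with $\gamma_1=\begin{pmatrix}\sqrt{\mu}&0\\0&\sqrt{\mu}^{-1}\end{pmatrix}\in\Gamma$, and let $\Gamma_1=\langle\gamma_1\rangle$. Let $n\ge1$, and for $k=1,\dots,n$ let $f_k$ be a holomorphic modular form of weight 2 for $\Gamma$ and let $\alpha_k$ be either $\operatorname{Re}(f_k(z)dz)$ or $\operatorname{Im}(f_k(z)dz)$. Assume $\langle\gamma_1,\alpha_k\rangle=0$ for $k=1,\dots,n$. Then there is $\sigma_0$ such that for fixed $z\in\mathbb{H}$ the series $$E^{\gamma_1}_{\epsilon_1,\ldots,\epsilon_n}(z,s,\vec 0)=\sum_{\gamma\in\Gamma_1\backslash\Gamma}\prod_{k=1}^n\langle\gamma,\alpha_k\rangle\left(\frac{\operatorname{Im}(\gamma z)}{|\gamma z|}\right)^s$$ converges absolutely for $\operatorname{Re}(s)>\sigma_0$, and the function it defines has meromorphic continuation to all $s\in\mathbb{C}$ which is analytic in $\operatorname{Re}(s)>1$.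
   Context: A holomorphic modular form of weight 2 for $\Gamma$ is a holomorphic $f:\mathbb{H}\to\mathbb{C}$ with $f(\gamma z)=(cz+d)^2f(z)$ for all $\gamma=\begin{pmatrix}a&b\\c&d\end{pmatrix}\in\Gamma$. For a $\Gamma$-invariant closed 1-form $\alpha$ on $\mathbb{H}$ (such as $\operatorname{Re}(f(z)dz)$ or $\operatorname{Im}(f(z)dz)$) and $\gamma\in\Gamma$, the modular symbol is $\langle\gamma,\alpha\rangle=-2\pi i\int_{z_0}^{\gamma z_0}\alpha$, independent of $z_0\in\mathbb{H}$ and of the path; $\gamma\mapsto\langle\gamma,\alpha\rangle$ is a homomorphism, so under the hypothesis each summand depends only on the coset $\Gamma_1\gamma$. *)

theory Defs
  imports "HOL-Complex_Analysis.Complex_Analysis" "HOL-Algebra.Generated_Groups"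
begin

no_notation fps_nth (infixl "$" 75)

section \<open>The topological group $PSL_2(R)$\<close>

definition SL2R :: "(real^2^2) monoid" where
  "SL2R = \<lparr>carrier = {A. det A = 1}, mult = (**), one = mat 1\<rparr>"

definition PSL2R :: "(real^2^2) set monoid" where
  "PSL2R = SL2R Mod {mat 1, - mat 1}"

definition psl2_class :: "real^2^2 \<Rightarrow> (real^2^2) set" where
  "psl2_class A = {mat 1, - mat 1} #>\<^bsub>SL2R\<^esub> A"

text \<open>The quotient topology on a partition \<open>P\<close> of the space \<open>X\<close>: a set of classes is open iff
  the union of these classes is open in \<open>X\<close>.\<close>

definition quotient_topology :: "'a topology \<Rightarrow> 'a set set \<Rightarrow> 'a set topology" where
  "quotient_topology X P = topology (\<lambda>U. U \<subseteq> P \<and> openin X (\<Union>U))"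

definition PSL2R_topology :: "(real^2^2) set topology" where
  "PSL2R_topology = quotient_topology (top_of_set (carrier SL2R)) (carrier PSL2R)"

definition discrete_subgroup :: "(real^2^2) set set \<Rightarrow> bool" where
  "discrete_subgroup \<Gamma> \<longleftrightarrow>
     subgroup \<Gamma> PSL2R \<and> subtopology PSL2R_topology \<Gamma> = discrete_topology \<Gamma>"

definition cocompact :: "(real^2^2) set set \<Rightarrow> bool" where
  "cocompact \<Gamma> \<longleftrightarrow> compact_space (quotient_topology PSL2R_topology (rcosets\<^bsub>PSL2R\<^esub> \<Gamma>))"

lemma istopology_quotient:
  assumes "disjoint P"
  shows "istopology (\<lambda>U. U \<subseteq> P \<and> openin X (\<Union>U))"
  unfolding istopology_def
proof (intro conjI allI impI)
  fix S T assume S: "S \<subseteq> P \<and> openin X (\<Union>S)" and T: "T \<subseteq> P \<and> openin X (\<Union>T)"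
  show "S \<inter> T \<subseteq> P" using S by blast
  have "\<Union>(S \<inter> T) = \<Union>S \<inter> \<Union>T"
  proof (intro equalityI subsetI)
    fix x assume "x \<in> \<Union>S \<inter> \<Union>T"
    then obtain a b where ab: "a \<in> S" "b \<in> T" "x \<in> a" "x \<in> b" by blast
    then have "a \<in> P" "b \<in> P" using S T by auto
    then have "a = b" using ab disjointD[OF assms] by blast
    with ab show "x \<in> \<Union>(S \<inter> T)" by blast
  qed blast
  then show "openin X (\<Union>(S \<inter> T))" using S T by auto
next
  fix K assume K: "\<forall>S\<in>K. S \<subseteq> P \<and> openin X (\<Union>S)"
  show "\<Union>K \<subseteq> P" using K by blast
  have "\<Union>(\<Union>K) = \<Union>((\<lambda>S. \<Union>S) ` K)" by blast
  then show "openin X (\<Union>(\<Union>K))" using K by auto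
qed

lemma openin_quotient_topology:
  assumes "disjoint P"
  shows "openin (quotient_topology X P) U \<longleftrightarrow> U \<subseteq> P \<and> openin X (\<Union>U)"
  unfolding quotient_topology_def topology_inverse'[OF istopology_quotient[OF assms]] ..

lemma SL2R_simps [simp]:
  "carrier SL2R = {A. det A = 1}" "A \<otimes>\<^bsub>SL2R\<^esub> B = A ** B" "\<one>\<^bsub>SL2R\<^esub> = mat 1"
  by (simp_all add: SL2R_def)

lemma det_uminus_2 [simp]: "det (- A :: real^2^2) = det A"
  by (simp add: det_2)

lemma uminus_matrix_mult: "(- A :: real^2^2) ** B = - (A ** B)"
  by (simp add: matrix_matrix_mult_def vec_eq_iff sum_negf)

lemma matrix_mult_uminus: "(A :: real^2^2) ** (- B) = - (A ** B)"
  by (simp add: matrix_matrix_mult_def vec_eq_iff sum_negf)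

lemma group_SL2R: "Group.group SL2R"
proof (rule groupI)
  fix A assume "A \<in> carrier SL2R"
  then have d: "det A = 1" by simp
  then have "invertible A" by (simp add: invertible_det_nz)
  then obtain B where B: "B ** A = mat 1" by (auto simp: invertible_def)
  then have "det B * det A = 1" using det_mul[of B A] by simp
  then show "\<exists>B\<in>carrier SL2R. B \<otimes>\<^bsub>SL2R\<^esub> A = \<one>\<^bsub>SL2R\<^esub>"
    using B d by auto
qed (auto simp: det_mul matrix_mul_assoc)

lemma normal_center: "{mat 1, - mat 1} \<lhd> SL2R"
proof -
  interpret group SL2R by (rule group_SL2R)
  have "inv\<^bsub>SL2R\<^esub> (- mat 1) = - mat 1"
    by (rule inv_equality) (auto simp: uminus_matrix_mult matrix_mult_uminus)
  moreover have "inv\<^bsub>SL2R\<^esub> (mat 1) = mat 1"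
    by (rule inv_equality) auto
  ultimately have "subgroup {mat 1, - mat 1} SL2R"
    by (intro subgroup.intro) (force simp: uminus_matrix_mult matrix_mult_uminus)+
  moreover have "{mat 1, - mat 1} #>\<^bsub>SL2R\<^esub> x = x <#\<^bsub>SL2R\<^esub> {mat 1, - mat 1}" for x
    by (simp add: r_coset_def l_coset_def uminus_matrix_mult matrix_mult_uminus)
  ultimately show ?thesis
    by (intro normal.intro normal_axioms.intro group_SL2R ballI)
qed

lemma group_PSL2R: "Group.group PSL2R"
  unfolding PSL2R_def by (rule normal.factorgroup_is_group[OF normal_center])

lemma psl2_class_eq: "psl2_class A = {A, - A}"
  by (auto simp: psl2_class_def r_coset_def uminus_matrix_mult)

lemma carrier_PSL2R: "carrier PSL2R = psl2_class ` {A. det A = 1}"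
  by (auto simp: PSL2R_def carrier_FactGroup psl2_class_def)

lemma mult_PSL2R:
  assumes "det A = 1" "det B = 1"
  shows "psl2_class A \<otimes>\<^bsub>PSL2R\<^esub> psl2_class B = psl2_class (A ** B)"
  using normal.rcos_sum[OF normal_center, of A B] assms
  by (simp add: PSL2R_def psl2_class_def)

lemma disjoint_PSL2R: "disjoint (carrier PSL2R)"
  using group.rcos_disjoint[OF group_SL2R] normal_imp_subgroup[OF normal_center]
  by (auto simp: PSL2R_def FactGroup_def)

lemma openin_PSL2R_topology:
  "openin PSL2R_topology U \<longleftrightarrow>
     U \<subseteq> carrier PSL2R \<and> openin (top_of_set (carrier SL2R)) (\<Union>U)"
  unfolding PSL2R_topology_def by (rule openin_quotient_topology[OF disjoint_PSL2R])

lemma openin_cocompact_quotient: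
  assumes "subgroup \<Gamma> PSL2R"
  shows "openin (quotient_topology PSL2R_topology (rcosets\<^bsub>PSL2R\<^esub> \<Gamma>)) U \<longleftrightarrow>
    U \<subseteq> rcosets\<^bsub>PSL2R\<^esub> \<Gamma> \<and> openin PSL2R_topology (\<Union>U)"
  by (rule openin_quotient_topology[OF group.rcos_disjoint[OF group_PSL2R assms]])


section \<open>The action on the upper half-plane\<close>

definition upper_half_plane :: "complex set" (\<open>\<H>\<close>) where
  "\<H> = {z. Im z > 0}"

definition sl2_act :: "real^2^2 \<Rightarrow> complex \<Rightarrow> complex" where
  "sl2_act A = moebius (of_real (A$1$1)) (of_real (A$1$2)) (of_real (A$2$1)) (of_real (A$2$2))"

definition psl2_act :: "(real^2^2) set \<Rightarrow> complex \<Rightarrow> complex" where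
  "psl2_act g z = (THE w. \<exists>A\<in>g. w = sl2_act A z)"

definition weight2_form :: "(real^2^2) set set \<Rightarrow> (complex \<Rightarrow> complex) \<Rightarrow> bool" where
  "weight2_form \<Gamma> f \<longleftrightarrow> f holomorphic_on \<H> \<and>
     (\<forall>g\<in>\<Gamma>. \<forall>A\<in>g. \<forall>z\<in>\<H>.
        f (sl2_act A z) = (of_real (A$2$1) * z + of_real (A$2$2))^2 * f z)"

lemma sl2_act_uminus: "sl2_act (- A) z = sl2_act A z"
proof -
  have "(- a * z + - b) / (- c * z + - d) = (a * z + b) / (c * z + d)" for a b c d :: complex
  proof -
    have "(- a * z + - b) = - (a * z + b)" "(- c * z + - d) = - (c * z + d)" by simp_all
    then show ?thesis by (simp only: minus_divide_divide)
  qed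
  then show ?thesis
    unfolding sl2_act_def moebius_def vector_uminus_component of_real_minus by blast
qed

lemma psl2_act_class: "psl2_act (psl2_class A) z = sl2_act A z"
  by (auto simp: psl2_act_def psl2_class_eq sl2_act_uminus)

lemma sl2_denom_nz:
  fixes A :: "real^2^2"
  assumes "det A = 1" "z \<in> \<H>"
  shows "of_real (A$2$1) * z + of_real (A$2$2) \<noteq> 0"
proof
  assume *: "of_real (A$2$1) * z + of_real (A$2$2) = 0"
  have "Im (of_real (A$2$1) * z + of_real (A$2$2)) = 0"
    and "Re (of_real (A$2$1) * z + of_real (A$2$2)) = 0" by (simp_all add: *)
  then have "A$2$1 = 0" "A$2$2 = 0" using assms by (auto simp: upper_half_plane_def)
  then show False using assms(1) by (simp add: det_2)
qed

lemma Im_sl2_act: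
  fixes A :: "real^2^2"
  assumes "det A = 1" "z \<in> \<H>"
  shows "Im (sl2_act A z) = Im z / (cmod (of_real (A$2$1) * z + of_real (A$2$2)))^2"
proof -
  have "Im ((of_real (A$1$1) * z + of_real (A$1$2)) * cnj (of_real (A$2$1) * z + of_real (A$2$2)))
      = det A * Im z"
    by (simp add: det_2 algebra_simps)
  then show ?thesis
    using assms(1) by (simp add: sl2_act_def moebius_def Im_divide cmod_power2 algebra_simps)
qed

lemma sl2_act_in_H:
  fixes A :: "real^2^2"
  assumes "det A = 1" "z \<in> \<H>"
  shows "sl2_act A z \<in> \<H>"
  using assms Im_sl2_act[OF assms] sl2_denom_nz[OF assms]
  by (simp add: upper_half_plane_def)

lemma sl2_act_mult:
  fixes A :: "real^2^2"
  assumes "det A = 1" "det B = 1" "z \<in> \<H>"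
  shows "sl2_act (A ** B) z = sl2_act A (sl2_act B z)"
proof -
  define p where "p = of_real (B$1$1) * z + of_real (B$1$2)"
  define q where "q = of_real (B$2$1) * z + of_real (B$2$2)"
  have q: "q \<noteq> 0" using sl2_denom_nz[OF assms(2,3)] by (simp add: q_def)
  have B: "sl2_act B z = p / q" by (simp add: sl2_act_def moebius_def p_def q_def)
  have "sl2_act (A ** B) z =
      (of_real (A$1$1) * p + of_real (A$1$2) * q) / (of_real (A$2$1) * p + of_real (A$2$2) * q)"
    by (simp add: sl2_act_def moebius_def matrix_matrix_mult_def sum_2 p_def q_def algebra_simps)
  also have "\<dots> = (of_real (A$1$1) * (p / q) + of_real (A$1$2)) / (of_real (A$2$1) * (p / q) + of_real (A$2$2))"
  proof -
    have "of_real (A$1$1) * p + of_real (A$1$2) * q = (of_real (A$1$1) * (p / q) + of_real (A$1$2)) * q"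
      "of_real (A$2$1) * p + of_real (A$2$2) * q = (of_real (A$2$1) * (p / q) + of_real (A$2$2)) * q"
      using q by (simp_all add: field_simps)
    then show ?thesis using q by simp
  qed
  finally show ?thesis by (simp add: B) (simp add: sl2_act_def moebius_def)
qed


section \<open>Modular symbols\<close>

text \<open>A real 1-form, as a function of a point and a tangent vector at that point.\<close>

type_synonym one_form = "complex \<Rightarrow> complex \<Rightarrow> real"

definition Re_form :: "(complex \<Rightarrow> complex) \<Rightarrow> one_form" where
  "Re_form f = (\<lambda>z v. Re (f z * v))"

definition Im_form :: "(complex \<Rightarrow> complex) \<Rightarrow> one_form" where
  "Im_form f = (\<lambda>z v. Im (f z * v))"

definition path_integral :: "one_form \<Rightarrow> (real \<Rightarrow> complex) \<Rightarrow> real" where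
  "path_integral \<alpha> p =
     integral {0..1} (\<lambda>t. \<alpha> (p t) (vector_derivative p (at t within {0..1})))"

text \<open>The base point \<open>\<i>\<close> and the straight path are an arbitrary choice; see
  \<open>modular_symbol_independent\<close> below.\<close>

definition modular_symbol :: "(real^2^2) set \<Rightarrow> one_form \<Rightarrow> complex" where
  "modular_symbol g \<alpha> =
     - 2 * of_real pi * \<i> * of_real (path_integral \<alpha> (linepath \<i> (psl2_act g \<i>)))"

definition E_summand ::
    "nat \<Rightarrow> (nat \<Rightarrow> one_form) \<Rightarrow> complex \<Rightarrow> complex \<Rightarrow> (real^2^2) set \<Rightarrow> complex" where
  "E_summand n \<alpha> z s g = (\<Prod>k = 1..n. modular_symbol g (\<alpha> k)) *
     of_real (Im (psl2_act g z) / cmod (psl2_act g z)) powr s"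

text \<open>The right cosets $\Gamma_1\gamma$, $\gamma\in\Gamma$.\<close>

definition coset_space :: "(real^2^2) set set \<Rightarrow> (real^2^2) set set \<Rightarrow> (real^2^2) set set set" where
  "coset_space \<Gamma>1 \<Gamma> = rcosets\<^bsub>PSL2R\<lparr>carrier := \<Gamma>\<rparr>\<^esub> \<Gamma>1"

text \<open>The summand of a coset is evaluated at an arbitrary representative; by
  \<open>E_summand_coset\<close> below the choice is immaterial when the modular symbols of \<open>\<gamma>\<^sub>1\<close> vanish.\<close>

definition E_term ::
    "nat \<Rightarrow> (nat \<Rightarrow> one_form) \<Rightarrow> complex \<Rightarrow> complex \<Rightarrow> (real^2^2) set set \<Rightarrow> complex" where
  "E_term n \<alpha> z s C = E_summand n \<alpha> z s (SOME g. g \<in> C)"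

lemma open_H: "open \<H>" and convex_H: "convex \<H>" and i_in_H: "\<i> \<in> \<H>"
  by (auto simp: upper_half_plane_def open_halfspace_Im_gt convex_halfspace_Im_gt)

lemma path_integral_Re_Im:
  assumes "(f has_contour_integral I) p"
  shows "path_integral (Re_form f) p = Re I" "path_integral (Im_form f) p = Im I"
proof -
  have *: "((\<lambda>x. f (p x) * vector_derivative p (at x within {0..1})) has_integral I) {0..1}"
    using assms by (simp add: has_contour_integral_def)
  show "path_integral (Re_form f) p = Re I" "path_integral (Im_form f) p = Im I"
    using has_integral_linear[OF * bounded_linear_Re] has_integral_linear[OF * bounded_linear_Im]
    by (auto simp: path_integral_def Re_form_def Im_form_def o_def intro!: integral_unique)
qed

lemma weight2_primitive:
  assumes "weight2_form \<Gamma> f"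
  obtains F where "\<And>z. z \<in> \<H> \<Longrightarrow> (F has_field_derivative f z) (at z)"
    "\<And>A. det A = 1 \<Longrightarrow> psl2_class A \<in> \<Gamma> \<Longrightarrow>
       \<exists>c. \<forall>z\<in>\<H>. F (sl2_act A z) - F z = c"
proof -
  have hol: "f holomorphic_on \<H>" using assms by (simp add: weight2_form_def)
  obtain F where F: "\<And>z. z \<in> \<H> \<Longrightarrow> (F has_field_derivative f z) (at z)"
  proof -
    have "\<exists>g. \<forall>z\<in>\<H>. (g has_field_derivative f z) (at z within \<H>)"
      using holomorphic_convex_primitive'[OF convex_H open_H hol] by metis
    then show ?thesis using that at_within_open[OF _ open_H] by metis
  qed
  have "\<exists>c. \<forall>z\<in>\<H>. F (sl2_act A z) - F z = c"
    if A: "det A = 1" "psl2_class A \<in> \<Gamma>" for A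
  proof (rule has_field_derivative_zero_constant[OF convex_H])
    fix z assume z: "z \<in> \<H>"
    let ?j = "of_real (A$2$1) * z + of_real (A$2$2) :: complex"
    have j: "?j \<noteq> 0" using sl2_denom_nz[OF A(1) z] .
    have det: "of_real (A$1$1) * of_real (A$2$2) - of_real (A$1$2) * of_real (A$2$1) = (1::complex)"
      using A(1) by (simp add: det_2 flip: of_real_mult of_real_diff)
    have num: "of_real (A$1$1) * ?j - (of_real (A$1$1) * z + of_real (A$1$2)) * of_real (A$2$1) = 1"
      using det by (simp add: algebra_simps)
    have d: "(sl2_act A has_field_derivative 1 / ?j^2) (at z)"
      unfolding sl2_act_def moebius_def
      by (rule derivative_eq_intros refl j | simp)+
         (use j num in \<open>simp add: power2_eq_square\<close>)
    have "f (sl2_act A z) = ?j^2 * f z"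
      using assms A(2) z by (auto simp: weight2_form_def psl2_class_eq)
    with DERIV_chain2[OF F[OF sl2_act_in_H[OF A(1) z]] d] j
    have "((\<lambda>z. F (sl2_act A z)) has_field_derivative f z) (at z)"
      by simp
    from DERIV_diff[OF this F[OF z]]
    show "((\<lambda>z. F (sl2_act A z) - F z) has_field_derivative 0) (at z within \<H>)"
      by (auto intro: has_field_derivative_at_within)
  qed
  with F that show ?thesis by blast
qed

lemma modular_symbol_independent:
  assumes f: "weight2_form \<Gamma> f" and \<Gamma>: "\<Gamma> \<subseteq> carrier PSL2R" and g: "g \<in> \<Gamma>"
    and \<alpha>: "\<alpha> = Re_form f \<or> \<alpha> = Im_form f"
    and p: "valid_path p" "path_image p \<subseteq> \<H>" "pathfinish p = psl2_act g (pathstart p)"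
  shows "modular_symbol g \<alpha> = - 2 * of_real pi * \<i> * of_real (path_integral \<alpha> p)"
proof -
  obtain A where A: "det A = 1" "g = psl2_class A" using g \<Gamma> by (auto simp: carrier_PSL2R)
  obtain F where F: "\<And>z. z \<in> \<H> \<Longrightarrow> (F has_field_derivative f z) (at z)"
    and c: "\<exists>c. \<forall>z\<in>\<H>. F (sl2_act A z) - F z = c"
    using weight2_primitive[OF f] A g by metis
  then obtain c where c: "\<And>z. z \<in> \<H> \<Longrightarrow> F (sl2_act A z) - F z = c" by blast
  have I: "(f has_contour_integral c) q"
    if q: "valid_path q" "path_image q \<subseteq> \<H>" "pathfinish q = psl2_act g (pathstart q)" for q
  proof -
    have "(f has_contour_integral (F (pathfinish q) - F (pathstart q))) q"
      using F q by (intro contour_integral_primitive[of \<H>]) (auto intro: has_field_derivative_at_within)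
    moreover have "pathstart q \<in> \<H>" using q(2) pathstart_in_path_image by blast
    ultimately show ?thesis using c q(3) A by (simp add: psl2_act_class)
  qed
  have "path_image (linepath \<i> (psl2_act g \<i>)) \<subseteq> \<H>"
    using closed_segment_subset[OF i_in_H _ convex_H] sl2_act_in_H[OF A(1) i_in_H]
    by (simp add: A psl2_act_class)
  then have "(f has_contour_integral c) (linepath \<i> (psl2_act g \<i>))"
    by (intro I) auto
  from path_integral_Re_Im[OF this] path_integral_Re_Im[OF I[OF p]]
  show ?thesis using \<alpha> by (auto simp: modular_symbol_def)
qed

lemma modular_symbol_hom:
  assumes f: "weight2_form \<Gamma> f" and \<Gamma>: "subgroup \<Gamma> PSL2R" and gh: "g \<in> \<Gamma>" "h \<in> \<Gamma>"
    and \<alpha>: "\<alpha> = Re_form f \<or> \<alpha> = Im_form f"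
  shows "modular_symbol (g \<otimes>\<^bsub>PSL2R\<^esub> h) \<alpha> = modular_symbol g \<alpha> + modular_symbol h \<alpha>"
proof -
  have sub: "\<Gamma> \<subseteq> carrier PSL2R" using \<Gamma> by (rule subgroup.subset)
  obtain A where A: "det A = 1" "g = psl2_class A" using gh sub by (auto simp: carrier_PSL2R)
  obtain B where B: "det B = 1" "h = psl2_class B" using gh sub by (auto simp: carrier_PSL2R)
  have AB: "g \<otimes>\<^bsub>PSL2R\<^esub> h = psl2_class (A ** B)" "det (A ** B) = 1"
    using A B by (simp_all add: mult_PSL2R det_mul)
  have gh': "psl2_class (A ** B) \<in> \<Gamma>" using subgroup.m_closed[OF \<Gamma> gh] AB by simp
  obtain F where F: "\<And>z. z \<in> \<H> \<Longrightarrow> (F has_field_derivative f z) (at z)"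
    and c: "\<And>A. det A = 1 \<Longrightarrow> psl2_class A \<in> \<Gamma> \<Longrightarrow> \<exists>c. \<forall>z\<in>\<H>. F (sl2_act A z) - F z = c"
    using weight2_primitive[OF f] by metis
  have I: "(f has_contour_integral (F (sl2_act M \<i>) - F \<i>)) (linepath \<i> (psl2_act (psl2_class M) \<i>))"
    if "det M = 1" for M
  proof -
    have "path_image (linepath \<i> (sl2_act M \<i>)) \<subseteq> \<H>"
      using closed_segment_subset[OF i_in_H _ convex_H] sl2_act_in_H[OF that i_in_H] by simp
    then show ?thesis
      using contour_integral_primitive[of \<H> F f "linepath \<i> (sl2_act M \<i>)"] F
      by (auto simp: psl2_act_class intro: has_field_derivative_at_within)
  qed
  have "F (sl2_act A (sl2_act B \<i>)) - F (sl2_act B \<i>) = F (sl2_act A \<i>) - F \<i>"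
    using c[OF A(1)] A gh sl2_act_in_H[OF B(1) i_in_H] i_in_H by auto
  then have "F (sl2_act (A ** B) \<i>) - F \<i> = (F (sl2_act A \<i>) - F \<i>) + (F (sl2_act B \<i>) - F \<i>)"
    by (simp add: sl2_act_mult[OF A(1) B(1) i_in_H] algebra_simps)
  then have "Re (F (sl2_act (A ** B) \<i>) - F \<i>) =
        Re (F (sl2_act A \<i>) - F \<i>) + Re (F (sl2_act B \<i>) - F \<i>)"
    "Im (F (sl2_act (A ** B) \<i>) - F \<i>) =
        Im (F (sl2_act A \<i>) - F \<i>) + Im (F (sl2_act B \<i>) - F \<i>)"
    by (metis plus_complex.sel)+
  then have "path_integral \<alpha> (linepath \<i> (psl2_act (g \<otimes>\<^bsub>PSL2R\<^esub> h) \<i>)) =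
      path_integral \<alpha> (linepath \<i> (psl2_act g \<i>)) + path_integral \<alpha> (linepath \<i> (psl2_act h \<i>))"
    unfolding A(2) B(2) mult_PSL2R[OF A(1) B(1)]
    using \<alpha> path_integral_Re_Im[OF I[OF A(1)]] path_integral_Re_Im[OF I[OF B(1)]]
      path_integral_Re_Im[OF I[OF AB(2)]] by metis
  then show ?thesis
    by (simp add: modular_symbol_def distrib_left)
qed

lemma E_summand_coset:
  assumes \<Gamma>: "subgroup \<Gamma> PSL2R" and \<mu>: "\<mu> > 1"
    and g1: "\<gamma>1 = psl2_class (vector [vector [sqrt \<mu>, 0], vector [0, inverse (sqrt \<mu>)]])"
      "\<gamma>1 \<in> \<Gamma>"
    and f: "\<And>k. k \<in> {1..n} \<Longrightarrow> weight2_form \<Gamma> (f k)"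
    and \<alpha>: "\<And>k. k \<in> {1..n} \<Longrightarrow> \<alpha> k = Re_form (f k) \<or> \<alpha> k = Im_form (f k)"
    and 0: "\<And>k. k \<in> {1..n} \<Longrightarrow> modular_symbol \<gamma>1 (\<alpha> k) = 0"
    and C: "C \<in> coset_space (generate PSL2R {\<gamma>1}) \<Gamma>" "g \<in> C" and z: "z \<in> \<H>"
  shows "E_term n \<alpha> z s C = E_summand n \<alpha> z s g"
proof -
  interpret G: group PSL2R by (rule group_PSL2R)
  let ?A = "vector [vector [sqrt \<mu>, 0], vector [0, inverse (sqrt \<mu>)]] :: real^2^2"
  have dA: "det ?A = 1" using \<mu> by (simp add: det_2)
  have sub: "\<Gamma> \<subseteq> carrier PSL2R" using \<Gamma> by (rule subgroup.subset)
  have actA: "sl2_act ?A w = of_real \<mu> * w" for w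
  proof -
    have "sl2_act ?A w = of_real (sqrt \<mu> * sqrt \<mu>) * w"
      using \<mu> by (simp only: of_real_mult) (simp add: sl2_act_def moebius_def field_simps)
    then show ?thesis using \<mu> by simp
  qed
  have act_H: "psl2_act x z \<in> \<H>" if "x \<in> \<Gamma>" for x
    using that sub sl2_act_in_H z by (auto simp: carrier_PSL2R psl2_act_class)
  have step: "E_summand n \<alpha> z s (\<gamma>1 \<otimes>\<^bsub>PSL2R\<^esub> x) = E_summand n \<alpha> z s x" if x: "x \<in> \<Gamma>" for x
  proof -
    obtain B where B: "det B = 1" "x = psl2_class B" using x sub by (auto simp: carrier_PSL2R)
    have "psl2_act (\<gamma>1 \<otimes>\<^bsub>PSL2R\<^esub> x) z = of_real \<mu> * psl2_act x z"
      using B dA by (simp add: g1(1) mult_PSL2R psl2_act_class sl2_act_mult[OF dA B(1) z] actA)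
    then have "Im (psl2_act (\<gamma>1 \<otimes>\<^bsub>PSL2R\<^esub> x) z) / cmod (psl2_act (\<gamma>1 \<otimes>\<^bsub>PSL2R\<^esub> x) z) =
        Im (psl2_act x z) / cmod (psl2_act x z)"
      using \<mu> by (simp add: norm_mult)
    moreover have "modular_symbol (\<gamma>1 \<otimes>\<^bsub>PSL2R\<^esub> x) (\<alpha> k) = modular_symbol x (\<alpha> k)"
      if "k \<in> {1..n}" for k
      using modular_symbol_hom[OF f[OF that] \<Gamma> g1(2) x \<alpha>[OF that]] 0[OF that] by simp
    then have "(\<Prod>k = 1..n. modular_symbol (\<gamma>1 \<otimes>\<^bsub>PSL2R\<^esub> x) (\<alpha> k)) = (\<Prod>k = 1..n. modular_symbol x (\<alpha> k))"
      by (intro prod.cong refl)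
    ultimately show ?thesis unfolding E_summand_def by (simp only:)
  qed
  have gen: "h \<in> \<Gamma> \<and> (\<forall>x\<in>\<Gamma>. E_summand n \<alpha> z s (h \<otimes>\<^bsub>PSL2R\<^esub> x) = E_summand n \<alpha> z s x)"
    if "h \<in> generate PSL2R {\<gamma>1}" for h
    using that
  proof induction
    case one
    then show ?case using sub subgroup.one_closed[OF \<Gamma>] by auto
  next
    case (incl h)
    then show ?case using step g1(2) by auto
  next
    case (inv h)
    then have h: "h = \<gamma>1" by simp
    have i: "inv\<^bsub>PSL2R\<^esub> \<gamma>1 \<in> \<Gamma>" using subgroup.m_inv_closed[OF \<Gamma> g1(2)] .
    have "E_summand n \<alpha> z s (inv\<^bsub>PSL2R\<^esub> \<gamma>1 \<otimes>\<^bsub>PSL2R\<^esub> x) = E_summand n \<alpha> z s x" if x: "x \<in> \<Gamma>" for x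
    proof -
      have "\<gamma>1 \<otimes>\<^bsub>PSL2R\<^esub> (inv\<^bsub>PSL2R\<^esub> \<gamma>1 \<otimes>\<^bsub>PSL2R\<^esub> x) = x"
        using x g1(2) sub by (simp add: subset_iff flip: G.m_assoc)
      then show ?thesis using step[OF subgroup.m_closed[OF \<Gamma> i x]] by simp
    qed
    then show ?case using h i by auto
  next
    case (eng h1 h2)
    then have "E_summand n \<alpha> z s (h1 \<otimes>\<^bsub>PSL2R\<^esub> h2 \<otimes>\<^bsub>PSL2R\<^esub> x) = E_summand n \<alpha> z s x"
      if x: "x \<in> \<Gamma>" for x
      using x sub subgroup.m_closed[OF \<Gamma>] by (simp add: G.m_assoc subset_iff)
    then show ?case using eng subgroup.m_closed[OF \<Gamma>] by auto
  qed
  obtain a where a: "a \<in> \<Gamma>" "C = (\<Union>h\<in>generate PSL2R {\<gamma>1}. {h \<otimes>\<^bsub>PSL2R\<^esub> a})"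
    using C(1) by (auto simp: coset_space_def RCOSETS_def r_coset_def)
  have "E_summand n \<alpha> z s x = E_summand n \<alpha> z s a" if "x \<in> C" for x
    using that gen a by auto
  then show ?thesis using C(2) someI[of "\<lambda>x. x \<in> C" g] unfolding E_term_def by metis
qed

end

theory Submission
  imports Defs
begin

text \<open>
  Since the modular symbol of \<open>\<gamma>\<^sub>1\<close> vanishes, each \<open>\<alpha>\<^sub>k\<close> has a \<open>\<Gamma>\<^sub>1\<close>-invariant primitive \<open>A\<^sub>k\<close>, it changes by a
  constant under each element of \<open>\<Gamma>\<close>, and by cocompactness it grows more slowly than any negative power of
  \<open>h(z) = Im z / |z|\<close>. Expanding \<open>\<Prod>\<^sub>k (A\<^sub>k(\<gamma>z) - A\<^sub>k(z))\<close> reduces the theorem to the series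
  \<open>E\<^sub>S(s, z) = \<Sum>\<^sub>\<gamma> (\<Prod>\<^sub>k\<^sub>\<in>\<^sub>S A\<^sub>k(\<gamma>z)) h(\<gamma>z)\<^sup>s\<close>, which are invariant under \<open>\<Gamma>\<close>.

  Let \<open>L\<close> be the convolution with a point-pair kernel supported in a small hyperbolic disc. A Taylor expansion gives
  \<open>L h\<^sup>s = a\<^sub>0(s) h\<^sup>s + a\<^sub>1(s) h\<^sup>s\<^sup>+\<^sup>2 + \<dots>\<close> with entire \<open>a\<^sub>j\<close>. Hence \<open>(a\<^sub>0(s) - L) E\<^sub>S(s)\<close> is a combination of the
  \<open>E\<^sub>S(s + 2j)\<close> with \<open>j > 0\<close>, of integral operators with the \<open>\<Gamma>\<close>-invariant kernels
  \<open>k(z, w) \<Prod>\<^sub>k\<^sub>\<in>\<^sub>T (A\<^sub>k(z) - A\<^sub>k(w))\<close> applied to \<open>E\<^sub>S\<^sub>-\<^sub>T(s)\<close> for nonempty \<open>T\<close>, and of a remainder series converging further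
  to the left. As \<open>\<Gamma>\<close> is cocompact, \<open>L\<close> is a small perturbation of an operator of finite rank on bounded invariant
  functions, so \<open>a\<^sub>0(s) - L\<close> can be inverted meromorphically on half-strips \<open>Re s > c, |Im s| < T\<close>, where \<open>a\<^sub>0\<close> is
  bounded away from zero once the disc is small. Induction on the strip and on \<open>S\<close> gives the continuation.
\<close>

section \<open>Hyperbolic distance and the cross-section function\<close>

text \<open>The averaging operator is preferred to the Laplacian because it is bounded and needs
  only continuity of the primitives. Its price is that the eigenvalue \<open>a\<^sub>0\<close> is an
  entire function without a usable lower bound on the whole plane. For |Im s| < T a disc of
  hyperbolic radius of order 1/T keeps the phase of Im(w)^s within one radian, so
  \<open>a\<^sub>0\<close> stays away from 0 there; hence one disc per strip, and a gluing at the
  end. Outside Re s > 1 there is no series to speak of, so the Fredholm step does not construct an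
  inverse. It says that every bounded solution u of the averaged equation satisfies d u = y, with d
  and y holomorphic on the strip; where the series converges it is such a solution, and y / d
  continues it. That d is not identically zero is seen far to the right, where
  |\<open>a\<^sub>0\<close>| exceeds the total mass of the kernel, which bounds the norm of
  \<open>L\<close>. Only even shifts occur in the expansion because the reflection in the imaginary
  axis preserves the disc around \<i>. Each induction step therefore moves the edge of the strip by
  2. Products of primitives cost no convergence, so that 1 remains the abscissa for every subset
  S.\<close>

definition hyp :: "complex \<Rightarrow> complex \<Rightarrow> real" where
  "hyp z w = (cmod (z - w))^2 / (Im z * Im w)"

text \<open>The sine of the argument of \<open>z\<close>, and 1 / cosh of the distance from
  \<open>z\<close> to the imaginary axis, which is the axis of \<open>\<gamma>1\<close>. It is the
  base of the power in \<open>E_summand\<close>.\<close>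

definition ht :: "complex \<Rightarrow> real" where
  "ht z = Im z / cmod z"

lemma H_iff: "z \<in> \<H> \<longleftrightarrow> Im z > 0"
  by (simp add: upper_half_plane_def)

lemma hyp_nonneg: "z \<in> \<H> \<Longrightarrow> w \<in> \<H> \<Longrightarrow> 0 \<le> hyp z w"
  by (simp add: hyp_def H_iff)

lemma hyp_sym: "hyp z w = hyp w z"
  by (simp add: hyp_def norm_minus_commute mult.commute)

lemma hyp_self [simp]: "hyp z z = 0"
  by (simp add: hyp_def)

lemma hyp_eq: "z \<in> \<H> \<Longrightarrow> w \<in> \<H> \<Longrightarrow> (cmod (z - w))^2 = hyp z w * (Im z * Im w)"
  by (simp add: hyp_def H_iff)

text \<open>If d is the hyperbolic distance, then \<open>hyp\<close> is 2 cosh d - 2, and a ratio of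
  imaginary parts is at most exp d \<le> 2 cosh d. The computation uses only (Im z - Im w)^2 \<le>
  |z - w|^2.\<close>

lemma Im_ratio:
  assumes "z \<in> \<H>" "w \<in> \<H>"
  shows "Im z \<le> (hyp z w + 2) * Im w"
proof -
  have p: "Im z > 0" "Im w > 0" using assms by (auto simp: H_iff)
  have "(Im z - Im w)^2 \<le> (cmod (z - w))^2"
    using abs_Im_le_cmod[of "z - w"] by (metis abs_ge_zero minus_complex.sel(2) power2_abs power_mono)
  also have "\<dots> = hyp z w * (Im z * Im w)" using hyp_eq[OF assms] .
  finally have "Im z * Im z + Im w * Im w \<le> (hyp z w + 2) * (Im z * Im w)"
    by (simp add: power2_eq_square algebra_simps)
  then have "Im z * Im z \<le> ((hyp z w + 2) * Im w) * Im z"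
    using p by (smt (verit, best) mult.assoc mult.commute mult_pos_pos)
  then show ?thesis using p by simp
qed

text \<open>Replaces the triangle inequality without leaving rational expressions. What matters
  later is only that steps of bounded \<open>hyp\<close> compose to a step of bounded
  \<open>hyp\<close>.\<close>

lemma hyp_quasi_triangle:
  assumes "z \<in> \<H>" "w \<in> \<H>" "v \<in> \<H>"
  shows "hyp z v \<le> 4 * (hyp z w + 2) * (hyp w v + 2)"
proof -
  have p: "Im z > 0" "Im w > 0" "Im v > 0" using assms by (auto simp: H_iff)
  have n: "hyp z w \<ge> 0" "hyp w v \<ge> 0" using assms hyp_nonneg by auto
  have "cmod (z - v) \<le> cmod (z - w) + cmod (w - v)"
    using norm_triangle_ineq[of "z - w" "w - v"] by simp
  then have "(cmod (z - v))^2 \<le> (cmod (z - w) + cmod (w - v))^2"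
    by (intro power_mono) auto
  also have "\<dots> \<le> 2 * (cmod (z - w))^2 + 2 * (cmod (w - v))^2"
    using zero_le_power2[of "cmod (z - w) - cmod (w - v)"]
    by (simp add: power2_eq_square algebra_simps)
  also have "\<dots> = 2 * (hyp z w * Im z * Im w) + 2 * (hyp w v * Im w * Im v)"
    using hyp_eq[OF assms(1,2)] hyp_eq[OF assms(2,3)] by simp
  also have "\<dots> \<le> 2 * (hyp z w * Im z * ((hyp w v + 2) * Im v)) + 2 * (hyp w v * ((hyp z w + 2) * Im z) * Im v)"
    using Im_ratio[OF assms(2,3)] Im_ratio[OF assms(2,1)] p n
    by (intro add_mono mult_left_mono mult_right_mono) (auto simp: hyp_sym)
  also have "\<dots> \<le> (4 * (hyp z w + 2) * (hyp w v + 2)) * (Im z * Im v)"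
  proof -
    have "2 * (hyp z w * (hyp w v + 2)) + 2 * (hyp w v * (hyp z w + 2)) \<le> 4 * (hyp z w + 2) * (hyp w v + 2)"
      using n by (simp add: algebra_simps)
    from mult_right_mono[OF this, of "Im z * Im v"] show ?thesis
      using p by (simp add: algebra_simps)
  qed
  finally show ?thesis using p by (simp add: hyp_def divide_le_eq)
qed

lemma hyp_chain:
  assumes "z \<in> \<H>" "w \<in> \<H>" "v \<in> \<H>" "hyp z w \<le> a" "hyp w v \<le> b"
  shows "hyp z v \<le> 4 * (a + 2) * (b + 2)"
proof -
  have "hyp z v \<le> 4 * (hyp z w + 2) * (hyp w v + 2)" using hyp_quasi_triangle assms by blast
  also have "\<dots> \<le> 4 * (a + 2) * (b + 2)"
    using assms hyp_nonneg[of z w] hyp_nonneg[of w v] by (intro mult_mono) auto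
  finally show ?thesis .
qed

lemma sl2_act_diff:
  fixes A :: "real^2^2"
  assumes "det A = 1" "z \<in> \<H>" "w \<in> \<H>"
  shows "sl2_act A z - sl2_act A w =
    (z - w) / ((of_real (A$2$1) * z + of_real (A$2$2)) * (of_real (A$2$1) * w + of_real (A$2$2)))"
proof -
  let ?j = "\<lambda>z. of_real (A$2$1) * z + of_real (A$2$2) :: complex"
  have nz: "?j z \<noteq> 0" "?j w \<noteq> 0" using sl2_denom_nz assms by auto
  have det: "complex_of_real (A$1$1) * of_real (A$2$2) - of_real (A$1$2) * of_real (A$2$1) = 1"
    using assms(1) by (simp add: det_2 flip: of_real_mult of_real_diff)
  have "(of_real (A$1$1) * z + of_real (A$1$2)) * ?j w - (of_real (A$1$1) * w + of_real (A$1$2)) * ?j z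
     = (complex_of_real (A$1$1) * of_real (A$2$2) - of_real (A$1$2) * of_real (A$2$1)) * (z - w)"
    by (simp add: algebra_simps)
  then show ?thesis using nz unfolding sl2_act_def moebius_def det
    by (simp add: diff_frac_eq)
qed

lemma hyp_sl2_act:
  fixes A :: "real^2^2"
  assumes "det A = 1" "z \<in> \<H>" "w \<in> \<H>"
  shows "hyp (sl2_act A z) (sl2_act A w) = hyp z w"
proof -
  let ?j = "\<lambda>z. of_real (A$2$1) * z + of_real (A$2$2) :: complex"
  have nz: "cmod (?j z) \<noteq> 0" "cmod (?j w) \<noteq> 0" using sl2_denom_nz assms by auto
  show ?thesis
    unfolding hyp_def sl2_act_diff[OF assms] Im_sl2_act[OF assms(1,2)] Im_sl2_act[OF assms(1,3)]
    using nz by (simp add: norm_divide norm_mult power_mult_distrib power_divide)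
qed

lemma ht_pos: "z \<in> \<H> \<Longrightarrow> ht z > 0"
  by (auto simp: ht_def H_iff intro!: divide_pos_pos)

lemma ht_le_1: "ht z \<le> 1"
  using abs_Im_le_cmod[of z] by (auto simp: ht_def divide_le_eq_1)

text \<open>Both parts of the quotient vary by bounded factors: the imaginary part by
  \<open>Im_ratio\<close>, and the modulus because |z - w| is at most a multiple of Im w, hence of
  |w|.\<close>

lemma ht_harnack:
  assumes "z \<in> \<H>" "w \<in> \<H>"
  shows "ht w \<le> (hyp z w + 2) * (hyp z w + 3) * ht z"
proof -
  let ?h = "hyp z w"
  have p: "Im z > 0" "Im w > 0" "cmod z > 0" "cmod w > 0" using assms by (auto simp: H_iff)
  have n: "?h \<ge> 0" using assms hyp_nonneg by auto
  have r: "Im w \<le> (?h + 2) * Im z" "Im z \<le> (?h + 2) * Im w"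
    using Im_ratio[OF assms] Im_ratio[OF assms(2,1)] by (auto simp: hyp_sym)
  have "(cmod (z - w))^2 = ?h * (Im z * Im w)" using hyp_eq[OF assms] .
  also have "\<dots> \<le> (?h + 2) * (((?h + 2) * Im w) * Im w)"
    using r p n by (intro mult_mono) auto
  also have "\<dots> = ((?h + 2) * Im w)^2" by (simp add: power2_eq_square)
  finally have "cmod (z - w) \<le> (?h + 2) * Im w"
    by (rule power2_le_imp_le) (use p n in simp)
  also have "\<dots> \<le> (?h + 2) * cmod w" using n abs_Im_le_cmod[of w] by (intro mult_left_mono) auto
  finally have c: "cmod z \<le> (?h + 3) * cmod w"
    using norm_triangle_ineq[of "z - w" w] by (simp add: algebra_simps)
  have "Im w * cmod z \<le> ((?h + 2) * Im z) * ((?h + 3) * cmod w)"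
    using r c p n by (intro mult_mono) auto
  then show ?thesis using p by (simp add: ht_def field_simps)
qed

lemma continuous_on_hyp:
  assumes "continuous_on X f" "continuous_on X g" "\<And>x. x \<in> X \<Longrightarrow> f x \<in> \<H>" "\<And>x. x \<in> X \<Longrightarrow> g x \<in> \<H>"
  shows "continuous_on X (\<lambda>x. hyp (f x) (g x))"
  unfolding hyp_def using assms(3,4)
  by (intro continuous_intros assms(1,2)) (fastforce simp: H_iff)

lemma sl2_act_derivative:
  fixes A :: "real^2^2"
  assumes A: "det A = 1" and z: "z \<in> \<H>"
  shows "(sl2_act A has_field_derivative 1 / (of_real (A$2$1) * z + of_real (A$2$2))^2) (at z)"
proof -
  let ?j = "of_real (A$2$1) * z + of_real (A$2$2) :: complex"
  have j: "?j \<noteq> 0" using sl2_denom_nz[OF A z] .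
  have det: "of_real (A$1$1) * of_real (A$2$2) - of_real (A$1$2) * of_real (A$2$1) = (1::complex)"
    using A by (simp add: det_2 flip: of_real_mult of_real_diff)
  have num: "of_real (A$1$1) * ?j - (of_real (A$1$1) * z + of_real (A$1$2)) * of_real (A$2$1) = 1"
    using det by (simp add: algebra_simps)
  show ?thesis
    unfolding sl2_act_def moebius_def
    by (rule derivative_eq_intros refl j | simp)+
       (use j num in \<open>simp add: power2_eq_square\<close>)
qed

lemma continuous_on_sl2_act: "det A = 1 \<Longrightarrow> continuous_on \<H> (sl2_act A)"
  by (rule DERIV_continuous_on[OF has_field_derivative_at_within[OF sl2_act_derivative]])

section \<open>The invariant measure\<close>

definition cx :: "real^2 \<Rightarrow> complex" where
  "cx p = Complex (p$1) (p$2)"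

definition rv :: "complex \<Rightarrow> real^2" where
  "rv w = vector [Re w, Im w]"

lemma cx_rv [simp]: "cx (rv w) = w" and rv_cx [simp]: "rv (cx p) = p"
  by (auto simp: cx_def rv_def vec_eq_iff forall_2)

lemma bounded_linear_cx: "bounded_linear cx"
  by (intro linear_conv_bounded_linear[THEN iffD1] linearI) (auto simp: cx_def complex_eq_iff)

lemma bounded_linear_rv: "bounded_linear rv"
  by (intro linear_conv_bounded_linear[THEN iffD1] linearI) (auto simp: rv_def vec_eq_iff forall_2)

lemma continuous_cx: "continuous_on X cx"
  by (intro linear_continuous_on bounded_linear_cx)

definition half :: "(real^2) set" where
  "half = {p. p$2 > 0}"

lemma open_half: "open half"
  unfolding half_def by (intro open_Collect_less continuous_intros)

lemma half_sets [measurable]: "half \<in> sets borel"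
  using open_half by auto

text \<open>Hyperbolic area dx dy / y^2. It is built on \<open>real^2\<close> and carried over by
  \<open>cx\<close>, because the change of variables theorem used below is stated for
  \<open>real^n\<close>.\<close>

definition hmeas :: "complex measure" where
  "hmeas = distr (density (restrict_space lborel half) (\<lambda>p. ennreal (1 / (p$2)^2))) (restrict_space borel \<H>) cx"

lemma space_hmeas [simp]: "space hmeas = \<H>"
  and sets_hmeas [measurable_cong]: "sets hmeas = sets (restrict_space borel \<H>)"
  by (auto simp: hmeas_def space_restrict_space)

lemma cx_measurable: "cx \<in> restrict_space lborel half \<rightarrow>\<^sub>M restrict_space borel \<H>"
  by (rule measurable_restrict_space3)
     (auto simp: cx_def half_def H_iff intro!: borel_measurable_continuous_onI continuous_cx[unfolded cx_def])

lemma emeasure_hmeas: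
  assumes "B \<in> sets hmeas"
  shows "emeasure hmeas B = (\<integral>\<^sup>+p. ennreal (1 / (p$2)^2) * indicator B (cx p) * indicator half p \<partial>lborel)"
proof -
  have B: "B \<in> sets (restrict_space borel \<H>)" using assms sets_hmeas by simp
  have m [measurable]: "(\<lambda>p::real^2. ennreal (1 / (p$2)^2)) \<in> borel_measurable (restrict_space lborel half)"
    by (intro measurable_restrict_space1) measurable
  have c: "cx -` B \<inter> half \<in> sets (restrict_space lborel half)"
    using measurable_sets[OF cx_measurable B] by (simp add: space_restrict_space)
  have "emeasure hmeas B = emeasure (density (restrict_space lborel half) (\<lambda>p. ennreal (1 / (p$2)^2))) (cx -` B \<inter> half)"
    unfolding hmeas_def using cx_measurable B
    by (subst emeasure_distr) (auto simp: space_restrict_space)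
  also have "\<dots> = (\<integral>\<^sup>+p. ennreal (1 / (p$2)^2) * indicator (cx -` B \<inter> half) p \<partial>restrict_space lborel half)"
    by (subst emeasure_density[OF m c]) simp
  also have "\<dots> = (\<integral>\<^sup>+p. ennreal (1 / (p$2)^2) * indicator B (cx p) * indicator half p \<partial>lborel)"
    by (subst nn_integral_restrict_space) (auto intro!: nn_integral_cong simp: indicator_def)
  finally show ?thesis .
qed

lemma set_integrable_vec_1:
  fixes F :: "real^2 \<Rightarrow> real"
  shows "(\<lambda>p. vec (F p) :: real^1) absolutely_integrable_on S \<longleftrightarrow> F absolutely_integrable_on S"
  by (simp add: absolutely_integrable_on_1_iff)

text \<open>The general theorem has vector-valued integrands, hence the detour through
  \<open>real^1\<close>. Integrability and value are transferred together, by an equivalence for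
  each \<open>b\<close>.\<close>

lemma change_of_variables_half:
  fixes F :: "real^2 \<Rightarrow> real" and g :: "real^2 \<Rightarrow> real^2"
  assumes der_g: "\<And>x. x \<in> half \<Longrightarrow> (g has_derivative g' x) (at x within half)"
    and inj: "inj_on g half" and img: "g ` half = half"
  shows "(\<lambda>x. \<bar>det (matrix (g' x))\<bar> * F (g x)) absolutely_integrable_on half \<and>
           integral half (\<lambda>x. \<bar>det (matrix (g' x))\<bar> * F (g x)) = b
     \<longleftrightarrow> F absolutely_integrable_on half \<and> integral half F = b"
proof -
  have S: "half \<in> sets lebesgue" by (simp add: lmeasurable_iff_integrable borel_open open_half)
  have v: "\<bar>a\<bar> *\<^sub>R vec c = (vec (\<bar>a\<bar> * c) :: real^1)" for a c :: real by (simp add: vec_eq_iff)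
  show ?thesis
    using has_absolute_integral_change_of_variables[OF S der_g inj, of "\<lambda>p. vec (F p) :: real^1" "vec b"]
    unfolding img v set_integrable_vec_1
    by (auto simp: integral_vec1_eq absolutely_integrable_on_def o_def integral_on_1_eq)
qed

lemma nn_integral_half:
  fixes F :: "real^2 \<Rightarrow> real"
  assumes m: "(\<lambda>p. indicator half p * F p) \<in> borel_measurable borel" and n: "\<And>p. p \<in> half \<Longrightarrow> F p \<ge> 0"
  shows "F absolutely_integrable_on half \<longleftrightarrow> (\<integral>\<^sup>+p. ennreal (indicator half p * F p) \<partial>lborel) < \<infinity>"
    and "F absolutely_integrable_on half \<Longrightarrow> (\<integral>\<^sup>+p. ennreal (indicator half p * F p) \<partial>lborel) = ennreal (integral half F)"
proof -
  let ?f = "\<lambda>p. indicator half p * F p"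
  have n': "?f p \<ge> 0" for p using n by (auto simp: indicator_def)
  have 1: "F absolutely_integrable_on half \<longleftrightarrow> integrable lborel ?f"
    unfolding set_integrable_def using integrable_completion[of ?f lborel] m by simp
  show "F absolutely_integrable_on half \<longleftrightarrow> (\<integral>\<^sup>+p. ennreal (?f p) \<partial>lborel) < \<infinity>"
    unfolding 1 using m n' by (simp add: integrable_iff_bounded)
  assume "F absolutely_integrable_on half"
  then have i: "integrable lborel ?f" using 1 by simp
  have "(\<integral>\<^sup>+p. ennreal (?f p) \<partial>lborel) = ennreal (integral\<^sup>L lborel ?f)"
    by (rule nn_integral_eq_integral[OF i]) (use n' in auto)
  also have "integral\<^sup>L lborel ?f = integral half F"
    using set_borel_integral_eq_integral(2)[of half F] i by (simp add: set_integrable_def set_lebesgue_integral_def)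
  finally show "(\<integral>\<^sup>+p. ennreal (?f p) \<partial>lborel) = ennreal (integral half F)" .
qed

lemma measurable_act_hmeas:
  assumes "continuous_on \<H> \<phi>" "\<phi> ` \<H> \<subseteq> \<H>"
  shows "\<phi> \<in> hmeas \<rightarrow>\<^sub>M hmeas"
proof -
  have "\<phi> \<in> borel_measurable (restrict_space borel \<H>)"
    using assms(1) by (rule borel_measurable_continuous_on_restrict)
  then have "\<phi> \<in> restrict_space borel \<H> \<rightarrow>\<^sub>M restrict_space borel \<H>"
    using assms(2) by (intro measurable_restrict_space2) (auto simp: space_restrict_space)
  then show ?thesis by (simp add: measurable_def sets_hmeas space_restrict_space)
qed

lemma hmeas_density_measurable:
  assumes "B \<in> sets hmeas"
  shows "(\<lambda>p. indicator half p * (indicator B (cx p) * (1 / (p$2)^2)) :: real) \<in> borel_measurable borel"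
proof -
  have "B \<in> sets (restrict_space borel \<H>)" using assms sets_hmeas by simp
  then have [measurable]: "B \<in> sets borel"
    using open_H by (simp add: sets_restrict_space_iff)
  have [measurable]: "cx \<in> borel_measurable borel"
    by (intro borel_measurable_continuous_onI continuous_cx)
  show ?thesis by measurable
qed

text \<open>The Jacobian (Im \<phi>(z) / Im z)^2 is exactly what the density 1 / y^2 absorbs. The
  derivative is a real-linear map so that the orientation-reversing reflection is covered along with
  the Moebius maps.\<close>

lemma emeasure_hmeas_vimage:
  assumes der: "\<And>z. z \<in> \<H> \<Longrightarrow> (\<phi> has_derivative D z) (at z)"
    and det: "\<And>z. z \<in> \<H> \<Longrightarrow> \<bar>det (matrix (\<lambda>v. rv (D z (cx v))))\<bar> = (Im (\<phi> z) / Im z)^2"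
    and bij: "bij_betw \<phi> \<H> \<H>" and B: "B \<in> sets hmeas"
  shows "emeasure hmeas (\<phi> -` B \<inter> \<H>) = emeasure hmeas B"
proof -
  have cont: "continuous_on \<H> \<phi>"
    by (rule has_derivative_continuous_on[OF has_derivative_at_withinI[OF der]])
  have \<phi>: "\<phi> ` \<H> = \<H>" using bij by (simp add: bij_betw_def)
  have B': "\<phi> -` B \<inter> \<H> \<in> sets hmeas"
    using measurable_sets[OF measurable_act_hmeas[OF cont] B] \<phi> by simp
  define F where "F B p = (indicator B (cx p) * (1 / (p$2)^2) :: real)" for B p
  have em: "emeasure hmeas C = (\<integral>\<^sup>+p. ennreal (indicator half p * F C p) \<partial>lborel)" if "C \<in> sets hmeas" for C
    unfolding emeasure_hmeas[OF that]
    by (intro nn_integral_cong) (auto simp: F_def indicator_def half_def)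
  have nn: "F C absolutely_integrable_on half \<longleftrightarrow> emeasure hmeas C < \<infinity>"
     "F C absolutely_integrable_on half \<Longrightarrow> emeasure hmeas C = ennreal (integral half (F C))"
     if "C \<in> sets hmeas" for C
    using nn_integral_half[of "F C"] hmeas_density_measurable[OF that] unfolding em[OF that]
    by (auto simp: F_def)
  define g where "g = rv \<circ> \<phi> \<circ> cx"
  have cxH: "cx x \<in> \<H> \<longleftrightarrow> x \<in> half" for x by (simp add: cx_def half_def H_iff)
  have rvH: "rv z \<in> half \<longleftrightarrow> z \<in> \<H>" for z using cxH[of "rv z"] by simp
  have der_g: "(g has_derivative (\<lambda>v. rv (D (cx x) (cx v)))) (at x within half)" if "x \<in> half" for x
  proof -
    have "((\<lambda>x. \<phi> (cx x)) has_derivative (\<lambda>v. D (cx x) (cx v))) (at x within half)"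
      using has_derivative_compose[OF bounded_linear_imp_has_derivative[OF bounded_linear_cx] der[of "cx x"]] that cxH
      by auto
    from bounded_linear.has_derivative[OF bounded_linear_rv this]
    show ?thesis by (simp add: g_def o_def)
  qed
  have inj: "inj_on g half"
  proof (rule inj_onI)
    fix x y assume xy: "x \<in> half" "y \<in> half" "g x = g y"
    then have "\<phi> (cx x) = \<phi> (cx y)" unfolding g_def using cx_rv by (metis comp_apply)
    then have "cx x = cx y" using xy cxH bij by (auto simp: bij_betw_def inj_on_def)
    then show "x = y" using rv_cx by metis
  qed
  have img: "g ` half = half"
  proof -
    have "cx ` half = \<H>" using cxH rvH by (metis cx_rv image_iff subsetI subset_antisym image_subsetI)
    moreover have "rv ` \<H> = half" using cxH rvH by (metis rv_cx image_iff subsetI subset_antisym image_subsetI)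
    ultimately show ?thesis unfolding g_def by (simp only: image_comp[symmetric] \<phi>)
  qed
  have eq: "\<bar>det (matrix (\<lambda>v. rv (D (cx x) (cx v))))\<bar> * F B (g x) = F (\<phi> -` B \<inter> \<H>) x" if "x \<in> half" for x
  proof -
    have x: "cx x \<in> \<H>" using that cxH by simp
    then have "Im (\<phi> (cx x)) > 0" using \<phi> by (auto simp: H_iff)
    moreover have "(rv (\<phi> (cx x)))$2 = Im (\<phi> (cx x))" by (simp add: rv_def)
    moreover have "x$2 = Im (cx x)" by (simp add: cx_def)
    ultimately show ?thesis using x unfolding det[OF x] F_def g_def
      by (auto simp: indicator_def power_divide)
  qed
  have iff: "F (\<phi> -` B \<inter> \<H>) absolutely_integrable_on half \<and> integral half (F (\<phi> -` B \<inter> \<H>)) = b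
     \<longleftrightarrow> F B absolutely_integrable_on half \<and> integral half (F B) = b" for b
  proof -
    have "(\<lambda>x. \<bar>det (matrix (\<lambda>v. rv (D (cx x) (cx v))))\<bar> * F B (g x)) absolutely_integrable_on half \<longleftrightarrow>
       F (\<phi> -` B \<inter> \<H>) absolutely_integrable_on half"
      by (intro set_integrable_cong refl) (simp add: eq)
    moreover have "integral half (\<lambda>x. \<bar>det (matrix (\<lambda>v. rv (D (cx x) (cx v))))\<bar> * F B (g x)) =
       integral half (F (\<phi> -` B \<inter> \<H>))"
      by (intro integral_cong) (simp add: eq)
    ultimately show ?thesis using change_of_variables_half[OF der_g inj img, of "F B" b] by simp
  qed
  show ?thesis
  \<comment> \<open>The change of variables speaks of integrable densities only. In the other case
    both densities fail to be integrable and both measures are infinite.\<close>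
  proof (cases "F B absolutely_integrable_on half")
    case True
    then show ?thesis using iff[of "integral half (F B)"] nn[OF B] nn[OF B'] by metis
  next
    case False
    then have "\<not> F (\<phi> -` B \<inter> \<H>) absolutely_integrable_on half" using iff by metis
    then show ?thesis using False nn(1)[OF B] nn(1)[OF B'] by (simp flip: top.not_eq_extremum)
  qed
qed

lemma distr_hmeas:
  assumes der: "\<And>z. z \<in> \<H> \<Longrightarrow> (\<phi> has_derivative D z) (at z)"
    and det: "\<And>z. z \<in> \<H> \<Longrightarrow> \<bar>det (matrix (\<lambda>v. rv (D z (cx v))))\<bar> = (Im (\<phi> z) / Im z)^2"
    and bij: "bij_betw \<phi> \<H> \<H>"
  shows "distr hmeas hmeas \<phi> = hmeas"
proof (rule measure_eqI)
  fix B assume "B \<in> sets (distr hmeas hmeas \<phi>)"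
  then have B: "B \<in> sets hmeas" by simp
  have "continuous_on \<H> \<phi>"
    by (rule has_derivative_continuous_on[OF has_derivative_at_withinI[OF der]])
  then have "\<phi> \<in> hmeas \<rightarrow>\<^sub>M hmeas"
    using bij by (intro measurable_act_hmeas) (auto simp: bij_betw_def)
  then show "emeasure (distr hmeas hmeas \<phi>) B = emeasure hmeas B"
    using emeasure_hmeas_vimage[OF der det bij B] B by (simp add: emeasure_distr)
qed simp

lemma bij_sl2_act:
  fixes A :: "real^2^2"
  assumes A: "det A = 1"
  shows "bij_betw (sl2_act A) \<H> \<H>"
proof -
  have "invertible A" using A by (simp add: invertible_det_nz)
  then obtain B where B: "B ** A = mat 1" "A ** B = mat 1" by (auto simp: invertible_def)
  then have dB: "det B = 1" using det_mul[of B A] A by simp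
  have one: "sl2_act (mat 1) z = z" for z by (simp add: sl2_act_def moebius_def mat_def)
  show ?thesis
  proof (rule bij_betw_byWitness[where f' = "sl2_act B"])
    show "\<forall>z\<in>\<H>. sl2_act B (sl2_act A z) = z" using sl2_act_mult[OF dB A] B one by auto
    show "\<forall>z\<in>\<H>. sl2_act A (sl2_act B z) = z" using sl2_act_mult[OF A dB] B one by auto
  qed (auto intro: sl2_act_in_H[OF A] sl2_act_in_H[OF dB])
qed

lemma det_matrix_complex_mult: "det (matrix (\<lambda>v. rv (a * cx v))) = (cmod a)^2"
  by (simp add: det_2 matrix_def cx_def rv_def axis_def cmod_power2) (simp add: power2_eq_square)

lemma distr_sl2_act:
  fixes A :: "real^2^2"
  assumes A: "det A = 1"
  shows "distr hmeas hmeas (sl2_act A) = hmeas"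
proof (rule distr_hmeas)
  let ?j = "\<lambda>z. of_real (A$2$1) * z + of_real (A$2$2) :: complex"
  fix z assume z: "z \<in> \<H>"
  show "(sl2_act A has_derivative (*) (1 / (?j z)^2)) (at z)"
    using sl2_act_derivative[OF A z] by (simp add: has_field_derivative_def)
  show "\<bar>det (matrix (\<lambda>v. rv (1 / (?j z)^2 * cx v)))\<bar> = (Im (sl2_act A z) / Im z)^2"
    unfolding det_matrix_complex_mult Im_sl2_act[OF A z] using z
    by (simp add: norm_divide norm_power H_iff)
qed (rule bij_sl2_act[OF A])

text \<open>Symmetry under the reflection in the imaginary axis; it serves to annihilate the odd
  moments in \<open>moment_odd\<close>.\<close>

lemma distr_reflect: "distr hmeas hmeas (\<lambda>z. - cnj z) = hmeas"
proof (rule distr_hmeas)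
  fix z assume z: "z \<in> \<H>"
  show "((\<lambda>z. - cnj z) has_derivative (\<lambda>z. - cnj z)) (at z)"
    by (auto intro!: derivative_eq_intros)
  show "\<bar>det (matrix (\<lambda>v. rv (- cnj (cx v))))\<bar> = (Im (- cnj z) / Im z)^2"
    using z by (simp add: det_2 matrix_def cx_def rv_def axis_def H_iff)
next
  show "bij_betw (\<lambda>z. - cnj z) \<H> \<H>"
    by (rule bij_betw_byWitness[where f' = "\<lambda>z. - cnj z"]) (auto simp: H_iff)
qed

lemma integral_hmeas_comp:
  fixes F :: "complex \<Rightarrow> 'b::{banach, second_countable_topology}"
  assumes "distr hmeas hmeas \<phi> = hmeas" "\<phi> \<in> hmeas \<rightarrow>\<^sub>M hmeas" "F \<in> borel_measurable hmeas"
  shows "(\<integral>w. F (\<phi> w) \<partial>hmeas) = (\<integral>w. F w \<partial>hmeas)"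
  using integral_distr[OF assms(2,3)] assms(1) by simp

lemma measurable_sl2_act: "det A = 1 \<Longrightarrow> sl2_act A \<in> hmeas \<rightarrow>\<^sub>M hmeas"
  by (intro measurable_act_hmeas continuous_on_sl2_act) (auto intro: sl2_act_in_H)

lemma measurable_reflect: "(\<lambda>z. - cnj z) \<in> hmeas \<rightarrow>\<^sub>M hmeas"
  by (intro measurable_act_hmeas continuous_intros) (auto simp: H_iff)

lemma borel_measurable_hmeasI: "continuous_on \<H> f \<Longrightarrow> f \<in> borel_measurable hmeas"
  for f :: "complex \<Rightarrow> 'b::topological_space"
  using borel_measurable_continuous_on_restrict[of \<H> f] measurable_cong_sets[OF sets_hmeas refl] by blast

section \<open>Discrete cocompact groups\<close>

text \<open>The adjugate: an inverse for determinant 1 whose entries are visibly continuous.\<close>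

definition adj2 :: "real^2^2 \<Rightarrow> real^2^2" where
  "adj2 A = (\<chi> i j. if i = 1 then if j = 1 then A$2$2 else - A$1$2 else if j = 1 then - A$2$1 else A$1$1)"

lemma adj2_mult: "det A = 1 \<Longrightarrow> adj2 A ** A = mat 1" "det A = 1 \<Longrightarrow> A ** adj2 A = mat 1"
  by (auto simp: adj2_def matrix_matrix_mult_def mat_def vec_eq_iff forall_2 sum_2 det_2 algebra_simps)

lemma det_adj2 [simp]: "det (adj2 A) = det A"
  by (simp add: adj2_def det_2)

lemma continuous_matrix_mult:
  fixes f g :: "'a::topological_space \<Rightarrow> real^2^2"
  assumes "continuous_on X f" "continuous_on X g"
  shows "continuous_on X (\<lambda>x. f x ** g x)"
  unfolding matrix_matrix_mult_def by (intro continuous_intros assms)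

lemma continuous_adj2:
  fixes f :: "'a::topological_space \<Rightarrow> real^2^2"
  assumes "continuous_on X f"
  shows "continuous_on X (\<lambda>x. adj2 (f x))"
proof -
  have "continuous_on X (\<lambda>x. if (i::2) = 1 then if (j::2) = 1 then f x$2$2 else - f x$1$2 else if j = 1 then - f x$2$1 else f x$1$1)" for i j
    by (cases "i = 1"; cases "j = 1") (auto intro!: continuous_intros assms)
  then show ?thesis unfolding adj2_def by (intro continuous_on_vec_lambda) simp
qed

lemma one_PSL2R: "\<one>\<^bsub>PSL2R\<^esub> = psl2_class (mat 1)"
proof -
  interpret G: group PSL2R by (rule group_PSL2R)
  have "psl2_class (mat 1) \<otimes>\<^bsub>PSL2R\<^esub> psl2_class (mat 1) = psl2_class (mat 1)"
    by (simp add: mult_PSL2R)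
  moreover have "psl2_class (mat 1) \<in> carrier PSL2R" by (auto simp: carrier_PSL2R)
  ultimately show ?thesis using G.r_cancel_one' by metis
qed

lemma inv_PSL2R: "det A = 1 \<Longrightarrow> inv\<^bsub>PSL2R\<^esub> (psl2_class A) = psl2_class (adj2 A)"
proof -
  assume A: "det A = 1"
  interpret G: group PSL2R by (rule group_PSL2R)
  show ?thesis
    using A by (intro G.inv_equality) (auto simp: mult_PSL2R adj2_mult one_PSL2R carrier_PSL2R)
qed

lemma psl2_class_self: "A \<in> psl2_class A"
  by (simp add: psl2_class_eq)

lemma carrier_PSL2R_eq: "X \<in> carrier PSL2R \<Longrightarrow> A \<in> X \<Longrightarrow> X = psl2_class A \<and> det A = 1"
  by (auto simp: carrier_PSL2R psl2_class_eq)

lemma norm_matrix_sq: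
  fixes A :: "real^2^2"
  shows "(norm A)^2 = (A$1$1)^2 + (A$1$2)^2 + (A$2$1)^2 + (A$2$2)^2"
  by (simp add: norm_vec_def L2_set_def sum_2)

text \<open>The dictionary between matrices, in which discreteness and cocompactness are formulated,
  and hyperbolic distance, in which they are used: the squared norm is 2 cosh of the distance by
  which \<i> is moved.\<close>

lemma hyp_act_i:
  fixes A :: "real^2^2"
  assumes A: "det A = 1"
  shows "hyp (sl2_act A \<i>) \<i> = (norm A)^2 - 2"
proof -
  let ?j = "of_real (A$2$1) * \<i> + of_real (A$2$2) :: complex"
  have j: "?j \<noteq> 0" using sl2_denom_nz[OF A i_in_H] .
  then have j2: "(cmod ?j)^2 > 0" by simp
  have "sl2_act A \<i> - \<i> = (of_real (A$1$1) * \<i> + of_real (A$1$2) - \<i> * ?j) / ?j"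
    using j by (simp add: sl2_act_def moebius_def diff_divide_distrib)
  then have "(cmod (sl2_act A \<i> - \<i>))^2 = (cmod (of_real (A$1$1) * \<i> + of_real (A$1$2) - \<i> * ?j))^2 / (cmod ?j)^2"
    by (simp add: norm_divide power_divide)
  also have "(cmod (of_real (A$1$1) * \<i> + of_real (A$1$2) - \<i> * ?j))^2 = (A$1$2 + A$2$1)^2 + (A$1$1 - A$2$2)^2"
    by (simp add: cmod_power2)
  finally have "hyp (sl2_act A \<i>) \<i> = (A$1$2 + A$2$1)^2 + (A$1$1 - A$2$2)^2"
    unfolding hyp_def Im_sl2_act[OF A i_in_H] using j2 by simp
  then show ?thesis using A unfolding norm_matrix_sq det_2
    by (simp add: power2_eq_square algebra_simps)
qed

text \<open>The upper triangular matrix that carries \<i> to \<open>z\<close>. It transports every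
  statement about discs to discs around \<i>.\<close>

definition aff :: "complex \<Rightarrow> real^2^2" where
  "aff z = vector [vector [sqrt (Im z), Re z / sqrt (Im z)], vector [0, 1 / sqrt (Im z)]]"

lemma det_aff: "z \<in> \<H> \<Longrightarrow> det (aff z) = 1"
  by (simp add: aff_def det_2 H_iff)

lemma sl2_act_aff: "z \<in> \<H> \<Longrightarrow> sl2_act (aff z) w = of_real (Re z) + of_real (Im z) * w"
proof -
  assume z: "z \<in> \<H>"
  then have p: "sqrt (Im z) > 0" by (simp add: H_iff)
  have "sl2_act (aff z) w = of_real (Re z) + of_real (sqrt (Im z) * sqrt (Im z)) * w"
    unfolding of_real_mult using p by (simp add: sl2_act_def moebius_def aff_def field_simps)
  then show ?thesis using z by (simp add: H_iff)
qed

lemma sl2_act_aff_i: "z \<in> \<H> \<Longrightarrow> sl2_act (aff z) \<i> = z"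
  by (simp add: sl2_act_aff complex_eq_iff)

locale cocompact_group =
  fixes \<Gamma> :: "(real^2^2) set set"
  assumes discrete: "discrete_subgroup \<Gamma>" and cocompact: "cocompact \<Gamma>"
begin

sublocale PSL: group PSL2R by (rule group_PSL2R)

lemma sub: "subgroup \<Gamma> PSL2R"
  using discrete by (simp add: discrete_subgroup_def)

lemma subset: "\<Gamma> \<subseteq> carrier PSL2R"
  using sub by (rule subgroup.subset)

lemma repr:
  assumes "g \<in> \<Gamma>"
  obtains A where "det A = 1" "g = psl2_class A"
  using assms subset by (auto simp: carrier_PSL2R)

lemma act_H: "g \<in> \<Gamma> \<Longrightarrow> z \<in> \<H> \<Longrightarrow> psl2_act g z \<in> \<H>"
  by (metis repr psl2_act_class sl2_act_in_H)

lemma act_mult: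
  "g \<in> \<Gamma> \<Longrightarrow> h \<in> \<Gamma> \<Longrightarrow> z \<in> \<H> \<Longrightarrow> psl2_act (g \<otimes>\<^bsub>PSL2R\<^esub> h) z = psl2_act g (psl2_act h z)"
  by (metis repr psl2_act_class sl2_act_mult mult_PSL2R)

lemma act_one [simp]: "psl2_act \<one>\<^bsub>PSL2R\<^esub> z = z"
  by (simp add: one_PSL2R psl2_act_class sl2_act_def moebius_def mat_def)

lemma inv_in: "g \<in> \<Gamma> \<Longrightarrow> inv\<^bsub>PSL2R\<^esub> g \<in> \<Gamma>"
  using subgroup.m_inv_closed[OF sub] .

lemma mult_in: "g \<in> \<Gamma> \<Longrightarrow> h \<in> \<Gamma> \<Longrightarrow> g \<otimes>\<^bsub>PSL2R\<^esub> h \<in> \<Gamma>"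
  using subgroup.m_closed[OF sub] .

lemma act_inv: "g \<in> \<Gamma> \<Longrightarrow> z \<in> \<H> \<Longrightarrow> psl2_act (inv\<^bsub>PSL2R\<^esub> g) (psl2_act g z) = z"
  "g \<in> \<Gamma> \<Longrightarrow> z \<in> \<H> \<Longrightarrow> psl2_act g (psl2_act (inv\<^bsub>PSL2R\<^esub> g) z) = z"
  using subset by (auto simp: act_mult[symmetric] inv_in subset_iff)

lemma hyp_act: "g \<in> \<Gamma> \<Longrightarrow> z \<in> \<H> \<Longrightarrow> w \<in> \<H> \<Longrightarrow> hyp (psl2_act g z) (psl2_act g w) = hyp z w"
  by (metis repr psl2_act_class hyp_sl2_act)

lemma act_sl2: "g \<in> \<Gamma> \<Longrightarrow> \<exists>A. det A = 1 \<and> psl2_act g = sl2_act A"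
  by (metis repr psl2_act_class ext)

lemma continuous_act: "g \<in> \<Gamma> \<Longrightarrow> continuous_on \<H> (psl2_act g)"
  using act_sl2 continuous_on_sl2_act by metis

lemma distr_act: "g \<in> \<Gamma> \<Longrightarrow> distr hmeas hmeas (psl2_act g) = hmeas"
  using act_sl2 distr_sl2_act by metis

lemma measurable_act: "g \<in> \<Gamma> \<Longrightarrow> psl2_act g \<in> hmeas \<rightarrow>\<^sub>M hmeas"
  using act_sl2 measurable_sl2_act by metis

lemma discrete_nbhd:
  obtains e where "e > 0" "\<And>A. det A = 1 \<Longrightarrow> psl2_class A \<in> \<Gamma> \<Longrightarrow> dist A (mat 1) < e \<Longrightarrow> A = mat 1"
proof -
  have "openin (subtopology PSL2R_topology \<Gamma>) {\<one>\<^bsub>PSL2R\<^esub>}"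
    using discrete subgroup.one_closed[OF sub] by (simp add: discrete_subgroup_def)
  then obtain U where U: "openin PSL2R_topology U" "{\<one>\<^bsub>PSL2R\<^esub>} = U \<inter> \<Gamma>"
    by (auto simp: openin_subtopology)
  then have o: "openin (top_of_set {A. det A = 1}) (\<Union>U)" and Uc: "U \<subseteq> carrier PSL2R"
    by (auto simp: openin_PSL2R_topology)
  have "mat 1 \<in> \<Union>U" using U(2) psl2_class_self[of "mat 1"] by (auto simp: one_PSL2R)
  then obtain e where e: "e > 0" "\<And>A. det A = 1 \<Longrightarrow> dist A (mat 1) < e \<Longrightarrow> A \<in> \<Union>U"
  proof -
    have "\<forall>x\<in>\<Union>U. \<exists>e>0. \<forall>x'\<in>{A. det A = 1}. dist x' x < e \<longrightarrow> x' \<in> \<Union>U"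
      using o unfolding openin_euclidean_subtopology_iff by blast
    then obtain e where "e > 0" "\<forall>x'\<in>{A. det A = 1}. dist x' (mat 1) < e \<longrightarrow> x' \<in> \<Union>U"
      using \<open>mat 1 \<in> \<Union>U\<close> by blast
    then show ?thesis using that by blast
  qed
  show ?thesis
  \<comment> \<open>The class of the identity also contains \<open>- mat 1\<close>; its first entry
    is at distance 2 from that of \<open>mat 1\<close>, so the bound 1 excludes it.\<close>
  proof (rule that[of "min e 1"])
    fix A :: "real^2^2"
    assume A: "det A = 1" "psl2_class A \<in> \<Gamma>" "dist A (mat 1) < min e 1"
    then obtain X where X: "X \<in> U" "A \<in> X" using e(2)[of A] by auto
    then have "X = psl2_class A" using carrier_PSL2R_eq Uc by blast
    then have "psl2_class A = psl2_class (mat 1)" using X U(2) A(2) one_PSL2R by blast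
    then have "A = mat 1 \<or> A = - mat 1" by (auto simp: psl2_class_eq doubleton_eq_iff)
    moreover have "A \<noteq> - mat 1"
    proof
      assume "A = - mat 1"
      then have "dist (A$1$1) ((mat 1 :: real^2^2)$1$1) = 2" by (simp add: mat_def dist_real_def)
      moreover have "dist (A$1$1) ((mat 1 :: real^2^2)$1$1) \<le> dist A (mat 1)"
        by (rule order_trans[OF dist_vec_nth_le dist_vec_nth_le])
      ultimately show False using A(3) by simp
    qed
    ultimately show "A = mat 1" by simp
  qed (use e in auto)
qed

text \<open>An infinite bounded set of matrices has a limit point l. Two different members A and B
  close to l have \<open>adj2 A ** B\<close> close to \<open>mat 1\<close>, against
  discreteness.\<close>

lemma finite_norm_bounded: "finite {A. det A = 1 \<and> psl2_class A \<in> \<Gamma> \<and> norm A \<le> R}" (is "finite ?S")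
proof (rule ccontr)
  assume inf: "infinite ?S"
  obtain e where e: "e > 0" "\<And>A. det A = 1 \<Longrightarrow> psl2_class A \<in> \<Gamma> \<Longrightarrow> dist A (mat 1) < e \<Longrightarrow> A = mat 1"
    using discrete_nbhd by blast
  let ?D = "{A::real^2^2. det A = 1} \<inter> cball 0 R"
  have cl: "closed {A::real^2^2. det A = 1}"
    unfolding det_2 by (intro closed_Collect_eq continuous_intros)
  then have "compact ?D" by (intro closed_Int_compact compact_cball)
  moreover have "?S \<subseteq> ?D" by auto
  ultimately obtain l where l: "l \<in> ?D" "l islimpt ?S"
    using inf unfolding compact_eq_Bolzano_Weierstrass by blast
  have "continuous_on UNIV (\<lambda>p :: (real^2^2) \<times> (real^2^2). adj2 (fst p) ** snd p)"
    by (rule continuous_matrix_mult[OF continuous_adj2]) (auto intro: continuous_intros)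
  then have "continuous (at (l, l)) (\<lambda>p :: (real^2^2) \<times> (real^2^2). adj2 (fst p) ** snd p)"
    by (simp add: continuous_on_eq_continuous_at)
  then obtain d where d: "d > 0" "\<And>p. dist p (l, l) < d \<Longrightarrow> dist (adj2 (fst p) ** snd p) (adj2 l ** l) < e"
    using e(1) unfolding continuous_at_eps_delta by fastforce
  obtain A where A: "A \<in> ?S" "A \<noteq> l" "dist A l < d/2"
    using l(2) d(1) unfolding islimpt_approachable by (meson half_gt_zero)
  \<comment> \<open>Strictly closer to \<open>l\<close> than \<open>A\<close> is, and therefore
    different from \<open>A\<close>.\<close>
  obtain B where B: "B \<in> ?S" "B \<noteq> l" "dist B l < min (d/2) (dist A l)"
  proof -
    have "min (d/2) (dist A l) > 0" using d(1) A(2) by simp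
    then show ?thesis using l(2) that unfolding islimpt_approachable by blast
  qed
  have "dist (A, B) (l, l) \<le> dist A l + dist B l"
    unfolding dist_Pair_Pair by (rule sqrt_sum_squares_le_sum) auto
  then have "dist (adj2 A ** B) (mat 1) < e"
    using d(2)[of "(A, B)"] A B l by (simp add: adj2_mult)
  moreover have "det (adj2 A ** B) = 1" using A B by (simp add: det_mul)
  moreover have "psl2_class (adj2 A ** B) \<in> \<Gamma>"
    using A B mult_in[OF inv_in, of "psl2_class A" "psl2_class B"] by (simp add: inv_PSL2R mult_PSL2R)
  ultimately have "adj2 A ** B = mat 1" using e(2) by blast
  then have "A ** (adj2 A ** B) = A" by simp
  then have "B = A" using A by (simp add: matrix_mul_assoc adj2_mult)
  then show False using B by simp
qed

lemma finite_hyp_i: "finite {g \<in> \<Gamma>. hyp (psl2_act g \<i>) \<i> \<le> R}"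
proof (rule finite_subset[OF _ finite_imageI[OF finite_norm_bounded[of "sqrt (R + 2)"], of psl2_class]], rule subsetI)
  fix g assume g: "g \<in> {g \<in> \<Gamma>. hyp (psl2_act g \<i>) \<i> \<le> R}"
  then obtain A where A: "det A = 1" "g = psl2_class A" using repr by blast
  then have "(norm A)^2 \<le> R + 2" using g hyp_act_i[OF A(1)] by (simp add: psl2_act_class)
  then have "norm A \<le> sqrt (R + 2)" by (simp add: real_le_rsqrt)
  then show "g \<in> psl2_class ` {A. det A = 1 \<and> psl2_class A \<in> \<Gamma> \<and> norm A \<le> sqrt (R + 2)}"
    using A g by auto
qed

text \<open>The cosets that contain a matrix of norm less than m form an open set
  \<open>V m\<close>. These sets increase to the whole compact quotient, so a single bound serves
  all cosets.\<close>

lemma cocompact_norm: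
  obtains R where "\<And>A. det A = 1 \<Longrightarrow> \<exists>C. det C = 1 \<and> psl2_class C \<in> \<Gamma> \<and> norm (C ** A) < R"
proof -
  let ?RC = "rcosets\<^bsub>PSL2R\<^esub> \<Gamma>"
  let ?X = "quotient_topology PSL2R_topology ?RC"
  define V where "V m = {K \<in> ?RC. \<exists>g\<in>K. \<exists>B\<in>g. norm B < real m}" for m :: nat
  have rc: "K \<in> ?RC \<Longrightarrow> g \<in> K \<Longrightarrow> g \<in> carrier PSL2R \<and> K = \<Gamma> #>\<^bsub>PSL2R\<^esub> g" for K g
  proof -
    assume K: "K \<in> ?RC" "g \<in> K"
    then obtain a where a: "a \<in> carrier PSL2R" "K = \<Gamma> #>\<^bsub>PSL2R\<^esub> a" by (auto simp: RCOSETS_def)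
    then show "g \<in> carrier PSL2R \<and> K = \<Gamma> #>\<^bsub>PSL2R\<^esub> g"
      using K PSL.repr_independence[OF _ a(1) sub] PSL.r_coset_subset_G[OF subset a(1)] by blast
  qed
  \<comment> \<open>Openness in the iterated quotient is openness of a set of matrices; of the two
    unions one opens the cosets of \<Gamma> and the other the classes {A, -A}. The right-hand side
    shows that this set is open.\<close>
  have V: "\<Union>(\<Union>(V m)) = {A. det A = 1} \<inter> (\<Union>C\<in>{C. det C = 1 \<and> psl2_class C \<in> \<Gamma>}. {A. norm (C ** A) < real m})" for m
  proof (intro equalityI subsetI)
    fix A assume "A \<in> \<Union>(\<Union>(V m))"
    then obtain K g g' B where K: "K \<in> ?RC" "g \<in> K" "A \<in> g" "g' \<in> K" "B \<in> g'" "norm B < real m"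
      by (auto simp: V_def)
    then have gA: "g = psl2_class A" "det A = 1" using rc carrier_PSL2R_eq by blast+
    have gB: "g' = psl2_class B" "det B = 1" using rc carrier_PSL2R_eq K by blast+
    have "g' \<in> \<Gamma> #>\<^bsub>PSL2R\<^esub> g" using rc K by blast
    then obtain \<gamma> where \<gamma>: "\<gamma> \<in> \<Gamma>" "g' = \<gamma> \<otimes>\<^bsub>PSL2R\<^esub> g" by (auto simp: r_coset_def)
    obtain C where C: "det C = 1" "\<gamma> = psl2_class C" using repr \<gamma> by blast
    have "psl2_class B = psl2_class (C ** A)" using \<gamma> C gA gB by (simp add: mult_PSL2R)
    then have "B = C ** A \<or> B = - (C ** A)" by (auto simp: psl2_class_eq doubleton_eq_iff)
    then have "norm (C ** A) < real m" using K(6) by auto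
    then show "A \<in> {A. det A = 1} \<inter> (\<Union>C\<in>{C. det C = 1 \<and> psl2_class C \<in> \<Gamma>}. {A. norm (C ** A) < real m})"
      using C \<gamma> gA by auto
  next
    fix A assume "A \<in> {A. det A = 1} \<inter> (\<Union>C\<in>{C. det C = 1 \<and> psl2_class C \<in> \<Gamma>}. {A. norm (C ** A) < real m})"
    then obtain C where C: "det A = 1" "det C = 1" "psl2_class C \<in> \<Gamma>" "norm (C ** A) < real m" by auto
    have Ac: "psl2_class A \<in> carrier PSL2R" using C by (auto simp: carrier_PSL2R)
    let ?K = "\<Gamma> #>\<^bsub>PSL2R\<^esub> psl2_class A"
    have "?K \<in> ?RC" using Ac subset by (simp add: PSL.rcosetsI)
    moreover have "psl2_class A \<in> ?K" using Ac sub by (simp add: PSL.rcos_self)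
    moreover have "psl2_class (C ** A) \<in> ?K" using C by (auto simp: r_coset_def mult_PSL2R[symmetric])
    ultimately show "A \<in> \<Union>(\<Union>(V m))" using C psl2_class_self by (auto simp: V_def)
  qed
  have o: "openin ?X (V m)" for m
  proof -
    have "open (\<Union>C\<in>{C. det C = 1 \<and> psl2_class C \<in> \<Gamma>}. {A::real^2^2. norm (C ** A) < real m})"
      by (intro open_UN ballI open_Collect_less continuous_on_norm continuous_matrix_mult continuous_on_const continuous_on_id)
    then have "openin (top_of_set {A. det A = 1}) (\<Union>(\<Union>(V m)))"
      unfolding V by (rule openin_open_Int)
    moreover have "\<Union>(V m) \<subseteq> carrier PSL2R" using rc by (auto simp: V_def)
    ultimately show ?thesis
      unfolding openin_cocompact_quotient[OF sub] openin_PSL2R_topology by (auto simp: V_def)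
  qed
  have all: "\<exists>m. K \<in> V m" if K: "K \<in> ?RC" for K
  proof -
    have "\<exists>g. g \<in> K" using K PSL.rcos_self[OF _ sub]
      by (auto simp: RCOSETS_def)
    then obtain g where "g \<in> K" by blast
    then obtain A where A: "A \<in> g" using rc[OF K] by (auto simp: carrier_PSL2R psl2_class_eq)
    obtain m where "norm A < real m" using reals_Archimedean2 by blast
    then show ?thesis using K A \<open>g \<in> K\<close> by (auto simp: V_def)
  qed
  have "compact_space ?X" using cocompact by (simp add: cocompact_def)
  moreover have "topspace ?X \<subseteq> \<Union>(range V)"
  proof
    fix K assume "K \<in> topspace ?X"
    then have "K \<in> ?RC" unfolding topspace_def openin_cocompact_quotient[OF sub] by blast
    then show "K \<in> \<Union>(range V)" using all by blast
  qed
  moreover have "Ball (range V) (openin ?X)" using o by blast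
  ultimately have "\<exists>\<F>. finite \<F> \<and> \<F> \<subseteq> range V \<and> topspace ?X \<subseteq> \<Union>\<F>"
    unfolding compact_space_def compactin_def by (elim conjE allE[of _ "range V"]) simp
  then obtain \<F> where \<F>: "finite \<F>" "\<F> \<subseteq> range V" "topspace ?X \<subseteq> \<Union>\<F>"
    by blast
  then obtain I where I: "finite I" "\<F> = V ` I" by (metis finite_subset_image)
  show ?thesis
  proof (rule that[of "real (Max (insert 0 I))"])
    fix A :: "real^2^2" assume A: "det A = 1"
    then have Ac: "psl2_class A \<in> carrier PSL2R" by (auto simp: carrier_PSL2R)
    then have "\<Gamma> #>\<^bsub>PSL2R\<^esub> psl2_class A \<in> ?RC" using subset by (simp add: PSL.rcosetsI)
    then obtain m where "\<Gamma> #>\<^bsub>PSL2R\<^esub> psl2_class A \<in> V m" using all by blast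
    then have "\<Gamma> #>\<^bsub>PSL2R\<^esub> psl2_class A \<in> topspace ?X" using openin_subset[OF o] by blast
    then obtain i where i: "i \<in> I" "\<Gamma> #>\<^bsub>PSL2R\<^esub> psl2_class A \<in> V i" using \<F>(3) I by blast
    then have "A \<in> \<Union>(\<Union>(V i))" using psl2_class_self PSL.rcos_self[OF Ac sub] by blast
    then obtain C where C: "det C = 1" "psl2_class C \<in> \<Gamma>" "norm (C ** A) < real i" unfolding V by blast
    have "i \<le> Max (insert 0 I)" using i I by simp
    then show "\<exists>C. det C = 1 \<and> psl2_class C \<in> \<Gamma> \<and> norm (C ** A) < real (Max (insert 0 I))"
      using C by (meson less_le_trans of_nat_le_iff)
  qed
qed

lemma cocompact_hyp:
  obtains R where "R \<ge> 0" "\<And>z. z \<in> \<H> \<Longrightarrow> \<exists>g\<in>\<Gamma>. hyp (psl2_act g z) \<i> \<le> R"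
proof -
  obtain R where R: "\<And>A. det A = 1 \<Longrightarrow> \<exists>C. det C = 1 \<and> psl2_class C \<in> \<Gamma> \<and> norm (C ** A) < R"
    using cocompact_norm by blast
  show ?thesis
  proof (rule that[of "R^2"])
    fix z assume z: "z \<in> \<H>"
    obtain C where C: "det C = 1" "psl2_class C \<in> \<Gamma>" "norm (C ** aff z) < R" using R[OF det_aff[OF z]] by blast
    have d: "det (C ** aff z) = 1" using C det_aff[OF z] by (simp add: det_mul)
    have "psl2_act (psl2_class C) z = sl2_act (C ** aff z) \<i>"
      using z C by (simp add: psl2_act_class sl2_act_mult det_aff i_in_H sl2_act_aff_i)
    then have "hyp (psl2_act (psl2_class C) z) \<i> = (norm (C ** aff z))^2 - 2" using hyp_act_i[OF d] by simp
    also have "\<dots> \<le> R^2" using C(3) power_mono[of "norm (C ** aff z)" R 2] by simp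
    finally show "\<exists>g\<in>\<Gamma>. hyp (psl2_act g z) \<i> \<le> R^2" using C by blast
  qed auto
qed

text \<open>Finiteness at \<i> is discreteness; uniformity in \<open>z\<close> and \<open>w\<close>
  is cocompactness, since \<Gamma> moves \<open>z\<close> to within a fixed distance of \<i>. All
  the sets inject into one finite set by translations within \<Gamma>.\<close>

lemma uniform_count:
  obtains N :: nat where "\<And>z w. z \<in> \<H> \<Longrightarrow> w \<in> \<H> \<Longrightarrow>
    finite {g \<in> \<Gamma>. hyp (psl2_act g z) w \<le> R} \<and> card {g \<in> \<Gamma>. hyp (psl2_act g z) w \<le> R} \<le> N"
proof -
  obtain R0 where R0: "R0 \<ge> 0" "\<And>z. z \<in> \<H> \<Longrightarrow> \<exists>g\<in>\<Gamma>. hyp (psl2_act g z) \<i> \<le> R0"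
    using cocompact_hyp by blast
  \<comment> \<open>\<open>R1\<close> bounds two points that both lie within \<open>R\<close> of
    \<open>w\<close>; \<open>R2\<close> chains the steps \<open>R0\<close>, \<open>R1\<close>,
    \<open>R0\<close> by \<open>hyp_chain\<close>.\<close>
  define R1 where "R1 = 4 * (R + 2) * (R + 2)"
  define R2 where "R2 = 4 * (4 * (R0 + 2) * (R1 + 2) + 2) * (R0 + 2)"
  let ?\<Phi> = "{g \<in> \<Gamma>. hyp (psl2_act g \<i>) \<i> \<le> R2}"
  show ?thesis
  proof (rule that[of "card ?\<Phi>"])
    fix z w assume z: "z \<in> \<H>" and w: "w \<in> \<H>"
    let ?S = "{g \<in> \<Gamma>. hyp (psl2_act g z) w \<le> R}"
    show "finite ?S \<and> card ?S \<le> card ?\<Phi>"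
    proof (cases "?S = {}")
      case False
      then obtain g0 where g0: "g0 \<in> \<Gamma>" "hyp (psl2_act g0 z) w \<le> R" by blast
      obtain h where h: "h \<in> \<Gamma>" "hyp (psl2_act h z) \<i> \<le> R0" using R0(2)[OF z] by blast
      \<comment> \<open>With d = h z, the map \<open>?f\<close> conjugates the motion from z to g z
        into one that nearly fixes d: it sends d to the image of g z under the isometry that sends
        g0 z to d, and g z is close to g0 z.\<close>
      let ?k = "h \<otimes>\<^bsub>PSL2R\<^esub> inv\<^bsub>PSL2R\<^esub> g0"
      let ?f = "\<lambda>g. ?k \<otimes>\<^bsub>PSL2R\<^esub> (g \<otimes>\<^bsub>PSL2R\<^esub> inv\<^bsub>PSL2R\<^esub> h)"
      have k: "?k \<in> \<Gamma>" using g0 h by (intro mult_in inv_in)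
      have kc: "?k \<in> carrier PSL2R" using k subset by blast
      have hc: "h \<in> carrier PSL2R" "inv\<^bsub>PSL2R\<^esub> h \<in> carrier PSL2R" using h subset by auto
      have inj: "inj_on ?f ?S"
      proof (rule inj_onI)
        fix a b assume ab: "a \<in> ?S" "b \<in> ?S" "?f a = ?f b"
        then have c: "a \<in> carrier PSL2R" "b \<in> carrier PSL2R" using subset by auto
        then have "a \<otimes>\<^bsub>PSL2R\<^esub> inv\<^bsub>PSL2R\<^esub> h = b \<otimes>\<^bsub>PSL2R\<^esub> inv\<^bsub>PSL2R\<^esub> h"
          using ab(3) kc hc by (simp add: PSL.m_closed)
        then show "a = b" using c hc by simp
      qed
      have img: "?f ` ?S \<subseteq> ?\<Phi>"
      proof (intro image_subsetI)
        fix g assume "g \<in> ?S"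
        then have g: "g \<in> \<Gamma>" "hyp (psl2_act g z) w \<le> R" by auto
        have ih: "inv\<^bsub>PSL2R\<^esub> h \<in> \<Gamma>" and ig0: "inv\<^bsub>PSL2R\<^esub> g0 \<in> \<Gamma>" using h g0 inv_in by auto
        define d where "d = psl2_act h z"
        have dH: "d \<in> \<H>" using h z act_H by (simp add: d_def)
        have gz: "psl2_act g z \<in> \<H>" "psl2_act g0 z \<in> \<H>" using g g0 z act_H by auto
        have f: "psl2_act (?f g) v = psl2_act ?k (psl2_act g (psl2_act (inv\<^bsub>PSL2R\<^esub> h) v))" if "v \<in> \<H>" for v
          using that g ih k by (simp add: act_mult mult_in act_H)
        have fd: "psl2_act (?f g) d = psl2_act ?k (psl2_act g z)"
          using f[OF dH] act_inv(1)[OF h(1) z] by (simp add: d_def)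
        have kd: "psl2_act ?k (psl2_act g0 z) = d"
          using act_mult[OF h(1) ig0 gz(2)] act_inv(1)[OF g0(1) z] by (simp add: d_def)
        have fin: "?f g \<in> \<Gamma>" using mult_in[OF k mult_in[OF g(1) ih]] .
        have "hyp (psl2_act g z) (psl2_act g0 z) \<le> R1"
          unfolding R1_def using hyp_chain[OF gz(1) w gz(2), of R R] g g0 by (simp add: hyp_sym)
        then have 1: "hyp (psl2_act (?f g) d) d \<le> R1"
          using hyp_act[OF k gz] kd fd by simp
        have 2: "hyp (psl2_act (?f g) \<i>) (psl2_act (?f g) d) \<le> R0"
          using hyp_act[OF fin i_in_H dH] h by (simp add: d_def hyp_sym)
        have "hyp (psl2_act (?f g) \<i>) d \<le> 4 * (R0 + 2) * (R1 + 2)"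
          using hyp_chain[OF _ _ dH 2 1] act_H[OF fin] i_in_H dH by blast
        then have "hyp (psl2_act (?f g) \<i>) \<i> \<le> R2"
          unfolding R2_def using hyp_chain[OF _ dH i_in_H] act_H[OF fin i_in_H] h by (simp add: d_def)
        then show "?f g \<in> ?\<Phi>" using fin by simp
      qed
      have fin: "finite ?\<Phi>" by (rule finite_hyp_i)
      show ?thesis using inj_on_finite[OF inj img fin] card_inj_on_le[OF inj img fin] by simp
    next
      case True
      show ?thesis unfolding True by simp
    qed
  qed
qed

end

lemma compact_hyp_ball:
  obtains K where "compact K" "K \<subseteq> \<H>" "{v \<in> \<H>. hyp v \<i> \<le> R} \<subseteq> K"
proof (cases "R \<ge> 0")
  case True
  let ?K = "cball \<i> (sqrt (R * (R + 2))) \<inter> {v. Im v \<ge> 1 / (R + 2)}"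
  show ?thesis
  proof (rule that[of ?K])
    show "compact ?K" by (intro compact_Int_closed compact_cball closed_halfspace_Im_ge)
    show "?K \<subseteq> \<H>"
    proof
      fix v assume v: "v \<in> ?K"
      have "0 < 1 / (R + 2)" using True by simp
      also have "\<dots> \<le> Im v" using v by simp
      finally show "v \<in> \<H>" unfolding H_iff .
    qed
    show "{v \<in> \<H>. hyp v \<i> \<le> R} \<subseteq> ?K"
    proof
      fix v assume "v \<in> {v \<in> \<H>. hyp v \<i> \<le> R}"
      then have v: "v \<in> \<H>" "hyp v \<i> \<le> R" by auto
      have p: "Im v > 0" using v by (simp add: H_iff)
      have h: "hyp v \<i> \<ge> 0" using hyp_nonneg[OF v(1) i_in_H] .
      have "Im v \<le> (hyp v \<i> + 2) * 1" using Im_ratio[OF v(1) i_in_H] by simp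
      then have 1: "Im v \<le> R + 2" using v by simp
      have "1 \<le> (hyp v \<i> + 2) * Im v" using Im_ratio[OF i_in_H v(1)] by (simp add: hyp_sym)
      also have "\<dots> \<le> (R + 2) * Im v" using v p by (intro mult_right_mono) auto
      finally have 2: "1 / (R + 2) \<le> Im v" using True by (simp add: field_simps)
      have "(cmod (v - \<i>))^2 = hyp v \<i> * Im v" using hyp_eq[OF v(1) i_in_H] by simp
      also have "\<dots> \<le> R * (R + 2)" using v h p 1 by (intro mult_mono) auto
      finally have "cmod (v - \<i>) \<le> sqrt (R * (R + 2))" by (rule real_le_rsqrt)
      then show "v \<in> ?K" using 2 by (simp add: dist_norm norm_minus_commute)
    qed
  qed
next
  case False
  show ?thesis
  proof (rule that[of "{}"])
    show "{v \<in> \<H>. hyp v \<i> \<le> R} \<subseteq> {}"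
      using hyp_nonneg[OF _ i_in_H] False by fastforce
  qed auto
qed

section \<open>The hyperbolic element, the group it generates, and the cosets\<close>

locale hyperbolic_group = cocompact_group +
  fixes \<mu> :: real and \<gamma>1 :: "(real^2^2) set"
  assumes \<mu>: "\<mu> > 1"
    and \<gamma>1: "\<gamma>1 = psl2_class (vector [vector [sqrt \<mu>, 0], vector [0, inverse (sqrt \<mu>)]])"
    and \<gamma>1_in: "\<gamma>1 \<in> \<Gamma>"
begin

definition \<Gamma>1 :: "(real^2^2) set set" where
  "\<Gamma>1 = generate PSL2R {\<gamma>1}"

definition cosets :: "(real^2^2) set set set" where
  "cosets = coset_space \<Gamma>1 \<Gamma>"

definition coset_rep :: "(real^2^2) set set \<Rightarrow> (real^2^2) set" where
  "coset_rep C = (SOME g. g \<in> C)"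

lemma act_\<gamma>1: "psl2_act \<gamma>1 z = of_real \<mu> * z"
proof -
  have "psl2_act \<gamma>1 z = of_real (sqrt \<mu> * sqrt \<mu>) * z"
    using \<mu> by (simp only: of_real_mult) (simp add: \<gamma>1 psl2_act_class sl2_act_def moebius_def field_simps)
  then show ?thesis using \<mu> by simp
qed

lemma \<Gamma>1_subgroup: "subgroup \<Gamma>1 PSL2R"
  unfolding \<Gamma>1_def using \<gamma>1_in subset by (intro PSL.generate_is_subgroup) auto

lemma \<Gamma>1_subset: "\<Gamma>1 \<subseteq> \<Gamma>"
  unfolding \<Gamma>1_def using \<gamma>1_in by (intro PSL.generate_subgroup_incl sub) auto

lemma \<gamma>1_in_\<Gamma>1: "\<gamma>1 \<in> \<Gamma>1"
  unfolding \<Gamma>1_def by (intro generate.incl) simp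

lemma \<Gamma>1_mult: "g \<in> \<Gamma>1 \<Longrightarrow> h \<in> \<Gamma>1 \<Longrightarrow> g \<otimes>\<^bsub>PSL2R\<^esub> h \<in> \<Gamma>1"
  using subgroup.m_closed[OF \<Gamma>1_subgroup] .

lemma \<Gamma>1_inv: "g \<in> \<Gamma>1 \<Longrightarrow> inv\<^bsub>PSL2R\<^esub> g \<in> \<Gamma>1"
  using subgroup.m_inv_closed[OF \<Gamma>1_subgroup] .

lemma \<Gamma>1_one: "\<one>\<^bsub>PSL2R\<^esub> \<in> \<Gamma>1"
  using subgroup.one_closed[OF \<Gamma>1_subgroup] .

lemma \<Gamma>1_invariant:
  assumes \<psi>: "\<And>z. z \<in> \<H> \<Longrightarrow> \<psi> (of_real \<mu> * z) = \<psi> z" and g: "g \<in> \<Gamma>1" and z: "z \<in> \<H>"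
  shows "\<psi> (psl2_act g z) = \<psi> z"
proof -
  have "\<forall>z\<in>\<H>. \<psi> (psl2_act g z) = \<psi> z"
    using g unfolding \<Gamma>1_def
  proof induction
    case (incl h)
    then show ?case using \<psi> by (simp add: act_\<gamma>1)
  next
    case (inv h)
    show ?case
    proof
      fix z assume z: "z \<in> \<H>"
      have h: "h = \<gamma>1" using inv by simp
      have "psl2_act (inv\<^bsub>PSL2R\<^esub> \<gamma>1) z \<in> \<H>" using act_H[OF inv_in[OF \<gamma>1_in] z] .
      from \<psi>[OF this] show "\<psi> (psl2_act (inv\<^bsub>PSL2R\<^esub> h) z) = \<psi> z"
        using act_inv(2)[OF \<gamma>1_in z] by (simp add: h act_\<gamma>1)
    qed
  next
    case (eng h1 h2)
    have "h1 \<in> \<Gamma>" "h2 \<in> \<Gamma>" using eng \<Gamma>1_subset by (auto simp: \<Gamma>1_def)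
    then show ?case using eng by (simp add: act_mult act_H)
  qed simp
  then show ?thesis using z by blast
qed

text \<open>All the dilations that the reduction needs, obtained without identifying the group with
  the integers.\<close>

lemma \<Gamma>1_scale: "\<exists>g\<in>\<Gamma>1. \<forall>z\<in>\<H>. psl2_act g z = of_real (\<mu> powi k) * z"
proof (induction k rule: int_induct[where k = 0])
  case base
  show ?case using \<Gamma>1_one by (intro bexI[of _ "\<one>\<^bsub>PSL2R\<^esub>"]) auto
next
  case (step1 i)
  then obtain g where g: "g \<in> \<Gamma>1" "\<forall>z\<in>\<H>. psl2_act g z = of_real (\<mu> powi i) * z" by blast
  have "psl2_act (\<gamma>1 \<otimes>\<^bsub>PSL2R\<^esub> g) z = of_real (\<mu> powi (i + 1)) * z" if "z \<in> \<H>" for z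
    using g \<Gamma>1_subset \<gamma>1_in \<mu> that act_mult[of \<gamma>1 g z]
    by (auto simp: act_\<gamma>1 power_int_add)
  then show ?case using \<Gamma>1_mult[OF \<gamma>1_in_\<Gamma>1 g(1)] by blast
next
  case (step2 i)
  then obtain g where g: "g \<in> \<Gamma>1" "\<forall>z\<in>\<H>. psl2_act g z = of_real (\<mu> powi i) * z" by blast
  let ?h = "inv\<^bsub>PSL2R\<^esub> \<gamma>1"
  have i: "psl2_act ?h w = w / of_real \<mu>" if "w \<in> \<H>" for w
  proof -
    have "of_real \<mu> * psl2_act ?h w = w" using act_inv(2)[OF \<gamma>1_in that] by (simp add: act_\<gamma>1)
    then show ?thesis using \<mu> by (auto simp: field_simps)
  qed
  have "psl2_act (?h \<otimes>\<^bsub>PSL2R\<^esub> g) z = of_real (\<mu> powi (i - 1)) * z" if z: "z \<in> \<H>" for z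
  proof -
    have "g \<in> \<Gamma>" using g \<Gamma>1_subset by blast
    then have "psl2_act (?h \<otimes>\<^bsub>PSL2R\<^esub> g) z = psl2_act g z / of_real \<mu>"
      using act_mult[OF inv_in[OF \<gamma>1_in] _ z] i act_H z by metis
    then show ?thesis using g z \<mu> by (simp add: power_int_diff)
  qed
  then show ?case using \<Gamma>1_mult[OF \<Gamma>1_inv[OF \<gamma>1_in_\<Gamma>1] g(1)] by blast
qed

text \<open>The half-annulus 1 \<le> |z| < \<mu> is a fundamental domain; the floor of the logarithm
  of |z| to the base \<mu> counts the factors to be removed.\<close>

lemma \<Gamma>1_reduce:
  assumes z: "z \<in> \<H>"
  obtains g where "g \<in> \<Gamma>1" "1 \<le> cmod (psl2_act g z)" "cmod (psl2_act g z) < \<mu>"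
proof -
  have p: "cmod z > 0" using z by (auto simp: H_iff)
  define k where "k = \<lfloor>log \<mu> (cmod z)\<rfloor>"
  obtain g where g: "g \<in> \<Gamma>1" "\<forall>z\<in>\<H>. psl2_act g z = of_real (\<mu> powi (- k)) * z" using \<Gamma>1_scale by blast
  have "cmod (psl2_act g z) = \<mu> powr (- real_of_int k) * \<mu> powr (log \<mu> (cmod z))"
  proof -
    have "cmod (psl2_act g z) = \<mu> powi (- k) * cmod z"
      using g(2) z \<mu> by (simp add: norm_mult norm_power_int)
    moreover have "\<mu> powi (- k) = \<mu> powr (- real_of_int k)"
      using \<mu> powr_real_of_int'[of \<mu> "- k"] by simp
    ultimately show ?thesis using \<mu> p by simp
  qed
  also have "\<dots> = \<mu> powr (log \<mu> (cmod z) - k)" by (simp flip: powr_add)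
  finally have e: "cmod (psl2_act g z) = \<mu> powr (log \<mu> (cmod z) - k)" .
  have "0 \<le> log \<mu> (cmod z) - k" "log \<mu> (cmod z) - k < 1" unfolding k_def by linarith+
  then have "\<mu> powr 0 \<le> \<mu> powr (log \<mu> (cmod z) - k)" "\<mu> powr (log \<mu> (cmod z) - k) < \<mu> powr 1"
    using \<mu> by (intro powr_mono powr_less_mono; simp)+
  then show ?thesis using that[OF g(1)] e \<mu> by simp
qed

lemma ht_\<mu>: "ht (of_real \<mu> * z) = ht z"
  using \<mu> by (simp add: ht_def norm_mult)

lemma ht_\<Gamma>1: "g \<in> \<Gamma>1 \<Longrightarrow> z \<in> \<H> \<Longrightarrow> ht (psl2_act g z) = ht z"
  by (rule \<Gamma>1_invariant[of ht]) (auto simp: ht_\<mu>)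

lemma cosets_eq: "cosets = (\<lambda>a. (\<lambda>k. k \<otimes>\<^bsub>PSL2R\<^esub> a) ` \<Gamma>1) ` \<Gamma>"
  unfolding cosets_def coset_space_def RCOSETS_def r_coset_def by auto

lemma cosets_orbit:
  assumes "C \<in> cosets" "a \<in> C"
  shows "a \<in> \<Gamma>" "C = (\<lambda>k. k \<otimes>\<^bsub>PSL2R\<^esub> a) ` \<Gamma>1"
proof -
  obtain b k where b: "b \<in> \<Gamma>" "C = (\<lambda>k. k \<otimes>\<^bsub>PSL2R\<^esub> b) ` \<Gamma>1" "k \<in> \<Gamma>1" "a = k \<otimes>\<^bsub>PSL2R\<^esub> b"
    using assms by (auto simp: cosets_eq)
  have G: "x \<in> \<Gamma>1 \<Longrightarrow> x \<in> carrier PSL2R" for x using \<Gamma>1_subset subset by blast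
  have bc: "b \<in> carrier PSL2R" using b subset by blast
  show "a \<in> \<Gamma>" using b mult_in \<Gamma>1_subset by blast
  show "C = (\<lambda>k. k \<otimes>\<^bsub>PSL2R\<^esub> a) ` \<Gamma>1"
  proof (intro equalityI subsetI)
    fix x assume "x \<in> C"
    then obtain l where l: "l \<in> \<Gamma>1" "x = l \<otimes>\<^bsub>PSL2R\<^esub> b" using b by blast
    have "x = (l \<otimes>\<^bsub>PSL2R\<^esub> inv\<^bsub>PSL2R\<^esub> k) \<otimes>\<^bsub>PSL2R\<^esub> a"
      using l b bc G by (simp add: PSL.m_assoc) (simp flip: PSL.m_assoc)
    then show "x \<in> (\<lambda>k. k \<otimes>\<^bsub>PSL2R\<^esub> a) ` \<Gamma>1" using l b \<Gamma>1_mult \<Gamma>1_inv by blast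
  next
    fix x assume "x \<in> (\<lambda>k. k \<otimes>\<^bsub>PSL2R\<^esub> a) ` \<Gamma>1"
    then obtain l where l: "l \<in> \<Gamma>1" "x = l \<otimes>\<^bsub>PSL2R\<^esub> a" by blast
    then have "x = (l \<otimes>\<^bsub>PSL2R\<^esub> k) \<otimes>\<^bsub>PSL2R\<^esub> b" using b bc G by (simp add: PSL.m_assoc)
    then show "x \<in> C" using l b \<Gamma>1_mult by blast
  qed
qed

lemma cosets_nonempty: "C \<in> cosets \<Longrightarrow> coset_rep C \<in> C"
proof -
  assume "C \<in> cosets"
  then have "C \<noteq> {}" using \<Gamma>1_one by (auto simp: cosets_eq)
  then show "coset_rep C \<in> C" unfolding coset_rep_def by (rule some_in_eq[THEN iffD2])
qed

lemma coset_rep_in: "C \<in> cosets \<Longrightarrow> coset_rep C \<in> \<Gamma>"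
  using cosets_orbit(1) cosets_nonempty by blast

lemma cosets_unique: "C \<in> cosets \<Longrightarrow> D \<in> cosets \<Longrightarrow> a \<in> C \<Longrightarrow> a \<in> D \<Longrightarrow> C = D"
  using cosets_orbit(2) by metis

lemma cosets_value:
  assumes \<psi>: "\<And>z. z \<in> \<H> \<Longrightarrow> \<psi> (of_real \<mu> * z) = \<psi> z"
    and C: "C \<in> cosets" "g \<in> C" and z: "z \<in> \<H>"
  shows "\<psi> (psl2_act (coset_rep C) z) = \<psi> (psl2_act g z)"
proof -
  obtain k where k: "k \<in> \<Gamma>1" "coset_rep C = k \<otimes>\<^bsub>PSL2R\<^esub> g"
    using cosets_nonempty[OF C(1)] cosets_orbit(2)[OF C] by blast
  have g: "g \<in> \<Gamma>" using cosets_orbit(1)[OF C] .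
  then have "psl2_act (coset_rep C) z = psl2_act k (psl2_act g z)"
    using k act_mult \<Gamma>1_subset z by auto
  then show ?thesis using \<Gamma>1_invariant[of \<psi>, OF \<psi> k(1) act_H[OF g z]] by simp
qed

text \<open>Right translation by \<Gamma> permutes the cosets. This reindexing is the source of the
  invariance of the series.\<close>

lemma cosets_shift:
  assumes d: "d \<in> \<Gamma>"
  shows "bij_betw (\<lambda>C. (\<lambda>g. g \<otimes>\<^bsub>PSL2R\<^esub> d) ` C) cosets cosets"
proof -
  have G: "x \<in> \<Gamma> \<Longrightarrow> x \<in> carrier PSL2R" for x using subset by blast
  have into: "(\<lambda>g. g \<otimes>\<^bsub>PSL2R\<^esub> e) ` C \<in> cosets" if e: "e \<in> \<Gamma>" and C: "C \<in> cosets" for e C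
  proof -
    obtain a where a: "a \<in> \<Gamma>" "C = (\<lambda>k. k \<otimes>\<^bsub>PSL2R\<^esub> a) ` \<Gamma>1" using C by (auto simp: cosets_eq)
    have "(\<lambda>g. g \<otimes>\<^bsub>PSL2R\<^esub> e) ` C = (\<lambda>k. k \<otimes>\<^bsub>PSL2R\<^esub> (a \<otimes>\<^bsub>PSL2R\<^esub> e)) ` \<Gamma>1"
      unfolding a(2) image_image using a e \<Gamma>1_subset subset
      by (intro image_cong refl PSL.m_assoc) auto
    then show ?thesis using mult_in[OF a(1) e] unfolding cosets_eq by blast
  qed
  have undo: "(\<lambda>g. g \<otimes>\<^bsub>PSL2R\<^esub> inv\<^bsub>PSL2R\<^esub> e) ` (\<lambda>g. g \<otimes>\<^bsub>PSL2R\<^esub> e) ` C = C" if e: "e \<in> \<Gamma>" and C: "C \<in> cosets" for e C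
  proof -
    have "(g \<otimes>\<^bsub>PSL2R\<^esub> e) \<otimes>\<^bsub>PSL2R\<^esub> inv\<^bsub>PSL2R\<^esub> e = g" if "g \<in> C" for g
      using G[OF e] G[OF cosets_orbit(1)[OF C that]] by (simp add: PSL.m_assoc)
    then show ?thesis unfolding image_image by simp
  qed
  show ?thesis
  proof (rule bij_betw_byWitness[where f' = "\<lambda>C. (\<lambda>g. g \<otimes>\<^bsub>PSL2R\<^esub> inv\<^bsub>PSL2R\<^esub> d) ` C"])
    show "\<forall>C\<in>cosets. (\<lambda>g. g \<otimes>\<^bsub>PSL2R\<^esub> inv\<^bsub>PSL2R\<^esub> d) ` (\<lambda>g. g \<otimes>\<^bsub>PSL2R\<^esub> d) ` C = C" using undo[OF d] by blast
    show "\<forall>C\<in>cosets. (\<lambda>g. g \<otimes>\<^bsub>PSL2R\<^esub> d) ` (\<lambda>g. g \<otimes>\<^bsub>PSL2R\<^esub> inv\<^bsub>PSL2R\<^esub> d) ` C = C"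
      using undo[OF inv_in[OF d]] PSL.inv_inv[OF G[OF d]] by simp
  qed (use into d inv_in in auto)
qed

section \<open>Absolute convergence for exponents larger than 1\<close>

lemma dyadic_box:
  assumes v: "v \<in> \<H>" "1 \<le> cmod v" "cmod v < \<mu>"
  defines "m \<equiv> nat \<lfloor>log 2 (\<mu> / Im v)\<rfloor>"
  defines "k \<equiv> \<lfloor>Re v * 2 ^ m / \<mu>\<rfloor>"
  shows "\<mu> / 2 ^ m < 2 * Im v" "Im v \<le> \<mu> / 2 ^ m" "k \<in> {- (2 ^ m)..2 ^ m}"
    "real_of_int k * (\<mu> / 2 ^ m) \<le> Re v" "Re v < (real_of_int k + 1) * (\<mu> / 2 ^ m)"
proof -
  have p: "Im v > 0" using v by (simp add: H_iff)
  have "Im v < \<mu>" using v abs_Im_le_cmod[of v] by linarith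
  then have q: "\<mu> / Im v > 1" using p by simp
  \<comment> \<open>Positivity of the logarithm means that \<open>nat\<close> truncates nothing in
    the definition of \<open>m\<close>.\<close>
  then have l: "log 2 (\<mu> / Im v) > 0" by simp
  have m: "real m \<le> log 2 (\<mu> / Im v)" "log 2 (\<mu> / Im v) < real m + 1"
    unfolding m_def using l by linarith+
  have "2 powr real m \<le> \<mu> / Im v" using m(1) q by (simp add: le_log_iff)
  then have a: "2 ^ m \<le> \<mu> / Im v" by (simp add: powr_realpow)
  then show "Im v \<le> \<mu> / 2 ^ m" using p by (simp add: field_simps)
  have "\<mu> / Im v < 2 powr (real m + 1)" using m(2) q by (simp add: log_less_iff)
  then have "\<mu> / Im v < 2 ^ m * 2" by (simp add: powr_realpow powr_add)
  then show "\<mu> / 2 ^ m < 2 * Im v" using p by (simp add: field_simps)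
  have b: "\<bar>Re v\<bar> < \<mu>" using v abs_Re_le_cmod[of v] by linarith
  then have "\<bar>Re v * 2 ^ m / \<mu>\<bar> \<le> 2 ^ m" using \<mu> by (simp add: abs_mult field_simps)
  then have c: "- (2 ^ m) \<le> Re v * 2 ^ m / \<mu>" "Re v * 2 ^ m / \<mu> \<le> 2 ^ m" unfolding abs_le_iff by linarith+
  have "- (2 ^ m) \<le> k" unfolding k_def using c(1) by (simp add: le_floor_iff)
  moreover have "real_of_int k \<le> 2 ^ m" unfolding k_def using c(2) of_int_floor_le order_trans by blast
  then have "k \<le> 2 ^ m" by (metis of_int_le_iff of_int_numeral of_int_power)
  ultimately show "k \<in> {- (2 ^ m)..2 ^ m}" by simp
  have d: "real_of_int k \<le> Re v * 2 ^ m / \<mu>" "Re v * 2 ^ m / \<mu> < real_of_int k + 1"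
    unfolding k_def by linarith+
  show "real_of_int k * (\<mu> / 2 ^ m) \<le> Re v" "Re v < (real_of_int k + 1) * (\<mu> / 2 ^ m)"
    using d \<mu> by (auto simp: field_simps)
qed

text \<open>A box with the side comparable to its height has bounded hyperbolic size: the squared
  distance is at most a^2 + (a/2)^2, and the product of the heights is at least (a/2)^2.\<close>

lemma box_hyp:
  assumes v: "v \<in> \<H>" "w \<in> \<H>" and a: "a < 2 * Im v" "Im v \<le> a" "a < 2 * Im w" "Im w \<le> a"
    "r * a \<le> Re v" "Re v < (r + 1) * a" "r * a \<le> Re w" "Re w < (r + 1) * a"
  shows "hyp v w \<le> 5"
proof -
  have p: "Im v > 0" "Im w > 0" using v by (auto simp: H_iff)
  have ap: "a > 0" using a p by linarith
  have "\<bar>Re v - Re w\<bar> \<le> a" using a by (auto simp: abs_if algebra_simps)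
  then have 1: "(Re v - Re w)^2 \<le> a^2" using power_mono[of "\<bar>Re v - Re w\<bar>" a 2] by simp
  have "\<bar>Im v - Im w\<bar> \<le> a / 2" using a by (auto simp: abs_if)
  then have 2: "(Im v - Im w)^2 \<le> (a/2)^2" using power_mono[of "\<bar>Im v - Im w\<bar>" "a/2" 2] by simp
  have 3: "(a/2) * (a/2) \<le> Im v * Im w" using a ap by (intro mult_mono) auto
  have "(cmod (v - w))^2 \<le> a^2 + (a/2)^2" using 1 2 by (simp add: cmod_power2)
  also have "\<dots> = 5 * ((a/2) * (a/2))" by (simp add: power2_eq_square)
  also have "\<dots> \<le> 5 * (Im v * Im w)" using 3 by simp
  finally show ?thesis using p by (simp add: hyp_def divide_le_eq)
qed

text \<open>Each orbit point is moved into the half-annulus and sorted by dyadic height \<mu> / 2^m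
  and horizontal slot. A level has about 2^m boxes, a box holds at most \<open>N\<close> points, and
  a point contributes at most (\<mu> / 2^m)^\<sigma>; the resulting geometric series has ratio 2^(1
  - \<sigma>), which is where \<sigma> > 1 enters.\<close>

lemma ht_powr_sum_bound:
  assumes \<sigma>: "\<sigma> > 1"
  obtains B where "\<And>z F. z \<in> \<H> \<Longrightarrow> finite F \<Longrightarrow> F \<subseteq> cosets \<Longrightarrow> (\<Sum>C\<in>F. ht (psl2_act (coset_rep C) z) powr \<sigma>) \<le> B"
proof -
  obtain N :: nat where N: "\<And>z w. z \<in> \<H> \<Longrightarrow> w \<in> \<H> \<Longrightarrow>
    finite {g \<in> \<Gamma>. hyp (psl2_act g z) w \<le> 5} \<and> card {g \<in> \<Gamma>. hyp (psl2_act g z) w \<le> 5} \<le> N"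
    using uniform_count[of 5] by blast
  define x where "x = 2 powr (1 - \<sigma>)"
  have x: "0 < x" "x < 1" using \<sigma> by (auto simp: x_def powr_less_one)
  show ?thesis
  proof (rule that[of "real N * (\<mu> powr \<sigma> * (3 * (1 / (1 - x))))"])
    fix z F assume z: "z \<in> \<H>" and F: "finite F" "F \<subseteq> cosets"
    have "\<exists>g\<in>C. 1 \<le> cmod (psl2_act g z) \<and> cmod (psl2_act g z) < \<mu>" if "C \<in> F" for C
    proof -
      have C: "C \<in> cosets" using that F by blast
      obtain k where k: "k \<in> \<Gamma>1" "1 \<le> cmod (psl2_act k (psl2_act (coset_rep C) z))" "cmod (psl2_act k (psl2_act (coset_rep C) z)) < \<mu>"
        using \<Gamma>1_reduce[OF act_H[OF coset_rep_in[OF C] z]] by blast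
      then have "k \<otimes>\<^bsub>PSL2R\<^esub> coset_rep C \<in> C" using cosets_orbit(2)[OF C cosets_nonempty[OF C]] by blast
      moreover have "psl2_act (k \<otimes>\<^bsub>PSL2R\<^esub> coset_rep C) z = psl2_act k (psl2_act (coset_rep C) z)"
        using k \<Gamma>1_subset coset_rep_in[OF C] z by (intro act_mult) auto
      ultimately show ?thesis using k by metis
    qed
    then obtain g where g: "\<And>C. C \<in> F \<Longrightarrow> g C \<in> C \<and> 1 \<le> cmod (psl2_act (g C) z) \<and> cmod (psl2_act (g C) z) < \<mu>"
      by metis
    define v where "v C = psl2_act (g C) z" for C
    have g\<Gamma>: "g C \<in> \<Gamma>" if "C \<in> F" for C using cosets_orbit(1) g that F by blast
    have v: "v C \<in> \<H>" "1 \<le> cmod (v C)" "cmod (v C) < \<mu>" if "C \<in> F" for C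
      using that g g\<Gamma> act_H z by (auto simp: v_def)
    have inj: "inj_on g F"
    proof (rule inj_onI)
      fix C D assume "C \<in> F" "D \<in> F" "g C = g D"
      then show "C = D" using cosets_unique[of C D "g C"] g F by (metis subset_iff)
    qed
    define m where "m C = nat \<lfloor>log 2 (\<mu> / Im (v C))\<rfloor>" for C
    define k where "k C = \<lfloor>Re (v C) * 2 ^ (m C) / \<mu>\<rfloor>" for C
    define key where "key C = (m C, k C)" for C
    define M where "M = Max (insert 0 (m ` F))"
    let ?Q = "SIGMA m:{..M}. {- (2 ^ m)..2 ^ m :: int}"
    let ?w = "\<lambda>q :: nat \<times> int. (\<mu> / 2 ^ fst q) powr \<sigma>"
    have box: "\<mu> / 2 ^ m C < 2 * Im (v C)" "Im (v C) \<le> \<mu> / 2 ^ m C" "k C \<in> {- (2 ^ m C)..2 ^ m C}"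
      "real_of_int (k C) * (\<mu> / 2 ^ m C) \<le> Re (v C)" "Re (v C) < (real_of_int (k C) + 1) * (\<mu> / 2 ^ m C)"
      if "C \<in> F" for C
      using dyadic_box[OF v[OF that]] unfolding k_def m_def by auto
    have keyQ: "key ` F \<subseteq> ?Q"
    proof
      fix q assume "q \<in> key ` F"
      then obtain C where C: "C \<in> F" "q = key C" by blast
      then have "m C \<le> M" unfolding M_def using F by (intro Max_ge) auto
      then show "q \<in> ?Q" using C box(3) by (auto simp: key_def)
    qed
    \<comment> \<open>Points of one box are within \<open>hyp\<close> 5 of a fixed one of them, so
      \<open>uniform_count\<close> applies with a bound that depends neither on the box nor on
      \<open>z\<close>.\<close>
    have cnt: "card {C \<in> F. key C = q} \<le> N" for q
    proof (cases "{C \<in> F. key C = q} = {}")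
      case False
      then obtain D where D: "D \<in> F" "key D = q" by blast
      have h: "hyp (v C) (v D) \<le> 5" if C: "C \<in> F" "key C = q" for C
      proof -
        have e: "m C = m D" "k C = k D" using C D by (auto simp: key_def)
        show ?thesis using box[OF C(1)] box[OF D(1)] v C D unfolding e
          by (intro box_hyp[of _ _ "\<mu> / 2 ^ m D" "real_of_int (k D)"]) auto
      qed
      have "card {C \<in> F. key C = q} = card (g ` {C \<in> F. key C = q})"
        using inj by (intro card_image[symmetric]) (auto simp: inj_on_def)
      also have "\<dots> \<le> card {g \<in> \<Gamma>. hyp (psl2_act g z) (v D) \<le> 5}"
        using N[OF z v(1)[OF D(1)]] h g\<Gamma> by (intro card_mono) (auto simp: v_def)
      also have "\<dots> \<le> N" using N[OF z v(1)[OF D(1)]] by blast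
      finally show ?thesis .
    next
      case True
      show ?thesis unfolding True by simp
    qed
    have "(\<Sum>C\<in>F. ht (psl2_act (coset_rep C) z) powr \<sigma>) \<le> (\<Sum>C\<in>F. ?w (key C))"
    proof (rule sum_mono)
      fix C assume C: "C \<in> F"
      then have CC: "C \<in> cosets" using F by blast
      have "ht (psl2_act (coset_rep C) z) = ht (v C)"
        unfolding v_def using g[OF C] by (intro cosets_value[of ht, OF ht_\<mu> CC _ z]) auto
      \<comment> \<open>This uses |v C| \<ge> 1, the lower edge of the half-annulus.\<close>
      also have "\<dots> \<le> Im (v C)"
        using v[OF C] by (auto simp: ht_def H_iff divide_le_eq mult_le_cancel_left1)
      also have "\<dots> \<le> \<mu> / 2 ^ m C" using box(2)[OF C] .
      finally have "ht (psl2_act (coset_rep C) z) \<le> \<mu> / 2 ^ m C" .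
      moreover have "0 < ht (psl2_act (coset_rep C) z)" using ht_pos act_H coset_rep_in[OF CC] z by blast
      ultimately show "ht (psl2_act (coset_rep C) z) powr \<sigma> \<le> ?w (key C)"
        using \<sigma> by (simp add: key_def powr_mono2)
    qed
    also have "\<dots> = (\<Sum>q\<in>key ` F. \<Sum>C\<in>{C \<in> F. key C = q}. ?w (key C))"
      by (rule sum.image_gen[OF F(1)])
    also have "\<dots> = (\<Sum>q\<in>key ` F. real (card {C \<in> F. key C = q}) * ?w q)"
      by (intro sum.cong refl) simp
    also have "\<dots> \<le> (\<Sum>q\<in>key ` F. real N * ?w q)"
      using cnt by (intro sum_mono mult_right_mono) auto
    also have "\<dots> \<le> (\<Sum>q\<in>?Q. real N * ?w q)"
      using keyQ by (intro sum_mono2) auto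
    also have "\<dots> = real N * (\<Sum>m\<le>M. real (2 * 2 ^ m + 1) * (\<mu> / 2 ^ m) powr \<sigma>)"
    proof -
      have c: "nat (2 ^ m + 2 ^ m + 1 :: int) = 2 * 2 ^ m + 1" for m :: nat
      proof -
        have "(2 ^ m + 2 ^ m + 1 :: int) = int (2 * 2 ^ m + 1)" by simp
        then show ?thesis by (simp only: nat_int)
      qed
      have "(\<Sum>q\<in>?Q. real N * ?w q) = (\<Sum>m\<le>M. \<Sum>k\<in>{- (2 ^ m)..2 ^ m :: int}. real N * (\<mu> / 2 ^ m) powr \<sigma>)"
        by (subst sum.Sigma) (auto intro!: sum.cong)
      also have "\<dots> = (\<Sum>m\<le>M. real N * (real (2 * 2 ^ m + 1) * (\<mu> / 2 ^ m) powr \<sigma>))"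
      proof (rule sum.cong[OF refl])
        fix m
        have "card {- (2 ^ m)..2 ^ m :: int} = 2 * 2 ^ m + 1" using c[of m] by simp
        then show "(\<Sum>k\<in>{- (2 ^ m)..2 ^ m :: int}. real N * (\<mu> / 2 ^ m) powr \<sigma>) = real N * (real (2 * 2 ^ m + 1) * (\<mu> / 2 ^ m) powr \<sigma>)"
          by (simp only: sum_constant mult.left_commute)
      qed
      finally show ?thesis by (simp only: sum_distrib_left)
    qed
    also have "\<dots> \<le> real N * (\<Sum>m\<le>M. \<mu> powr \<sigma> * (3 * x ^ m))"
    proof (intro mult_left_mono sum_mono)
      fix m
      have "(\<mu> / 2 ^ m) powr \<sigma> = \<mu> powr \<sigma> * (2 powr (- \<sigma>)) ^ m"
      proof -
        have "(2 ^ m) powr \<sigma> = (2 powr real m) powr \<sigma>" by (simp add: powr_realpow)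
        then have 1: "(2 ^ m) powr \<sigma> = 2 powr (real m * \<sigma>)" by (simp add: powr_powr)
        have "(2 powr (- \<sigma>)) ^ m = (2 powr (- \<sigma>)) powr real m" by (simp add: powr_realpow)
        then have 2: "(2 powr (- \<sigma>)) ^ m = 2 powr (- (real m * \<sigma>))" by (simp add: powr_powr mult.commute)
        have "(\<mu> / 2 ^ m) powr \<sigma> = \<mu> powr \<sigma> / (2 ^ m) powr \<sigma>" using \<mu> by (simp add: powr_def ln_div exp_diff algebra_simps)
        then show ?thesis unfolding 1 2 by (simp only: powr_minus divide_inverse)
      qed
      then have e: "real (2 * 2 ^ m + 1) * (\<mu> / 2 ^ m) powr \<sigma> = \<mu> powr \<sigma> * ((2 * 2 ^ m + 1) * (2 powr (- \<sigma>)) ^ m)"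
        by simp
      \<comment> \<open>The number of slots at level m is at most 3 * 2^m, which explains the
        constant 3 in the bound.\<close>
      have "(2 * 2 ^ m + 1) * (2 powr (- \<sigma>)) ^ m \<le> (3 * 2 ^ m) * (2 powr (- \<sigma>)) ^ m"
        by (intro mult_right_mono) auto
      also have "\<dots> = 3 * x ^ m" by (simp add: x_def powr_diff powr_minus divide_inverse power_mult_distrib)
      finally show "real (2 * 2 ^ m + 1) * (\<mu> / 2 ^ m) powr \<sigma> \<le> \<mu> powr \<sigma> * (3 * x ^ m)"
        unfolding e by (intro mult_left_mono) auto
    qed simp
    also have "\<dots> = real N * (\<mu> powr \<sigma> * (3 * (\<Sum>m\<le>M. x ^ m)))" by (simp add: sum_distrib_left)
    also have "\<dots> \<le> real N * (\<mu> powr \<sigma> * (3 * (1 / (1 - x))))"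
    proof -
      have "(\<Sum>m\<le>M. x ^ m) \<le> (\<Sum>m. x ^ m)" using x by (intro sum_le_suminf summable_geometric) auto
      also have "\<dots> = 1 / (1 - x)" using x by (simp add: suminf_geometric)
      finally show ?thesis by (intro mult_left_mono) auto
    qed
    finally show "(\<Sum>C\<in>F. ht (psl2_act (coset_rep C) z) powr \<sigma>) \<le> real N * (\<mu> powr \<sigma> * (3 * (1 / (1 - x))))" .
  qed
qed

lemma ht_powr_summable:
  assumes \<sigma>: "\<sigma> > 1"
  obtains B where "\<And>z. z \<in> \<H> \<Longrightarrow> (\<lambda>C. ht (psl2_act (coset_rep C) z) powr \<sigma>) summable_on cosets"
     "\<And>z. z \<in> \<H> \<Longrightarrow> (\<Sum>\<^sub>\<infinity>C\<in>cosets. ht (psl2_act (coset_rep C) z) powr \<sigma>) \<le> B"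
proof -
  obtain B where B: "\<And>z F. z \<in> \<H> \<Longrightarrow> finite F \<Longrightarrow> F \<subseteq> cosets \<Longrightarrow> (\<Sum>C\<in>F. ht (psl2_act (coset_rep C) z) powr \<sigma>) \<le> B"
    using ht_powr_sum_bound[OF \<sigma>] by blast
  have s: "(\<lambda>C. ht (psl2_act (coset_rep C) z) powr \<sigma>) summable_on cosets" if "z \<in> \<H>" for z
    using B[OF that] by (intro nonneg_bdd_above_summable_on) (auto simp: bdd_above_def)
  show ?thesis
    using s B by (intro that[of B] infsum_le_finite_sums) auto
qed

end

section \<open>Automorphic primitives and Poincare series\<close>

lemma holomorphic_local:
  assumes "\<And>s. s \<in> U \<Longrightarrow> \<exists>r>0. f holomorphic_on ball s r"
  shows "f holomorphic_on U"
  unfolding holomorphic_on_def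
proof
  fix s assume "s \<in> U"
  then obtain r where "r > 0" "f holomorphic_on ball s r" using assms by blast
  then have "f field_differentiable at s"
    by (intro holomorphic_on_imp_differentiable_at[of _ "ball s r"]) auto
  then show "f field_differentiable at s within U" by (rule field_differentiable_at_within)
qed

context hyperbolic_group
begin

text \<open>What the argument retains of the real or imaginary part of a primitive of
  \<open>f k\<close>: constant periods under \<Gamma>, and period zero under the dilation by \<mu>,
  which is the vanishing of the symbol of \<open>\<gamma>1\<close>.\<close>

definition additive :: "(complex \<Rightarrow> real) \<Rightarrow> bool" where
  "additive A \<longleftrightarrow> continuous_on \<H> A \<and> (\<forall>g\<in>\<Gamma>. \<exists>c. \<forall>z\<in>\<H>. A (psl2_act g z) = A z + c) \<and>
     (\<forall>z\<in>\<H>. A (of_real \<mu> * z) = A z)"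

text \<open>The symbol is an integral of an exact form, hence a difference of values of the
  primitive; as the period is constant, the base point \<i> may be replaced by any
  \<open>z\<close>.\<close>

lemma weight2_additive:
  assumes f: "weight2_form \<Gamma> f" and \<alpha>: "\<alpha> = Re_form f \<or> \<alpha> = Im_form f" and 0: "modular_symbol \<gamma>1 \<alpha> = 0"
  obtains A where "additive A"
    "\<And>g z. g \<in> \<Gamma> \<Longrightarrow> z \<in> \<H> \<Longrightarrow> modular_symbol g \<alpha> = - 2 * of_real pi * \<i> * of_real (A (psl2_act g z) - A z)"
proof -
  obtain F where F: "\<And>z. z \<in> \<H> \<Longrightarrow> (F has_field_derivative f z) (at z)"
    and c: "\<And>A. det A = 1 \<Longrightarrow> psl2_class A \<in> \<Gamma> \<Longrightarrow> \<exists>c. \<forall>z\<in>\<H>. F (sl2_act A z) - F z = c"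
    using weight2_primitive[OF f] by metis
  have cF: "continuous_on \<H> F"
    by (rule DERIV_continuous_on[OF has_field_derivative_at_within[OF F]])
  define P where "P = (if \<alpha> = Re_form f then Re else Im)"
  define A where "A z = P (F z)" for z
  have P: "P (a - b) = P a - P b" for a b by (simp add: P_def)
  have int: "path_integral \<alpha> p = P I" if "(f has_contour_integral I) p" for p I
    using path_integral_Re_Im[OF that] \<alpha> by (auto simp: P_def)
  have const: "\<exists>c. \<forall>z\<in>\<H>. F (psl2_act g z) - F z = c" if g: "g \<in> \<Gamma>" for g
    using c g repr psl2_act_class by metis
  have ms: "modular_symbol g \<alpha> = - 2 * of_real pi * \<i> * of_real (A (psl2_act g z) - A z)"
    if g: "g \<in> \<Gamma>" and z: "z \<in> \<H>" for g z
  proof -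
    have gi: "psl2_act g \<i> \<in> \<H>" using act_H[OF g i_in_H] .
    have "path_image (linepath \<i> (psl2_act g \<i>)) \<subseteq> \<H>"
      using closed_segment_subset[OF i_in_H gi convex_H] by simp
    then have "(f has_contour_integral (F (psl2_act g \<i>) - F \<i>)) (linepath \<i> (psl2_act g \<i>))"
      using contour_integral_primitive[of \<H> F f "linepath \<i> (psl2_act g \<i>)"] F
      by (auto intro: has_field_derivative_at_within)
    moreover have "F (psl2_act g \<i>) - F \<i> = F (psl2_act g z) - F z"
      using const[OF g] z i_in_H by metis
    ultimately have "path_integral \<alpha> (linepath \<i> (psl2_act g \<i>)) = A (psl2_act g z) - A z"
      using int unfolding A_def P[symmetric] by simp
    then show ?thesis by (simp add: modular_symbol_def)
  qed
  have "additive A"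
    unfolding additive_def
  proof (intro conjI ballI)
    show "continuous_on \<H> A" unfolding A_def P_def using cF by (auto intro!: continuous_intros)
    fix g assume "g \<in> \<Gamma>"
    then obtain c where "\<forall>z\<in>\<H>. F (psl2_act g z) - F z = c" using const by blast
    then have "\<forall>z\<in>\<H>. A (psl2_act g z) = A z + P c" unfolding A_def using P by (metis add_diff_cancel_left' diff_add_cancel add.commute)
    then show "\<exists>c. \<forall>z\<in>\<H>. A (psl2_act g z) = A z + c" by blast
  next
    fix z assume "z \<in> \<H>"
    then show "A (of_real \<mu> * z) = A z" using ms[OF \<gamma>1_in] 0 by (simp add: act_\<gamma>1)
  qed
  then show ?thesis using that ms by blast
qed

lemma additive_diff: "additive A \<Longrightarrow> g \<in> \<Gamma> \<Longrightarrow> z \<in> \<H> \<Longrightarrow> w \<in> \<H> \<Longrightarrow>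
   A (psl2_act g z) - A (psl2_act g w) = A z - A w"
  unfolding additive_def by (metis add_diff_cancel_right)

text \<open>Differences A z - A w are invariant under the diagonal action of \<Gamma>, so that
  \<open>z\<close> may be moved to a compact set, where a continuous function is bounded.\<close>

lemma additive_lipschitz:
  assumes A: "additive A"
  obtains L where "L \<ge> 0" "\<And>z w. z \<in> \<H> \<Longrightarrow> w \<in> \<H> \<Longrightarrow> hyp z w \<le> 1 \<Longrightarrow> \<bar>A z - A w\<bar> \<le> L"
proof -
  obtain R where R: "R \<ge> 0" "\<And>z. z \<in> \<H> \<Longrightarrow> \<exists>g\<in>\<Gamma>. hyp (psl2_act g z) \<i> \<le> R" using cocompact_hyp by blast
  define R' where "R' = 4 * (1 + 2) * (R + 2)"
  obtain K where K: "compact K" "K \<subseteq> \<H>" "{v \<in> \<H>. hyp v \<i> \<le> R'} \<subseteq> K" using compact_hyp_ball by blast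
  have "compact (A ` K)"
    using A K by (intro compact_continuous_image) (auto simp: additive_def intro: continuous_on_subset)
  then have "bounded (A ` K)" by (rule compact_imp_bounded)
  then obtain B where B: "\<And>v. v \<in> K \<Longrightarrow> \<bar>A v\<bar> \<le> B" unfolding bounded_iff by auto
  show ?thesis
  proof (rule that[of "\<bar>2 * B\<bar>"])
    fix z w assume zw: "z \<in> \<H>" "w \<in> \<H>" "hyp z w \<le> 1"
    obtain g where g: "g \<in> \<Gamma>" "hyp (psl2_act g z) \<i> \<le> R" using R zw by blast
    have H: "psl2_act g z \<in> \<H>" "psl2_act g w \<in> \<H>" using g zw act_H by auto
    have "R \<le> R'" using R(1) by (simp add: R'_def)
    then have 1: "psl2_act g z \<in> K" using K g H by auto
    have "hyp (psl2_act g w) (psl2_act g z) \<le> 1" using hyp_act[OF g(1) zw(2,1)] zw(3) by (simp add: hyp_sym)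
    then have "hyp (psl2_act g w) \<i> \<le> R'"
      unfolding R'_def using hyp_chain[OF H(2,1) i_in_H _ g(2)] by blast
    then have 2: "psl2_act g w \<in> K" using K H by auto
    show "\<bar>A z - A w\<bar> \<le> \<bar>2 * B\<bar>"
      using B[OF 1] B[OF 2] additive_diff[OF A g(1) zw(1,2)] by linarith
  qed simp
qed

text \<open>Below height 1/2, doubling the imaginary part is a step of bounded hyperbolic length
  which raises \<open>ht\<close> by a definite factor. Repetition leads to \<open>ht\<close> \<ge>
  1/2 in a number of steps logarithmic in 1 / \<open>ht\<close>.\<close>

lemma ht_double:
  assumes z: "z \<in> \<H>" "ht z \<le> 1/2"
  defines "z' \<equiv> Complex (Re z) (2 * Im z)"
  shows "z' \<in> \<H>" "hyp z z' \<le> 1" "3/2 * ht z \<le> ht z'"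
proof -
  have p: "Im z > 0" using z by (simp add: H_iff)
  show H: "z' \<in> \<H>" using p by (simp add: z'_def H_iff)
  have "(cmod (z - z'))^2 = (Im z)^2" by (simp add: z'_def cmod_power2)
  then have "hyp z z' = 1/2" using p by (simp add: hyp_def z'_def power2_eq_square)
  then show "hyp z z' \<le> 1" by simp
  have zp: "cmod z > 0" "cmod z' > 0" using z H by (auto simp: H_iff)
  have "Im z \<le> cmod z / 2" using z zp by (simp add: ht_def field_simps)
  then have "(Im z)^2 \<le> (cmod z / 2)^2" using p by (intro power_mono) auto
  then have "4 * (Im z)^2 \<le> (cmod z)^2" by (simp add: power_divide)
  moreover have "(cmod z')^2 = (cmod z)^2 + 3 * (Im z)^2" by (simp add: z'_def cmod_power2 power_mult_distrib)
  ultimately have "(cmod z')^2 \<le> 16/9 * (cmod z)^2" using zero_le_power2[of "cmod z"] by linarith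
  then have "(cmod z')^2 \<le> (4/3 * cmod z)^2" by (simp add: power2_eq_square)
  then have "cmod z' \<le> 4/3 * cmod z" by (rule power2_le_imp_le) simp
  then have "3/2 * Im z * cmod z' \<le> 3/2 * Im z * (4/3 * cmod z)" using p by (intro mult_left_mono) auto
  then have "3/2 * Im z * cmod z' \<le> Im z' * cmod z" by (simp add: z'_def)
  then show "3/2 * ht z \<le> ht z'" using zp by (simp add: ht_def field_simps)
qed

text \<open>The growth is logarithmic in 1 / \<open>ht\<close>: each doubling changes A by at most
  L. The power form with arbitrary e is the one that can be absorbed into exponents, and the
  induction on the number of doublings proves it directly.\<close>

lemma additive_growth:
  assumes A: "additive A" and e: "e > 0"
  obtains K where "\<And>z. z \<in> \<H> \<Longrightarrow> \<bar>A z\<bar> \<le> K * ht z powr (- e)"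
proof -
  obtain L where L: "L \<ge> 0" "\<And>z w. z \<in> \<H> \<Longrightarrow> w \<in> \<H> \<Longrightarrow> hyp z w \<le> 1 \<Longrightarrow> \<bar>A z - A w\<bar> \<le> L"
    using additive_lipschitz[OF A] by blast
  \<comment> \<open>After reduction a point with \<open>ht\<close> \<ge> 1/2 has modulus between 1
    and \<mu>, hence imaginary part at least 1/2, and so lies in this compact set.\<close>
  let ?Q = "{v. Im v \<ge> 1/2} \<inter> cball 0 \<mu>"
  have "compact ?Q" by (intro closed_Int_compact closed_halfspace_Im_ge compact_cball)
  moreover have "?Q \<subseteq> \<H>" by (auto simp: H_iff)
  ultimately have "compact (A ` ?Q)"
    using A by (intro compact_continuous_image) (auto simp: additive_def intro: continuous_on_subset)
  then have "bounded (A ` ?Q)" by (rule compact_imp_bounded)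
  then obtain B where "\<forall>x\<in>A ` ?Q. norm x \<le> B" unfolding bounded_iff by blast
  then have B: "\<And>v. v \<in> ?Q \<Longrightarrow> \<bar>A v\<bar> \<le> B" by (metis image_eqI real_norm_def)
  define q where "q = (3/2::real) powr (- e)"
  have q: "0 < q" "q < 1" using e by (auto simp: q_def powr_less_one)
  \<comment> \<open>The choice gives K q + L \<le> K, so that the factor q gained at a doubling pays
    for the cost L.\<close>
  define K where "K = max \<bar>B\<bar> (L / (1 - q))"
  have K0: "K \<ge> 0" by (simp add: K_def)
  have KL: "L \<le> K * (1 - q)"
  proof -
    have "L / (1 - q) \<le> K" by (simp add: K_def)
    then show ?thesis using q by (simp add: field_simps)
  qed
  have one: "1 \<le> ht z powr (- e)" if "z \<in> \<H>" for z
    using ht_pos[OF that] ht_le_1[of z] e by (simp add: powr_minus one_le_inverse powr_le_one_le powr_le1)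
  have base: "\<bar>A z\<bar> \<le> K * ht z powr (- e)" if z: "z \<in> \<H>" "ht z \<ge> 1/2" for z
  proof -
    obtain g where g: "g \<in> \<Gamma>1" "1 \<le> cmod (psl2_act g z)" "cmod (psl2_act g z) < \<mu>" using \<Gamma>1_reduce[OF z(1)] by blast
    let ?w = "psl2_act g z"
    have "ht ?w \<ge> 1/2" using ht_\<Gamma>1[OF g(1) z(1)] z by simp
    moreover have "cmod ?w > 0" using g by linarith
    ultimately have "Im ?w \<ge> cmod ?w / 2" by (simp add: ht_def field_simps)
    then have "?w \<in> ?Q" using g by auto
    then have "\<bar>A ?w\<bar> \<le> B" using B by blast
    moreover have "A ?w = A z" using A by (intro \<Gamma>1_invariant[OF _ g(1) z(1)]) (auto simp: additive_def)
    ultimately have "\<bar>A z\<bar> \<le> K * 1" by (simp add: K_def)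
    also have "\<dots> \<le> K * ht z powr (- e)" using one[OF z(1)] K0 by (intro mult_left_mono) auto
    finally show ?thesis .
  qed
  have ind: "\<forall>z\<in>\<H>. (2/3) ^ j / 2 \<le> ht z \<longrightarrow> \<bar>A z\<bar> \<le> K * ht z powr (- e)" for j :: nat
  proof (induction j)
    case 0
    then show ?case using base by simp
  next
    case (Suc j)
    show ?case
    proof (intro ballI impI)
      fix z assume z: "z \<in> \<H>" "(2/3) ^ Suc j / 2 \<le> ht z"
      show "\<bar>A z\<bar> \<le> K * ht z powr (- e)"
      proof (cases "ht z \<ge> 1/2")
        case False
        then have zh: "ht z \<le> 1/2" by simp
        define z' where "z' = Complex (Re z) (2 * Im z)"
        have z': "z' \<in> \<H>" "hyp z z' \<le> 1" "3/2 * ht z \<le> ht z'"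
          using ht_double[OF z(1) zh] by (auto simp: z'_def)
        have "(2/3) ^ j / 2 \<le> ht z'" using z z'(3) by simp
        then have "\<bar>A z'\<bar> \<le> K * ht z' powr (- e)" using Suc z'(1) by blast
        also have "\<dots> \<le> K * (3/2 * ht z) powr (- e)"
        proof -
          have "ht z' powr (- e) \<le> (3/2 * ht z) powr (- e)"
            using z'(3) ht_pos[OF z(1)] e by (intro powr_mono2') auto
          then show ?thesis using K0 by (intro mult_left_mono) auto
        qed
        also have "(3/2 * ht z) powr (- e) = (3/2) powr (- e) * ht z powr (- e)"
          by (rule powr_mult; use ht_pos[OF z(1)] in simp)
        also have "K * ((3/2) powr (- e) * ht z powr (- e)) = K * q * ht z powr (- e)"
          by (simp add: q_def)
        finally have 1: "\<bar>A z'\<bar> \<le> K * q * ht z powr (- e)" .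
        have "L \<le> K * (1 - q) * 1" using KL by simp
        also have "\<dots> \<le> K * (1 - q) * ht z powr (- e)"
          using one[OF z(1)] K0 q by (intro mult_left_mono) auto
        finally have 2: "L \<le> K * (1 - q) * ht z powr (- e)" .
        have "\<bar>A z\<bar> \<le> \<bar>A z'\<bar> + L" using L(2)[OF z(1) z'(1,2)] by linarith
        also have "\<dots> \<le> K * q * ht z powr (- e) + K * (1 - q) * ht z powr (- e)" using 1 2 by linarith
        also have "\<dots> = K * ht z powr (- e)" by (simp add: algebra_simps)
        finally show ?thesis .
      qed (use base z in auto)
    qed
  qed
  show ?thesis
  proof (rule that[of K])
    fix z assume z: "z \<in> \<H>"
    have "2 * ht z > 0" using ht_pos[OF z] by simp
    then obtain j where "(2/3::real) ^ j < 2 * ht z" using real_arch_pow_inv[of "2 * ht z" "2/3"] by auto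
    then show "\<bar>A z\<bar> \<le> K * ht z powr (- e)" using ind[of j] z by simp
  qed
qed

section \<open>Poincare series and their holomorphic families\<close>

definition poinc :: "(complex \<Rightarrow> complex) \<Rightarrow> complex \<Rightarrow> complex" where
  "poinc \<psi> z = (\<Sum>\<^sub>\<infinity>C\<in>cosets. \<psi> (psl2_act (coset_rep C) z))"

text \<open>Holomorphic families of summands for \<open>poinc\<close>, and of \<open>\<Gamma>\<close>-invariant functions such as their sums.\<close>

definition cylfam :: "complex set \<Rightarrow> (complex \<Rightarrow> complex \<Rightarrow> complex) \<Rightarrow> bool" where
  "cylfam U \<psi> \<longleftrightarrow> (\<forall>s\<in>U. continuous_on \<H> (\<psi> s)) \<and> (\<forall>z\<in>\<H>. (\<lambda>s. \<psi> s z) holomorphic_on U) \<and>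
     (\<forall>s\<in>U. \<forall>z\<in>\<H>. \<psi> s (of_real \<mu> * z) = \<psi> s z) \<and>
     (\<forall>K. compact K \<and> K \<subseteq> U \<longrightarrow> (\<exists>\<sigma>>1. \<exists>B\<ge>0. \<forall>s\<in>K. \<forall>z\<in>\<H>. cmod (\<psi> s z) \<le> B * ht z powr \<sigma>))"

definition autfam :: "complex set \<Rightarrow> (complex \<Rightarrow> complex \<Rightarrow> complex) \<Rightarrow> bool" where
  "autfam U u \<longleftrightarrow> (\<forall>s\<in>U. u s \<in> borel_measurable hmeas) \<and> (\<forall>z\<in>\<H>. (\<lambda>s. u s z) holomorphic_on U) \<and>
     (\<forall>s\<in>U. \<forall>g\<in>\<Gamma>. \<forall>z\<in>\<H>. u s (psl2_act g z) = u s z) \<and>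
     (\<forall>K. compact K \<and> K \<subseteq> U \<longrightarrow> (\<exists>B\<ge>0. \<forall>s\<in>K. \<forall>z\<in>\<H>. cmod (u s z) \<le> B))"

lemma ht_harnack_act:
  assumes "g \<in> \<Gamma>" "z \<in> \<H>" "w \<in> \<H>" "hyp z w \<le> 1"
  shows "ht (psl2_act g w) \<le> 12 * ht (psl2_act g z)"
proof -
  have H: "psl2_act g z \<in> \<H>" "psl2_act g w \<in> \<H>" using assms act_H by auto
  have h: "0 \<le> hyp z w" using assms hyp_nonneg by blast
  have "ht (psl2_act g w) \<le> (hyp z w + 2) * (hyp z w + 3) * ht (psl2_act g z)"
    using ht_harnack[OF H] hyp_act[OF assms(1-3)] by simp
  also have "\<dots> \<le> (3 * 4) * ht (psl2_act g z)"
    using assms(4) h ht_pos[OF H(1)] by (intro mult_right_mono mult_mono) auto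
  finally show ?thesis by simp
qed

text \<open>The majorant depends on \<open>z\<close> and not on the nearby point \<open>w\<close>,
  which turns pointwise summability into locally uniform convergence. The factor 12 is the Harnack
  factor 3 * 4 for \<open>hyp\<close> \<le> 1.\<close>

lemma poinc_bound_near:
  assumes \<psi>: "\<And>z. z \<in> \<H> \<Longrightarrow> cmod (\<psi> z) \<le> B * ht z powr \<sigma>" and "B \<ge> 0" "\<sigma> > 1"
    and z: "z \<in> \<H>" and w: "w \<in> \<H>" "hyp z w \<le> 1" and C: "C \<in> cosets"
  shows "cmod (\<psi> (psl2_act (coset_rep C) w)) \<le> B * 12 powr \<sigma> * ht (psl2_act (coset_rep C) z) powr \<sigma>"
proof -
  have H: "psl2_act (coset_rep C) w \<in> \<H>" "psl2_act (coset_rep C) z \<in> \<H>" using coset_rep_in[OF C] z w act_H by auto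
  have "cmod (\<psi> (psl2_act (coset_rep C) w)) \<le> B * ht (psl2_act (coset_rep C) w) powr \<sigma>" using \<psi>[OF H(1)] .
  also have "\<dots> \<le> B * (12 * ht (psl2_act (coset_rep C) z)) powr \<sigma>"
    using ht_harnack_act[OF coset_rep_in[OF C] z w] ht_pos[OF H(1)] assms(2,3)
    by (intro mult_left_mono powr_mono2) auto
  also have "\<dots> = B * 12 powr \<sigma> * ht (psl2_act (coset_rep C) z) powr \<sigma>"
    using ht_pos[OF H(2)] by (simp add: powr_mult)
  finally show ?thesis .
qed

lemma poinc_summable:
  assumes \<psi>: "\<And>z. z \<in> \<H> \<Longrightarrow> cmod (\<psi> z) \<le> B * ht z powr \<sigma>" and B: "B \<ge> 0" and \<sigma>: "\<sigma> > 1" and z: "z \<in> \<H>"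
  shows "(\<lambda>C. cmod (\<psi> (psl2_act (coset_rep C) z))) summable_on cosets"
proof -
  obtain B' where "\<And>z. z \<in> \<H> \<Longrightarrow> (\<lambda>C. ht (psl2_act (coset_rep C) z) powr \<sigma>) summable_on cosets"
    using ht_powr_summable[OF \<sigma>] by blast
  then have "(\<lambda>C. B * ht (psl2_act (coset_rep C) z) powr \<sigma>) summable_on cosets"
    using z by (intro summable_on_cmult_right) auto
  then show ?thesis
    by (rule Infinite_Sum.abs_summable_on_comparison_test') (use \<psi> act_H coset_rep_in z in auto)
qed

lemma poinc_bounded:
  assumes \<sigma>: "\<sigma> > 1"
  obtains M where "M \<ge> 0" "\<And>\<psi> B z. (\<And>z. z \<in> \<H> \<Longrightarrow> cmod (\<psi> z) \<le> B * ht z powr \<sigma>) \<Longrightarrow> B \<ge> 0 \<Longrightarrow> z \<in> \<H> \<Longrightarrow>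
     cmod (poinc \<psi> z) \<le> B * M"
proof -
  obtain M where M: "\<And>z. z \<in> \<H> \<Longrightarrow> (\<lambda>C. ht (psl2_act (coset_rep C) z) powr \<sigma>) summable_on cosets"
     "\<And>z. z \<in> \<H> \<Longrightarrow> (\<Sum>\<^sub>\<infinity>C\<in>cosets. ht (psl2_act (coset_rep C) z) powr \<sigma>) \<le> M"
    using ht_powr_summable[OF \<sigma>] by blast
  show ?thesis
  proof (rule that[of M])
    have "0 \<le> (\<Sum>\<^sub>\<infinity>C\<in>cosets. ht (psl2_act (coset_rep C) \<i>) powr \<sigma>)" by (intro infsum_nonneg) simp
    then show "M \<ge> 0" using M(2)[OF i_in_H] by linarith
    fix \<psi> :: "complex \<Rightarrow> complex" and B z
    assume \<psi>: "\<And>z. z \<in> \<H> \<Longrightarrow> cmod (\<psi> z) \<le> B * ht z powr \<sigma>" and B: "B \<ge> 0" and z: "z \<in> \<H>"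
    have as: "(\<lambda>C. cmod (\<psi> (psl2_act (coset_rep C) z))) summable_on cosets" by (rule poinc_summable[OF \<psi> B \<sigma> z])
    have "cmod (poinc \<psi> z) \<le> (\<Sum>\<^sub>\<infinity>C\<in>cosets. cmod (\<psi> (psl2_act (coset_rep C) z)))"
      unfolding poinc_def by (rule norm_infsum_bound[OF as])
    also have "\<dots> \<le> (\<Sum>\<^sub>\<infinity>C\<in>cosets. B * ht (psl2_act (coset_rep C) z) powr \<sigma>)"
      using as M(1)[OF z] \<psi> act_H coset_rep_in z by (intro infsum_mono summable_on_cmult_right) auto
    also have "\<dots> = B * (\<Sum>\<^sub>\<infinity>C\<in>cosets. ht (psl2_act (coset_rep C) z) powr \<sigma>)"
      using M(1)[OF z] by (intro infsum_cmult_right) auto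
    also have "\<dots> \<le> B * M" using M(2)[OF z] B by (intro mult_left_mono) auto
    finally show "cmod (poinc \<psi> z) \<le> B * M" .
  qed
qed

lemma poinc_invariant:
  assumes \<psi>: "\<And>z. z \<in> \<H> \<Longrightarrow> \<psi> (of_real \<mu> * z) = \<psi> z" and d: "d \<in> \<Gamma>" and z: "z \<in> \<H>"
  shows "poinc \<psi> (psl2_act d z) = poinc \<psi> z"
proof -
  let ?s = "\<lambda>C. (\<lambda>g. g \<otimes>\<^bsub>PSL2R\<^esub> d) ` C"
  have "\<psi> (psl2_act (coset_rep C) (psl2_act d z)) = \<psi> (psl2_act (coset_rep (?s C)) z)" if C: "C \<in> cosets" for C
  proof -
    have "?s C \<in> cosets" using cosets_shift[OF d] C by (auto simp: bij_betw_def)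
    moreover have "coset_rep C \<otimes>\<^bsub>PSL2R\<^esub> d \<in> ?s C" using cosets_nonempty[OF C] by blast
    ultimately have "\<psi> (psl2_act (coset_rep (?s C)) z) = \<psi> (psl2_act (coset_rep C \<otimes>\<^bsub>PSL2R\<^esub> d) z)"
      using cosets_value[of \<psi>, OF \<psi> _ _ z] by blast
    then show ?thesis using act_mult[OF coset_rep_in[OF C] d z] by simp
  qed
  then have "poinc \<psi> (psl2_act d z) = (\<Sum>\<^sub>\<infinity>C\<in>cosets. \<psi> (psl2_act (coset_rep (?s C)) z))"
    unfolding poinc_def by (intro infsum_cong) auto
  also have "\<dots> = poinc \<psi> z"
    unfolding poinc_def using infsum_reindex_bij_betw[OF cosets_shift[OF d], of "\<lambda>C. \<psi> (psl2_act (coset_rep C) z)"] .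
  finally show ?thesis .
qed

lemma hyp_ball_open: "z \<in> \<H> \<Longrightarrow> open {w \<in> \<H>. hyp z w < r}"
proof -
  assume z: "z \<in> \<H>"
  have "continuous_on \<H> (hyp z)" using z by (intro continuous_on_hyp continuous_intros) auto
  then have "open (hyp z -` {..<r} \<inter> \<H>)" using open_H by (simp add: continuous_on_open_vimage)
  moreover have "hyp z -` {..<r} \<inter> \<H> = {w \<in> \<H>. hyp z w < r}" by auto
  ultimately show ?thesis by simp
qed

lemma poinc_uniform:
  assumes \<psi>: "\<And>z. z \<in> \<H> \<Longrightarrow> cmod (\<psi> z) \<le> B * ht z powr \<sigma>" and B: "B \<ge> 0" and \<sigma>: "\<sigma> > 1" and z: "z \<in> \<H>"
  shows "uniform_limit {w \<in> \<H>. hyp z w \<le> 1} (\<lambda>F w. \<Sum>C\<in>F. \<psi> (psl2_act (coset_rep C) w)) (poinc \<psi>) (finite_subsets_at_top cosets)"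
proof -
  obtain M where "\<And>z. z \<in> \<H> \<Longrightarrow> (\<lambda>C. ht (psl2_act (coset_rep C) z) powr \<sigma>) summable_on cosets"
    using ht_powr_summable[OF \<sigma>] by blast
  then have s: "(\<lambda>C. B * 12 powr \<sigma> * ht (psl2_act (coset_rep C) z) powr \<sigma>) summable_on cosets"
    using z by (intro summable_on_cmult_right) auto
  show ?thesis
    unfolding poinc_def
    by (rule Weierstrass_m_test_general[OF _ s]) (use poinc_bound_near[of \<psi>, OF \<psi> B \<sigma> z] in auto)
qed

lemma poinc_continuous:
  assumes \<psi>: "\<And>z. z \<in> \<H> \<Longrightarrow> cmod (\<psi> z) \<le> B * ht z powr \<sigma>" and B: "B \<ge> 0" and \<sigma>: "\<sigma> > 1"
    and c: "continuous_on \<H> \<psi>"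
  shows "continuous_on \<H> (poinc \<psi>)"
  unfolding continuous_on_eq_continuous_at[OF open_H]
proof
  fix z assume z: "z \<in> \<H>"
  let ?N = "{w \<in> \<H>. hyp z w < 1}"
  have "continuous_on ?N (poinc \<psi>)"
  proof (rule uniform_limit_theorem)
    show "\<forall>\<^sub>F F in finite_subsets_at_top cosets. continuous_on ?N (\<lambda>w. \<Sum>C\<in>F. \<psi> (psl2_act (coset_rep C) w))"
    proof (rule eventually_finite_subsets_at_top_weakI)
      fix F assume F: "finite F" "F \<subseteq> cosets"
      have "continuous_on ?N (\<lambda>w. \<psi> (psl2_act (coset_rep C) w))" if "C \<in> F" for C
      proof (rule continuous_on_compose2[OF c])
        show "continuous_on ?N (psl2_act (coset_rep C))"
          using continuous_act[OF coset_rep_in, of C] that F by (auto intro: continuous_on_subset)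
        show "psl2_act (coset_rep C) ` ?N \<subseteq> \<H>" using act_H coset_rep_in that F by auto
      qed
      then show "continuous_on ?N (\<lambda>w. \<Sum>C\<in>F. \<psi> (psl2_act (coset_rep C) w))" by (intro continuous_on_sum) auto
    qed
    show "uniform_limit ?N (\<lambda>F w. \<Sum>C\<in>F. \<psi> (psl2_act (coset_rep C) w)) (poinc \<psi>) (finite_subsets_at_top cosets)"
      by (rule uniform_limit_on_subset[OF poinc_uniform[of \<psi>, OF \<psi> B \<sigma> z]]) auto
  qed simp
  moreover have "z \<in> ?N" using z by simp
  ultimately show "isCont (poinc \<psi>) z"
    using continuous_on_eq_continuous_at[OF hyp_ball_open[OF z, of 1]] by blast
qed

lemma cylfam_bound:
  assumes "cylfam U \<psi>" "s \<in> U"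
  obtains \<sigma> B where "\<sigma> > 1" "B \<ge> 0" "\<And>z. z \<in> \<H> \<Longrightarrow> cmod (\<psi> s z) \<le> B * ht z powr \<sigma>"
proof -
  have "compact {s}" "{s} \<subseteq> U" using assms by auto
  then have "\<exists>\<sigma>>1. \<exists>B\<ge>0. \<forall>t\<in>{s}. \<forall>z\<in>\<H>. cmod (\<psi> t z) \<le> B * ht z powr \<sigma>"
    using assms(1) unfolding cylfam_def by blast
  then show ?thesis using that by blast
qed

text \<open>The bound holds on all of \<H>, since the sums of \<open>ht_powr_summable\<close> are
  bounded independently of the point. The Fredholm argument takes place in such bounded invariant
  functions.\<close>

lemma poinc_autfam:
  assumes U: "open U" and \<psi>: "cylfam U \<psi>"
  shows "autfam U (\<lambda>s. poinc (\<psi> s))"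
  unfolding autfam_def
proof (intro conjI ballI allI impI)
  fix s assume s: "s \<in> U"
  obtain \<sigma> B where b: "\<sigma> > 1" "B \<ge> 0" "\<And>z. z \<in> \<H> \<Longrightarrow> cmod (\<psi> s z) \<le> B * ht z powr \<sigma>"
    using cylfam_bound[OF \<psi> s] by blast
  have "continuous_on \<H> (poinc (\<psi> s))"
    using \<psi> s by (intro poinc_continuous[OF b(3,2,1)]) (auto simp: cylfam_def)
  then show "poinc (\<psi> s) \<in> borel_measurable hmeas" by (rule borel_measurable_hmeasI)
next
  fix s g z assume "s \<in> U" "g \<in> \<Gamma>" "z \<in> \<H>"
  then show "poinc (\<psi> s) (psl2_act g z) = poinc (\<psi> s) z"
    using \<psi> by (intro poinc_invariant) (auto simp: cylfam_def)
next
  fix z assume z: "z \<in> \<H>"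
  show "(\<lambda>s. poinc (\<psi> s) z) holomorphic_on U"
  proof (rule holomorphic_local)
    fix s assume "s \<in> U"
    then obtain r where r: "r > 0" "cball s r \<subseteq> U" using U open_contains_cball by blast
    then obtain \<sigma> B where b: "\<sigma> > 1" "B \<ge> 0" "\<And>t z. t \<in> cball s r \<Longrightarrow> z \<in> \<H> \<Longrightarrow> cmod (\<psi> t z) \<le> B * ht z powr \<sigma>"
      using \<psi> unfolding cylfam_def by (meson compact_cball)
    obtain M where "\<And>z. z \<in> \<H> \<Longrightarrow> (\<lambda>C. ht (psl2_act (coset_rep C) z) powr \<sigma>) summable_on cosets"
      using ht_powr_summable[OF b(1)] by blast
    then have sm: "(\<lambda>C. B * ht (psl2_act (coset_rep C) z) powr \<sigma>) summable_on cosets"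
      using z by (intro summable_on_cmult_right) auto
    have u: "uniform_limit (cball s r) (\<lambda>F t. \<Sum>C\<in>F. \<psi> t (psl2_act (coset_rep C) z)) (\<lambda>t. poinc (\<psi> t) z) (finite_subsets_at_top cosets)"
      unfolding poinc_def
      by (rule Weierstrass_m_test_general[OF _ sm]) (use b act_H coset_rep_in z in auto)
    have h: "\<forall>\<^sub>F F in finite_subsets_at_top cosets. continuous_on (cball s r) (\<lambda>t. \<Sum>C\<in>F. \<psi> t (psl2_act (coset_rep C) z)) \<and>
       (\<lambda>t. \<Sum>C\<in>F. \<psi> t (psl2_act (coset_rep C) z)) holomorphic_on ball s r"
    proof (rule eventually_finite_subsets_at_top_weakI)
      fix F assume F: "finite F" "F \<subseteq> cosets"
      have "(\<lambda>t. \<psi> t (psl2_act (coset_rep C) z)) holomorphic_on U" if "C \<in> F" for C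
        using \<psi> act_H coset_rep_in z F that by (auto simp: cylfam_def)
      then have *: "(\<lambda>t. \<Sum>C\<in>F. \<psi> t (psl2_act (coset_rep C) z)) holomorphic_on U"
        by (rule holomorphic_on_sum)
      have "ball s r \<subseteq> U" using r ball_subset_cball by blast
      then show "continuous_on (cball s r) (\<lambda>t. \<Sum>C\<in>F. \<psi> t (psl2_act (coset_rep C) z)) \<and>
       (\<lambda>t. \<Sum>C\<in>F. \<psi> t (psl2_act (coset_rep C) z)) holomorphic_on ball s r"
        using holomorphic_on_subset[OF *] r holomorphic_on_imp_continuous_on by blast
    qed
    have "(\<lambda>t. poinc (\<psi> t) z) holomorphic_on ball s r"
      by (rule holomorphic_uniform_limit[OF h u]) auto
    then show "\<exists>r>0. (\<lambda>s. poinc (\<psi> s) z) holomorphic_on ball s r" using r by blast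
  qed
next
  fix K assume "compact K \<and> K \<subseteq> U"
  then obtain \<sigma> B where b: "\<sigma> > 1" "B \<ge> 0" "\<And>s z. s \<in> K \<Longrightarrow> z \<in> \<H> \<Longrightarrow> cmod (\<psi> s z) \<le> B * ht z powr \<sigma>"
    using \<psi> unfolding cylfam_def by meson
  obtain M where M: "M \<ge> 0" "\<And>\<psi> B z. (\<And>z. z \<in> \<H> \<Longrightarrow> cmod (\<psi> z) \<le> B * ht z powr \<sigma>) \<Longrightarrow> B \<ge> 0 \<Longrightarrow> z \<in> \<H> \<Longrightarrow>
     cmod (poinc \<psi> z) \<le> B * M" using poinc_bounded[OF b(1)] by blast
  have "cmod (poinc (\<psi> s) z) \<le> B * M" if "s \<in> K" "z \<in> \<H>" for s z
    using M(2)[of "\<psi> s" B z] b that by blast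
  then show "\<exists>B\<ge>0. \<forall>s\<in>K. \<forall>z\<in>\<H>. cmod (poinc (\<psi> s) z) \<le> B" using b(2) M(1) by (meson mult_nonneg_nonneg)
qed

text \<open>A bound with exponent \<sigma> > 1 leaves room: half of \<sigma> - 1 is spent on the
  growth of A, and the new exponent still exceeds 1. The domain U is therefore kept.\<close>

lemma cylfam_mult_additive:
  assumes A: "additive A" and \<psi>: "cylfam U \<psi>"
  shows "cylfam U (\<lambda>s z. of_real (A z) * \<psi> s z)"
  unfolding cylfam_def
proof (intro conjI ballI allI impI)
  fix s assume "s \<in> U"
  then show "continuous_on \<H> (\<lambda>z. of_real (A z) * \<psi> s z)"
    using A \<psi> unfolding additive_def cylfam_def by (intro continuous_intros) auto
next
  fix z assume "z \<in> \<H>"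
  then show "(\<lambda>s. of_real (A z) * \<psi> s z) holomorphic_on U"
    using \<psi> unfolding cylfam_def by (intro holomorphic_intros) auto
next
  fix s z assume "s \<in> U" "z \<in> \<H>"
  then show "of_real (A (of_real \<mu> * z)) * \<psi> s (of_real \<mu> * z) = of_real (A z) * \<psi> s z"
    using A \<psi> unfolding cylfam_def additive_def by simp
next
  fix K assume "compact K \<and> K \<subseteq> U"
  then obtain \<sigma> B where b: "\<sigma> > 1" "B \<ge> 0" "\<And>s z. s \<in> K \<Longrightarrow> z \<in> \<H> \<Longrightarrow> cmod (\<psi> s z) \<le> B * ht z powr \<sigma>"
    using \<psi> unfolding cylfam_def by meson
  define e where "e = (\<sigma> - 1) / 2"
  have e: "e > 0" "\<sigma> - e > 1" using b(1) by (auto simp: e_def field_simps)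
  obtain L where L: "\<And>z. z \<in> \<H> \<Longrightarrow> \<bar>A z\<bar> \<le> L * ht z powr (- e)" using additive_growth[OF A e(1)] by blast
  have "cmod (of_real (A z) * \<psi> s z) \<le> (\<bar>L\<bar> * B) * ht z powr (\<sigma> - e)" if "s \<in> K" "z \<in> \<H>" for s z
  proof -
    have "\<bar>A z\<bar> \<le> \<bar>L\<bar> * ht z powr (- e)" using L[OF that(2)]
      by (smt (verit) mult_right_mono powr_ge_zero)
    then have "cmod (of_real (A z) * \<psi> s z) \<le> (\<bar>L\<bar> * ht z powr (- e)) * (B * ht z powr \<sigma>)"
      unfolding norm_mult norm_of_real using b(3)[OF that] by (intro mult_mono) auto
    also have "\<dots> = (\<bar>L\<bar> * B) * ht z powr (\<sigma> - e)"
    proof -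
      have "ht z powr (- e) * ht z powr \<sigma> = ht z powr (\<sigma> - e)" by (simp flip: powr_add)
      then show ?thesis by (metis mult.assoc mult.left_commute)
    qed
    finally show ?thesis .
  qed
  then show "\<exists>\<sigma>>1. \<exists>B\<ge>0. \<forall>s\<in>K. \<forall>z\<in>\<H>. cmod (of_real (A z) * \<psi> s z) \<le> B * ht z powr \<sigma>"
    using e b(2) by (intro exI[of _ "\<sigma> - e"] conjI exI[of _ "\<bar>L\<bar> * B"]) auto
qed

lemma cylfam_mult_additives:
  assumes "finite S" "\<And>k. k \<in> S \<Longrightarrow> additive (A k)" and \<psi>: "cylfam U \<psi>"
  shows "cylfam U (\<lambda>s z. of_real (\<Prod>k\<in>S. A k z) * \<psi> s z)"
  using assms(1,2)
proof (induction S)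
  case empty
  then show ?case using \<psi> by simp
next
  case (insert k S)
  then show ?case using cylfam_mult_additive[of "A k" U, OF _ insert.IH] by (simp add: mult.assoc)
qed

end

section \<open>Integral operators with invariant kernels\<close>

text \<open>Cauchy's estimate bounds the derivative on the smaller disc. The result is the majorant
  of the difference quotients in the next lemma.\<close>

lemma holomorphic_difference_bound:
  assumes f: "f holomorphic_on U" and c: "cball s (2 * r) \<subseteq> U" and r: "r > 0"
    and B: "\<And>x. x \<in> cball s (2 * r) \<Longrightarrow> cmod (f x) \<le> B" and h: "cmod h \<le> r"
  shows "cmod (f (s + h) - f s) \<le> B / r * cmod h"
proof -
  have d: "cmod (deriv f x) \<le> B / r" if x: "x \<in> cball s r" for x
  proof -
    have sub: "cball x r \<subseteq> cball s (2 * r)"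
      using x by (auto simp: dist_norm) (smt (verit) norm_diff_triangle_ineq norm_minus_commute norm_triangle_ineq4 diff_add_cancel dist_norm dist_triangle)
    then have "f holomorphic_on cball x r" using f c holomorphic_on_subset by blast
    then have "cmod ((deriv ^^ 1) f x) \<le> fact 1 * B / r ^ 1"
      using sub r B by (intro Cauchy_inequality holomorphic_on_imp_continuous_on)
        (auto intro: holomorphic_on_subset simp: dist_norm subset_iff)
    then show ?thesis by simp
  qed
  have "cmod (f (s + h) - f s) \<le> B / r * cmod ((s + h) - s)"
  proof (rule field_differentiable_bound[of "cball s r" f "deriv f"])
    fix x assume x: "x \<in> cball s r"
    have "x \<in> ball s (2 * r)" using x r by auto
    moreover have "f holomorphic_on ball s (2 * r)" using f c ball_subset_cball holomorphic_on_subset by blast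
    ultimately have "(f has_field_derivative deriv f x) (at x)"
      using holomorphic_derivI open_ball by blast
    then show "(f has_field_derivative deriv f x) (at x within cball s r)" by (rule has_field_derivative_at_within)
    show "cmod (deriv f x) \<le> B / r" using d[OF x] .
  qed (use r h in \<open>auto simp: dist_norm\<close>)
  then show ?thesis by simp
qed

text \<open>Differentiation under the integral: near a point the difference quotients are dominated
  by g / r, with g an integrable bound for the integrand on a compact disc.\<close>

lemma holomorphic_on_lebesgue_integral:
  fixes f :: "complex \<Rightarrow> 'a \<Rightarrow> complex"
  assumes U: "open U" and hol: "\<And>w. w \<in> space M \<Longrightarrow> (\<lambda>s. f s w) holomorphic_on U"
    and meas: "\<And>s. s \<in> U \<Longrightarrow> f s \<in> borel_measurable M"
    and dom: "\<And>K. compact K \<Longrightarrow> K \<subseteq> U \<Longrightarrow> \<exists>g. integrable M g \<and> (\<forall>s\<in>K. \<forall>w\<in>space M. cmod (f s w) \<le> g w)"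
  shows "(\<lambda>s. \<integral>w. f s w \<partial>M) holomorphic_on U"
  unfolding holomorphic_on_open[OF U]
proof
  fix s assume s: "s \<in> U"
  then obtain R where R: "R > 0" "cball s R \<subseteq> U" using U open_contains_cball by blast
  define r where "r = R / 2"
  have r: "r > 0" "cball s (2 * r) \<subseteq> U" using R by (auto simp: r_def)
  obtain g where g: "integrable M g" "\<And>t w. t \<in> cball s (2 * r) \<Longrightarrow> w \<in> space M \<Longrightarrow> cmod (f t w) \<le> g w"
    using dom[OF compact_cball r(2)] by blast
  have int: "integrable M (f t)" if "t \<in> cball s (2 * r)" for t
    using meas[of t] g(2)[OF that] r(2) that
    by (intro Bochner_Integration.integrable_bound[OF g(1)]) (auto intro!: AE_I2 order_trans[OF _ abs_ge_self])
  define D where "D w = deriv (\<lambda>t. f t w) s" for w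
  define Q where "Q h w = (f (s + h) w - f s w) / h" for h w
  have Qm: "Q h \<in> borel_measurable M" if "cmod h \<le> r" for h
  proof -
    have "s + h \<in> U" using that r by (auto simp: dist_norm subset_iff)
    then show ?thesis unfolding Q_def using meas s by (intro borel_measurable_divide borel_measurable_diff) auto
  qed
  have Qb: "cmod (Q h w) \<le> g w / r" if "cmod h \<le> r" "h \<noteq> 0" "w \<in> space M" for h w
    using holomorphic_difference_bound[OF hol[OF that(3)] r(2,1) g(2)[OF _ that(3)] that(1)] that(2)
    by (simp add: Q_def norm_divide field_simps)
  have Ql: "(\<lambda>n. Q (X n) w) \<longlonglongrightarrow> D w" if "w \<in> space M" "X \<longlonglongrightarrow> 0" "\<And>n. X n \<noteq> 0" for X w
  proof -
    have "((\<lambda>t. f t w) has_field_derivative D w) (at s)"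
      unfolding D_def using holomorphic_derivI[OF hol[OF that(1)] U s] .
    then have "((\<lambda>h. Q h w) \<longlongrightarrow> D w) (at 0)" unfolding DERIV_def Q_def .
    then show ?thesis using that(2,3) unfolding tendsto_at_iff_sequentially by (auto simp: o_def)
  qed
  \<comment> \<open>The derivative is measurable as a limit of measurable quotients along the
    increments r / (n + 1).\<close>
  have Dm: "D \<in> borel_measurable M"
  proof (rule borel_measurable_LIMSEQ_metric)
    fix n show "Q (of_real (r / real (Suc n))) \<in> borel_measurable M"
    proof (rule Qm)
      have "r / real (Suc n) \<le> r / 1" using r by (intro divide_left_mono) auto
      then show "cmod (complex_of_real (r / real (Suc n))) \<le> r" using r by (simp only: norm_of_real) simp
    qed
  next
    fix w assume "w \<in> space M"
    then show "(\<lambda>n. Q (of_real (r / real (Suc n))) w) \<longlonglongrightarrow> D w"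
    proof (rule Ql)
      show "(\<lambda>n. complex_of_real (r / real (Suc n))) \<longlonglongrightarrow> 0"
        using tendsto_of_real[OF LIMSEQ_Suc[OF lim_const_over_n[of r]], where ?'a = complex] by simp
      have "r / real (Suc n) \<noteq> 0" for n using r by simp
      then show "complex_of_real (r / real (Suc n)) \<noteq> 0" for n by (simp only: of_real_eq_0_iff not_False_eq_True)
    qed
  qed
  have "((\<lambda>t. \<integral>w. f t w \<partial>M) has_field_derivative (\<integral>w. D w \<partial>M)) (at s)"
    unfolding DERIV_def tendsto_at_iff_sequentially
  proof (intro allI impI)
    fix X assume X0: "\<forall>i. X i \<in> UNIV - {0::complex}" and X: "X \<longlonglongrightarrow> 0"
    obtain N where N: "\<And>n. n \<ge> N \<Longrightarrow> cmod (X n) < r"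
      using X r(1) unfolding lim_sequentially by auto
    have Xn: "cmod (X (n + N)) \<le> r" "X (n + N) \<noteq> 0" for n using N[of "n + N"] X0 by auto
    have "(\<lambda>n. \<integral>w. Q (X (n + N)) w \<partial>M) \<longlonglongrightarrow> (\<integral>w. D w \<partial>M)"
    proof (rule integral_dominated_convergence[where w = "\<lambda>w. g w / r"])
      show "AE w in M. (\<lambda>n. Q (X (n + N)) w) \<longlonglongrightarrow> D w"
        using Ql[of _ "\<lambda>n. X (n + N)"] LIMSEQ_ignore_initial_segment[OF X, of N] Xn by (intro AE_I2) auto
    qed (use Dm Qm Xn Qb g(1) in auto)
    moreover have "(\<integral>w. Q (X (n + N)) w \<partial>M) = ((\<integral>w. f (s + X (n + N)) w \<partial>M) - (\<integral>w. f s w \<partial>M)) / X (n + N)" for n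
    proof -
      have "s + X (n + N) \<in> cball s (2 * r)" "s \<in> cball s (2 * r)" using Xn(1)[of n] r by (auto simp: dist_norm)
      then show ?thesis unfolding Q_def using int by simp
    qed
    ultimately have "(\<lambda>n. ((\<integral>w. f (s + X (n + N)) w \<partial>M) - (\<integral>w. f s w \<partial>M)) / X (n + N)) \<longlonglongrightarrow> (\<integral>w. D w \<partial>M)" by simp
    from LIMSEQ_offset[OF this]
    show "((\<lambda>h. ((\<integral>w. f (s + h) w \<partial>M) - (\<integral>w. f s w \<partial>M)) / h) \<circ> X) \<longlonglongrightarrow> (\<integral>w. D w \<partial>M)" by (simp add: o_def)
  qed
  then show "\<exists>f'. ((\<lambda>s. \<integral>w. f s w \<partial>M) has_field_derivative f') (at s)" by blast
qed

text \<open>The integral of a non-integrable function is 0 by convention, so the estimate requires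
  nothing of \<open>f\<close> beyond the pointwise bound.\<close>

lemma integral_norm_le:
  fixes f :: "'a \<Rightarrow> complex"
  assumes g: "integrable M g" and le: "\<And>w. w \<in> space M \<Longrightarrow> cmod (f w) \<le> g w"
  shows "cmod (\<integral>w. f w \<partial>M) \<le> (\<integral>w. g w \<partial>M)"
proof (cases "integrable M f")
  case True
  have "cmod (\<integral>w. f w \<partial>M) \<le> (\<integral>w. cmod (f w) \<partial>M)" by (rule integral_norm_bound)
  also have "\<dots> \<le> (\<integral>w. g w \<partial>M)" using True g le by (intro integral_mono) auto
  finally show ?thesis .
next
  case False
  have "0 \<le> g w" if "w \<in> space M" for w using le[OF that] norm_ge_zero order_trans by blast
  then have "0 \<le> (\<integral>w. g w \<partial>M)" by (rule Bochner_Integration.integral_nonneg)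
  then show ?thesis using False by (simp add: not_integrable_integral_eq)
qed

definition hball :: "complex \<Rightarrow> real \<Rightarrow> complex set" where
  "hball z R = {w \<in> \<H>. hyp z w \<le> R}"

lemma hyp_measurable [measurable]: "z \<in> \<H> \<Longrightarrow> hyp z \<in> borel_measurable hmeas"
  by (intro borel_measurable_hmeasI continuous_on_hyp continuous_intros) auto

lemma hball_sets [measurable]: "z \<in> \<H> \<Longrightarrow> hball z R \<in> sets hmeas"
proof -
  assume "z \<in> \<H>"
  then have "{w \<in> space hmeas. hyp z w \<le> R} \<in> sets hmeas" by (intro borel_measurable_le) auto
  then show ?thesis by (simp add: hball_def)
qed

lemma compact_sets_hmeas: "compact K \<Longrightarrow> K \<subseteq> \<H> \<Longrightarrow> K \<in> sets hmeas"
  using open_H by (simp add: sets_hmeas sets_restrict_space_iff compact_imp_closed)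

lemma emeasure_compact_hmeas:
  assumes K: "compact K" "K \<subseteq> \<H>"
  shows "emeasure hmeas K < \<infinity>"
proof (cases "K = {}")
  case False
  have "continuous_on K Im" by (intro continuous_intros)
  then obtain v where v: "v \<in> K" "\<And>w. w \<in> K \<Longrightarrow> Im v \<le> Im w"
    using continuous_attains_inf[OF K(1) False, of Im] by blast
  have p: "Im v > 0" using v K by (auto simp: H_iff)
  have c: "compact (rv ` K)"
    using K by (intro compact_continuous_image linear_continuous_on bounded_linear_rv)
  then have m: "rv ` K \<in> sets borel" by (intro borel_closed compact_imp_closed)
  have "emeasure hmeas K = (\<integral>\<^sup>+p. ennreal (1 / (p$2)^2) * indicator K (cx p) * indicator half p \<partial>lborel)"
    by (rule emeasure_hmeas[OF compact_sets_hmeas[OF K]])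
  also have "\<dots> \<le> (\<integral>\<^sup>+p. ennreal (1 / (Im v)^2) * indicator (rv ` K) p \<partial>lborel)"
  proof (rule nn_integral_mono)
    fix p :: "real^2"
    have "1 / (p$2)^2 \<le> 1 / (Im v)^2" if "cx p \<in> K"
    proof -
      have "Im v \<le> p$2" using v(2)[OF that] by (simp add: cx_def)
      then show ?thesis using p by (intro divide_left_mono power_mono) auto
    qed
    moreover have "p \<in> rv ` K" if "cx p \<in> K" using that rv_cx by (metis image_eqI)
    ultimately show "ennreal (1 / (p$2)^2) * indicator K (cx p) * indicator half p \<le> ennreal (1 / (Im v)^2) * indicator (rv ` K) p"
      by (auto simp: indicator_def intro!: ennreal_leI)
  qed
  also have "\<dots> = ennreal (1 / (Im v)^2) * emeasure lborel (rv ` K)"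
    using m by (intro nn_integral_cmult_indicator) simp
  also have "\<dots> < \<infinity>" using emeasure_compact_finite[OF c] by (simp add: ennreal_mult_less_top)
  finally show ?thesis .
qed simp

text \<open>The isometry \<open>aff z\<close> maps the ball around \<i> onto the ball around
  \<open>z\<close>, so all estimates for kernels are uniform in the centre.\<close>

lemma emeasure_hball:
  assumes z: "z \<in> \<H>"
  shows "emeasure hmeas (hball z R) = emeasure hmeas (hball \<i> R)" "emeasure hmeas (hball z R) < \<infinity>"
proof -
  let ?f = "sl2_act (aff z)"
  have d: "det (aff z) = 1" using det_aff[OF z] .
  have "?f -` hball z R \<inter> \<H> = hball \<i> R"
    using hyp_sl2_act[OF d i_in_H] sl2_act_in_H[OF d] sl2_act_aff_i[OF z] by (auto simp: hball_def)
  then have "emeasure (distr hmeas hmeas ?f) (hball z R) = emeasure hmeas (hball \<i> R)"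
    using measurable_sl2_act[OF d] hball_sets[OF z] by (simp add: emeasure_distr)
  then show 1: "emeasure hmeas (hball z R) = emeasure hmeas (hball \<i> R)" by (simp add: distr_sl2_act[OF d])
  obtain K where K: "compact K" "K \<subseteq> \<H>" "{v \<in> \<H>. hyp v \<i> \<le> R} \<subseteq> K" using compact_hyp_ball by blast
  have "emeasure hmeas (hball \<i> R) \<le> emeasure hmeas K"
    using K(3) compact_sets_hmeas[OF K(1,2)] by (intro emeasure_mono) (auto simp: hball_def hyp_sym)
  also have "\<dots> < \<infinity>" by (rule emeasure_compact_hmeas[OF K(1,2)])
  finally show "emeasure hmeas (hball z R) < \<infinity>" using 1 by simp
qed

definition vol :: "real \<Rightarrow> real" where
  "vol R = measure hmeas (hball \<i> R)"

lemma integrable_hball: "z \<in> \<H> \<Longrightarrow> integrable hmeas (\<lambda>w. c * indicator (hball z R) w :: real)"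
  using emeasure_hball(2)[of z R] hball_sets[of z R]
  by (intro integrable_mult_right integrable_real_indicator) auto

lemma integral_hball: "z \<in> \<H> \<Longrightarrow> (\<integral>w. c * indicator (hball z R) w \<partial>hmeas) = c * vol R"
  using emeasure_hball(1)[of z R] hball_sets[of z R] emeasure_hball(2)[of z R]
  by (simp add: vol_def measure_def hball_def Int_absorb2 Collect_conj_eq)

lemma vol_nonneg: "vol R \<ge> 0"
  by (simp add: vol_def)

definition Lop :: "(complex \<Rightarrow> complex \<Rightarrow> complex) \<Rightarrow> (complex \<Rightarrow> complex) \<Rightarrow> complex \<Rightarrow> complex" where
  "Lop \<kappa> v z = (\<integral>w. \<kappa> z w * v w \<partial>hmeas)"

context hyperbolic_group
begin

text \<open>Invariance is asked only under the diagonal action of \<Gamma>: kernels multiplied by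
  differences A z - A w are not invariant under the whole group. Vanishing for \<open>hyp\<close>
  \<ge> 1 keeps all integrals local.\<close>

definition good_kernel :: "(complex \<Rightarrow> complex \<Rightarrow> complex) \<Rightarrow> bool" where
  "good_kernel \<kappa> \<longleftrightarrow> continuous_on (\<H> \<times> \<H>) (\<lambda>(z, w). \<kappa> z w) \<and>
     (\<forall>z\<in>\<H>. \<forall>w\<in>\<H>. hyp z w \<ge> 1 \<longrightarrow> \<kappa> z w = 0) \<and>
     (\<forall>g\<in>\<Gamma>. \<forall>z\<in>\<H>. \<forall>w\<in>\<H>. \<kappa> (psl2_act g z) (psl2_act g w) = \<kappa> z w) \<and>
     (\<exists>B. \<forall>z\<in>\<H>. \<forall>w\<in>\<H>. cmod (\<kappa> z w) \<le> B)"

lemma good_kernel_bound: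
  assumes "good_kernel \<kappa>"
  obtains B where "B \<ge> 0" "\<And>z w. z \<in> \<H> \<Longrightarrow> w \<in> \<H> \<Longrightarrow> cmod (\<kappa> z w) \<le> B * indicator (hball z 1) w"
proof -
  obtain B where B: "\<And>z w. z \<in> \<H> \<Longrightarrow> w \<in> \<H> \<Longrightarrow> cmod (\<kappa> z w) \<le> B"
    and 0: "\<And>z w. z \<in> \<H> \<Longrightarrow> w \<in> \<H> \<Longrightarrow> hyp z w \<ge> 1 \<Longrightarrow> \<kappa> z w = 0"
    using assms unfolding good_kernel_def by blast
  have "B \<ge> 0" using B[OF i_in_H i_in_H] norm_ge_zero order_trans by blast
  moreover have "cmod (\<kappa> z w) \<le> B * indicator (hball z 1) w" if "z \<in> \<H>" "w \<in> \<H>" for z w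
    using B[OF that] 0[OF that] that by (auto simp: hball_def indicator_def)
  ultimately show ?thesis using that by blast
qed

lemma good_kernel_continuous:
  assumes "good_kernel \<kappa>"
  shows "z \<in> \<H> \<Longrightarrow> continuous_on \<H> (\<kappa> z)" "w \<in> \<H> \<Longrightarrow> continuous_on \<H> (\<lambda>z. \<kappa> z w)"
proof -
  have c: "continuous_on (\<H> \<times> \<H>) (\<lambda>(z, w). \<kappa> z w)" using assms by (simp add: good_kernel_def)
  show "continuous_on \<H> (\<kappa> z)" if "z \<in> \<H>"
  proof -
    have "continuous_on \<H> (\<lambda>w. (z, w))" "(\<lambda>w. (z, w)) ` \<H> \<subseteq> \<H> \<times> \<H>"
      using that by (auto intro!: continuous_intros)
    from continuous_on_compose2[OF c this] show ?thesis by simp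
  qed
  show "continuous_on \<H> (\<lambda>z. \<kappa> z w)" if "w \<in> \<H>"
  proof -
    have "continuous_on \<H> (\<lambda>z. (z, w))" "(\<lambda>z. (z, w)) ` \<H> \<subseteq> \<H> \<times> \<H>"
      using that by (auto intro!: continuous_intros)
    from continuous_on_compose2[OF c this] show ?thesis by simp
  qed
qed

lemma good_kernel_measurable: "good_kernel \<kappa> \<Longrightarrow> z \<in> \<H> \<Longrightarrow> \<kappa> z \<in> borel_measurable hmeas"
  by (intro borel_measurable_hmeasI good_kernel_continuous)

lemma Lop_integrable:
  assumes k: "good_kernel \<kappa>" and z: "z \<in> \<H>" and v: "v \<in> borel_measurable hmeas" "\<And>w. w \<in> \<H> \<Longrightarrow> cmod (v w) \<le> V"
  shows "integrable hmeas (\<lambda>w. \<kappa> z w * v w)"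
proof -
  obtain B where B: "B \<ge> 0" "\<And>z w. z \<in> \<H> \<Longrightarrow> w \<in> \<H> \<Longrightarrow> cmod (\<kappa> z w) \<le> B * indicator (hball z 1) w"
    using good_kernel_bound[OF k] by blast
  show ?thesis
  proof (rule Bochner_Integration.integrable_bound[OF integrable_hball[OF z, of "B * V" 1]])
    show "(\<lambda>w. \<kappa> z w * v w) \<in> borel_measurable hmeas"
      using good_kernel_measurable[OF k z] v by (intro borel_measurable_times)
    have "cmod (\<kappa> z w * v w) \<le> norm (B * V * indicator (hball z 1) w)" if w: "w \<in> \<H>" for w
    proof -
      have "cmod (\<kappa> z w * v w) \<le> (B * indicator (hball z 1) w) * V"
        unfolding norm_mult using B v(2)[OF w] z w by (intro mult_mono) auto
      also have "\<dots> = B * V * indicator (hball z 1) w" by simp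
      finally show ?thesis by (rule order_trans) (simp only: real_norm_def abs_ge_self)
    qed
    then show "AE w in hmeas. cmod (\<kappa> z w * v w) \<le> norm (B * V * indicator (hball z 1) w)" by (intro AE_I2) auto
  qed
qed

lemma Lop_bound_aux:
  assumes "z \<in> \<H>" "B \<ge> 0" "\<And>w. w \<in> \<H> \<Longrightarrow> cmod (f w) \<le> B * indicator (hball z R) w"
  shows "cmod (\<integral>w. f w \<partial>hmeas) \<le> B * vol R"
proof -
  have "cmod (\<integral>w. f w \<partial>hmeas) \<le> (\<integral>w. B * indicator (hball z R) w \<partial>hmeas)"
    using assms integrable_hball[OF assms(1)] by (intro integral_norm_le) auto
  then show ?thesis unfolding integral_hball[OF assms(1)] .
qed

lemma Lop_bound:
  assumes k: "good_kernel \<kappa>"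
  obtains B where "B \<ge> 0" "\<And>v V z. z \<in> \<H> \<Longrightarrow> (\<And>w. w \<in> \<H> \<Longrightarrow> cmod (v w) \<le> V) \<Longrightarrow> V \<ge> 0 \<Longrightarrow> cmod (Lop \<kappa> v z) \<le> B * V"
proof -
  obtain B where B: "B \<ge> 0" "\<And>z w. z \<in> \<H> \<Longrightarrow> w \<in> \<H> \<Longrightarrow> cmod (\<kappa> z w) \<le> B * indicator (hball z 1) w"
    using good_kernel_bound[OF k] by blast
  show ?thesis
  proof (rule that[of "B * vol 1"])
    show "B * vol 1 \<ge> 0" using B vol_nonneg by simp
    fix v :: "complex \<Rightarrow> complex" and V z
    assume z: "z \<in> \<H>" and v: "\<And>w. w \<in> \<H> \<Longrightarrow> cmod (v w) \<le> V" and V: "V \<ge> 0"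
    have "cmod (\<kappa> z w * v w) \<le> B * V * indicator (hball z 1) w" if w: "w \<in> \<H>" for w
    proof -
      have "cmod (\<kappa> z w * v w) \<le> (B * indicator (hball z 1) w) * V"
        unfolding norm_mult using B v[OF w] z w by (intro mult_mono) auto
      then show ?thesis by (simp only: mult_ac)
    qed
    then have "cmod (Lop \<kappa> v z) \<le> B * V * vol 1"
      unfolding Lop_def using B V z by (intro Lop_bound_aux) auto
    then show "cmod (Lop \<kappa> v z) \<le> B * vol 1 * V" by (simp add: mult_ac)
  qed
qed

text \<open>Continuity of z \<mapsto> \<kappa>(z, .) in the L^1 norm. It makes the operator map a
  bounded set of functions to an equicontinuous one, which is the compactness behind
  \<open>kernel_cells\<close>.\<close>

lemma kernel_equicontinuous:
  assumes k: "good_kernel \<kappa>" and z0: "z0 \<in> \<H>" and e: "e > 0"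
  obtains S where "open S" "z0 \<in> S" "S \<subseteq> \<H>" "\<And>z. z \<in> S \<Longrightarrow> (\<integral>w. cmod (\<kappa> z w - \<kappa> z0 w) \<partial>hmeas) < e"
proof -
  obtain B where B: "B \<ge> 0" "\<And>z w. z \<in> \<H> \<Longrightarrow> w \<in> \<H> \<Longrightarrow> cmod (\<kappa> z w) \<le> B * indicator (hball z 1) w"
    using good_kernel_bound[OF k] by blast
  let ?f = "\<lambda>z. (\<integral>w. cmod (\<kappa> z w - \<kappa> z0 w) \<partial>hmeas)"
  have "(?f \<longlongrightarrow> 0) (at z0 within \<H>)"
    unfolding tendsto_at_iff_sequentially
  proof (intro allI impI)
    fix X assume XH: "\<forall>i. X i \<in> \<H> - {z0}" and X: "X \<longlonglongrightarrow> z0"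
    have "open {w \<in> \<H>. hyp z0 w < 1}" "z0 \<in> {w \<in> \<H>. hyp z0 w < 1}" using hyp_ball_open z0 by auto
    then have "eventually (\<lambda>n. X n \<in> {w \<in> \<H>. hyp z0 w < 1}) sequentially" using X topological_tendstoD by blast
    then obtain N where N: "\<And>n. n \<ge> N \<Longrightarrow> hyp z0 (X n) < 1" unfolding eventually_sequentially by auto
    have "(\<lambda>n. \<integral>w. cmod (\<kappa> (X (n + N)) w - \<kappa> z0 w) \<partial>hmeas) \<longlonglongrightarrow> (\<integral>w. 0 \<partial>hmeas)"
    \<comment> \<open>For z within 1 of z0 the support of \<kappa>(z, .) lies within 4 * 3 * 3 = 36
      of z0, by \<open>hyp_chain\<close>.\<close>
    proof (rule integral_dominated_convergence[where w = "\<lambda>w. 2 * B * indicator (hball z0 36) w"])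
      show "integrable hmeas (\<lambda>w. 2 * B * indicator (hball z0 36) w)" by (rule integrable_hball[OF z0])
      fix n
      show "(\<lambda>w. cmod (\<kappa> (X (n + N)) w - \<kappa> z0 w)) \<in> borel_measurable hmeas"
      proof -
        have "\<kappa> (X (n + N)) \<in> borel_measurable hmeas" using XH by (intro good_kernel_measurable[OF k]) auto
        from borel_measurable_diff[OF this good_kernel_measurable[OF k z0]] show ?thesis by measurable
      qed
      have "cmod (\<kappa> (X (n + N)) w - \<kappa> z0 w) \<le> 2 * B * indicator (hball z0 36) w" if w: "w \<in> \<H>" for w
      proof -
        have XnH: "X (n + N) \<in> \<H>" using XH by auto
        have "w \<in> hball z0 36" if "w \<in> hball (X (n + N)) 1"
          using hyp_chain[OF z0 XnH w, of 1 1] N[of "n + N"] that w by (auto simp: hball_def)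
        moreover have "w \<in> hball z0 36" if "w \<in> hball z0 1" using that by (auto simp: hball_def)
        ultimately have "B * indicator (hball (X (n + N)) 1) w + B * indicator (hball z0 1) w \<le> 2 * B * indicator (hball z0 36) w"
          using B(1) by (auto simp: indicator_def)
        moreover have "cmod (\<kappa> (X (n + N)) w - \<kappa> z0 w) \<le> cmod (\<kappa> (X (n + N)) w) + cmod (\<kappa> z0 w)"
          by (rule norm_triangle_ineq4)
        ultimately show ?thesis using B(2)[OF XnH w] B(2)[OF z0 w] by linarith
      qed
      then show "AE w in hmeas. norm (cmod (\<kappa> (X (n + N)) w - \<kappa> z0 w)) \<le> 2 * B * indicator (hball z0 36) w"
        by (intro AE_I2) auto
    next
      have "(\<lambda>n. cmod (\<kappa> (X (n + N)) w - \<kappa> z0 w)) \<longlonglongrightarrow> 0" if w: "w \<in> \<H>" for w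
      proof -
        have "(\<lambda>n. \<kappa> (X (n + N)) w) \<longlonglongrightarrow> \<kappa> z0 w"
          using continuous_on_tendsto_compose[OF good_kernel_continuous(2)[OF k w] LIMSEQ_ignore_initial_segment[OF X, of N] z0] XH
          by auto
        then have "(\<lambda>n. \<kappa> (X (n + N)) w - \<kappa> z0 w) \<longlonglongrightarrow> 0" by (simp add: LIM_zero)
        then show ?thesis by (rule tendsto_norm_zero)
      qed
      then show "AE w in hmeas. (\<lambda>n. cmod (\<kappa> (X (n + N)) w - \<kappa> z0 w)) \<longlonglongrightarrow> 0" by (intro AE_I2) auto
    qed auto
    then have "(\<lambda>n. ?f (X (n + N))) \<longlonglongrightarrow> 0" by simp
    from LIMSEQ_offset[OF this] show "(?f \<circ> X) \<longlonglongrightarrow> 0" by (simp add: o_def)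
  qed
  then have "eventually (\<lambda>z. ?f z < e) (at z0 within \<H>)" using e by (rule order_tendstoD)
  then obtain S where S: "open S" "z0 \<in> S" "\<And>z. z \<in> S \<Longrightarrow> z \<noteq> z0 \<Longrightarrow> z \<in> \<H> \<Longrightarrow> ?f z < e"
    unfolding eventually_at_topological by blast
  show ?thesis
  proof (rule that[of "S \<inter> \<H>"])
    fix z assume "z \<in> S \<inter> \<H>"
    then show "?f z < e" using S(3)[of z] e by (cases "z = z0") auto
  qed (use S z0 open_H in auto)
qed

lemma Lop_diff_bound:
  assumes k: "good_kernel \<kappa>" and z: "z \<in> \<H>" "z0 \<in> \<H>" and v: "v \<in> borel_measurable hmeas" "\<And>w. w \<in> \<H> \<Longrightarrow> cmod (v w) \<le> V" "V \<ge> 0"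
  shows "cmod (Lop \<kappa> v z - Lop \<kappa> v z0) \<le> V * (\<integral>w. cmod (\<kappa> z w - \<kappa> z0 w) \<partial>hmeas)"
proof -
  have i1: "integrable hmeas (\<kappa> a)" if "a \<in> \<H>" for a
    using Lop_integrable[OF k that, of "\<lambda>_. 1" 1] by simp
  have i: "integrable hmeas (\<lambda>w. cmod (\<kappa> z w - \<kappa> z0 w))" using i1 z by auto
  have "Lop \<kappa> v z - Lop \<kappa> v z0 = (\<integral>w. (\<kappa> z w - \<kappa> z0 w) * v w \<partial>hmeas)"
    unfolding Lop_def using Lop_integrable[OF k z(1) v(1,2)] Lop_integrable[OF k z(2) v(1,2)]
    by (simp add: left_diff_distrib)
  also have "cmod \<dots> \<le> (\<integral>w. V * cmod (\<kappa> z w - \<kappa> z0 w) \<partial>hmeas)"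
  proof (rule integral_norm_le)
    show "integrable hmeas (\<lambda>w. V * cmod (\<kappa> z w - \<kappa> z0 w))" using i by simp
    fix w assume "w \<in> space hmeas"
    then have "cmod (v w) \<le> V" using v by simp
    then show "cmod ((\<kappa> z w - \<kappa> z0 w) * v w) \<le> V * cmod (\<kappa> z w - \<kappa> z0 w)"
      unfolding norm_mult by (subst mult.commute) (intro mult_right_mono, auto)
  qed
  finally show ?thesis by simp
qed

lemma Lop_continuous:
  assumes k: "good_kernel \<kappa>" and v: "v \<in> borel_measurable hmeas" "\<And>w. w \<in> \<H> \<Longrightarrow> cmod (v w) \<le> V"
  shows "continuous_on \<H> (Lop \<kappa> v)"
  unfolding continuous_on_eq_continuous_at[OF open_H]
proof
  fix z0 assume z0: "z0 \<in> \<H>"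
  have V: "V \<ge> 0" using v(2)[OF i_in_H] norm_ge_zero order_trans by blast
  show "isCont (Lop \<kappa> v) z0"
    unfolding continuous_at_eps_delta
  proof (intro allI impI)
    fix e :: real assume e: "e > 0"
    obtain S where S: "open S" "z0 \<in> S" "S \<subseteq> \<H>" "\<And>z. z \<in> S \<Longrightarrow> (\<integral>w. cmod (\<kappa> z w - \<kappa> z0 w) \<partial>hmeas) < e / (V + 1)"
      using kernel_equicontinuous[OF k z0, of "e / (V + 1)"] e V by auto
    obtain d where d: "d > 0" "ball z0 d \<subseteq> S" using S openE by blast
    have "dist (Lop \<kappa> v z) (Lop \<kappa> v z0) < e" if "dist z z0 < d" for z
    proof -
      have z: "z \<in> S" using that d by (auto simp: dist_commute)
      have "cmod (Lop \<kappa> v z - Lop \<kappa> v z0) \<le> V * (\<integral>w. cmod (\<kappa> z w - \<kappa> z0 w) \<partial>hmeas)"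
        using Lop_diff_bound[OF k _ z0 v V] z S by blast
      also have "\<dots> \<le> V * (e / (V + 1))" using S(4)[OF z] V by (intro mult_left_mono) auto
      also have "\<dots> < e" using V e by (simp add: field_simps)
      finally show ?thesis by (simp add: dist_norm)
    qed
    then show "\<exists>d>0. \<forall>z. dist z z0 < d \<longrightarrow> dist (Lop \<kappa> v z) (Lop \<kappa> v z0) < e" using d by blast
  qed
qed

text \<open>Substitute g w for w: the measure, the kernel and \<open>v\<close> are all
  unchanged.\<close>

lemma Lop_invariant:
  assumes k: "good_kernel \<kappa>" and v: "v \<in> borel_measurable hmeas"
    and g: "g \<in> \<Gamma>" "\<And>w. w \<in> \<H> \<Longrightarrow> v (psl2_act g w) = v w" and z: "z \<in> \<H>"
  shows "Lop \<kappa> v (psl2_act g z) = Lop \<kappa> v z"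
proof -
  have gz: "psl2_act g z \<in> \<H>" using act_H g z by blast
  have "(\<integral>w. \<kappa> (psl2_act g z) (psl2_act g w) * v (psl2_act g w) \<partial>hmeas) = Lop \<kappa> v (psl2_act g z)"
    unfolding Lop_def
    using integral_hmeas_comp[OF distr_act[OF g(1)] measurable_act[OF g(1)], of "\<lambda>w. \<kappa> (psl2_act g z) w * v w"]
      good_kernel_measurable[OF k gz] v by simp
  moreover have "(\<integral>w. \<kappa> (psl2_act g z) (psl2_act g w) * v (psl2_act g w) \<partial>hmeas) = Lop \<kappa> v z"
    unfolding Lop_def using k g z by (intro Bochner_Integration.integral_cong) (auto simp: good_kernel_def)
  ultimately show ?thesis by simp
qed

lemma autfam_bound:
  assumes "autfam U u" "s \<in> U"
  obtains V where "V \<ge> 0" "\<And>w. w \<in> \<H> \<Longrightarrow> cmod (u s w) \<le> V"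
proof -
  have "compact {s}" "{s} \<subseteq> U" using assms by auto
  then have "\<exists>B\<ge>0. \<forall>t\<in>{s}. \<forall>z\<in>\<H>. cmod (u t z) \<le> B" using assms(1) unfolding autfam_def by blast
  then show ?thesis using that by blast
qed

lemma autfam_measurable: "autfam U u \<Longrightarrow> s \<in> U \<Longrightarrow> u s \<in> borel_measurable hmeas"
  and autfam_holomorphic: "autfam U u \<Longrightarrow> z \<in> \<H> \<Longrightarrow> (\<lambda>s. u s z) holomorphic_on U"
  and autfam_invariant: "autfam U u \<Longrightarrow> s \<in> U \<Longrightarrow> g \<in> \<Gamma> \<Longrightarrow> z \<in> \<H> \<Longrightarrow> u s (psl2_act g z) = u s z"
  by (auto simp: autfam_def)

lemma autfam_compact_bound:
  assumes "autfam U u" "compact K" "K \<subseteq> U"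
  obtains V where "V \<ge> 0" "\<And>s w. s \<in> K \<Longrightarrow> w \<in> \<H> \<Longrightarrow> cmod (u s w) \<le> V"
  using assms unfolding autfam_def by meson

lemma Lop_autfam:
  assumes U: "open U" and k: "good_kernel \<kappa>" and u: "autfam U u"
  shows "autfam U (\<lambda>s. Lop \<kappa> (u s))"
  unfolding autfam_def
proof (intro conjI ballI allI impI)
  fix s assume s: "s \<in> U"
  obtain V where V: "V \<ge> 0" "\<And>w. w \<in> \<H> \<Longrightarrow> cmod (u s w) \<le> V" using autfam_bound[OF u s] by blast
  show "Lop \<kappa> (u s) \<in> borel_measurable hmeas"
    by (rule borel_measurable_hmeasI[OF Lop_continuous[OF k autfam_measurable[OF u s] V(2)]])
next
  fix s g z assume "s \<in> U" "g \<in> \<Gamma>" "z \<in> \<H>"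
  then show "Lop \<kappa> (u s) (psl2_act g z) = Lop \<kappa> (u s) z"
    using autfam_measurable[OF u] autfam_invariant[OF u] by (intro Lop_invariant[OF k]) auto
next
  fix z assume z: "z \<in> \<H>"
  obtain B where B: "B \<ge> 0" "\<And>z w. z \<in> \<H> \<Longrightarrow> w \<in> \<H> \<Longrightarrow> cmod (\<kappa> z w) \<le> B * indicator (hball z 1) w"
    using good_kernel_bound[OF k] by blast
  show "(\<lambda>s. Lop \<kappa> (u s) z) holomorphic_on U"
    unfolding Lop_def
  proof (rule holomorphic_on_lebesgue_integral[OF U])
    fix w assume "w \<in> space hmeas"
    then show "(\<lambda>s. \<kappa> z w * u s w) holomorphic_on U" using autfam_holomorphic[OF u] by (intro holomorphic_intros) auto
  next
    fix s assume "s \<in> U"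
    then show "(\<lambda>w. \<kappa> z w * u s w) \<in> borel_measurable hmeas"
      using autfam_measurable[OF u] good_kernel_measurable[OF k z] by (intro borel_measurable_times) auto
  next
    fix K assume "compact K" "K \<subseteq> U"
    then obtain V where V: "V \<ge> 0" "\<And>s w. s \<in> K \<Longrightarrow> w \<in> \<H> \<Longrightarrow> cmod (u s w) \<le> V" using autfam_compact_bound[OF u] by blast
    have "cmod (\<kappa> z w * u s w) \<le> B * V * indicator (hball z 1) w" if "s \<in> K" "w \<in> \<H>" for s w
    proof -
      have "cmod (\<kappa> z w * u s w) \<le> (B * indicator (hball z 1) w) * V"
        unfolding norm_mult using B V(2)[OF that] z that by (intro mult_mono) auto
      then show ?thesis by (simp only: mult_ac)
    qed
    then show "\<exists>g. integrable hmeas g \<and> (\<forall>s\<in>K. \<forall>w\<in>space hmeas. cmod (\<kappa> z w * u s w) \<le> g w)"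
      using integrable_hball[OF z, of "B * V" 1] by (intro exI[of _ "\<lambda>w. B * V * indicator (hball z 1) w"]) auto
  qed
next
  fix K assume K: "compact K \<and> K \<subseteq> U"
  obtain V where V: "V \<ge> 0" "\<And>s w. s \<in> K \<Longrightarrow> w \<in> \<H> \<Longrightarrow> cmod (u s w) \<le> V" using autfam_compact_bound[OF u] K by blast
  obtain B where B: "B \<ge> 0" "\<And>v V z. z \<in> \<H> \<Longrightarrow> (\<And>w. w \<in> \<H> \<Longrightarrow> cmod (v w) \<le> V) \<Longrightarrow> V \<ge> 0 \<Longrightarrow> cmod (Lop \<kappa> v z) \<le> B * V"
    using Lop_bound[OF k] by blast
  have "cmod (Lop \<kappa> (u s) z) \<le> B * V" if "s \<in> K" "z \<in> \<H>" for s z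
    by (rule B(2)[OF that(2) _ V(1)]) (use V(2)[OF that(1)] in auto)
  then show "\<exists>B\<ge>0. \<forall>s\<in>K. \<forall>z\<in>\<H>. cmod (Lop \<kappa> (u s) z) \<le> B" using B(1) V(1) by (meson mult_nonneg_nonneg)
qed

text \<open>The kernel in \<open>w\<close> is supported in a ball of finite area, on which the
  series converges uniformly; hence sum and integral may be exchanged.\<close>

lemma Lop_poinc:
  assumes k: "good_kernel \<kappa>" and \<psi>: "\<And>z. z \<in> \<H> \<Longrightarrow> cmod (\<psi> z) \<le> B * ht z powr \<sigma>" and B: "B \<ge> 0" and \<sigma>: "\<sigma> > 1"
    and c: "continuous_on \<H> \<psi>" and z: "z \<in> \<H>"
  shows "((\<lambda>C. \<integral>w. \<kappa> z w * \<psi> (psl2_act (coset_rep C) w) \<partial>hmeas) has_sum Lop \<kappa> (poinc \<psi>) z) cosets"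
  unfolding has_sum_def
proof (rule tendstoI)
  fix e :: real assume e: "e > 0"
  obtain Bk where Bk: "Bk \<ge> 0" "\<And>z w. z \<in> \<H> \<Longrightarrow> w \<in> \<H> \<Longrightarrow> cmod (\<kappa> z w) \<le> Bk * indicator (hball z 1) w"
    using good_kernel_bound[OF k] by blast
  obtain M where M: "M \<ge> 0" "\<And>\<psi> B z. (\<And>z. z \<in> \<H> \<Longrightarrow> cmod (\<psi> z) \<le> B * ht z powr \<sigma>) \<Longrightarrow> B \<ge> 0 \<Longrightarrow> z \<in> \<H> \<Longrightarrow>
     cmod (poinc \<psi> z) \<le> B * M" using poinc_bounded[OF \<sigma>] by blast
  have Pb: "cmod (poinc \<psi> w) \<le> B * M" if "w \<in> \<H>" for w using M(2)[OF \<psi> B that] by blast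
  have Pm: "poinc \<psi> \<in> borel_measurable hmeas"
    by (rule borel_measurable_hmeasI[OF poinc_continuous[of \<psi>, OF \<psi> B \<sigma> c]])
  have \<psi>b: "cmod (\<psi> w) \<le> B" if "w \<in> \<H>" for w
  proof -
    have "ht w powr \<sigma> \<le> 1" using ht_pos[OF that] ht_le_1[of w] \<sigma> by (simp add: powr_le1)
    then have "B * ht w powr \<sigma> \<le> B * 1" using B by (intro mult_left_mono) auto
    then show ?thesis using \<psi>[OF that] by simp
  qed
  have gi: "integrable hmeas (\<lambda>w. \<kappa> z w * \<psi> (psl2_act (coset_rep C) w))" if C: "C \<in> cosets" for C
  proof (rule Lop_integrable[OF k z])
    have "\<psi> \<in> borel_measurable hmeas" by (rule borel_measurable_hmeasI[OF c])
    then show "(\<lambda>w. \<psi> (psl2_act (coset_rep C) w)) \<in> borel_measurable hmeas"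
      using measurable_act[OF coset_rep_in[OF C]] by (rule measurable_compose[rotated])
    show "cmod (\<psi> (psl2_act (coset_rep C) w)) \<le> B" if "w \<in> \<H>" for w
      using \<psi>b act_H coset_rep_in[OF C] that by blast
  qed
  define d where "d = e / (Bk * vol 1 + 1)"
  have pos: "Bk * vol 1 \<ge> 0" using Bk vol_nonneg by simp
  have d: "d > 0" using e pos by (simp add: d_def)
  have "\<forall>\<^sub>F F in finite_subsets_at_top cosets. \<forall>w\<in>{w \<in> \<H>. hyp z w \<le> 1}. dist (\<Sum>C\<in>F. \<psi> (psl2_act (coset_rep C) w)) (poinc \<psi> w) < d"
    using poinc_uniform[of \<psi>, OF \<psi> B \<sigma> z] d unfolding uniform_limit_iff by blast
  moreover have "\<forall>\<^sub>F F in finite_subsets_at_top cosets. finite F \<and> F \<subseteq> cosets"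
    by (rule eventually_finite_subsets_at_top_weakI) auto
  ultimately show "\<forall>\<^sub>F F in finite_subsets_at_top cosets. dist (\<Sum>C\<in>F. \<integral>w. \<kappa> z w * \<psi> (psl2_act (coset_rep C) w) \<partial>hmeas) (Lop \<kappa> (poinc \<psi>) z) < e"
  proof eventually_elim
    case (elim F)
    have "(\<Sum>C\<in>F. \<integral>w. \<kappa> z w * \<psi> (psl2_act (coset_rep C) w) \<partial>hmeas) = (\<integral>w. (\<Sum>C\<in>F. \<kappa> z w * \<psi> (psl2_act (coset_rep C) w)) \<partial>hmeas)"
      using elim gi by (subst Bochner_Integration.integral_sum) auto
    also have "\<dots> - Lop \<kappa> (poinc \<psi>) z = (\<integral>w. (\<Sum>C\<in>F. \<kappa> z w * \<psi> (psl2_act (coset_rep C) w)) - \<kappa> z w * poinc \<psi> w \<partial>hmeas)"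
      unfolding Lop_def using elim gi Lop_integrable[OF k z Pm Pb]
      by (subst Bochner_Integration.integral_diff) (auto intro!: Bochner_Integration.integrable_sum)
    finally have "cmod ((\<Sum>C\<in>F. \<integral>w. \<kappa> z w * \<psi> (psl2_act (coset_rep C) w) \<partial>hmeas) - Lop \<kappa> (poinc \<psi>) z)
      = cmod (\<integral>w. (\<Sum>C\<in>F. \<kappa> z w * \<psi> (psl2_act (coset_rep C) w)) - \<kappa> z w * poinc \<psi> w \<partial>hmeas)" by simp
    also have "\<dots> \<le> (Bk * d) * vol 1"
    proof (rule Lop_bound_aux[OF z])
      show "Bk * d \<ge> 0" using Bk d by simp
      fix w assume w: "w \<in> \<H>"
      have "(\<Sum>C\<in>F. \<kappa> z w * \<psi> (psl2_act (coset_rep C) w)) - \<kappa> z w * poinc \<psi> w = \<kappa> z w * ((\<Sum>C\<in>F. \<psi> (psl2_act (coset_rep C) w)) - poinc \<psi> w)"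
        by (simp add: sum_distrib_left right_diff_distrib)
      moreover have "cmod (\<kappa> z w * ((\<Sum>C\<in>F. \<psi> (psl2_act (coset_rep C) w)) - poinc \<psi> w)) \<le> Bk * d * indicator (hball z 1) w"
      proof (cases "w \<in> hball z 1")
        case True
        then have "cmod ((\<Sum>C\<in>F. \<psi> (psl2_act (coset_rep C) w)) - poinc \<psi> w) \<le> d"
          using elim w by (auto simp: hball_def dist_norm intro: less_imp_le)
        then have "cmod (\<kappa> z w * ((\<Sum>C\<in>F. \<psi> (psl2_act (coset_rep C) w)) - poinc \<psi> w)) \<le> Bk * d"
          unfolding norm_mult using Bk(2)[OF z w] Bk(1) True by (intro mult_mono) auto
        then show ?thesis using True by simp
      next
        case False
        then have "\<kappa> z w = 0" using Bk(2)[OF z w] by simp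
        then show ?thesis using False by simp
      qed
      ultimately show "cmod ((\<Sum>C\<in>F. \<kappa> z w * \<psi> (psl2_act (coset_rep C) w)) - \<kappa> z w * poinc \<psi> w) \<le> Bk * d * indicator (hball z 1) w" by simp
    qed
    also have "\<dots> = (Bk * vol 1) * d" by simp
    also have "\<dots> < e" using e pos by (simp add: d_def field_simps)
    finally show ?case by (simp add: dist_norm)
  qed
qed

text \<open>A tent rather than the indicator of a disc, for the sake of continuity. It depends on
  \<open>hyp\<close> alone and so commutes with all isometries.\<close>

definition disc_kernel :: "real \<Rightarrow> complex \<Rightarrow> complex \<Rightarrow> complex" where
  "disc_kernel r z w = of_real (max 0 (r - hyp z w))"

lemma good_kernel_disc_kernel:
  assumes "0 < r" "r \<le> 1"
  shows "good_kernel (disc_kernel r)"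
  unfolding good_kernel_def
proof (intro conjI ballI impI)
  have "continuous_on (\<H> \<times> \<H>) (\<lambda>p. hyp (fst p) (snd p))"
    by (intro continuous_on_hyp continuous_intros) auto
  then show "continuous_on (\<H> \<times> \<H>) (\<lambda>(z, w). disc_kernel r z w)"
    unfolding disc_kernel_def split_beta by (intro continuous_intros)
  fix g z w assume gzw: "g \<in> \<Gamma>" "z \<in> \<H>" "w \<in> \<H>"
  show "disc_kernel r (psl2_act g z) (psl2_act g w) = disc_kernel r z w" using hyp_act[OF gzw] by (simp add: disc_kernel_def)
next
  show "\<exists>B. \<forall>z\<in>\<H>. \<forall>w\<in>\<H>. cmod (disc_kernel r z w) \<le> B"
  proof (intro exI ballI)
    fix z w assume "z \<in> \<H>" "w \<in> \<H>"
    then show "cmod (disc_kernel r z w) \<le> 1" using assms hyp_nonneg[of z w] by (simp add: disc_kernel_def)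
  qed
qed (use assms in \<open>auto simp: disc_kernel_def\<close>)

text \<open>The primitive itself is unbounded and not invariant; its differences are invariant, and
  bounded on the support of the kernel by \<open>additive_lipschitz\<close>.\<close>

lemma good_kernel_mult_additive:
  assumes k: "good_kernel \<kappa>" and A: "additive A"
  shows "good_kernel (\<lambda>z w. \<kappa> z w * of_real (A z - A w))"
  unfolding good_kernel_def
proof (intro conjI ballI impI)
  have cA: "continuous_on \<H> A" using A by (simp add: additive_def)
  have "continuous_on (\<H> \<times> \<H>) (\<lambda>p. A (fst p))" "continuous_on (\<H> \<times> \<H>) (\<lambda>p. A (snd p))"
    by (auto intro!: continuous_on_compose2[OF cA] continuous_intros)
  moreover have "continuous_on (\<H> \<times> \<H>) (\<lambda>p. \<kappa> (fst p) (snd p))"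
    using k by (simp add: good_kernel_def split_beta)
  ultimately show "continuous_on (\<H> \<times> \<H>) (\<lambda>(z, w). \<kappa> z w * of_real (A z - A w))"
    unfolding split_beta by (intro continuous_intros)
  fix g z w assume gzw: "g \<in> \<Gamma>" "z \<in> \<H>" "w \<in> \<H>"
  have "\<kappa> (psl2_act g z) (psl2_act g w) = \<kappa> z w" using k gzw by (simp add: good_kernel_def)
  then show "\<kappa> (psl2_act g z) (psl2_act g w) * of_real (A (psl2_act g z) - A (psl2_act g w)) = \<kappa> z w * of_real (A z - A w)"
    using additive_diff[OF A gzw] by (simp only:)
next
  obtain L where L: "L \<ge> 0" "\<And>z w. z \<in> \<H> \<Longrightarrow> w \<in> \<H> \<Longrightarrow> hyp z w \<le> 1 \<Longrightarrow> \<bar>A z - A w\<bar> \<le> L"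
    using additive_lipschitz[OF A] by blast
  obtain B where B: "B \<ge> 0" "\<And>z w. z \<in> \<H> \<Longrightarrow> w \<in> \<H> \<Longrightarrow> cmod (\<kappa> z w) \<le> B * indicator (hball z 1) w"
    using good_kernel_bound[OF k] by blast
  have "cmod (\<kappa> z w * of_real (A z - A w)) \<le> B * L" if zw: "z \<in> \<H>" "w \<in> \<H>" for z w
  proof (cases "w \<in> hball z 1")
    case True
    then have "\<bar>A z - A w\<bar> \<le> L" using L(2)[OF zw] by (auto simp: hball_def)
    then show ?thesis unfolding norm_mult norm_of_real using B(2)[OF zw] True B(1) by (intro mult_mono) auto
  next
    case False
    then have "\<kappa> z w = 0" using B(2)[OF zw] by simp
    then show ?thesis using B L by simp
  qed
  then show "\<exists>B. \<forall>z\<in>\<H>. \<forall>w\<in>\<H>. cmod (\<kappa> z w * of_real (A z - A w)) \<le> B" by blast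
qed (use k in \<open>auto simp: good_kernel_def\<close>)

lemma good_kernel_mult_additives:
  assumes "finite T" "\<And>k. k \<in> T \<Longrightarrow> additive (A k)" and \<kappa>: "good_kernel \<kappa>"
  shows "good_kernel (\<lambda>z w. \<kappa> z w * of_real (\<Prod>k\<in>T. A k z - A k w))"
  using assms(1,2)
proof (induction T)
  case empty
  then show ?case using \<kappa> by simp
next
  case (insert k T)
  have "good_kernel (\<lambda>z w. \<kappa> z w * of_real (\<Prod>k\<in>T. A k z - A k w) * of_real (A k z - A k w))"
    using insert by (intro good_kernel_mult_additive) auto
  moreover have "(\<lambda>z w. \<kappa> z w * of_real (\<Prod>k\<in>T. A k z - A k w) * of_real (A k z - A k w)) =
      (\<lambda>z w. \<kappa> z w * of_real (\<Prod>k\<in>insert k T. A k z - A k w))"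
    using insert.hyps by (intro ext) (simp add: mult_ac)
  ultimately show ?case by simp
qed

end

section \<open>Meromorphic Fredholm theory\<close>

text \<open>Gaussian elimination without division. No solution is constructed: any given solution,
  multiplied by the product d of the pivots, equals a holomorphic function. Injectivity at
  \<open>s0\<close> provides pivots that do not vanish there.\<close>

lemma linear_system_holomorphic:
  fixes a :: "'i \<Rightarrow> 'j \<Rightarrow> complex \<Rightarrow> complex"
  assumes "finite J" "\<And>i j. i \<in> I \<Longrightarrow> j \<in> J \<Longrightarrow> a i j holomorphic_on U" "\<And>i. i \<in> I \<Longrightarrow> b i holomorphic_on U"
    and inj: "\<And>x. (\<And>i. i \<in> I \<Longrightarrow> (\<Sum>j\<in>J. a i j s0 * x j) = 0) \<Longrightarrow> \<forall>j\<in>J. x j = 0"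
  shows "\<exists>d y. d holomorphic_on U \<and> d s0 \<noteq> 0 \<and> (\<forall>j\<in>J. y j holomorphic_on U) \<and>
    (\<forall>s\<in>U. \<forall>x. (\<forall>i\<in>I. (\<Sum>j\<in>J. a i j s * x j) = b i s) \<longrightarrow> (\<forall>j\<in>J. d s * x j = y j s))"
  using assms
proof (induction J arbitrary: a b)
  case empty
  then show ?case by (intro exI[of _ "\<lambda>_. 1"]) auto
next
  case (insert j0 J)
  \<comment> \<open>If the column \<open>j0\<close> vanished at \<open>s0\<close>, its unit vector
    would contradict injectivity.\<close>
  obtain p where p: "p \<in> I" "a p j0 s0 \<noteq> 0"
  proof (rule ccontr)
    assume "\<not> thesis"
    then have z: "a i j0 s0 = 0" if "i \<in> I" for i using that \<open>\<And>p. \<lbrakk>p \<in> I; a p j0 s0 \<noteq> 0\<rbrakk> \<Longrightarrow> thesis\<close> by blast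
    have "(\<Sum>j\<in>insert j0 J. a i j s0 * (if j = j0 then 1 else 0)) = 0" if "i \<in> I" for i
      using z[OF that] insert.hyps by (auto intro!: sum.neutral)
    from insert.prems(3)[of "\<lambda>j. if j = j0 then 1 else 0", OF this] show False by auto
  qed
  \<comment> \<open>Cross-multiplication by the pivot instead of division keeps the coefficients
    holomorphic on all of U, even where the pivot has zeros.\<close>
  define a' where "a' i j s = a p j0 s * a i j s - a i j0 s * a p j s" for i j s
  define b' where "b' i s = a p j0 s * b i s - a i j0 s * b p s" for i s
  have sum': "(\<Sum>j\<in>J. a' i j s * x j) = a p j0 s * (\<Sum>j\<in>J. a i j s * x j) - a i j0 s * (\<Sum>j\<in>J. a p j s * x j)" for i s x
    by (simp add: a'_def sum_distrib_left sum_subtractf left_diff_distrib mult.assoc)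
  have "\<exists>d y. d holomorphic_on U \<and> d s0 \<noteq> 0 \<and> (\<forall>j\<in>J. y j holomorphic_on U) \<and>
    (\<forall>s\<in>U. \<forall>x. (\<forall>i\<in>I. (\<Sum>j\<in>J. a' i j s * x j) = b' i s) \<longrightarrow> (\<forall>j\<in>J. d s * x j = y j s))"
  proof (rule insert.IH)
    show "a' i j holomorphic_on U" if "i \<in> I" "j \<in> J" for i j
      unfolding a'_def using insert.prems(1) that p by (intro holomorphic_intros) auto
    show "b' i holomorphic_on U" if "i \<in> I" for i
      unfolding b'_def using insert.prems(1,2) that p by (intro holomorphic_intros) auto
    fix x assume x: "\<And>i. i \<in> I \<Longrightarrow> (\<Sum>j\<in>J. a' i j s0 * x j) = 0"
    define x0 where "x0 = - (\<Sum>j\<in>J. a p j s0 * x j) / a p j0 s0"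
    define xx where "xx j = (if j = j0 then x0 else x j)" for j
    have xx: "(\<Sum>j\<in>J. a i j s0 * xx j) = (\<Sum>j\<in>J. a i j s0 * x j)" for i
      using insert.hyps by (intro sum.cong) (auto simp: xx_def)
    have "(\<Sum>j\<in>insert j0 J. a i j s0 * xx j) = 0" if "i \<in> I" for i
    proof -
      have "a p j0 s0 * (\<Sum>j\<in>insert j0 J. a i j s0 * xx j) = (\<Sum>j\<in>J. a' i j s0 * x j)"
        unfolding sum' using insert.hyps p xx by (simp add: xx_def x0_def field_simps)
      then show ?thesis using x[OF that] p by simp
    qed
    from insert.prems(3)[of xx, OF this] show "\<forall>j\<in>J. x j = 0"
      using insert.hyps by (auto simp: xx_def split: if_splits)
  qed
  then obtain d y where dy: "d holomorphic_on U" "d s0 \<noteq> 0" "\<And>j. j \<in> J \<Longrightarrow> y j holomorphic_on U"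
    "\<And>s x. s \<in> U \<Longrightarrow> (\<And>i. i \<in> I \<Longrightarrow> (\<Sum>j\<in>J. a' i j s * x j) = b' i s) \<Longrightarrow> (\<forall>j\<in>J. d s * x j = y j s)" by blast
  define Y where "Y j s = (if j = j0 then d s * b p s - (\<Sum>j\<in>J. a p j s * y j s) else a p j0 s * y j s)" for j s
  have Yh: "Y j holomorphic_on U" if "j \<in> insert j0 J" for j
  proof (cases "j = j0")
    case True
    then show ?thesis unfolding Y_def using dy insert.prems(1,2) p
      by (auto intro!: holomorphic_intros)
  next
    case False
    then show ?thesis unfolding Y_def using dy insert.prems(1) p that
      by (auto intro!: holomorphic_intros)
  qed
  have sol: "d s * a p j0 s * x j = Y j s"
    if s: "s \<in> U" and x: "\<And>i. i \<in> I \<Longrightarrow> (\<Sum>j\<in>insert j0 J. a i j s * x j) = b i s" and j: "j \<in> insert j0 J" for s x j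
  proof -
    have e: "(\<Sum>j\<in>J. a i j s * x j) = b i s - a i j0 s * x j0" if "i \<in> I" for i
      using x[OF that] insert.hyps by (simp add: algebra_simps)
    have "(\<Sum>j\<in>J. a' i j s * x j) = b' i s" if "i \<in> I" for i
      unfolding sum' e[OF that] e[OF p(1)] b'_def by (simp add: algebra_simps)
    from dy(4)[OF s this] have y: "\<forall>j\<in>J. d s * x j = y j s" .
    show ?thesis
    proof (cases "j = j0")
      case True
      have "d s * (a p j0 s * x j0) = d s * (b p s - (\<Sum>j\<in>J. a p j s * x j))" using e[OF p(1)] by simp
      also have "\<dots> = d s * b p s - (\<Sum>j\<in>J. a p j s * (d s * x j))"
        by (simp add: right_diff_distrib sum_distrib_left mult.left_commute)
      also have "\<dots> = Y j s" using True y by (simp add: Y_def)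
      finally show ?thesis using True by (metis mult.assoc)
    next
      case False
      then show ?thesis using j y by (auto simp: Y_def)
    qed
  qed
  show ?case
  proof (rule exI[of _ "\<lambda>s. d s * a p j0 s"], rule exI[of _ Y], intro conjI ballI allI impI)
    show "(\<lambda>s. d s * a p j0 s) holomorphic_on U" using dy insert.prems(1) p by (intro holomorphic_intros) auto
  qed (use dy p Yh sol in auto)
qed

text \<open>Uniqueness by iteration: a bounded function whose every bound V improves to q V is below
  q^n times the first bound for all n.\<close>

lemma contraction_zero:
  fixes w :: "complex \<Rightarrow> complex"
  assumes b: "\<And>z. z \<in> \<H> \<Longrightarrow> cmod (w z) \<le> V0" and q: "0 \<le> q" "q < 1"
    and c: "\<And>V z. V \<ge> 0 \<Longrightarrow> (\<And>z. z \<in> \<H> \<Longrightarrow> cmod (w z) \<le> V) \<Longrightarrow> z \<in> \<H> \<Longrightarrow> cmod (w z) \<le> q * V"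
    and z: "z \<in> \<H>"
  shows "w z = 0"
proof -
  have V0: "V0 \<ge> 0" using b[OF z] norm_ge_zero order_trans by blast
  have n: "\<forall>z\<in>\<H>. cmod (w z) \<le> q ^ n * V0" for n
  proof (induction n)
    case (Suc n)
    then show ?case using c[of "q ^ n * V0"] q V0 by (simp add: mult.assoc)
  qed (use b in auto)
  have "(\<lambda>n. q ^ n * V0) \<longlonglongrightarrow> 0" using q by (intro tendsto_mult_left_zero LIMSEQ_power_zero) auto
  then have "cmod (w z) \<le> 0" using n z by (intro LIMSEQ_le_const[of "\<lambda>n. q ^ n * V0"]) auto
  then show ?thesis by simp
qed

context hyperbolic_group
begin

section \<open>Bounded invariant functions\<close>

definition bdd_inv :: "(complex \<Rightarrow> complex) \<Rightarrow> bool" where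
  "bdd_inv v \<longleftrightarrow> v \<in> borel_measurable hmeas \<and> (\<exists>V. \<forall>z\<in>\<H>. cmod (v z) \<le> V) \<and> (\<forall>g\<in>\<Gamma>. \<forall>z\<in>\<H>. v (psl2_act g z) = v z)"

lemma bdd_inv_bound:
  assumes "bdd_inv v"
  obtains V where "V \<ge> 0" "\<And>z. z \<in> \<H> \<Longrightarrow> cmod (v z) \<le> V"
proof -
  obtain V where V: "\<And>z. z \<in> \<H> \<Longrightarrow> cmod (v z) \<le> V" using assms unfolding bdd_inv_def by blast
  moreover have "V \<ge> 0" using V[OF i_in_H] norm_ge_zero order_trans by blast
  ultimately show ?thesis using that by blast
qed

lemma bdd_inv_add: "bdd_inv u \<Longrightarrow> bdd_inv v \<Longrightarrow> bdd_inv (\<lambda>z. u z + v z)"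
proof -
  assume u: "bdd_inv u" and v: "bdd_inv v"
  obtain V where V: "\<And>z. z \<in> \<H> \<Longrightarrow> cmod (u z) \<le> V" using bdd_inv_bound[OF u] by blast
  obtain W where W: "\<And>z. z \<in> \<H> \<Longrightarrow> cmod (v z) \<le> W" using bdd_inv_bound[OF v] by blast
  have "cmod (u z + v z) \<le> V + W" if "z \<in> \<H>" for z
    using V[OF that] W[OF that] norm_triangle_ineq[of "u z" "v z"] by linarith
  then show ?thesis using u v unfolding bdd_inv_def by auto
qed

lemma bdd_inv_scale: "bdd_inv v \<Longrightarrow> bdd_inv (\<lambda>z. c * v z)"
proof -
  assume v: "bdd_inv v"
  obtain V where V: "\<And>z. z \<in> \<H> \<Longrightarrow> cmod (v z) \<le> V" using bdd_inv_bound[OF v] by blast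
  have "cmod (c * v z) \<le> cmod c * V" if "z \<in> \<H>" for z
    unfolding norm_mult using V[OF that] by (intro mult_left_mono) auto
  then show ?thesis using v unfolding bdd_inv_def by auto
qed

lemma bdd_inv_zero: "bdd_inv (\<lambda>_. 0)"
  by (auto simp: bdd_inv_def)

lemma bdd_inv_sum: "finite I \<Longrightarrow> (\<And>i. i \<in> I \<Longrightarrow> bdd_inv (f i)) \<Longrightarrow> bdd_inv (\<lambda>z. \<Sum>i\<in>I. f i z)"
  by (induction I rule: finite_induct) (auto intro: bdd_inv_add bdd_inv_zero)

lemma bdd_inv_diff: "bdd_inv u \<Longrightarrow> bdd_inv v \<Longrightarrow> bdd_inv (\<lambda>z. u z - v z)"
  using bdd_inv_add[of u "\<lambda>z. (-1) * v z"] bdd_inv_scale[of v "-1"] by simp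

lemma autfam_bdd_inv:
  assumes "autfam U u" "s \<in> U"
  shows "bdd_inv (u s)"
proof -
  obtain V where "\<And>w. w \<in> \<H> \<Longrightarrow> cmod (u s w) \<le> V" using autfam_bound[OF assms] by blast
  then show ?thesis
    unfolding bdd_inv_def using autfam_measurable[OF assms] autfam_invariant[OF assms] by blast
qed

lemma Lop_bdd_inv_integrable: "good_kernel \<kappa> \<Longrightarrow> bdd_inv v \<Longrightarrow> z \<in> \<H> \<Longrightarrow> integrable hmeas (\<lambda>w. \<kappa> z w * v w)"
  using Lop_integrable[of \<kappa> z v] unfolding bdd_inv_def by blast

lemma Lop_add: "good_kernel \<kappa> \<Longrightarrow> bdd_inv u \<Longrightarrow> bdd_inv v \<Longrightarrow> z \<in> \<H> \<Longrightarrow>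
    Lop \<kappa> (\<lambda>w. u w + v w) z = Lop \<kappa> u z + Lop \<kappa> v z"
  unfolding Lop_def distrib_left using Lop_bdd_inv_integrable
  by (intro Bochner_Integration.integral_add) auto

lemma Lop_scale: "Lop \<kappa> (\<lambda>w. c * v w) z = c * Lop \<kappa> v z"
  unfolding Lop_def mult.left_commute[of _ c] by (rule Bochner_Integration.integral_mult_right_zero)

lemma Lop_zero: "Lop \<kappa> (\<lambda>_. 0) z = 0"
  by (simp add: Lop_def)

lemma Lop_sum:
  assumes k: "good_kernel \<kappa>" and z: "z \<in> \<H>" and "finite I" "\<And>i. i \<in> I \<Longrightarrow> bdd_inv (f i)"
  shows "Lop \<kappa> (\<lambda>w. \<Sum>i\<in>I. f i w) z = (\<Sum>i\<in>I. Lop \<kappa> (f i) z)"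
  using assms(3,4)
proof (induction I rule: finite_induct)
  case (insert i I)
  then show ?case using Lop_add[OF k, of "f i" "\<lambda>w. \<Sum>i\<in>I. f i w" z] bdd_inv_sum[of I f] z by simp
qed (simp add: Lop_zero)

lemma Lop_cong: "(\<And>w. w \<in> \<H> \<Longrightarrow> u w = v w) \<Longrightarrow> Lop \<kappa> u z = Lop \<kappa> v z"
  unfolding Lop_def by (intro Bochner_Integration.integral_cong) auto

lemma autfamI:
  assumes "\<And>s. s \<in> U \<Longrightarrow> u s \<in> borel_measurable hmeas" "\<And>z. z \<in> \<H> \<Longrightarrow> (\<lambda>s. u s z) holomorphic_on U"
    "\<And>s g z. s \<in> U \<Longrightarrow> g \<in> \<Gamma> \<Longrightarrow> z \<in> \<H> \<Longrightarrow> u s (psl2_act g z) = u s z"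
    "\<And>K. compact K \<Longrightarrow> K \<subseteq> U \<Longrightarrow> \<exists>B. \<forall>s\<in>K. \<forall>z\<in>\<H>. cmod (u s z) \<le> B"
  shows "autfam U u"
  unfolding autfam_def
proof (intro conjI ballI allI impI)
  fix K assume "compact K \<and> K \<subseteq> U"
  then obtain B where "\<forall>s\<in>K. \<forall>z\<in>\<H>. cmod (u s z) \<le> B" using assms(4) by blast
  then show "\<exists>B\<ge>0. \<forall>s\<in>K. \<forall>z\<in>\<H>. cmod (u s z) \<le> B" by (intro exI[of _ "\<bar>B\<bar>"]) force
qed (use assms(1-3) in auto)

lemma autfam_add:
  assumes u: "autfam U u" and v: "autfam U v"
  shows "autfam U (\<lambda>s z. u s z + v s z)"
proof (rule autfamI)
  fix K assume K: "compact K" "K \<subseteq> U"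
  obtain B where B: "B \<ge> 0" "\<And>s w. s \<in> K \<Longrightarrow> w \<in> \<H> \<Longrightarrow> cmod (u s w) \<le> B" using autfam_compact_bound[OF u K] by blast
  obtain C where C: "C \<ge> 0" "\<And>s w. s \<in> K \<Longrightarrow> w \<in> \<H> \<Longrightarrow> cmod (v s w) \<le> C" using autfam_compact_bound[OF v K] by blast
  show "\<exists>B. \<forall>s\<in>K. \<forall>z\<in>\<H>. cmod (u s z + v s z) \<le> B"
    using B C by (intro exI[of _ "B + C"] ballI order_trans[OF norm_triangle_ineq] add_mono) auto
next
  fix s assume "s \<in> U"
  then show "(\<lambda>z. u s z + v s z) \<in> borel_measurable hmeas"
    using autfam_measurable[OF u] autfam_measurable[OF v] by (intro borel_measurable_add) auto
next
  fix z assume "z \<in> \<H>"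
  then show "(\<lambda>s. u s z + v s z) holomorphic_on U"
    using autfam_holomorphic[OF u] autfam_holomorphic[OF v] by (intro holomorphic_on_add) auto
qed (use autfam_invariant[OF u] autfam_invariant[OF v] in auto)

lemma autfam_scale:
  assumes u: "autfam U u" and c: "c holomorphic_on U"
  shows "autfam U (\<lambda>s z. c s * u s z)"
proof (rule autfamI)
  fix K assume K: "compact K" "K \<subseteq> U"
  obtain B where B: "B \<ge> 0" "\<And>s w. s \<in> K \<Longrightarrow> w \<in> \<H> \<Longrightarrow> cmod (u s w) \<le> B" using autfam_compact_bound[OF u K] by blast
  have "compact (c ` K)"
    using holomorphic_on_imp_continuous_on[OF c] K by (intro compact_continuous_image) (auto intro: continuous_on_subset)
  then have "bounded (c ` K)" by (rule compact_imp_bounded)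
  then obtain C where C: "C > 0" "\<forall>x\<in>c ` K. cmod x \<le> C" unfolding bounded_pos by blast
  show "\<exists>B. \<forall>s\<in>K. \<forall>z\<in>\<H>. cmod (c s * u s z) \<le> B"
    unfolding norm_mult using B C by (intro exI[of _ "C * B"] ballI mult_mono) auto
next
  fix s assume "s \<in> U"
  then show "(\<lambda>z. c s * u s z) \<in> borel_measurable hmeas"
    using autfam_measurable[OF u] by (intro borel_measurable_times borel_measurable_const) auto
next
  fix z assume "z \<in> \<H>"
  then show "(\<lambda>s. c s * u s z) holomorphic_on U"
    using autfam_holomorphic[OF u] c by (intro holomorphic_on_mult) auto
qed (use autfam_invariant[OF u] in auto)

lemma autfam_const:
  assumes "bdd_inv v"
  shows "autfam U (\<lambda>_. v)"
proof (rule autfamI)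
  obtain V where "\<And>z. z \<in> \<H> \<Longrightarrow> cmod (v z) \<le> V" using bdd_inv_bound[OF assms] by blast
  then show "\<exists>B. \<forall>s\<in>K. \<forall>z\<in>\<H>. cmod (v z) \<le> B" for K :: "complex set" by blast
qed (use assms in \<open>auto simp: bdd_inv_def\<close>)

lemma autfam_cong:
  assumes u: "autfam U u" and e: "\<And>s z. z \<in> \<H> \<Longrightarrow> v s z = u s z"
  shows "autfam U v"
proof (rule autfamI)
  show "v s \<in> borel_measurable hmeas" if "s \<in> U" for s
  proof -
    have "v s \<in> borel_measurable hmeas \<longleftrightarrow> u s \<in> borel_measurable hmeas"
      by (rule measurable_cong) (simp add: e)
    then show ?thesis using autfam_measurable[OF u that] by simp
  qed
  show "(\<lambda>s. v s z) holomorphic_on U" if "z \<in> \<H>" for z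
    using autfam_holomorphic[OF u that] by (simp add: e that)
  show "v s (psl2_act g z) = v s z" if "s \<in> U" "g \<in> \<Gamma>" "z \<in> \<H>" for s g z
    using autfam_invariant[OF u that] act_H that by (simp add: e)
  show "\<exists>B. \<forall>s\<in>K. \<forall>z\<in>\<H>. cmod (v s z) \<le> B" if "compact K" "K \<subseteq> U" for K
    using autfam_compact_bound[OF u that] e by metis
qed

lemma autfam_sum: "finite I \<Longrightarrow> (\<And>i. i \<in> I \<Longrightarrow> autfam U (f i)) \<Longrightarrow> autfam U (\<lambda>s z. \<Sum>i\<in>I. f i s z)"
  by (induction I rule: finite_induct) (auto intro: autfam_add autfam_const bdd_inv_zero)

lemma autfam_subset: "autfam U u \<Longrightarrow> V \<subseteq> U \<Longrightarrow> autfam V u"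
  unfolding autfam_def by (meson holomorphic_on_subset order_trans subsetD)

lemma autfam_diff: "autfam U u \<Longrightarrow> autfam U v \<Longrightarrow> autfam U (\<lambda>s z. u s z - v s z)"
  using autfam_add[of U u "\<lambda>s z. (-1) * v s z"] autfam_scale[of U v "\<lambda>_. -1"] by simp

text \<open>Finitely many invariant cells on which the operator varies by at most \<open>e\<close>: this is where cocompactness
  makes the operator nearly of finite rank.\<close>

lemma kernel_cells:
  assumes k: "good_kernel \<kappa>" and e: "e > 0"
  obtains N :: nat and pt :: "nat \<Rightarrow> complex" and idx :: "complex \<Rightarrow> nat"
  where "\<And>i. i < N \<Longrightarrow> pt i \<in> \<H>" "\<And>z. z \<in> \<H> \<Longrightarrow> idx z < N"
    "\<And>g z. g \<in> \<Gamma> \<Longrightarrow> z \<in> \<H> \<Longrightarrow> idx (psl2_act g z) = idx z"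
    "idx \<in> hmeas \<rightarrow>\<^sub>M count_space UNIV"
    "\<And>v V z. bdd_inv v \<Longrightarrow> (\<And>w. w \<in> \<H> \<Longrightarrow> cmod (v w) \<le> V) \<Longrightarrow> V \<ge> 0 \<Longrightarrow> z \<in> \<H> \<Longrightarrow>
        cmod (Lop \<kappa> v z - Lop \<kappa> v (pt (idx z))) \<le> e * V"
proof -
  obtain R where R: "R \<ge> 0" "\<And>z. z \<in> \<H> \<Longrightarrow> \<exists>g\<in>\<Gamma>. hyp (psl2_act g z) \<i> \<le> R" using cocompact_hyp by blast
  obtain K where K: "compact K" "K \<subseteq> \<H>" "{v \<in> \<H>. hyp v \<i> \<le> R} \<subseteq> K" using compact_hyp_ball by blast
  have "\<exists>S. open S \<and> z0 \<in> S \<and> S \<subseteq> \<H> \<and> (\<forall>z\<in>S. (\<integral>w. cmod (\<kappa> z w - \<kappa> z0 w) \<partial>hmeas) < e)" if "z0 \<in> \<H>" for z0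
    using kernel_equicontinuous[OF k that e] by metis
  then obtain S where S: "\<And>z0. z0 \<in> \<H> \<Longrightarrow> open (S z0) \<and> z0 \<in> S z0 \<and> S z0 \<subseteq> \<H> \<and> (\<forall>z\<in>S z0. (\<integral>w. cmod (\<kappa> z w - \<kappa> z0 w) \<partial>hmeas) < e)"
    by metis
  obtain Z where Z: "Z \<subseteq> K" "finite Z" "K \<subseteq> (\<Union>z\<in>Z. S z)"
  proof (rule compactE_image[OF K(1), of K S])
    show "open (S z)" if "z \<in> K" for z using S K that by blast
    show "K \<subseteq> (\<Union>z\<in>K. S z)" using S K by blast
  qed blast
  obtain pt where pt: "bij_betw pt {0..<card Z} Z" using ex_bij_betw_nat_finite[OF Z(2)] by blast
  define N where "N = card Z"
  define G where "G i = {z \<in> \<H>. \<exists>g\<in>\<Gamma>. psl2_act g z \<in> S (pt i)}" for i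
  have ptZ: "pt i \<in> Z" if "i < N" for i using pt that by (auto simp: bij_betw_def N_def)
  then have ptH: "pt i \<in> \<H>" if "i < N" for i using Z K that by blast
  have Zpt: "\<exists>i<N. z = pt i" if "z \<in> Z" for z
    using pt that unfolding bij_betw_def N_def by (metis atLeastLessThan_iff image_iff)
  have cover: "\<exists>i. i < N \<and> z \<in> G i" if z: "z \<in> \<H>" for z
  proof -
    obtain g where g: "g \<in> \<Gamma>" "hyp (psl2_act g z) \<i> \<le> R" using R z by blast
    then have "psl2_act g z \<in> K" using K act_H z by auto
    then obtain y where "y \<in> Z" "psl2_act g z \<in> S y" using Z by blast
    then show ?thesis using Zpt g z unfolding G_def by blast
  qed
  \<comment> \<open>The least index turns the open cover into disjoint cells, each a difference of
    open invariant sets; the cell number is thus measurable and constant on orbits.\<close>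
  define idx where "idx z = (LEAST i. i < N \<and> z \<in> G i)" for z
  have idx: "idx z < N \<and> z \<in> G (idx z)" if "z \<in> \<H>" for z
    unfolding idx_def using cover[OF that] by (rule LeastI_ex)
  have Ginv: "psl2_act g z \<in> G i \<longleftrightarrow> z \<in> G i" if g: "g \<in> \<Gamma>" and z: "z \<in> \<H>" for g z i
  proof -
    have 1: "w \<in> G i" if gw: "g \<in> \<Gamma>" "w \<in> \<H>" "psl2_act g w \<in> G i" for g w
    proof -
      obtain h where "h \<in> \<Gamma>" "psl2_act h (psl2_act g w) \<in> S (pt i)" using gw by (auto simp: G_def)
      then have "h \<otimes>\<^bsub>PSL2R\<^esub> g \<in> \<Gamma>" "psl2_act (h \<otimes>\<^bsub>PSL2R\<^esub> g) w \<in> S (pt i)" using gw by (auto simp: act_mult mult_in)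
      then show ?thesis using gw by (auto simp: G_def)
    qed
    show ?thesis using 1[OF g z] 1[OF inv_in[OF g] act_H[OF g z]] act_inv(1)[OF g z] by auto
  qed
  have Gopen: "open (G i)" if "i < N" for i
  proof -
    have eq: "G i = (\<Union>g\<in>\<Gamma>. psl2_act g -` S (pt i) \<inter> \<H>)" by (auto simp: G_def)
    have "open (psl2_act g -` S (pt i) \<inter> \<H>)" if "g \<in> \<Gamma>" for g
      using continuous_act[OF that] S[OF ptH[OF \<open>i < N\<close>]] open_H by (simp add: continuous_on_open_vimage)
    then show ?thesis unfolding eq by (intro open_UN) blast
  qed
  have GH: "G i \<subseteq> \<H>" for i by (auto simp: G_def)
  have Gm: "G i \<in> sets hmeas" if "i < N" for i
    using Gopen[OF that] GH open_H by (simp add: sets_hmeas sets_restrict_space_iff)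
  have idxm: "idx \<in> hmeas \<rightarrow>\<^sub>M count_space UNIV"
    unfolding measurable_count_space_eq2_countable
  proof (intro conjI ballI)
    fix i :: nat
    have "idx -` {i} \<inter> space hmeas = (if i < N then G i - (\<Union>j\<in>{..<i}. G j) else {})"
    proof -
      have "idx z = i \<longleftrightarrow> z \<in> G i \<and> (\<forall>j<i. z \<notin> G j)" if z: "z \<in> \<H>" and i: "i < N" for z
      proof
        assume "idx z = i"
        then show "z \<in> G i \<and> (\<forall>j<i. z \<notin> G j)"
          using idx[OF z] i not_less_Least[of _ "\<lambda>i. i < N \<and> z \<in> G i"] unfolding idx_def by (metis less_trans)
      next
        assume "z \<in> G i \<and> (\<forall>j<i. z \<notin> G j)"
        then show "idx z = i" unfolding idx_def using i by (intro Least_equality) (auto simp: not_less[symmetric])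
      qed
      then have "idx -` {i} \<inter> \<H> = {z \<in> \<H>. z \<in> G i \<and> (\<forall>j<i. z \<notin> G j)}" if "i < N"
        using that by blast
      moreover have "{z \<in> \<H>. z \<in> G i \<and> (\<forall>j<i. z \<notin> G j)} = G i - (\<Union>j\<in>{..<i}. G j)"
        using GH by blast
      moreover have "idx -` {i} \<inter> \<H> = {}" if "\<not> i < N" using idx that by blast
      ultimately show ?thesis by simp
    qed
    moreover have "(if i < N then G i - (\<Union>j\<in>{..<i}. G j) else {}) \<in> sets hmeas"
      using Gm by (auto intro!: sets.Diff sets.finite_UN)
    ultimately show "idx -` {i} \<inter> space hmeas \<in> sets hmeas" by simp
  qed auto
  show ?thesis
  proof (rule that[of N pt idx])
    show "idx (psl2_act g z) = idx z" if "g \<in> \<Gamma>" "z \<in> \<H>" for g z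
      unfolding idx_def using Ginv[OF that] by simp
    fix v V z assume v: "bdd_inv v" "\<And>w. w \<in> \<H> \<Longrightarrow> cmod (v w) \<le> V" "V \<ge> 0" and z: "z \<in> \<H>"
    obtain g where g: "g \<in> \<Gamma>" "psl2_act g z \<in> S (pt (idx z))" using idx[OF z] by (auto simp: G_def)
    have ptz: "pt (idx z) \<in> \<H>" using ptH idx[OF z] by blast
    have vm: "v \<in> borel_measurable hmeas" and vi: "\<And>w. w \<in> \<H> \<Longrightarrow> v (psl2_act g w) = v w"
      using v(1) g by (auto simp: bdd_inv_def)
    have "Lop \<kappa> v z = Lop \<kappa> v (psl2_act g z)" using Lop_invariant[OF k vm g(1) vi z] by simp
    then have "cmod (Lop \<kappa> v z - Lop \<kappa> v (pt (idx z))) \<le> V * (\<integral>w. cmod (\<kappa> (psl2_act g z) w - \<kappa> (pt (idx z)) w) \<partial>hmeas)"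
      using Lop_diff_bound[OF k act_H[OF g(1) z] ptz vm v(2,3)] by simp
    also have "\<dots> \<le> V * e" using S[OF ptz] g(2) v(3) by (intro mult_left_mono) (auto intro: less_imp_le)
    finally show "cmod (Lop \<kappa> v z - Lop \<kappa> v (pt (idx z))) \<le> e * V" by (simp add: mult.commute)
  qed (use idx ptH idxm in auto)
qed

text \<open>The solution is the sum of the T^j v / h^(j+1), with ratio at most 1/2 since |h| \<ge> 2
  e. The operator is abstract because in \<open>fredholm\<close> it is \<open>Lop\<close> minus a
  part of finite rank, whose kernel jumps between cells.\<close>

lemma neumann_series:
  assumes U: "open U" and e: "e > 0" and h: "h holomorphic_on U" "\<And>s. s \<in> U \<Longrightarrow> cmod (h s) \<ge> 2 * e"
    and T_autfam: "\<And>u. autfam U u \<Longrightarrow> autfam U (\<lambda>s. T (u s))"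
    and T_add: "\<And>u v z. bdd_inv u \<Longrightarrow> bdd_inv v \<Longrightarrow> z \<in> \<H> \<Longrightarrow> T (\<lambda>w. u w + v w) z = T u z + T v z"
    and T_scale: "\<And>u c z. bdd_inv u \<Longrightarrow> z \<in> \<H> \<Longrightarrow> T (\<lambda>w. c * u w) z = c * T u z"
    and T_bound: "\<And>v V z. bdd_inv v \<Longrightarrow> (\<And>w. w \<in> \<H> \<Longrightarrow> cmod (v w) \<le> V) \<Longrightarrow> V \<ge> 0 \<Longrightarrow> z \<in> \<H> \<Longrightarrow> cmod (T v z) \<le> e * V"
    and v: "autfam U v"
  obtains W where "autfam U W" "\<And>s z. s \<in> U \<Longrightarrow> z \<in> \<H> \<Longrightarrow> h s * W s z - T (W s) z = v s z"
proof -
  have hn: "h s \<noteq> 0" if "s \<in> U" for s using h(2)[OF that] e by auto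
  define t where "t j s z = (T ^^ j) (v s) z" for j s z
  have t0: "t j s = (T ^^ j) (v s)" for j s by (rule ext) (simp add: t_def)
  have tS: "t (Suc j) s = T (t j s)" for j s by (simp add: t0)
  have tAF: "autfam U (t j)" for j
    unfolding t_def
  proof (induction j)
    case (Suc j)
    then show ?case using T_autfam[of "\<lambda>s z. (T ^^ j) (v s) z"] by simp
  qed (use v in simp)
  have tb: "cmod (t j s z) \<le> e ^ j * V" if s: "s \<in> U" and V: "\<And>w. w \<in> \<H> \<Longrightarrow> cmod (v s w) \<le> V" "V \<ge> 0" and z: "z \<in> \<H>" for j s z V
    using z
  proof (induction j arbitrary: z)
    case (Suc j)
    have BMt: "bdd_inv (t j s)" using autfam_bdd_inv[OF tAF s] .
    then have "cmod (T (t j s) z) \<le> e * (e ^ j * V)" using Suc e V BMt by (intro T_bound) auto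
    then show ?case by (simp add: tS mult.assoc)
  qed (use V in \<open>simp add: t_def\<close>)
  define a where "a j s z = t j s z / h s ^ Suc j" for j s z
  have aAF: "autfam U (a j)" for j
  proof -
    have "autfam U (\<lambda>s z. (1 / h s ^ Suc j) * t j s z)"
      using hn h by (intro autfam_scale tAF holomorphic_intros) auto
    then show ?thesis by (simp add: a_def[abs_def])
  qed
  have ab: "cmod (a j s z) \<le> V / (2 * e) * (1/2) ^ j"
    if s: "s \<in> U" and V: "\<And>w. w \<in> \<H> \<Longrightarrow> cmod (v s w) \<le> V" "V \<ge> 0" and z: "z \<in> \<H>" for j s z V
  proof -
    have "cmod (a j s z) \<le> (e ^ j * V) / (2 * e) ^ Suc j"
      unfolding a_def norm_divide norm_power using tb[OF s V z, of j] h(2)[OF s] e V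
      by (intro frac_le power_mono) auto
    also have "\<dots> = V / (2 * e) * (1/2) ^ j" using e by (simp add: field_simps power_mult_distrib power_divide)
    finally show ?thesis .
  qed
  define W where "W s z = (\<Sum>j. a j s z)" for s z
  have sg: "summable (\<lambda>j. V / (2 * e) * (1/2) ^ j)" for V by (intro summable_mult summable_geometric) auto
  have asum: "summable (\<lambda>j. a j s z)" if s: "s \<in> U" and z: "z \<in> \<H>" for s z
  proof -
    obtain V where V: "V \<ge> 0" "\<And>w. w \<in> \<H> \<Longrightarrow> cmod (v s w) \<le> V" using autfam_bound[OF v s] by blast
    show ?thesis using ab[OF s V(2,1) z] by (intro summable_comparison_test'[OF sg[of V]]) auto
  qed
  have Wb: "cmod (W s z) \<le> V / e" if s: "s \<in> U" and V: "\<And>w. w \<in> \<H> \<Longrightarrow> cmod (v s w) \<le> V" "V \<ge> 0" and z: "z \<in> \<H>" for s z V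
  proof -
    have sn: "summable (\<lambda>j. cmod (a j s z))"
      using ab[OF s V z] by (intro summable_comparison_test'[OF sg[of V]]) auto
    have "cmod (W s z) \<le> (\<Sum>j. cmod (a j s z))" unfolding W_def by (rule summable_norm[OF sn])
    also have "\<dots> \<le> (\<Sum>j. V / (2 * e) * (1/2) ^ j)" using ab[OF s V z] sn sg by (intro suminf_le) auto
    also have "\<dots> = V / e" by (subst suminf_mult) (auto simp: suminf_geometric summable_geometric)
    finally show ?thesis .
  qed
  have WAF: "autfam U W"
    unfolding autfam_def
  proof (intro conjI ballI allI impI)
    fix s assume "s \<in> U"
    then show "W s \<in> borel_measurable hmeas"
      unfolding W_def using autfam_measurable[OF aAF] by (intro borel_measurable_suminf) auto
  next
    fix s g z assume "s \<in> U" "g \<in> \<Gamma>" "z \<in> \<H>"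
    then show "W s (psl2_act g z) = W s z" unfolding W_def using autfam_invariant[OF aAF] by simp
  next
    fix z assume z: "z \<in> \<H>"
    show "(\<lambda>s. W s z) holomorphic_on U"
    proof (rule holomorphic_uniform_sequence[OF U])
      show "(\<lambda>s. \<Sum>j<n. a j s z) holomorphic_on U" for n
        using autfam_holomorphic[OF aAF z] by (intro holomorphic_intros) auto
      fix s assume "s \<in> U"
      then obtain r where r: "r > 0" "cball s r \<subseteq> U" using U open_contains_cball by blast
      obtain V where V: "V \<ge> 0" "\<And>x w. x \<in> cball s r \<Longrightarrow> w \<in> \<H> \<Longrightarrow> cmod (v x w) \<le> V"
        using autfam_compact_bound[OF v compact_cball r(2)] by blast
      have "uniform_limit (cball s r) (\<lambda>n s. \<Sum>j<n. a j s z) (\<lambda>s. W s z) sequentially"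
        unfolding W_def
      proof (rule Weierstrass_m_test[OF _ sg[of V]])
        show "cmod (a j x z) \<le> V / (2 * e) * (1/2) ^ j" if "x \<in> cball s r" for j x
          using that r V by (intro ab z) auto
      qed
      then show "\<exists>d>0. cball s d \<subseteq> U \<and> uniform_limit (cball s d) (\<lambda>n s. \<Sum>j<n. a j s z) (\<lambda>s. W s z) sequentially"
        using r by blast
    qed
  next
    fix K assume K: "compact K \<and> K \<subseteq> U"
    obtain V where V: "V \<ge> 0" "\<And>s w. s \<in> K \<Longrightarrow> w \<in> \<H> \<Longrightarrow> cmod (v s w) \<le> V"
      using autfam_compact_bound[OF v] K by blast
    have "cmod (W s z) \<le> V / e" if "s \<in> K" "z \<in> \<H>" for s z using that K V by (intro Wb) auto
    then show "\<exists>B\<ge>0. \<forall>s\<in>K. \<forall>z\<in>\<H>. cmod (W s z) \<le> B" using V(1) e by (intro exI[of _ "V / e"]) auto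
  qed
  have eq: "h s * W s z - T (W s) z = v s z" if s: "s \<in> U" and z: "z \<in> \<H>" for s z
  proof -
    obtain V where V: "V \<ge> 0" "\<And>w. w \<in> \<H> \<Longrightarrow> cmod (v s w) \<le> V" using autfam_bound[OF v s] by blast
    define P where "P n w = (\<Sum>j<n. a j s w)" for n w
    have aBM: "bdd_inv (a j s)" for j using autfam_bdd_inv[OF aAF s] .
    have PBM: "bdd_inv (P n)" for n unfolding P_def using aBM by (intro bdd_inv_sum) auto
    have WBM: "bdd_inv (W s)" using autfam_bdd_inv[OF WAF s] .
    have tBM: "bdd_inv (t j s)" for j using autfam_bdd_inv[OF tAF s] .
    have Ta: "T (a j s) z = t (Suc j) s z / h s ^ Suc j" for j
    proof -
      have "a j s = (\<lambda>w. (1 / h s ^ Suc j) * t j s w)" by (auto simp: a_def)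
      then show ?thesis using T_scale[OF tBM z, of "1 / h s ^ Suc j" j] by (simp add: tS)
    qed
    have TP: "T (P n) z = (\<Sum>j<n. t (Suc j) s z / h s ^ Suc j)" for n
    proof (induction n)
      case 0
      have "T (P 0) z = T (\<lambda>w. 0 * (0::complex)) z" by (simp add: P_def[abs_def])
      also have "\<dots> = 0" using T_scale[OF bdd_inv_zero z, of 0] by simp
      finally show ?case by simp
    next
      case (Suc n)
      have "P (Suc n) = (\<lambda>w. P n w + a n s w)" by (auto simp: P_def)
      then show ?case using T_add[OF PBM aBM z] Suc Ta by simp
    qed
    have hP: "h s * P n z = (\<Sum>j<n. t j s z / h s ^ j)" for n
      unfolding P_def a_def sum_distrib_left using hn[OF s] by (intro sum.cong) auto
    \<comment> \<open>h times the j-th term equals the image under \<open>T\<close> of the term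
      before it, so only the first and the last contribution survive.\<close>
    have tel: "h s * P n z - T (P n) z = v s z - t n s z / h s ^ n" for n
      unfolding hP TP sum_subtractf[symmetric]
      using sum_lessThan_telescope'[of "\<lambda>j. t j s z / h s ^ j" n] by (simp add: t_def)
    have Plim: "(\<lambda>n. P n z) \<longlonglongrightarrow> W s z" unfolding P_def W_def using asum[OF s z] by (rule summable_LIMSEQ)
    have tail: "cmod (W s w - P n w) \<le> V / e * (1/2) ^ n" if w: "w \<in> \<H>" for n w
    proof -
      have "W s w - P n w = (\<Sum>j. a (j + n) s w)"
        unfolding W_def P_def using suminf_minus_initial_segment[OF asum[OF s w], of n] by simp
      moreover have sn: "summable (\<lambda>j. cmod (a (j + n) s w))"
        using ab[OF s V(2,1) w] by (intro summable_ignore_initial_segment summable_comparison_test'[OF sg[of V]]) auto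
      moreover have "cmod (\<Sum>j. a (j + n) s w) \<le> (\<Sum>j. cmod (a (j + n) s w))" by (rule summable_norm[OF sn])
      moreover have "(\<Sum>j. cmod (a (j + n) s w)) \<le> (\<Sum>j. V / (2 * e) * (1/2) ^ n * (1/2) ^ j)"
      proof (rule suminf_le[OF _ sn])
        show "cmod (a (j + n) s w) \<le> V / (2 * e) * (1/2) ^ n * (1/2) ^ j" for j
          using ab[OF s V(2,1) w, of "j + n"] by (simp add: power_add mult_ac)
        show "summable (\<lambda>j. V / (2 * e) * (1/2) ^ n * (1/2) ^ j)" by (intro summable_mult summable_geometric) auto
      qed
      moreover have "(\<Sum>j. V / (2 * e) * (1/2) ^ n * (1/2) ^ j) = V / e * (1/2) ^ n"
        by (subst suminf_mult) (auto simp: suminf_geometric summable_geometric)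
      ultimately show ?thesis by simp
    qed
    have zero: "(\<lambda>n. c * (1/2) ^ n) \<longlonglongrightarrow> 0" for c :: real
      by (intro tendsto_mult_right_zero LIMSEQ_power_zero) auto
    have TPlim: "(\<lambda>n. T (P n) z) \<longlonglongrightarrow> T (W s) z"
    \<comment> \<open>Only finite additivity of \<open>T\<close> is known; the limit is justified by
      applying \<open>T_bound\<close> to the uniformly small tail.\<close>
    proof (rule LIM_zero_cancel, rule Lim_null_comparison[OF _ zero[of V]])
      have "cmod (T (P n) z - T (W s) z) \<le> V * (1/2) ^ n" for n
      proof -
        have "P n = (\<lambda>w. W s w + (-1) * (W s w - P n w))" by auto
        moreover have d: "bdd_inv (\<lambda>w. W s w - P n w)" by (intro bdd_inv_diff WBM PBM)
        ultimately have "T (P n) z = T (W s) z + (-1) * T (\<lambda>w. W s w - P n w) z"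
          using T_add[OF WBM bdd_inv_scale[OF d] z, of "-1"] T_scale[OF d z, of "-1"] by simp
        then have "cmod (T (P n) z - T (W s) z) = cmod (T (\<lambda>w. W s w - P n w) z)" by simp
        also have "\<dots> \<le> e * (V / e * (1/2) ^ n)" using tail V e by (intro T_bound d z) auto
        also have "\<dots> = V * (1/2) ^ n" using e by simp
        finally show ?thesis .
      qed
      then show "\<forall>\<^sub>F n in sequentially. norm (T (P n) z - T (W s) z) \<le> V * (1/2) ^ n" by simp
    qed
    have tlim: "(\<lambda>n. t n s z / h s ^ n) \<longlonglongrightarrow> 0"
    proof (rule Lim_null_comparison[OF _ zero[of V]])
      have "cmod (t n s z / h s ^ n) \<le> V * (1/2) ^ n" for n
      proof -
        have "cmod (t n s z / h s ^ n) \<le> (e ^ n * V) / (2 * e) ^ n"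
          unfolding norm_divide norm_power using tb[OF s V(2,1) z, of n] h(2)[OF s] e V
          by (intro frac_le power_mono) auto
        also have "\<dots> = V * (1/2) ^ n" using e by (simp add: power_mult_distrib power_divide)
        finally show ?thesis .
      qed
      then show "\<forall>\<^sub>F n in sequentially. norm (t n s z / h s ^ n) \<le> V * (1/2) ^ n" by simp
    qed
    have "(\<lambda>n. h s * P n z - T (P n) z) \<longlonglongrightarrow> h s * W s z - T (W s) z"
      by (intro tendsto_intros Plim TPlim)
    moreover have "(\<lambda>n. h s * P n z - T (P n) z) \<longlonglongrightarrow> v s z - 0"
      unfolding tel by (intro tendsto_intros tlim)
    ultimately show ?thesis using LIMSEQ_unique by fastforce
  qed
  show ?thesis using that WAF eq by blast
qed

text \<open>Modulo the small operator \<open>T\<close> of \<open>neumann_series\<close>,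
  \<open>Lop\<close> has finite rank: on each cell it is replaced by its value at one point. A
  solution \<open>u\<close> is then determined by its N values \<open>Lop \<kappa> u (pt i)\<close>,
  which satisfy a holomorphic linear system. At \<open>s0\<close> the bound |h| > m on the operator
  makes that system injective, so that d does not vanish there.\<close>

theorem fredholm:
  assumes U: "open U" and k: "good_kernel \<kappa>" and h: "h holomorphic_on U"
    and eta: "\<eta> > 0" "\<And>s. s \<in> U \<Longrightarrow> cmod (h s) \<ge> \<eta>"
    and m: "m \<ge> 0" "\<And>v V z. (\<And>w. w \<in> \<H> \<Longrightarrow> cmod (v w) \<le> V) \<Longrightarrow> V \<ge> 0 \<Longrightarrow> z \<in> \<H> \<Longrightarrow> cmod (Lop \<kappa> v z) \<le> m * V"
    and s0: "s0 \<in> U" "cmod (h s0) > m" and v: "autfam U v"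
  obtains d y where "d holomorphic_on U" "d s0 \<noteq> 0" "autfam U y"
    "\<And>s u z. s \<in> U \<Longrightarrow> bdd_inv u \<Longrightarrow> (\<And>z. z \<in> \<H> \<Longrightarrow> h s * u z - Lop \<kappa> u z = v s z) \<Longrightarrow> z \<in> \<H> \<Longrightarrow> d s * u z = y s z"
proof -
  \<comment> \<open>Half of the lower bound for |h|, as \<open>neumann_series\<close>
    requires.\<close>
  define e where "e = \<eta> / 2"
  have e: "e > 0" using eta by (simp add: e_def)
  have h2: "cmod (h s) \<ge> 2 * e" if "s \<in> U" for s using eta(2)[OF that] by (simp add: e_def)
  have hn: "h s \<noteq> 0" if "s \<in> U" for s using h2[OF that] e by auto
  obtain N :: nat and pt idx where c: "\<And>i. i < N \<Longrightarrow> pt i \<in> \<H>" "\<And>z. z \<in> \<H> \<Longrightarrow> idx z < N"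
    "\<And>g z. g \<in> \<Gamma> \<Longrightarrow> z \<in> \<H> \<Longrightarrow> idx (psl2_act g z) = idx z"
    "idx \<in> hmeas \<rightarrow>\<^sub>M count_space UNIV"
    "\<And>v V z. bdd_inv v \<Longrightarrow> (\<And>w. w \<in> \<H> \<Longrightarrow> cmod (v w) \<le> V) \<Longrightarrow> V \<ge> 0 \<Longrightarrow> z \<in> \<H> \<Longrightarrow>
        cmod (Lop \<kappa> v z - Lop \<kappa> v (pt (idx z))) \<le> e * V"
    using kernel_cells[OF k e] by blast
  \<comment> \<open>The remainder after sampling at the centre of the cell; it has norm at most
    \<open>e\<close> although \<open>Lop\<close> itself need not be small.\<close>
  define T where "T v z = Lop \<kappa> v z - Lop \<kappa> v (pt (idx z))" for v z
  define ind where "ind i z = (if idx z = i then 1 else 0 :: complex)" for i z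
  have indm: "(\<lambda>z. F (idx z)) \<in> borel_measurable hmeas" for F :: "nat \<Rightarrow> complex"
    by (rule measurable_compose[OF c(4)]) simp
  have indBM: "bdd_inv (ind i)" for i
    unfolding bdd_inv_def ind_def using indm[of "\<lambda>j. if j = i then 1 else 0"] c(3)
    by (auto intro!: exI[of _ 1])
  have pick: "F (idx z) = (\<Sum>i<N. F i * ind i z)" if "z \<in> \<H>" for F z
    using c(2)[OF that] by (simp add: ind_def if_distrib[of "\<lambda>x. _ * x"] cong: if_cong)
  have T_autfam: "autfam U (\<lambda>s. T (u s))" if u: "autfam U u" for u
  proof -
    have L: "autfam U (\<lambda>s. Lop \<kappa> (u s))" by (rule Lop_autfam[OF U k u])
    have "autfam U (\<lambda>s z. \<Sum>i<N. Lop \<kappa> (u s) (pt i) * ind i z)"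
      using autfam_holomorphic[OF L c(1)] by (intro autfam_sum autfam_scale autfam_const indBM) auto
    then have "autfam U (\<lambda>s z. Lop \<kappa> (u s) z - (\<Sum>i<N. Lop \<kappa> (u s) (pt i) * ind i z))" by (rule autfam_diff[OF L])
    moreover have "T (u s) z = Lop \<kappa> (u s) z - (\<Sum>i<N. Lop \<kappa> (u s) (pt i) * ind i z)" if "z \<in> \<H>" for s z
      using pick[OF that, of "\<lambda>i. Lop \<kappa> (u s) (pt i)"] by (simp add: T_def)
    ultimately show ?thesis by (rule autfam_cong)
  qed
  have T_add: "T (\<lambda>w. u w + v w) z = T u z + T v z" if "bdd_inv u" "bdd_inv v" "z \<in> \<H>" for u v z
    unfolding T_def using that Lop_add[OF k that] Lop_add[OF k that(1,2) c(1)[OF c(2)[OF that(3)]]] by simp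
  have T_scale: "T (\<lambda>w. a * u w) z = a * T u z" for u a z
    unfolding T_def Lop_scale by (simp add: right_diff_distrib)
  have T_bound: "cmod (T v z) \<le> e * V" if "bdd_inv v" "\<And>w. w \<in> \<H> \<Longrightarrow> cmod (v w) \<le> V" "V \<ge> 0" "z \<in> \<H>" for v V z
    unfolding T_def using c(5)[OF that] .
  have T_sum: "T (\<lambda>w. \<Sum>i<n. a i * f i w) z = (\<Sum>i<n. a i * T (f i) z)" if "\<And>i. bdd_inv (f i)" "z \<in> \<H>" for n :: nat and a f z
    unfolding T_def using that c(1)[OF c(2)[OF that(2)]]
    by (simp add: Lop_sum[OF k] bdd_inv_scale Lop_scale sum_subtractf right_diff_distrib)
  have T_scale': "T (\<lambda>w. c * u w) z = c * T u z" if "bdd_inv u" "z \<in> \<H>" for u c z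
    by (rule T_scale)
  have neu: "\<exists>W. autfam U W \<and> (\<forall>s\<in>U. \<forall>z\<in>\<H>. h s * W s z - T (W s) z = f s z)" if f: "autfam U f" for f
    by (rule neumann_series[of U e h T f]) (fact U e h h2 T_autfam T_add T_scale' T_bound f | blast)+
  obtain W where W: "autfam U W" "\<And>s z. s \<in> U \<Longrightarrow> z \<in> \<H> \<Longrightarrow> h s * W s z - T (W s) z = v s z"
    using neu[OF v] by blast
  have "\<exists>W. autfam U W \<and> (\<forall>s\<in>U. \<forall>z\<in>\<H>. h s * W s z - T (W s) z = ind i z)" for i
    using neu[OF autfam_const[OF indBM]] .
  then obtain Y where Y: "\<And>i. autfam U (Y i)" "\<And>i s z. s \<in> U \<Longrightarrow> z \<in> \<H> \<Longrightarrow> h s * Y i s z - T (Y i s) z = ind i z"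
    by metis
  have YBM: "bdd_inv (Y i s)" if "s \<in> U" for i s using autfam_bdd_inv[OF Y(1) that] .
  have Yeq: "h s * (\<Sum>i<N. x i * Y i s z) - T (\<lambda>w. \<Sum>i<N. x i * Y i s w) z = x (idx z)"
    if s: "s \<in> U" and z: "z \<in> \<H>" for s z x
  proof -
    have "h s * (\<Sum>i<N. x i * Y i s z) - T (\<lambda>w. \<Sum>i<N. x i * Y i s w) z = (\<Sum>i<N. x i * (h s * Y i s z - T (Y i s) z))"
      unfolding T_sum[of "\<lambda>i. Y i s", OF YBM[OF s] z]
      by (simp add: sum_distrib_left sum_subtractf right_diff_distrib mult.left_commute)
    then show ?thesis using Y(2)[OF s z] pick[OF z, of x] by simp
  qed
  \<comment> \<open>The condition that x j be the sampled value of \<open>Lop\<close> on W + \<Sum>i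
    x i * Y i, written as a linear system.\<close>
  define a where "a j i s = (if i = j then 1 else 0) - Lop \<kappa> (Y i s) (pt j)" for j i s
  define b where "b j s = Lop \<kappa> (W s) (pt j)" for j s
  have asum: "(\<Sum>i<N. a j i s * x i) = x j - Lop \<kappa> (\<lambda>w. \<Sum>i<N. x i * Y i s w) (pt j)" if "j < N" "s \<in> U" for j s x
  proof -
    have "Lop \<kappa> (\<lambda>w. \<Sum>i<N. x i * Y i s w) (pt j) = (\<Sum>i<N. x i * Lop \<kappa> (Y i s) (pt j))"
      using c(1)[OF that(1)] YBM[OF that(2)] by (simp add: Lop_sum[OF k] bdd_inv_scale Lop_scale)
    moreover have "(\<Sum>i<N. a j i s * x i) = (\<Sum>i<N. if i = j then x i else 0) - (\<Sum>i<N. x i * Lop \<kappa> (Y i s) (pt j))"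
      unfolding sum_subtractf[symmetric] by (intro sum.cong) (auto simp: a_def algebra_simps)
    moreover have "(\<Sum>i<N. if i = j then x i else 0) = x j" using that(1) by simp
    ultimately show ?thesis by simp
  qed
  \<comment> \<open>A null vector produces a bounded q with h q = L q at \<open>s0\<close>. As |h|
    exceeds the norm bound m, q vanishes, and the components of the vector are sampled values of L
    q.\<close>
  have inj: "\<forall>i\<in>{..<N}. x i = 0" if x: "\<And>j. j \<in> {..<N} \<Longrightarrow> (\<Sum>i<N. a j i s0 * x i) = 0" for x
  proof -
    define q where "q w = (\<Sum>i<N. x i * Y i s0 w)" for w
    have qBM: "bdd_inv q" unfolding q_def using YBM[OF s0(1)] by (intro bdd_inv_sum bdd_inv_scale) auto
    have xq: "x j = Lop \<kappa> q (pt j)" if "j < N" for j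
      using x[of j] asum[OF that s0(1), of x] that by (simp add: q_def[abs_def])
    have hq: "h s0 * q z = Lop \<kappa> q z" if z: "z \<in> \<H>" for z
    proof -
      have "h s0 * q z - T q z = x (idx z)" using Yeq[OF s0(1) z, of x] by (simp add: q_def[abs_def])
      then show ?thesis using xq[OF c(2)[OF z]] by (simp add: T_def)
    qed
    obtain V where V: "\<And>z. z \<in> \<H> \<Longrightarrow> cmod (q z) \<le> V" using bdd_inv_bound[OF qBM] by blast
    have hp: "cmod (h s0) > 0" using s0(2) m(1) by linarith
    have q0: "q z = 0" if z: "z \<in> \<H>" for z
    proof (rule contraction_zero[of q V "m / cmod (h s0)", OF V _ _ _ z])
      show "0 \<le> m / cmod (h s0)" "m / cmod (h s0) < 1" using m(1) s0(2) hp by auto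
      fix V z assume V: "V \<ge> 0" "\<And>z. z \<in> \<H> \<Longrightarrow> cmod (q z) \<le> V" and z: "z \<in> \<H>"
      have "cmod (h s0) * cmod (q z) \<le> m * V" using m(2)[of q V z] V z hq[OF z] by (simp flip: norm_mult)
      then show "cmod (q z) \<le> m / cmod (h s0) * V" using hp by (simp add: field_simps)
    qed
    have "Lop \<kappa> q z = 0" for z using Lop_cong[of q "\<lambda>_. 0" \<kappa> z] q0 Lop_zero by simp
    then show ?thesis using xq by simp
  qed
  obtain d y where dy: "d holomorphic_on U" "d s0 \<noteq> 0" "\<And>i. i < N \<Longrightarrow> y i holomorphic_on U"
    "\<And>s x i. s \<in> U \<Longrightarrow> (\<And>j. j < N \<Longrightarrow> (\<Sum>i<N. a j i s * x i) = b j s) \<Longrightarrow> i < N \<Longrightarrow> d s * x i = y i s"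
  proof -
    have "\<exists>d y. d holomorphic_on U \<and> d s0 \<noteq> 0 \<and> (\<forall>j\<in>{..<N}. y j holomorphic_on U) \<and>
      (\<forall>s\<in>U. \<forall>x. (\<forall>i\<in>{..<N}. (\<Sum>j<N. a i j s * x j) = b i s) \<longrightarrow> (\<forall>j\<in>{..<N}. d s * x j = y j s))"
    proof (rule linear_system_holomorphic[OF _ _ _ inj])
      show "a j i holomorphic_on U" if "j \<in> {..<N}" for j i
        unfolding a_def using autfam_holomorphic[OF Lop_autfam[OF U k Y(1)] c(1)] that
        by (intro holomorphic_on_diff holomorphic_on_const) auto
      show "b j holomorphic_on U" if "j \<in> {..<N}" for j
        unfolding b_def using autfam_holomorphic[OF Lop_autfam[OF U k W(1)] c(1)] that by auto
    qed auto
    then obtain d y where D: "d holomorphic_on U" "d s0 \<noteq> 0" "\<forall>j\<in>{..<N}. y j holomorphic_on U"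
      "\<forall>s\<in>U. \<forall>x. (\<forall>i\<in>{..<N}. (\<Sum>j<N. a i j s * x j) = b i s) \<longrightarrow> (\<forall>j\<in>{..<N}. d s * x j = y j s)"
      by blast
    show ?thesis by (rule that[of d y]) (use D in auto)
  qed
  \<comment> \<open>d times the representation u = W + \<Sum>i x i * Y i, after replacing d x i by
    its holomorphic value.\<close>
  define R where "R s z = d s * W s z + (\<Sum>i<N. y i s * Y i s z)" for s z
  have "autfam U R"
    unfolding R_def using dy W Y by (intro autfam_add autfam_scale autfam_sum) auto
  moreover have "d s * u z = R s z"
    if s: "s \<in> U" and u: "bdd_inv u" and eq: "\<And>z. z \<in> \<H> \<Longrightarrow> h s * u z - Lop \<kappa> u z = v s z" and z: "z \<in> \<H>" for s u z
  proof -
    define x where "x i = Lop \<kappa> u (pt i)" for i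
    \<comment> \<open>The candidate assembled from the sampled values of \<open>u\<close>. It
      satisfies the same equation as \<open>u\<close> for h - T, and h - T is injective on bounded
      functions for every s in U.\<close>
    define p where "p w = W s w + (\<Sum>i<N. x i * Y i s w)" for w
    have WBM: "bdd_inv (W s)" using autfam_bdd_inv[OF W(1) s] .
    have SBM: "bdd_inv (\<lambda>w. \<Sum>i<N. x i * Y i s w)" using YBM[OF s] by (intro bdd_inv_sum bdd_inv_scale) auto
    have pBM: "bdd_inv p" unfolding p_def by (rule bdd_inv_add[OF WBM SBM])
    have pe: "h s * p w - T p w = v s w + x (idx w)" if w: "w \<in> \<H>" for w
      unfolding p_def using T_add[OF WBM SBM w] Yeq[OF s w, of x] W(2)[OF s w] by (simp add: algebra_simps)
    have ue: "h s * u w - T u w = v s w + x (idx w)" if w: "w \<in> \<H>" for w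
      using eq[OF w] by (simp add: T_def x_def algebra_simps)
    define q where "q w = u w - p w" for w
    have qBM: "bdd_inv q" unfolding q_def by (rule bdd_inv_diff[OF u pBM])
    have hq: "h s * q w = T q w" if w: "w \<in> \<H>" for w
    proof -
      have "q = (\<lambda>w. u w + (-1) * p w)" by (auto simp: q_def)
      then have "T q w = T u w - T p w" using T_add[OF u bdd_inv_scale[OF pBM] w, of "-1"] T_scale[of "-1" p w] by simp
      then show ?thesis using pe[OF w] ue[OF w] by (simp add: q_def algebra_simps)
    qed
    obtain V where V: "\<And>z. z \<in> \<H> \<Longrightarrow> cmod (q z) \<le> V" using bdd_inv_bound[OF qBM] by blast
    have q0: "q w = 0" if w: "w \<in> \<H>" for w
    proof (rule contraction_zero[of q V "1/2", OF V _ _ _ w])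
      fix V z assume V: "V \<ge> 0" "\<And>z. z \<in> \<H> \<Longrightarrow> cmod (q z) \<le> V" and z: "z \<in> \<H>"
      have "2 * e * cmod (q z) \<le> cmod (h s) * cmod (q z)" using h2[OF s] by (intro mult_right_mono) auto
      also have "\<dots> \<le> e * V" using T_bound[OF qBM V(2,1) z] hq[OF z] by (simp flip: norm_mult)
      finally show "cmod (q z) \<le> 1/2 * V" using e by (simp add: field_simps)
    qed auto
    have up: "u w = p w" if "w \<in> \<H>" for w using q0[OF that] by (simp add: q_def)
    have "(\<Sum>i<N. a j i s * x i) = b j s" if j: "j < N" for j
    proof -
      have "x j = Lop \<kappa> p (pt j)" unfolding x_def by (rule Lop_cong[OF up])
      also have "\<dots> = b j s + Lop \<kappa> (\<lambda>w. \<Sum>i<N. x i * Y i s w) (pt j)"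
        unfolding p_def b_def by (rule Lop_add[OF k WBM SBM c(1)[OF j]])
      finally show ?thesis using asum[OF j s, of x] by simp
    qed
    then have dx: "d s * x i = y i s" if "i < N" for i using dy(4)[OF s _ that] by blast
    have "d s * u z = d s * W s z + (\<Sum>i<N. (d s * x i) * Y i s z)"
      unfolding up[OF z] p_def by (simp add: distrib_left sum_distrib_left mult.assoc)
    also have "\<dots> = R s z" unfolding R_def using dx by simp
    finally show ?thesis .
  qed
  ultimately show ?thesis using that dy(1,2) by blast
qed

end

section \<open>Expansion of the averaged powers\<close>

lemma cpow_exp: "x > 0 \<Longrightarrow> complex_of_real x powr s = exp (s * of_real (ln x))"
  by (simp add: powr_def Ln_of_real)

lemma norm_cpow: "x > 0 \<Longrightarrow> cmod (complex_of_real x powr s) = x powr Re s"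
  by (simp add: cpow_exp powr_def)

lemma cpow_mult: "x > 0 \<Longrightarrow> y > 0 \<Longrightarrow>
    complex_of_real (x * y) powr s = complex_of_real x powr s * complex_of_real y powr s"
  by (simp add: cpow_exp ln_mult distrib_left exp_add del: of_real_mult)

lemma cpow_add: "x > 0 \<Longrightarrow> complex_of_real x powr (s + t) = complex_of_real x powr s * complex_of_real x powr t"
  by (simp add: cpow_exp distrib_right exp_add)

lemma cpow_nat: "x > 0 \<Longrightarrow> complex_of_real x powr (of_nat n) = of_real (x ^ n)"
  by (simp add: cpow_exp exp_of_nat_mult exp_of_real)

lemma cpow_div_sqrt:
  assumes "x > 0" "q > 0"
  shows "complex_of_real (x / sqrt q) powr s = complex_of_real x powr s * complex_of_real q powr (- s / 2)"
proof -
  have l: "ln (x / sqrt q) = ln x - ln q / 2" using assms by (simp add: ln_div ln_sqrt)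
  have "complex_of_real (x / sqrt q) powr s = exp (s * of_real (ln x - ln q / 2))"
    using cpow_exp[of "x / sqrt q" s] assms unfolding l by simp
  also have "\<dots> = exp (s * of_real (ln x) + (- s / 2) * of_real (ln q))" by (simp add: algebra_simps)
  finally show ?thesis unfolding exp_add cpow_exp[OF assms(1)] cpow_exp[OF assms(2)] .
qed

lemma holomorphic_cpow: "x > 0 \<Longrightarrow> f holomorphic_on U \<Longrightarrow> (\<lambda>s. complex_of_real x powr (f s)) holomorphic_on U"
  by (simp add: cpow_exp) (intro holomorphic_intros)

lemma powr_bound:
  fixes x \<sigma> L M :: real
  assumes "x > 0" "\<bar>ln x\<bar> \<le> L" "\<bar>\<sigma>\<bar> \<le> M"
  shows "x powr \<sigma> \<le> exp (M * L)"
proof -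
  have "\<sigma> * ln x \<le> \<bar>\<sigma>\<bar> * \<bar>ln x\<bar>" using abs_ge_self[of "\<sigma> * ln x"] by (simp add: abs_mult)
  also have "\<dots> \<le> M * L" using assms by (intro mult_mono) auto
  finally show ?thesis using assms(1) by (simp add: powr_def)
qed

text \<open>The binomial coefficient of -s/2 over k, a polynomial in s.\<close>

definition taylor_coeff :: "nat \<Rightarrow> complex \<Rightarrow> complex" where
  "taylor_coeff k s = (\<Prod>j<k. (- s / 2 - of_nat j)) / fact k"

lemma holomorphic_taylor_coeff: "taylor_coeff k holomorphic_on U"
  unfolding taylor_coeff_def by (intro holomorphic_intros) auto

lemma taylor_coeff_0 [simp]: "taylor_coeff 0 s = 1"
  by (simp add: taylor_coeff_def)

text \<open>The constant must be uniform for s in a compact set, since it later bounds a holomorphic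
  family; compactness bounds both the falling factorials and the powers of x.\<close>

lemma taylor_power:
  assumes K: "compact K" and ab: "0 < \<alpha>" "\<alpha> \<le> 1" "1 \<le> \<beta>"
  obtains C where "C \<ge> 0" "\<And>s x. s \<in> K \<Longrightarrow> \<alpha> \<le> x \<Longrightarrow> x \<le> \<beta> \<Longrightarrow>
    cmod (complex_of_real x powr (- s / 2) - (\<Sum>k\<le>n. taylor_coeff k s * of_real (x - 1) ^ k)) \<le> C * \<bar>x - 1\<bar> ^ Suc n"
proof -
  let ?S = "complex_of_real ` {\<alpha>..\<beta>}"
  have conv: "convex ?S" by (intro convex_linear_image linear_of_real) auto
  \<comment> \<open>The i-th derivative of w powr (- s / 2).\<close>
  define f where "f i s w = (\<Prod>j<i. (- s / 2 - of_nat j)) * w powr (- s / 2 - of_nat i)" for i :: nat and s w :: complex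
  have der: "(f i s has_field_derivative f (Suc i) s w) (at w within ?S)" if "w \<in> ?S" for i s w
  proof -
    have w: "w \<notin> \<real>\<^sub>\<le>\<^sub>0" using that ab by (auto simp: complex_nonpos_Reals_iff)
    have "((\<lambda>w. w powr (- s / 2 - of_nat i)) has_field_derivative (- s / 2 - of_nat i) * w powr (- s / 2 - of_nat i - 1)) (at w within ?S)"
      by (rule has_field_derivative_at_within[OF has_field_derivative_powr[OF w]])
    from DERIV_cmult[OF this, of "\<Prod>j<i. (- s / 2 - of_nat j)"] show ?thesis
      unfolding f_def by (simp add: mult.assoc algebra_simps)
  qed
  have "compact ((\<lambda>s. cmod s) ` K)" using K by (intro compact_continuous_image continuous_intros)
  then have "bounded ((\<lambda>s. cmod s) ` K)" by (rule compact_imp_bounded)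
  then obtain M where M: "M > 0" "\<And>s. s \<in> K \<Longrightarrow> cmod s \<le> M" unfolding bounded_pos by auto
  define L where "L = max \<bar>ln \<alpha>\<bar> \<bar>ln \<beta>\<bar>"
  define B where "B = (M + n + 1) ^ Suc n * exp ((M + Suc n) * L)"
  have B: "B \<ge> 0" using M by (simp add: B_def)
  have bound: "cmod (f (Suc n) s w) \<le> B" if s: "s \<in> K" and w: "w \<in> ?S" for s w
  proof -
    obtain x where x: "w = of_real x" "\<alpha> \<le> x" "x \<le> \<beta>" using w by auto
    have x0: "x > 0" using x ab by linarith
    have "ln \<alpha> \<le> ln x" "ln x \<le> ln \<beta>" using x x0 ab by auto
    then have lx: "\<bar>ln x\<bar> \<le> L" by (auto simp: L_def)
    have "cmod (\<Prod>j<Suc n. (- s / 2 - of_nat j)) \<le> (\<Prod>j<Suc n. M + n + 1)"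
      unfolding prod_norm[symmetric]
    proof (rule prod_mono)
      fix j assume "j \<in> {..<Suc n}"
      then have j: "real j \<le> n" by auto
      have "cmod (- s / 2 - of_nat j) \<le> cmod (- s / 2) + cmod (of_nat j)" by (rule norm_triangle_ineq4)
      also have "\<dots> = cmod s / 2 + real j" by (simp add: norm_divide)
      also have "\<dots> \<le> M + n + 1" using M(1) M(2)[OF s] j by linarith
      finally show "0 \<le> cmod (- s / 2 - of_nat j) \<and> cmod (- s / 2 - of_nat j) \<le> M + n + 1" by simp
    qed
    then have 1: "cmod (\<Prod>j<Suc n. (- s / 2 - of_nat j)) \<le> (M + n + 1) ^ Suc n" by simp
    have "\<bar>Re (- s / 2 - of_nat (Suc n))\<bar> \<le> M + Suc n"
      using abs_Re_le_cmod[of s] M(2)[OF s] M(1) by simp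
    then have 2: "cmod (w powr (- s / 2 - of_nat (Suc n))) \<le> exp ((M + Suc n) * L)"
      unfolding x(1) norm_cpow[OF x0] by (intro powr_bound x0 lx)
    show ?thesis unfolding f_def B_def norm_mult using 1 2 M by (intro mult_mono) auto
  qed
  show ?thesis
  proof (rule that[of "B / fact n"])
    show "B / fact n \<ge> 0" using B by simp
    fix s x assume s: "s \<in> K" and x: "\<alpha> \<le> x" "x \<le> \<beta>"
    have "cmod (f 0 s (of_real x) - (\<Sum>i\<le>n. f i s 1 * (of_real x - 1) ^ i / fact i)) \<le> B * cmod (of_real x - 1) ^ Suc n / fact n"
    proof (rule complex_Taylor[OF conv])
      show "1 \<in> ?S" using ab by (intro image_eqI[of _ _ 1]) auto
    qed (use der bound s x in auto)
    moreover have "f i s 1 * (of_real x - 1) ^ i / fact i = taylor_coeff i s * of_real (x - 1) ^ i" for i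
      by (simp add: f_def taylor_coeff_def)
    moreover have "cmod (of_real x - 1) = \<bar>x - 1\<bar>" by (metis norm_of_real of_real_1 of_real_diff)
    moreover have "f 0 s (of_real x) = of_real x powr (- s / 2)" by (simp add: f_def)
    ultimately show "cmod (complex_of_real x powr (- s / 2) - (\<Sum>k\<le>n. taylor_coeff k s * of_real (x - 1) ^ k)) \<le> B / fact n * \<bar>x - 1\<bar> ^ Suc n"
      by simp
  qed
qed

text \<open>Only values on the circle t^2 + c^2 = 1 count, so that c^2 may be traded for 1 - t^2.
  What remains is a polynomial in t^2 with entire coefficients, and t will be \<open>ht z\<close>:
  this is why the exponent is shifted by even integers only.\<close>

definition evenpoly :: "(complex \<Rightarrow> real \<Rightarrow> real \<Rightarrow> complex) \<Rightarrow> bool" where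
  "evenpoly F \<longleftrightarrow> (\<exists>n a. (\<forall>j. a j holomorphic_on UNIV) \<and>
     (\<forall>s t c. t^2 + c^2 = 1 \<longrightarrow> F s t c = (\<Sum>j<n. a j s * of_real t ^ (2 * j))))"

lemma evenpoly_cong: "evenpoly F \<Longrightarrow> (\<And>s t c. t^2 + c^2 = 1 \<Longrightarrow> G s t c = F s t c) \<Longrightarrow> evenpoly G"
  unfolding evenpoly_def by metis

lemma evenpoly_holomorphic: "g holomorphic_on UNIV \<Longrightarrow> evenpoly (\<lambda>s t c. g s)"
  unfolding evenpoly_def by (intro exI[of _ "Suc 0"] exI[of _ "\<lambda>_. g"]) auto

lemma evenpoly_add:
  assumes "evenpoly F" "evenpoly G"
  shows "evenpoly (\<lambda>s t c. F s t c + G s t c)"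
proof -
  obtain n a where a: "\<And>j. a j holomorphic_on UNIV" "\<And>s t c. t^2 + c^2 = 1 \<Longrightarrow> F s t c = (\<Sum>j<n. a j s * of_real t ^ (2 * j))"
    using assms(1) unfolding evenpoly_def by blast
  obtain m b where b: "\<And>j. b j holomorphic_on UNIV" "\<And>s t c. t^2 + c^2 = 1 \<Longrightarrow> G s t c = (\<Sum>j<m. b j s * of_real t ^ (2 * j))"
    using assms(2) unfolding evenpoly_def by blast
  define e where "e j s = (if j < n then a j s else 0) + (if j < m then b j s else 0)" for j s
  have "e j holomorphic_on UNIV" for j
    unfolding e_def using a(1)[of j] b(1)[of j] by (cases "j < n"; cases "j < m") (auto intro!: holomorphic_intros)
  moreover have "F s t c + G s t c = (\<Sum>j<max n m. e j s * of_real t ^ (2 * j))" if "t^2 + c^2 = 1" for s t c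
  proof -
    have "(\<Sum>j<max n m. (if j < n then a j s else 0) * of_real t ^ (2 * j)) = (\<Sum>j<n. a j s * complex_of_real t ^ (2 * j))"
      by (rule sum.mono_neutral_cong_right) auto
    moreover have "(\<Sum>j<max n m. (if j < m then b j s else 0) * of_real t ^ (2 * j)) = (\<Sum>j<m. b j s * complex_of_real t ^ (2 * j))"
      by (rule sum.mono_neutral_cong_right) auto
    ultimately show ?thesis unfolding e_def distrib_right sum.distrib a(2)[OF that] b(2)[OF that] by simp
  qed
  ultimately show ?thesis unfolding evenpoly_def by blast
qed

lemma evenpoly_scale:
  assumes "evenpoly F" "g holomorphic_on UNIV"
  shows "evenpoly (\<lambda>s t c. g s * F s t c)"
proof -
  obtain n a where a: "\<And>j. a j holomorphic_on UNIV" "\<And>s t c. t^2 + c^2 = 1 \<Longrightarrow> F s t c = (\<Sum>j<n. a j s * of_real t ^ (2 * j))"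
    using assms(1) unfolding evenpoly_def by blast
  have "(\<lambda>s. g s * a j s) holomorphic_on UNIV" for j using a(1) assms(2) by (intro holomorphic_intros) auto
  moreover have "g s * F s t c = (\<Sum>j<n. (g s * a j s) * of_real t ^ (2 * j))" if "t^2 + c^2 = 1" for s t c
    unfolding a(2)[OF that] by (simp add: sum_distrib_left mult.assoc)
  ultimately show ?thesis unfolding evenpoly_def by (intro exI[of _ n] exI[of _ "\<lambda>j s. g s * a j s"]) blast
qed

lemma evenpoly_t2:
  assumes "evenpoly F"
  shows "evenpoly (\<lambda>s t c. of_real (t^2) * F s t c)"
proof -
  obtain n a where a: "\<And>j. a j holomorphic_on UNIV" "\<And>s t c. t^2 + c^2 = 1 \<Longrightarrow> F s t c = (\<Sum>j<n. a j s * of_real t ^ (2 * j))"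
    using assms(1) unfolding evenpoly_def by blast
  define e where "e j s = (case j of 0 \<Rightarrow> 0 | Suc i \<Rightarrow> a i s)" for j s
  have "e j holomorphic_on UNIV" for j unfolding e_def using a(1) by (cases j) auto
  moreover have "of_real (t^2) * F s t c = (\<Sum>j<Suc n. e j s * of_real t ^ (2 * j))" if "t^2 + c^2 = 1" for s t c
    unfolding a(2)[OF that] sum.lessThan_Suc_shift
    by (simp add: e_def sum_distrib_left power_add power2_eq_square mult_ac)
  ultimately show ?thesis unfolding evenpoly_def by blast
qed

lemma evenpoly_c2:
  assumes "evenpoly F"
  shows "evenpoly (\<lambda>s t c. of_real (c^2) * F s t c)"
proof (rule evenpoly_cong[OF evenpoly_add[OF assms evenpoly_scale[OF evenpoly_t2[OF assms], of "\<lambda>_. -1"]]])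
  fix s :: complex and t c :: real assume "t^2 + c^2 = 1"
  then have "c^2 = 1 - t^2" by simp
  then show "of_real (c^2) * F s t c = F s t c + -1 * (of_real (t^2) * F s t c)"
    by (simp add: left_diff_distrib)
qed auto

lemma evenpoly_t2_pow: "evenpoly F \<Longrightarrow> evenpoly (\<lambda>s t c. of_real (t^2) ^ m * F s t c)"
proof (induction m)
  case (Suc m)
  then show ?case using evenpoly_t2[of "\<lambda>s t c. of_real (t^2) ^ m * F s t c"] by (simp add: mult.assoc)
qed simp

lemma evenpoly_c2_pow: "evenpoly F \<Longrightarrow> evenpoly (\<lambda>s t c. of_real (c^2) ^ m * F s t c)"
proof (induction m)
  case (Suc m)
  then show ?case using evenpoly_c2[of "\<lambda>s t c. of_real (c^2) ^ m * F s t c"] by (simp add: mult.assoc)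
qed simp

lemma evenpoly_sum: "finite I \<Longrightarrow> (\<And>i. i \<in> I \<Longrightarrow> evenpoly (F i)) \<Longrightarrow> evenpoly (\<lambda>s t c. \<Sum>i\<in>I. F i s t c)"
proof (induction I rule: finite_induct)
  case empty
  then show ?case using evenpoly_holomorphic[of "\<lambda>_. 0"] by simp
next
  case (insert i I)
  then show ?case using evenpoly_add[of "F i"] by simp
qed

text \<open>Here \<open>t\<close> and \<open>c\<close> are the sine and cosine of the argument of \<open>z\<close>; then \<open>ht\<close> at the image of \<open>w\<close> under
  \<open>aff z\<close> is \<open>t * Im w / sqrt (1 + ht_dev t c w)\<close>.\<close>

definition ht_dev :: "real \<Rightarrow> real \<Rightarrow> complex \<Rightarrow> real" where
  "ht_dev t c w = ((cmod w)^2 - 1) * t^2 + 2 * Re w * (t * c)"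

text \<open>The tent kernel with its centre moved to \<i>, where all averages are computed.\<close>

definition disc_weight :: "real \<Rightarrow> complex \<Rightarrow> real" where
  "disc_weight r w = max 0 (r - hyp \<i> w)"

lemma disc_weight_bound:
  assumes "w \<in> \<H>"
  shows "0 \<le> disc_weight r w" "r \<le> 1 \<Longrightarrow> disc_weight r w \<le> indicator (hball \<i> 1) w"
proof -
  show "0 \<le> disc_weight r w" by (simp add: disc_weight_def)
  show "disc_weight r w \<le> indicator (hball \<i> 1) w" if "r \<le> 1"
    using hyp_nonneg[OF i_in_H assms] that assms by (auto simp: disc_weight_def hball_def indicator_def)
qed

lemma disc_weight_measurable: "disc_weight r \<in> borel_measurable hmeas"
  unfolding disc_weight_def using hyp_measurable[OF i_in_H] by (intro borel_measurable_max borel_measurable_diff) auto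

lemma hball_1_bounds:
  assumes "w \<in> hball \<i> 1"
  shows "w \<in> \<H>" "1/3 \<le> Im w" "Im w \<le> 3" "cmod w \<le> 3" "\<bar>ln (Im w)\<bar> \<le> 3"
proof -
  have w: "w \<in> \<H>" "hyp \<i> w \<le> 1" using assms by (auto simp: hball_def)
  have h: "hyp \<i> w \<ge> 0" using hyp_nonneg[OF i_in_H w(1)] .
  show "w \<in> \<H>" by fact
  have p: "Im w > 0" using w by (simp add: H_iff)
  have "1 \<le> (hyp \<i> w + 2) * Im w" using Im_ratio[OF i_in_H w(1)] by simp
  also have "\<dots> \<le> 3 * Im w" using w p by (intro mult_right_mono) auto
  finally show 1: "1/3 \<le> Im w" by simp
  have "Im w \<le> (hyp \<i> w + 2) * 1" using Im_ratio[OF w(1) i_in_H] by (simp add: hyp_sym)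
  then show 2: "Im w \<le> 3" using w by simp
  have "(cmod (w - \<i>))^2 = hyp \<i> w * Im w" using hyp_eq[OF w(1) i_in_H] by (simp add: hyp_sym)
  also have "\<dots> \<le> 1 * 3" using w h p 2 by (intro mult_mono) auto
  also have "\<dots> \<le> 2^2" by simp
  finally have "cmod (w - \<i>) \<le> 2" by (rule power2_le_imp_le) simp
  then show "cmod w \<le> 3" using norm_triangle_ineq[of "w - \<i>" \<i>] by simp
  have "ln (Im w) \<le> Im w - 1" using p by (rule ln_le_minus_one)
  moreover have "- ln (Im w) \<le> 1 / Im w - 1" using ln_le_minus_one[of "1 / Im w"] p by (simp add: ln_div)
  moreover have "1 / Im w \<le> 3" using 1 p by (simp add: field_simps)
  ultimately show "\<bar>ln (Im w)\<bar> \<le> 3" using 2 by (auto simp: abs_le_iff)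
qed

lemma disc_weight_integrable:
  assumes r: "r \<le> 1" and f: "f \<in> borel_measurable hmeas" and b: "\<And>w. w \<in> hball \<i> 1 \<Longrightarrow> cmod (f w) \<le> B"
  shows "integrable hmeas (\<lambda>w. of_real (disc_weight r w) * f w)" "cmod (\<integral>w. of_real (disc_weight r w) * f w \<partial>hmeas) \<le> \<bar>B\<bar> * vol 1"
proof -
  have le: "cmod (of_real (disc_weight r w) * f w) \<le> \<bar>B\<bar> * indicator (hball \<i> 1) w" if w: "w \<in> \<H>" for w
  proof (cases "w \<in> hball \<i> 1")
    case True
    have "cmod (of_real (disc_weight r w) * f w) \<le> 1 * \<bar>B\<bar>"
      unfolding norm_mult norm_of_real using disc_weight_bound[OF w] r b[OF True] True
      by (intro mult_mono) (auto intro: order_trans[OF _ abs_ge_self])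
    then show ?thesis using True by simp
  next
    case False
    then have "disc_weight r w = 0" using disc_weight_bound[OF w, of r] r by (simp add: indicator_def)
    then show ?thesis using False by simp
  qed
  show "integrable hmeas (\<lambda>w. of_real (disc_weight r w) * f w)"
  proof (rule Bochner_Integration.integrable_bound[OF integrable_hball[OF i_in_H, of "\<bar>B\<bar>" 1]])
    show "(\<lambda>w. of_real (disc_weight r w) * f w) \<in> borel_measurable hmeas"
      using f disc_weight_measurable by (intro borel_measurable_times borel_measurable_of_real) auto
    show "AE w in hmeas. cmod (of_real (disc_weight r w) * f w) \<le> norm (\<bar>B\<bar> * indicator (hball \<i> 1) w)"
      using le by (intro AE_I2) (simp only: space_hmeas real_norm_def abs_mult abs_abs abs_of_nonneg[OF indicator_pos_le])
  qed
  show "cmod (\<integral>w. of_real (disc_weight r w) * f w \<partial>hmeas) \<le> \<bar>B\<bar> * vol 1"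
    by (rule order_trans[OF integral_norm_le[OF integrable_hball[OF i_in_H, of "\<bar>B\<bar>" 1]]])
       (use le integral_hball[OF i_in_H, of "\<bar>B\<bar>" 1] in auto)
qed

lemma disc_weight_reflect: "w \<in> \<H> \<Longrightarrow> disc_weight r (- cnj w) = disc_weight r w"
proof -
  have "cmod (\<i> - (- cnj w)) = cmod (\<i> - w)"
    by (simp add: cmod_def)
  then show ?thesis by (simp add: disc_weight_def hyp_def)
qed

text \<open>For i = j = 0 this is the eigenvalue of the averaging operator on Im(w)^s, the leading
  coefficient of the expansion. The other moments arise from expanding powers of
  \<open>ht_dev\<close>.\<close>

definition moment :: "real \<Rightarrow> nat \<Rightarrow> nat \<Rightarrow> complex \<Rightarrow> complex" where
  "moment r i j s = (\<integral>w. of_real (disc_weight r w) * (of_real (Im w) powr s * of_real (((cmod w)^2 - 1) ^ i * (2 * Re w) ^ j)) \<partial>hmeas)"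

lemma cpow_measurable:
  assumes "continuous_on \<H> f" "\<And>w. w \<in> \<H> \<Longrightarrow> f w > 0"
  shows "(\<lambda>w. complex_of_real (f w) powr s) \<in> borel_measurable hmeas"
proof (rule borel_measurable_hmeasI)
  have "continuous_on \<H> (\<lambda>w. exp (s * of_real (ln (f w))))"
    using assms by (intro continuous_intros) (auto simp: less_imp_neq[symmetric])
  then show "continuous_on \<H> (\<lambda>w. complex_of_real (f w) powr s)"
    using assms(2) by (subst continuous_on_cong[OF refl cpow_exp]) auto
qed

lemma Im_cpow_measurable: "(\<lambda>w. complex_of_real (Im w) powr s) \<in> borel_measurable hmeas"
  by (rule cpow_measurable) (auto simp: H_iff intro: continuous_intros)

lemma moment_bound:
  assumes w: "w \<in> hball \<i> 1" and s: "\<bar>Re s\<bar> \<le> M"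
  shows "cmod (of_real (Im w) powr s * of_real (((cmod w)^2 - 1) ^ i * (2 * Re w) ^ j)) \<le> exp (M * 3) * (10 ^ i * 6 ^ j)"
proof -
  note b = hball_1_bounds[OF w]
  have p: "Im w > 0" using b by linarith
  have 1: "cmod (of_real (Im w) powr s) \<le> exp (M * 3)"
    unfolding norm_cpow[OF p] by (rule powr_bound[OF p b(5) s])
  have "(cmod w)^2 \<le> 9" using power_mono[OF b(4), of 2] by simp
  then have "\<bar>(cmod w)^2 - 1\<bar> \<le> 10" using zero_le_power2[of "cmod w"] unfolding abs_le_iff by linarith
  then have 2: "\<bar>(cmod w)^2 - 1\<bar> ^ i \<le> 10 ^ i" by (intro power_mono) auto
  have "\<bar>2 * Re w\<bar> \<le> 6" using abs_Re_le_cmod[of w] b(4) by simp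
  then have 3: "\<bar>2 * Re w\<bar> ^ j \<le> 6 ^ j" by (intro power_mono) auto
  have "cmod (of_real (Im w) powr s * of_real (((cmod w)^2 - 1) ^ i * (2 * Re w) ^ j)) =
      cmod (of_real (Im w) powr s) * (\<bar>(cmod w)^2 - 1\<bar> ^ i * \<bar>2 * Re w\<bar> ^ j)"
    by (simp only: norm_mult norm_of_real abs_mult power_abs)
  also have "\<dots> \<le> exp (M * 3) * (10 ^ i * 6 ^ j)"
    by (rule mult_mono[OF 1 mult_mono[OF 2 3]]) simp_all
  finally show ?thesis .
qed

lemma moment_measurable:
  "(\<lambda>w. of_real (Im w) powr s * of_real (((cmod w)^2 - 1) ^ i * (2 * Re w) ^ j) :: complex) \<in> borel_measurable hmeas"
proof (intro borel_measurable_times Im_cpow_measurable)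
  show "(\<lambda>w. of_real (((cmod w)^2 - 1) ^ i * (2 * Re w) ^ j) :: complex) \<in> borel_measurable hmeas"
    by (intro borel_measurable_hmeasI continuous_intros)
qed

lemma compact_Re_bound:
  assumes "compact K"
  obtains M where "M \<ge> 0" "\<And>s. s \<in> K \<Longrightarrow> \<bar>Re s\<bar> \<le> M"
proof -
  obtain M where M: "M > 0" "\<And>s. s \<in> K \<Longrightarrow> cmod s \<le> M"
    using compact_imp_bounded[OF assms] unfolding bounded_pos by blast
  then show ?thesis using that[of M] abs_Re_le_cmod order_trans by (metis less_imp_le)
qed

lemma holomorphic_disc_weight_integral:
  assumes r: "r \<le> 1" and U: "open U" and hol: "\<And>w. w \<in> \<H> \<Longrightarrow> (\<lambda>s. f s w) holomorphic_on U"
    and meas: "\<And>s. s \<in> U \<Longrightarrow> f s \<in> borel_measurable hmeas"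
    and bd: "\<And>K. compact K \<Longrightarrow> K \<subseteq> U \<Longrightarrow> \<exists>B. \<forall>s\<in>K. \<forall>w\<in>hball \<i> 1. cmod (f s w) \<le> B"
  shows "(\<lambda>s. \<integral>w. of_real (disc_weight r w) * f s w \<partial>hmeas) holomorphic_on U"
proof (rule holomorphic_on_lebesgue_integral[OF U])
  show "(\<lambda>s. of_real (disc_weight r w) * f s w) holomorphic_on U" if "w \<in> space hmeas" for w
    using hol that by (intro holomorphic_intros) auto
  show "(\<lambda>w. of_real (disc_weight r w) * f s w) \<in> borel_measurable hmeas" if "s \<in> U" for s
    using meas[OF that] disc_weight_measurable by (intro borel_measurable_times borel_measurable_of_real) auto
  fix K assume "compact K" "K \<subseteq> U"
  from bd[OF this] obtain B where "\<forall>s\<in>K. \<forall>w\<in>hball \<i> 1. cmod (f s w) \<le> B" by blast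
  then have B: "\<And>s w. s \<in> K \<Longrightarrow> w \<in> hball \<i> 1 \<Longrightarrow> cmod (f s w) \<le> B" by blast
  have "cmod (of_real (disc_weight r w) * f s w) \<le> \<bar>B\<bar> * indicator (hball \<i> 1) w" if w: "w \<in> \<H>" and s: "s \<in> K" for w s
  proof (cases "w \<in> hball \<i> 1")
    case True
    have "cmod (of_real (disc_weight r w) * f s w) \<le> 1 * \<bar>B\<bar>"
      unfolding norm_mult norm_of_real using disc_weight_bound[OF w] r B[OF s True] True
      by (intro mult_mono) (auto intro: order_trans[OF _ abs_ge_self])
    then show ?thesis using True by simp
  next
    case False
    then have "disc_weight r w = 0" using disc_weight_bound[OF w, of r] r by (simp add: indicator_def)
    then show ?thesis using False by simp
  qed
  then show "\<exists>g. integrable hmeas g \<and> (\<forall>s\<in>K. \<forall>w\<in>space hmeas. cmod (of_real (disc_weight r w) * f s w) \<le> g w)"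
    using integrable_hball[OF i_in_H, of "\<bar>B\<bar>" 1] by (intro exI[of _ "\<lambda>w. \<bar>B\<bar> * indicator (hball \<i> 1) w"]) auto
qed

lemma holomorphic_moment:
  assumes r: "r \<le> 1"
  shows "moment r i j holomorphic_on UNIV"
  unfolding moment_def
proof (rule holomorphic_disc_weight_integral[OF r open_UNIV])
  show "(\<lambda>s. of_real (Im w) powr s * of_real (((cmod w)^2 - 1) ^ i * (2 * Re w) ^ j)) holomorphic_on UNIV" if "w \<in> \<H>" for w
    using that by (intro holomorphic_on_mult holomorphic_cpow holomorphic_on_const holomorphic_on_ident) (auto simp: H_iff)
  show "\<exists>B. \<forall>s\<in>K. \<forall>w\<in>hball \<i> 1. cmod (of_real (Im w) powr s * of_real (((cmod w)^2 - 1) ^ i * (2 * Re w) ^ j)) \<le> B"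
    if "compact K" for K
    using compact_Re_bound[OF that] moment_bound by metis
qed (rule moment_measurable)

text \<open>The reflection w \<mapsto> - cnj w preserves the disc, the measure and Im w, and changes
  the sign of Re w.\<close>

lemma moment_odd: "odd j \<Longrightarrow> moment r i j s = 0"
proof -
  assume j: "odd j"
  let ?F = "\<lambda>w. complex_of_real (disc_weight r w) * (of_real (Im w) powr s * of_real (((cmod w)^2 - 1) ^ i * (2 * Re w) ^ j))"
  have m: "?F \<in> borel_measurable hmeas"
    by (rule borel_measurable_times[OF measurable_compose[OF disc_weight_measurable borel_measurable_of_real] moment_measurable])
  have "moment r i j s = (\<integral>w. ?F (- cnj w) \<partial>hmeas)"
    unfolding moment_def using integral_hmeas_comp[OF distr_reflect measurable_reflect m] by simp
  also have "\<dots> = (\<integral>w. - ?F w \<partial>hmeas)"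
    using j by (intro Bochner_Integration.integral_cong) (auto simp: disc_weight_reflect power_minus_odd power_mult_distrib)
  also have "\<dots> = - moment r i j s" unfolding moment_def by (rule Bochner_Integration.integral_minus)
  finally show ?thesis by simp
qed

definition dev_moment :: "real \<Rightarrow> nat \<Rightarrow> complex \<Rightarrow> real \<Rightarrow> real \<Rightarrow> complex" where
  "dev_moment r k s t c = (\<integral>w. of_real (disc_weight r w) * (of_real (Im w) powr s * of_real (ht_dev t c w) ^ k) \<partial>hmeas)"

lemma dev_moment_expand:
  assumes r: "r \<le> 1"
  shows "dev_moment r k s t c = (\<Sum>j\<le>k. of_nat (k choose j) * of_real (t^2) ^ (k - j) * of_real (t * c) ^ j * moment r (k - j) j s)"
proof -
  let ?M = "\<lambda>i j w. complex_of_real (disc_weight r w) * (of_real (Im w) powr s * of_real (((cmod w)^2 - 1) ^ i * (2 * Re w) ^ j))"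
  have int: "integrable hmeas (?M i j)" for i j
    using disc_weight_integrable(1)[OF r moment_measurable moment_bound[OF _ order_refl]] .
  have "ht_dev t c w ^ k = (\<Sum>j\<le>k. real (k choose j) * (2 * Re w * (t * c)) ^ j * (((cmod w)^2 - 1) * t^2) ^ (k - j))" for w
    unfolding ht_dev_def by (subst add.commute) (rule binomial_ring)
  then have "complex_of_real (ht_dev t c w) ^ k = of_real (\<Sum>j\<le>k. real (k choose j) * (2 * Re w * (t * c)) ^ j * (((cmod w)^2 - 1) * t^2) ^ (k - j))" for w
    by (metis of_real_power)
  then have "dev_moment r k s t c = (\<integral>w. (\<Sum>j\<le>k. of_nat (k choose j) * of_real (t^2) ^ (k - j) * of_real (t * c) ^ j * ?M (k - j) j w) \<partial>hmeas)"
    unfolding dev_moment_def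
    by (intro Bochner_Integration.integral_cong) (auto simp: sum_distrib_left power_mult_distrib mult_ac intro!: sum.cong)
  also have "\<dots> = (\<Sum>j\<le>k. \<integral>w. of_nat (k choose j) * of_real (t^2) ^ (k - j) * of_real (t * c) ^ j * ?M (k - j) j w \<partial>hmeas)"
    using int by (intro Bochner_Integration.integral_sum Bochner_Integration.integrable_mult_right) auto
  also have "\<dots> = (\<Sum>j\<le>k. of_nat (k choose j) * of_real (t^2) ^ (k - j) * of_real (t * c) ^ j * moment r (k - j) j s)"
    unfolding moment_def by (intro sum.cong refl Bochner_Integration.integral_mult_right_zero)
  finally show ?thesis .
qed

text \<open>The mixed term of \<open>ht_dev\<close> contributes powers (t c)^j. The odd ones come
  with vanishing moments, and the even ones are polynomials in t^2 and c^2.\<close>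

lemma evenpoly_dev_moment:
  assumes r: "r \<le> 1"
  shows "evenpoly (\<lambda>s t c. dev_moment r k s t c)"
proof (rule evenpoly_cong)
  have E: "evenpoly (\<lambda>s t c. of_real (t^2) ^ (k - j + j div 2) * (of_real (c^2) ^ (j div 2) * (if even j then of_nat (k choose j) * moment r (k - j) j s else 0)))" for j
  proof (intro evenpoly_t2_pow evenpoly_c2_pow)
    have "(\<lambda>s. if even j then of_nat (k choose j) * moment r (k - j) j s else 0) holomorphic_on UNIV"
      using holomorphic_moment[OF r] by (cases "even j") (auto intro!: holomorphic_intros)
    then show "evenpoly (\<lambda>s t c. if even j then of_nat (k choose j) * moment r (k - j) j s else 0)" by (rule evenpoly_holomorphic)
  qed
  show "evenpoly (\<lambda>s t c. \<Sum>j\<le>k. of_real (t^2) ^ (k - j + j div 2) * (of_real (c^2) ^ (j div 2) * (if even j then of_nat (k choose j) * moment r (k - j) j s else 0)))"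
    by (rule evenpoly_sum[OF finite_atMost E])
next
  fix s t c
  show "dev_moment r k s t c = (\<Sum>j\<le>k. of_real (t^2) ^ (k - j + j div 2) * (of_real (c^2) ^ (j div 2) * (if even j then of_nat (k choose j) * moment r (k - j) j s else 0)))"
    unfolding dev_moment_expand[OF r]
  proof (rule sum.cong[OF refl])
    fix j
    show "of_nat (k choose j) * of_real (t^2) ^ (k - j) * of_real (t * c) ^ j * moment r (k - j) j s =
      of_real (t^2) ^ (k - j + j div 2) * (of_real (c^2) ^ (j div 2) * (if even j then of_nat (k choose j) * moment r (k - j) j s else 0))"
    proof (cases "even j")
      case True
      then obtain l where j: "j = 2 * l" by blast
      have "complex_of_real (t * c) ^ j = of_real (t^2) ^ l * of_real (c^2) ^ l"
        unfolding j power_mult by (simp add: power_mult_distrib)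
      then show ?thesis using True j by (simp add: power_add mult_ac)
    next
      case False
      then show ?thesis by (simp add: moment_odd)
    qed
  qed
qed

lemma ht_dev_eq: "t^2 + c^2 = 1 \<Longrightarrow> 1 + ht_dev t c w = (cmod (of_real c + of_real t * w))^2"
proof -
  assume "t^2 + c^2 = 1"
  then have c: "c^2 = 1 - t^2" by simp
  have "(cmod (of_real c + of_real t * w))^2 = c^2 + 2 * Re w * (t * c) + t^2 * (cmod w)^2"
    unfolding cmod_power2 by (simp add: power2_eq_square algebra_simps)
  then show ?thesis unfolding c ht_dev_def by (simp add: algebra_simps)
qed

lemma ht_dev_pos: "t^2 + c^2 = 1 \<Longrightarrow> w \<in> \<H> \<Longrightarrow> 1 + ht_dev t c w > 0"
proof -
  assume taylor_coeff: "t^2 + c^2 = 1" and w: "w \<in> \<H>"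
  have "of_real c + of_real t * w \<noteq> 0"
  proof
    assume 0: "of_real c + of_real t * w = 0"
    then have "Im (of_real c + of_real t * w) = 0" "Re (of_real c + of_real t * w) = 0" by simp_all
    then have "t = 0" "c = 0" using w by (auto simp: H_iff)
    then show False using taylor_coeff by simp
  qed
  then show ?thesis unfolding ht_dev_eq[OF taylor_coeff] by simp
qed

section \<open>The height on a small disc around a point\<close>

definition cos_arg :: "complex \<Rightarrow> real" where
  "cos_arg z = Re z / cmod z"

lemma ht_cos_arg: "z \<in> \<H> \<Longrightarrow> (ht z)^2 + (cos_arg z)^2 = 1"
proof -
  assume "z \<in> \<H>"
  then have "cmod z \<noteq> 0" by (auto simp: H_iff)
  then show ?thesis
    by (simp add: ht_def cos_arg_def power_divide add_divide_distrib[symmetric]) (simp add: cmod_power2 add.commute)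
qed

lemma aff_in_H: "z \<in> \<H> \<Longrightarrow> w \<in> \<H> \<Longrightarrow> sl2_act (aff z) w \<in> \<H>"
  using sl2_act_in_H[OF det_aff] by blast

lemma hyp_aff: "z \<in> \<H> \<Longrightarrow> w \<in> \<H> \<Longrightarrow> hyp z (sl2_act (aff z) w) = hyp \<i> w"
  using hyp_sl2_act[OF det_aff, of z \<i> w] sl2_act_aff_i i_in_H by simp

text \<open>After the modulus of \<open>z\<close> is divided out, the image of \<open>w\<close> is c
  + t w with t, c the sine and cosine of the argument of \<open>z\<close>; only these enter the
  height.\<close>

lemma ht_aff:
  assumes z: "z \<in> \<H>" and w: "w \<in> \<H>"
  shows "ht (sl2_act (aff z) w) = ht z * (Im w / sqrt (1 + ht_dev (ht z) (cos_arg z) w))"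
proof -
  have p: "cmod z > 0" using z by (auto simp: H_iff)
  have "sl2_act (aff z) w = of_real (cmod z) * (of_real (cos_arg z) + of_real (ht z) * w)"
    using p unfolding sl2_act_aff[OF z] by (simp add: cos_arg_def ht_def field_simps)
  then have "cmod (sl2_act (aff z) w) = cmod z * sqrt (1 + ht_dev (ht z) (cos_arg z) w)"
    unfolding ht_dev_eq[OF ht_cos_arg[OF z]] using p by (simp add: norm_mult)
  moreover have "Im (sl2_act (aff z) w) = Im z * Im w" by (simp add: sl2_act_aff[OF z])
  ultimately show ?thesis by (simp add: ht_def)
qed

text \<open>The first two bounds are the Harnack inequality: Im w / sqrt (1 + \<open>ht_dev\<close>)
  lies between 1/12 and 12 and Im w between 1/3 and 3, whence 1296 = 36^2. They keep the base of the
  power away from 0. The third makes each further Taylor term smaller by a factor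
  \<open>ht z\<close>.\<close>

lemma ht_dev_bounds:
  assumes z: "z \<in> \<H>" and w: "w \<in> hball \<i> 1"
  shows "1/1296 \<le> 1 + ht_dev (ht z) (cos_arg z) w" "1 + ht_dev (ht z) (cos_arg z) w \<le> 1296" "\<bar>ht_dev (ht z) (cos_arg z) w\<bar> \<le> 16 * ht z"
proof -
  note b = hball_1_bounds[OF w]
  let ?A = "sl2_act (aff z) w" and ?q = "1 + ht_dev (ht z) (cos_arg z) w"
  have wH: "w \<in> \<H>" and h1: "hyp \<i> w \<le> 1" using w by (auto simp: hball_def)
  have h0: "hyp \<i> w \<ge> 0" using hyp_nonneg[OF i_in_H wH] .
  have A: "?A \<in> \<H>" using aff_in_H[OF z wH] .
  have t: "ht z > 0" "ht z \<le> 1" using ht_pos[OF z] ht_le_1 by auto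
  have q: "?q > 0" using ht_dev_pos[OF ht_cos_arg[OF z] wH] .
  define x where "x = Im w / sqrt ?q"
  have htA: "ht ?A = ht z * x" unfolding x_def by (rule ht_aff[OF z wH])
  have c: "(hyp \<i> w + 2) * (hyp \<i> w + 3) \<le> 3 * 4" using h1 h0 by (intro mult_mono) auto
  have "ht ?A \<le> (hyp \<i> w + 2) * (hyp \<i> w + 3) * ht z" using ht_harnack[OF z A] hyp_aff[OF z wH] by simp
  also have "\<dots> \<le> 3 * 4 * ht z" using c t by (intro mult_right_mono) auto
  finally have "ht z * x \<le> ht z * 12" unfolding htA by simp
  then have "x \<le> 12" by (simp only: mult_le_cancel_left_pos[OF t(1)])
  then have "Im w / sqrt ?q \<le> 12" unfolding x_def .
  then have "1/3 \<le> 12 * sqrt ?q" using q b by (simp add: field_simps)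
  then have "1/36 \<le> sqrt ?q" by simp
  then have "(1/36)^2 \<le> (sqrt ?q)^2" by (intro power_mono) auto
  then show "1/1296 \<le> ?q" using q by (simp add: power2_eq_square)
  have "ht z \<le> (hyp \<i> w + 2) * (hyp \<i> w + 3) * ht ?A" using ht_harnack[OF A z] hyp_aff[OF z wH] by (simp add: hyp_sym)
  also have "\<dots> \<le> 3 * 4 * ht ?A" using c ht_pos[OF A] by (intro mult_right_mono) auto
  finally have "ht z * 1 \<le> ht z * (12 * x)" unfolding htA by simp
  then have "1 \<le> 12 * x" by (simp only: mult_le_cancel_left_pos[OF t(1)])
  then have "1 \<le> 12 * (Im w / sqrt ?q)" unfolding x_def .
  then have "sqrt ?q \<le> 12 * Im w" using q by (simp add: field_simps)
  then have "sqrt ?q \<le> 36" using b by linarith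
  then have "(sqrt ?q)^2 \<le> 36^2" using q by (intro power_mono) auto
  then show "?q \<le> 1296" using q by simp
  have "(cmod w)^2 \<le> 9" using power_mono[OF b(4), of 2] by simp
  then have 1: "\<bar>(cmod w)^2 - 1\<bar> \<le> 10" using zero_le_power2[of "cmod w"] unfolding abs_le_iff by linarith
  have "(ht z)^2 \<le> ht z" using t by (simp add: power2_eq_square mult_le_one mult_left_le)
  then have 2: "\<bar>((cmod w)^2 - 1) * (ht z)^2\<bar> \<le> 10 * ht z"
    unfolding abs_mult using 1 t by (intro mult_mono) auto
  have "\<bar>cos_arg z\<bar> \<le> 1" using abs_Re_le_cmod[of z] by (simp add: cos_arg_def divide_le_eq)
  then have "\<bar>ht z * cos_arg z\<bar> \<le> ht z * 1" unfolding abs_mult using t by (intro mult_mono) auto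
  moreover have "\<bar>2 * Re w\<bar> \<le> 6" using abs_Re_le_cmod[of w] b(4) by simp
  ultimately have 3: "\<bar>2 * Re w * (ht z * cos_arg z)\<bar> \<le> 6 * (ht z * 1)"
    unfolding abs_mult[of "2 * Re w"] by (intro mult_mono) auto
  show "\<bar>ht_dev (ht z) (cos_arg z) w\<bar> \<le> 16 * ht z"
    unfolding ht_dev_def using abs_triangle_ineq[of "((cmod w)^2 - 1) * (ht z)^2" "2 * Re w * (ht z * cos_arg z)"] 2 3 by linarith
qed

lemma continuous_on_ht: "continuous_on \<H> ht"
  unfolding ht_def by (intro continuous_intros) (auto simp: H_iff)

section \<open>Averages of powers of the height\<close>

context hyperbolic_group
begin

lemma Lop_disc_kernel_subst:
  assumes z: "z \<in> \<H>" and v: "v \<in> borel_measurable hmeas" and r: "0 < r" "r \<le> 1"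
  shows "Lop (disc_kernel r) v z = (\<integral>w. of_real (disc_weight r w) * v (sl2_act (aff z) w) \<partial>hmeas)"
proof -
  have m: "(\<lambda>w. disc_kernel r z w * v w) \<in> borel_measurable hmeas"
    using good_kernel_measurable[OF good_kernel_disc_kernel[OF r] z] v by (intro borel_measurable_times)
  have "Lop (disc_kernel r) v z = (\<integral>w. disc_kernel r z (sl2_act (aff z) w) * v (sl2_act (aff z) w) \<partial>hmeas)"
    unfolding Lop_def
    using integral_hmeas_comp[OF distr_sl2_act[OF det_aff[OF z]] measurable_sl2_act[OF det_aff[OF z]] m] by simp
  also have "\<dots> = (\<integral>w. of_real (disc_weight r w) * v (sl2_act (aff z) w) \<partial>hmeas)"
    using hyp_aff[OF z] by (intro Bochner_Integration.integral_cong) (auto simp: disc_kernel_def disc_weight_def)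
  finally show ?thesis .
qed

text \<open>The integral of the kernel over one variable; it bounds the operator in the supremum
  norm, and the leading coefficient has to exceed it somewhere.\<close>

definition disc_mass :: "real \<Rightarrow> real" where
  "disc_mass r = (\<integral>w. disc_weight r w \<partial>hmeas)"

lemma disc_mass_nonneg: "disc_mass r \<ge> 0"
  unfolding disc_mass_def using disc_weight_bound(1) by (intro Bochner_Integration.integral_nonneg) auto

lemma Lop_disc_kernel_bound:
  assumes r: "0 < r" "r \<le> 1" and v: "\<And>w. w \<in> \<H> \<Longrightarrow> cmod (v w) \<le> V" "V \<ge> 0" and z: "z \<in> \<H>"
  shows "cmod (Lop (disc_kernel r) v z) \<le> disc_mass r * V"
proof -
  have k: "good_kernel (disc_kernel r)" by (rule good_kernel_disc_kernel[OF r])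
  have i: "integrable hmeas (disc_kernel r z)"
    using Lop_integrable[OF k z, of "\<lambda>_. 1" 1] by simp
  have m: "(\<lambda>w. cmod (disc_kernel r z w)) \<in> borel_measurable hmeas"
    using i by (intro borel_measurable_integrable integrable_norm)
  have "cmod (Lop (disc_kernel r) v z) \<le> (\<integral>w. V * cmod (disc_kernel r z w) \<partial>hmeas)"
    unfolding Lop_def
  proof (rule integral_norm_le)
    show "integrable hmeas (\<lambda>w. V * cmod (disc_kernel r z w))" using i by (intro integrable_mult_right integrable_norm)
    show "cmod (disc_kernel r z w * v w) \<le> V * cmod (disc_kernel r z w)" if "w \<in> space hmeas" for w
      unfolding norm_mult mult.commute[of V] using v that by (intro mult_left_mono) auto
  qed
  also have "\<dots> = V * (\<integral>w. cmod (disc_kernel r z w) \<partial>hmeas)" by simp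
  also have "(\<integral>w. cmod (disc_kernel r z w) \<partial>hmeas) = (\<integral>w. cmod (disc_kernel r z (sl2_act (aff z) w)) \<partial>hmeas)"
    using integral_hmeas_comp[OF distr_sl2_act[OF det_aff[OF z]] measurable_sl2_act[OF det_aff[OF z]] m] by simp
  also have "\<dots> = disc_mass r"
    unfolding disc_mass_def using hyp_aff[OF z] by (intro Bochner_Integration.integral_cong) (auto simp: disc_kernel_def disc_weight_def)
  finally show ?thesis by (simp add: mult.commute)
qed

text \<open>For Re s < 0 the power of the height is unbounded on \<H>. Near a given point the
  operator sees only a ball, so the function may be cut off there; the radius 36 is again 4 * 3 *
  3.\<close>

lemma Lop_continuous_local:
  assumes k: "good_kernel \<kappa>" and v: "v \<in> borel_measurable hmeas"
    and b: "\<And>z. z \<in> \<H> \<Longrightarrow> \<exists>V. \<forall>w\<in>hball z 36. cmod (v w) \<le> V"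
  shows "continuous_on \<H> (Lop \<kappa> v)"
  unfolding continuous_on_eq_continuous_at[OF open_H]
proof
  fix z0 assume z0: "z0 \<in> \<H>"
  obtain V where V: "\<forall>w\<in>hball z0 36. cmod (v w) \<le> V" using b[OF z0] by blast
  define v' where "v' w = indicator (hball z0 36) w * v w" for w
  have m: "v' \<in> borel_measurable hmeas"
    unfolding v'_def by (intro borel_measurable_times borel_measurable_indicator hball_sets z0 v)
  have vb: "cmod (v' w) \<le> \<bar>V\<bar>" for w
    using V by (auto simp: v'_def indicator_def intro: order_trans[OF _ abs_ge_self])
  have c: "continuous_on \<H> (Lop \<kappa> v')" by (rule Lop_continuous[OF k m vb])
  let ?N = "{z \<in> \<H>. hyp z0 z < 1}"
  have eq: "Lop \<kappa> v z = Lop \<kappa> v' z" if z: "z \<in> ?N" for z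
    unfolding Lop_def
  proof (rule Bochner_Integration.integral_cong[OF refl])
    fix w assume "w \<in> space hmeas"
    then have w: "w \<in> \<H>" by simp
    show "\<kappa> z w * v w = \<kappa> z w * v' w"
    proof (cases "hyp z w < 1")
      case True
      then have "hyp z0 w \<le> 36" using hyp_chain[OF z0 _ w, of z 1 1] z by simp
      then show ?thesis using w by (simp add: v'_def hball_def)
    next
      case False
      then have "\<kappa> z w = 0" using k z w by (auto simp: good_kernel_def)
      then show ?thesis by simp
    qed
  qed
  have "continuous_on ?N (Lop \<kappa> v')" using c by (rule continuous_on_subset) auto
  then have "continuous_on ?N (Lop \<kappa> v)" using eq by (subst continuous_on_cong[OF refl, of _ _ "Lop \<kappa> v'"]) auto
  moreover have "z0 \<in> ?N" using z0 by simp
  ultimately show "isCont (Lop \<kappa> v) z0" using continuous_on_eq_continuous_at[OF hyp_ball_open[OF z0, of 1]] by blast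
qed

abbreviation \<phi> :: "complex \<Rightarrow> complex \<Rightarrow> complex" where
  "\<phi> s z \<equiv> complex_of_real (ht z) powr s"

lemma \<phi>_measurable: "\<phi> s \<in> borel_measurable hmeas"
  by (rule cpow_measurable[OF continuous_on_ht ht_pos])

lemma \<phi>_continuous: "continuous_on \<H> (\<phi> s)"
proof -
  have "continuous_on \<H> (\<lambda>w. exp (s * of_real (ln (ht w))))"
    using continuous_on_ht ht_pos by (intro continuous_intros) (auto simp: less_imp_neq[symmetric])
  then show ?thesis
    using ht_pos by (subst continuous_on_cong[OF refl cpow_exp]) auto
qed

lemma ln_ht_bound:
  assumes "z \<in> \<H>" "w \<in> hball z 36"
  shows "\<bar>ln (ht w)\<bar> \<le> \<bar>ln (ht z)\<bar> + ln 1482"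
proof -
  have w: "w \<in> \<H>" "hyp z w \<le> 36" using assms by (auto simp: hball_def)
  have p: "ht z > 0" "ht w > 0" using ht_pos assms(1) w by auto
  have h: "hyp z w \<ge> 0" using hyp_nonneg assms(1) w by blast
  \<comment> \<open>For \<open>hyp\<close> \<le> 36 the Harnack factor is 38 * 39 = 1482.\<close>
  have c: "(hyp z w + 2) * (hyp z w + 3) \<le> 38 * 39" using w h by (intro mult_mono) auto
  have "ht w \<le> (38 * 39) * ht z"
    by (rule order_trans[OF ht_harnack[OF assms(1) w(1)] mult_right_mono[OF c less_imp_le[OF p(1)]]])
  then have "ln (ht w) \<le> ln (1482 * ht z)" using p by (subst ln_le_cancel_iff) auto
  then have 1: "ln (ht w) \<le> ln 1482 + ln (ht z)" using p by (simp add: ln_mult)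
  have "ht z \<le> (38 * 39) * ht w"
    by (rule order_trans[OF ht_harnack[OF w(1) assms(1), unfolded hyp_sym[of w z]] mult_right_mono[OF c less_imp_le[OF p(2)]]])
  then have "ln (ht z) \<le> ln (1482 * ht w)" using p by (subst ln_le_cancel_iff) auto
  then have 2: "ln (ht z) \<le> ln 1482 + ln (ht w)" using p by (simp add: ln_mult)
  show ?thesis using 1 2 by linarith
qed

lemma \<phi>_bound_local:
  assumes "z \<in> \<H>" "w \<in> hball z 36" "\<bar>Re s\<bar> \<le> M"
  shows "cmod (\<phi> s w) \<le> exp (M * (\<bar>ln (ht z)\<bar> + ln 1482))"
proof -
  have "ht w > 0" using ht_pos assms(2) by (auto simp: hball_def)
  then show ?thesis unfolding norm_cpow[OF \<open>ht w > 0\<close>]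
    by (intro powr_bound ln_ht_bound assms)
qed

lemma Lop_\<phi>_continuous: "good_kernel \<kappa> \<Longrightarrow> continuous_on \<H> (Lop \<kappa> (\<phi> s))"
  by (rule Lop_continuous_local[OF _ \<phi>_measurable]) (use \<phi>_bound_local[OF _ _ order_refl] in blast)+

lemma Lop_\<phi>_invariant:
  assumes k: "good_kernel \<kappa>" and z: "z \<in> \<H>"
  shows "Lop \<kappa> (\<phi> s) (of_real \<mu> * z) = Lop \<kappa> (\<phi> s) z"
  using Lop_invariant[OF k \<phi>_measurable[of s] \<gamma>1_in _ z] by (simp add: act_\<gamma>1 ht_\<mu>)

lemma Lop_\<phi>_holomorphic:
  assumes r: "0 < r" "r \<le> 1" and z: "z \<in> \<H>"
  shows "(\<lambda>s. Lop (disc_kernel r) (\<phi> s) z) holomorphic_on UNIV"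
  unfolding Lop_disc_kernel_subst[OF z \<phi>_measurable r]
proof (rule holomorphic_disc_weight_integral[OF r(2) open_UNIV])
  show "(\<lambda>s. \<phi> s (sl2_act (aff z) w)) holomorphic_on UNIV" if "w \<in> \<H>" for w
    using ht_pos[OF aff_in_H[OF z that]] by (intro holomorphic_cpow holomorphic_on_ident)
  show "(\<lambda>w. \<phi> s (sl2_act (aff z) w)) \<in> borel_measurable hmeas" for s
    using measurable_compose[OF measurable_sl2_act[OF det_aff[OF z]] \<phi>_measurable] .
  show "\<exists>B. \<forall>s\<in>K. \<forall>w\<in>hball \<i> 1. cmod (\<phi> s (sl2_act (aff z) w)) \<le> B" if K: "compact K" for K
  proof -
    obtain M where M: "M \<ge> 0" "\<And>s. s \<in> K \<Longrightarrow> \<bar>Re s\<bar> \<le> M" using compact_Re_bound[OF K] by blast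
    have "cmod (\<phi> s (sl2_act (aff z) w)) \<le> exp (M * (\<bar>ln (ht z)\<bar> + ln 1482))" if "s \<in> K" "w \<in> hball \<i> 1" for s w
    proof (rule \<phi>_bound_local[OF z _ M(2)[OF that(1)]])
      show "sl2_act (aff z) w \<in> hball z 36"
        using that(2) aff_in_H[OF z] hyp_aff[OF z] by (auto simp: hball_def)
    qed
    then show ?thesis by blast
  qed
qed

lemma Lop_\<phi>_eq:
  assumes r: "0 < r" "r \<le> 1" and z: "z \<in> \<H>"
  shows "Lop (disc_kernel r) (\<phi> s) z = \<phi> s z *
    (\<integral>w. of_real (disc_weight r w) * (of_real (Im w) powr s * of_real (1 + ht_dev (ht z) (cos_arg z) w) powr (- s / 2)) \<partial>hmeas)"
proof -
  have "\<phi> s (sl2_act (aff z) w) = \<phi> s z * (of_real (Im w) powr s * of_real (1 + ht_dev (ht z) (cos_arg z) w) powr (- s / 2))"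
    if w: "w \<in> \<H>" for w
  proof -
    have q: "1 + ht_dev (ht z) (cos_arg z) w > 0" using ht_dev_pos[OF ht_cos_arg[OF z] w] .
    have p: "Im w > 0" using w by (simp add: H_iff)
    have "Im w / sqrt (1 + ht_dev (ht z) (cos_arg z) w) > 0" using p q by simp
    then show ?thesis
      unfolding ht_aff[OF z w] cpow_mult[OF ht_pos[OF z] \<open>Im w / sqrt _ > 0\<close>] cpow_div_sqrt[OF p q] by simp
  qed
  then have "Lop (disc_kernel r) (\<phi> s) z = (\<integral>w. \<phi> s z * (of_real (disc_weight r w) * (of_real (Im w) powr s * of_real (1 + ht_dev (ht z) (cos_arg z) w) powr (- s / 2))) \<partial>hmeas)"
    unfolding Lop_disc_kernel_subst[OF z \<phi>_measurable r]
    by (intro Bochner_Integration.integral_cong) auto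
  then show ?thesis by simp
qed

text \<open>Taylor's formula of order n in \<open>ht_dev\<close>, which is O(\<open>ht z\<close>) on
  the disc, so that the error gains n + 1 powers of the height. The retained terms are regrouped
  into even powers of the height; the regrouped sum may reach beyond order n.\<close>

lemma Lop_\<phi>_expansion:
  assumes r: "0 < r" "r \<le> 1"
  obtains N :: nat and a where "\<And>j. a j holomorphic_on UNIV" "a 0 = moment r 0 0" "N > 0"
    "\<And>K. compact K \<Longrightarrow> \<exists>C\<ge>0. \<forall>s\<in>K. \<forall>z\<in>\<H>.
       cmod (Lop (disc_kernel r) (\<phi> s) z - (\<Sum>j<N. a j s * \<phi> (s + of_nat (2 * j)) z)) \<le> C * ht z powr (Re s + Suc n)"
proof -
  have "evenpoly (\<lambda>s t c. \<Sum>k\<le>n. taylor_coeff k s * dev_moment r k s t c)"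
    using evenpoly_dev_moment[OF r(2)] holomorphic_taylor_coeff by (intro evenpoly_sum evenpoly_scale) auto
  then obtain N0 a0 where a0: "\<And>j. a0 j holomorphic_on UNIV"
    "\<And>s t c. t^2 + c^2 = 1 \<Longrightarrow> (\<Sum>k\<le>n. taylor_coeff k s * dev_moment r k s t c) = (\<Sum>j<N0. a0 j s * of_real t ^ (2 * j))"
    unfolding evenpoly_def by blast
  \<comment> \<open>The padding by a zero coefficient guarantees an index 0, even if the polynomial
    is empty.\<close>
  define N where "N = Suc N0"
  define a where "a j s = (if j < N0 then a0 j s else 0)" for j s
  have ah: "a j holomorphic_on UNIV" for j unfolding a_def using a0(1) by (cases "j < N0") auto
  have a: "(\<Sum>k\<le>n. taylor_coeff k s * dev_moment r k s t c) = (\<Sum>j<N. a j s * of_real t ^ (2 * j))" if "t^2 + c^2 = 1" for s t c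
    unfolding a0(2)[OF that] N_def by (simp add: a_def)
  have "a 0 s = moment r 0 0 s" for s
  proof -
    \<comment> \<open>At t = 0, c = 1 the deviation \<open>ht_dev\<close> is zero and only k = 0
      contributes, which identifies the leading coefficient.\<close>
    have "(\<Sum>k\<le>n. taylor_coeff k s * dev_moment r k s 0 1) = (\<Sum>j<N. a j s * 0 ^ (2 * j))" using a[of 0 1 s] by simp
    also have "\<dots> = a 0 s" unfolding N_def sum.lessThan_Suc_shift by simp
    also have "(\<Sum>k\<le>n. taylor_coeff k s * dev_moment r k s 0 1) = (\<Sum>k\<le>n. if k = 0 then moment r 0 0 s else 0)"
    proof (rule sum.cong[OF refl])
      fix k
      show "taylor_coeff k s * dev_moment r k s 0 1 = (if k = 0 then moment r 0 0 s else 0)"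
        by (cases k) (simp_all add: dev_moment_def moment_def ht_dev_def)
    qed
    finally show ?thesis by simp
  qed
  then have a00: "a 0 = moment r 0 0" by auto
  have bd: "\<exists>C\<ge>0. \<forall>s\<in>K. \<forall>z\<in>\<H>.
       cmod (Lop (disc_kernel r) (\<phi> s) z - (\<Sum>j<N. a j s * \<phi> (s + of_nat (2 * j)) z)) \<le> C * ht z powr (Re s + Suc n)"
    if K: "compact K" for K
  proof -
    obtain C where C: "C \<ge> 0" "\<And>s x. s \<in> K \<Longrightarrow> 1/1296 \<le> x \<Longrightarrow> x \<le> 1296 \<Longrightarrow>
      cmod (complex_of_real x powr (- s / 2) - (\<Sum>k\<le>n. taylor_coeff k s * of_real (x - 1) ^ k)) \<le> C * \<bar>x - 1\<bar> ^ Suc n"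
      using taylor_power[OF K, of "1/1296" 1296 n] by auto
    obtain M where M: "M \<ge> 0" "\<And>s. s \<in> K \<Longrightarrow> \<bar>Re s\<bar> \<le> M" using compact_Re_bound[OF K] by blast
    define D where "D = exp (M * 3) * (C * 16 ^ Suc n) * vol 1"
    have D: "D \<ge> 0" using C(1) vol_nonneg by (simp add: D_def)
    have "cmod (Lop (disc_kernel r) (\<phi> s) z - (\<Sum>j<N. a j s * \<phi> (s + of_nat (2 * j)) z)) \<le> D * ht z powr (Re s + Suc n)"
      if s: "s \<in> K" and z: "z \<in> \<H>" for s z
    proof -
      let ?X = "ht_dev (ht z) (cos_arg z)"
      have t: "ht z > 0" using ht_pos[OF z] .
      have cX: "continuous_on \<H> ?X" unfolding ht_dev_def by (intro continuous_intros)
      have m1: "(\<lambda>w. complex_of_real (1 + ?X w) powr (- s / 2)) \<in> borel_measurable hmeas"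
        using ht_dev_pos[OF ht_cos_arg[OF z]] by (intro cpow_measurable continuous_intros cX) auto
      have m2: "(\<lambda>w. complex_of_real (?X w) ^ k) \<in> borel_measurable hmeas" for k
        by (intro borel_measurable_hmeasI continuous_intros cX)
      have vb: "cmod (complex_of_real (Im w) powr s) \<le> exp (M * 3)" if w: "w \<in> hball \<i> 1" for w
        using moment_bound[OF w M(2)[OF s], of 0 0] by simp
      have Xb: "\<bar>?X w\<bar> \<le> 1296" if w: "w \<in> hball \<i> 1" for w
        using ht_dev_bounds[OF z w] by linarith
      have i2: "integrable hmeas (\<lambda>w. of_real (disc_weight r w) * (of_real (Im w) powr s * of_real (?X w) ^ k))" for k
      proof (rule disc_weight_integrable(1)[OF r(2) borel_measurable_times[OF Im_cpow_measurable m2]])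
        fix w assume w: "w \<in> hball \<i> 1"
        show "cmod (of_real (Im w) powr s * of_real (?X w) ^ k) \<le> exp (M * 3) * 1296 ^ k"
          unfolding norm_mult norm_power norm_of_real
          using vb[OF w] Xb[OF w] by (intro mult_mono power_mono) auto
      qed
      have i1: "integrable hmeas (\<lambda>w. of_real (disc_weight r w) * (of_real (Im w) powr s * of_real (1 + ?X w) powr (- s / 2)))"
      proof (rule disc_weight_integrable(1)[OF r(2) borel_measurable_times[OF Im_cpow_measurable m1]])
        fix w assume w: "w \<in> hball \<i> 1"
        have q: "1 + ?X w > 0" using ht_dev_bounds(1)[OF z w] by linarith
        have "ln (1/1296) \<le> ln (1 + ?X w)" "ln (1 + ?X w) \<le> ln 1296"
          using ht_dev_bounds[OF z w] q by (auto simp del: ln_le_cancel_iff intro: ln_mono)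
        then have "\<bar>ln (1 + ?X w)\<bar> \<le> ln 1296" by (simp add: ln_div)
        then have "cmod (of_real (1 + ?X w) powr (- s / 2)) \<le> exp (M * ln 1296)"
          unfolding norm_cpow[OF q] using M(2)[OF s] M(1) by (intro powr_bound q) auto
        then show "cmod (of_real (Im w) powr s * of_real (1 + ?X w) powr (- s / 2)) \<le> exp (M * 3) * exp (M * ln 1296)"
          unfolding norm_mult using vb[OF w] by (intro mult_mono) auto
      qed
      define R where "R w = complex_of_real (1 + ?X w) powr (- s / 2) - (\<Sum>k\<le>n. taylor_coeff k s * of_real (?X w) ^ k)" for w
      have main: "(\<Sum>j<N. a j s * \<phi> (s + of_nat (2 * j)) z) = \<phi> s z * (\<Sum>k\<le>n. taylor_coeff k s * dev_moment r k s (ht z) (cos_arg z))"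
      proof -
        have "\<phi> (s + of_nat (2 * j)) z = \<phi> s z * of_real (ht z) ^ (2 * j)" for j
          unfolding cpow_add[OF t] cpow_nat[OF t] by simp
        then show ?thesis unfolding a[OF ht_cos_arg[OF z]] by (simp add: sum_distrib_left mult_ac)
      qed
      have "(\<Sum>k\<le>n. taylor_coeff k s * dev_moment r k s (ht z) (cos_arg z)) = (\<Sum>k\<le>n. \<integral>w. taylor_coeff k s * (of_real (disc_weight r w) * (of_real (Im w) powr s * of_real (?X w) ^ k)) \<partial>hmeas)"
        unfolding dev_moment_def by simp
      also have "\<dots> = (\<integral>w. (\<Sum>k\<le>n. taylor_coeff k s * (of_real (disc_weight r w) * (of_real (Im w) powr s * of_real (?X w) ^ k))) \<partial>hmeas)"
        using i2 by (intro Bochner_Integration.integral_sum[symmetric] Bochner_Integration.integrable_mult_right) auto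
      finally have J: "(\<Sum>k\<le>n. taylor_coeff k s * dev_moment r k s (ht z) (cos_arg z)) = (\<integral>w. (\<Sum>k\<le>n. taylor_coeff k s * (of_real (disc_weight r w) * (of_real (Im w) powr s * of_real (?X w) ^ k))) \<partial>hmeas)" .
      have "(\<integral>w. of_real (disc_weight r w) * (of_real (Im w) powr s * of_real (1 + ?X w) powr (- s / 2)) \<partial>hmeas) - (\<Sum>k\<le>n. taylor_coeff k s * dev_moment r k s (ht z) (cos_arg z))
         = (\<integral>w. of_real (disc_weight r w) * (of_real (Im w) powr s * of_real (1 + ?X w) powr (- s / 2)) - (\<Sum>k\<le>n. taylor_coeff k s * (of_real (disc_weight r w) * (of_real (Im w) powr s * of_real (?X w) ^ k))) \<partial>hmeas)"
        unfolding J using i1 i2 by (intro Bochner_Integration.integral_diff[symmetric] Bochner_Integration.integrable_sum Bochner_Integration.integrable_mult_right) auto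
      also have "\<dots> = (\<integral>w. of_real (disc_weight r w) * (of_real (Im w) powr s * R w) \<partial>hmeas)"
        unfolding R_def by (intro Bochner_Integration.integral_cong refl) (simp add: right_diff_distrib sum_distrib_left mult_ac)
      finally have diff: "(\<integral>w. of_real (disc_weight r w) * (of_real (Im w) powr s * of_real (1 + ?X w) powr (- s / 2)) \<partial>hmeas) - (\<Sum>k\<le>n. taylor_coeff k s * dev_moment r k s (ht z) (cos_arg z))
         = (\<integral>w. of_real (disc_weight r w) * (of_real (Im w) powr s * R w) \<partial>hmeas)" .
      have Rm: "R \<in> borel_measurable hmeas"
        unfolding R_def using m1 m2 by (intro borel_measurable_diff borel_measurable_sum borel_measurable_times borel_measurable_const) auto
      define B where "B = exp (M * 3) * (C * (16 * ht z) ^ Suc n)"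
      have B0: "B \<ge> 0" using C(1) t by (simp add: B_def)
      have "cmod (of_real (Im w) powr s * R w) \<le> B" if w: "w \<in> hball \<i> 1" for w
      proof -
        have "cmod (R w) \<le> C * \<bar>?X w\<bar> ^ Suc n"
          using C(2)[OF s ht_dev_bounds(1,2)[OF z w]] by (simp add: R_def)
        also have "\<dots> \<le> C * (16 * ht z) ^ Suc n"
          using ht_dev_bounds(3)[OF z w] C(1) by (intro mult_left_mono power_mono) auto
        finally show ?thesis unfolding B_def norm_mult using vb[OF w] by (intro mult_mono) auto
      qed
      from disc_weight_integrable(2)[OF r(2) borel_measurable_times[OF Im_cpow_measurable Rm] this]
      have "cmod (\<integral>w. of_real (disc_weight r w) * (of_real (Im w) powr s * R w) \<partial>hmeas) \<le> B * vol 1" using B0 by simp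
      then have "cmod (\<phi> s z) * cmod (\<integral>w. of_real (disc_weight r w) * (of_real (Im w) powr s * R w) \<partial>hmeas) \<le> cmod (\<phi> s z) * (B * vol 1)"
        by (intro mult_left_mono) auto
      also have "\<dots> = D * (ht z powr Re s * ht z ^ Suc n)"
        unfolding norm_cpow[OF t] B_def D_def power_mult_distrib by (simp only: mult_ac)
      also have "ht z powr Re s * ht z ^ Suc n = ht z powr (Re s + Suc n)"
        using t by (simp only: powr_add powr_realpow)
      finally have "cmod (\<phi> s z * (\<integral>w. of_real (disc_weight r w) * (of_real (Im w) powr s * R w) \<partial>hmeas)) \<le> D * ht z powr (Re s + Suc n)"
        by (simp only: norm_mult)
      then show ?thesis unfolding Lop_\<phi>_eq[OF r z] main right_diff_distrib[symmetric] diff .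
    qed
    then show ?thesis using D by blast
  qed
  show ?thesis
    by (rule that[OF ah a00 _ bd]) (simp_all add: N_def)
qed

end

section \<open>Continuation of the automorphic series\<close>

lemma has_sum_finite_sum:
  fixes f :: "'i \<Rightarrow> 'a \<Rightarrow> complex"
  assumes "finite I" "\<And>i. i \<in> I \<Longrightarrow> (f i has_sum l i) X"
  shows "((\<lambda>x. \<Sum>i\<in>I. f i x) has_sum (\<Sum>i\<in>I. l i)) X"
  using assms by (induction I rule: finite_induct) (auto intro: has_sum_add)

section \<open>Lower bounds for the leading coefficient on strips\<close>

lemma emeasure_hmeas_open_pos:
  assumes Z: "open Z" "Z \<noteq> {}" "Z \<subseteq> \<H>"
  shows "emeasure hmeas Z \<noteq> 0"
proof
  assume 0: "emeasure hmeas Z = 0"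
  have Zs: "Z \<in> sets hmeas" using Z open_H by (simp add: sets_hmeas sets_restrict_space_iff)
  have Zb [measurable]: "Z \<in> sets borel" using Z by simp
  have [measurable]: "cx \<in> borel_measurable borel"
    by (intro borel_measurable_continuous_onI continuous_cx)
  let ?f = "\<lambda>p::real^2. ennreal (1 / (p$2)^2) * indicator Z (cx p) * indicator half p"
  have m: "?f \<in> borel_measurable lborel" by measurable
  have "AE p in lborel. ?f p = 0"
    using 0 unfolding emeasure_hmeas[OF Zs] nn_integral_0_iff_AE[OF m] .
  moreover have "?f p = 0 \<longleftrightarrow> p \<notin> cx -` Z" for p
  proof -
    have "p$2 > 0" if "cx p \<in> Z" using that Z(3) by (auto simp: cx_def H_iff)
    then show ?thesis by (auto simp: indicator_def half_def)
  qed
  ultimately have "AE p in lborel. p \<notin> cx -` Z" by simp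
  moreover have o: "open (cx -` Z)" using Z(1) continuous_cx by (intro open_vimage) auto
  ultimately have "cx -` Z \<in> null_sets lborel"
    using AE_iff_null_sets[of "cx -` Z" lborel] by simp
  then have "cx -` Z \<in> null_sets lebesgue" by (rule null_sets_completionI)
  then have "negligible (cx -` Z)" by (simp add: negligible_iff_null_sets)
  moreover have "cx -` Z \<noteq> {}"
  proof -
    obtain w where "w \<in> Z" using Z by blast
    then have "rv w \<in> cx -` Z" by simp
    then show ?thesis by blast
  qed
  ultimately show False using open_not_negligible[OF o] by blast
qed

lemma cos_ge_half: "\<bar>x\<bar> \<le> 1 \<Longrightarrow> cos x \<ge> 1/2" for x :: real
proof -
  assume x: "\<bar>x\<bar> \<le> 1"
  have "cos (pi / 3) \<le> cos \<bar>x\<bar>" using x pi_gt3 by (intro cos_monotone_0_pi_le) auto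
  then show ?thesis by (simp add: cos_60)
qed

text \<open>On the support the phase Im s * ln (Im w) is at most 1 in absolute value, so its cosine
  is at least 1/2 and nothing cancels in the real part. The set Z, well inside the disc, supplies a
  definite contribution.\<close>

lemma moment_Re_lower:
  assumes r: "0 < r" "r \<le> 1" and T: "\<And>w. w \<in> \<H> \<Longrightarrow> hyp \<i> w < r \<Longrightarrow> \<bar>Im s * ln (Im w)\<bar> \<le> 1"
    and Z: "Z \<in> sets hmeas" "\<And>w. w \<in> Z \<Longrightarrow> hyp \<i> w < r / 2" and L: "L \<ge> 0" "\<And>w. w \<in> Z \<Longrightarrow> L \<le> Im w powr Re s"
  shows "r / 4 * L * measure hmeas Z \<le> cmod (moment r 0 0 s)"
proof -
  have ZH: "Z \<subseteq> \<H>" using sets.sets_into_space[OF Z(1)] by simp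
  let ?f = "\<lambda>w. complex_of_real (disc_weight r w) * (of_real (Im w) powr s * of_real (((cmod w)^2 - 1) ^ 0 * (2 * Re w) ^ 0))"
  have i: "integrable hmeas ?f"
    by (rule disc_weight_integrable(1)[OF r(2) moment_measurable moment_bound[OF _ order_refl]])
  have sub: "Z \<subseteq> hball \<i> 1" using Z(2) ZH r by (fastforce simp: hball_def)
  have "emeasure hmeas Z \<le> emeasure hmeas (hball \<i> 1)" by (rule emeasure_mono[OF sub hball_sets[OF i_in_H]])
  then have fin: "emeasure hmeas Z < \<infinity>" using emeasure_hball(2)[OF i_in_H, of 1] by (rule order_le_less_trans)
  have "r / 4 * L * measure hmeas Z = (\<integral>w. r / 4 * L * indicator Z w \<partial>hmeas)"
    using Z(1) ZH by (simp add: Int_absorb2)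
  also have "\<dots> \<le> (\<integral>w. Re (?f w) \<partial>hmeas)"
  proof (rule integral_mono)
    show "integrable hmeas (\<lambda>w. r / 4 * L * indicator Z w)"
      using Z(1) fin by (intro integrable_mult_right integrable_real_indicator)
    show "integrable hmeas (\<lambda>w. Re (?f w))" using i by (rule integrable_Re)
    fix w assume "w \<in> space hmeas"
    then have w: "w \<in> \<H>" by simp
    have p: "Im w > 0" using w by (simp add: H_iff)
    have Ref: "Re (?f w) = disc_weight r w * (Im w powr Re s * cos (Im s * ln (Im w)))"
      using p by (simp add: cpow_exp Re_exp powr_def)
    show "r / 4 * L * indicator Z w \<le> Re (?f w)"
    proof (cases "hyp \<i> w < r")
      case True
      have "1/2 \<le> cos (Im s * ln (Im w))" using T[OF w True] by (rule cos_ge_half)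
      then have c: "Im w powr Re s * (1/2) \<le> Im w powr Re s * cos (Im s * ln (Im w))"
        by (intro mult_left_mono) auto
      show ?thesis
      proof (cases "w \<in> Z")
        case wZ: True
        have "r - hyp \<i> w \<le> disc_weight r w" by (simp add: disc_weight_def)
        then have A: "r / 2 \<le> disc_weight r w" using Z(2)[OF wZ] by linarith
        have B: "L * (1/2) \<le> Im w powr Re s * cos (Im s * ln (Im w))"
          using c L(2)[OF wZ] by (intro order_trans[OF _ c] mult_right_mono) auto
        have "(r / 2) * (L * (1/2)) \<le> disc_weight r w * (Im w powr Re s * cos (Im s * ln (Im w)))"
          by (rule mult_mono[OF A B disc_weight_bound(1)[OF w]]) (use L(1) in simp)
        then show ?thesis using wZ unfolding Ref by simp
      next
        case False
        have "0 \<le> Im w powr Re s * cos (Im s * ln (Im w))"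
          using c by (rule order_trans[rotated]) simp
        then show ?thesis using False disc_weight_bound(1)[OF w] unfolding Ref by simp
      qed
    next
      case False
      then have "w \<notin> Z" using Z(2) r by fastforce
      moreover have "disc_weight r w = 0" using False by (simp add: disc_weight_def)
      ultimately show ?thesis by simp
    qed
  qed
  also have "\<dots> = Re (moment r 0 0 s)" unfolding moment_def using i by (rule integral_Re)
  also have "\<dots> \<le> cmod (moment r 0 0 s)" by (rule complex_Re_le_cmod)
  finally show ?thesis .
qed

definition strip :: "real \<Rightarrow> real \<Rightarrow> complex set" where
  "strip c T = {s. Re s > c \<and> \<bar>Im s\<bar> < T}"

lemma open_Re_gt: "open {s. c < Re s}"
  by (intro open_Collect_less continuous_intros)

lemma open_strip: "open (strip c T)"
proof -
  have "strip c T = {s. c < Re s} \<inter> {s. \<bar>Im s\<bar> < T}" by (auto simp: strip_def)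
  then show ?thesis by (auto intro!: open_Int open_Collect_less continuous_intros)
qed

lemma connected_strip: "connected (strip c T)"
proof -
  have "strip c T = {s. c < Re s} \<inter> ({s. Im s < T} \<inter> {s. - T < Im s})" by (auto simp: strip_def abs_less_iff)
  moreover have "convex {s. c < Re s}" "convex {s. Im s < T}" "convex {s. - T < Im s}"
    using convex_halfspace_Re_gt[of c] convex_halfspace_Im_lt[of T] convex_halfspace_Im_gt[of "- T"] by (simp_all add: conj_commute)
  ultimately show ?thesis by (intro convex_connected) (auto intro: convex_Int)
qed

lemma strip_real: "T > 0 \<Longrightarrow> x > c \<Longrightarrow> of_real x \<in> strip c T"
  by (simp add: strip_def)

text \<open>Denominators are combined by multiplication; by the identity theorem a product of two
  that do not vanish identically does not vanish identically.\<close>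

lemma holomorphic_mult_nonzero:
  assumes U: "open U" "connected U" and f: "f holomorphic_on U" "g holomorphic_on U"
    and nz: "\<exists>s\<in>U. f s \<noteq> 0" "\<exists>s\<in>U. g s \<noteq> 0"
  shows "\<exists>s\<in>U. f s * g s \<noteq> (0::complex)"
proof (rule ccontr)
  assume "\<not> ?thesis"
  then have z: "f s * g s = 0" if "s \<in> U" for s using that by blast
  obtain s1 where s1: "s1 \<in> U" "f s1 \<noteq> 0" using nz by blast
  have "open (U \<inter> f -` (- {0}))" using U(1) holomorphic_on_imp_continuous_on[OF f(1)]
    by (intro continuous_open_preimage) auto
  moreover have "g s = 0" if "s \<in> U \<inter> f -` (- {0})" for s using z[of s] that by auto
  ultimately have "g s = 0" if "s \<in> U" for s
    using analytic_continuation_open[of "U \<inter> f -` (- {0})" U g "\<lambda>_. 0" s] U f(2) s1 that by auto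
  then show False using nz by blast
qed

text \<open>The disc is chosen for T alone and serves all left edges c. The set Z lies where Im w >
  1 + \<delta>: powers are bounded below there when Re s is bounded below, and tend to infinity with
  Re s, so that the leading coefficient outgrows any given m, in particular
  \<open>disc_mass r\<close>.\<close>

lemma moment_strip_bound:
  assumes T: "T > 0"
  obtains r where "0 < r" "r \<le> 1"
    "\<And>c. \<exists>\<eta>>0. \<forall>s\<in>strip c T. cmod (moment r 0 0 s) \<ge> \<eta>"
    "\<And>c m. \<exists>s\<in>strip c T. cmod (moment r 0 0 s) > m"
proof -
  \<comment> \<open>On the disc |Im w - 1| \<le> d \<le> 1/2 will hold, hence |ln (Im w)| \<le> 2 d
    \<le> 1 / T. The choice of r below comes from |w - \<i>|^2 = \<open>hyp\<close> * Im w \<le> 3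
    r.\<close>
  define d where "d = min (1/2) (1 / (2 * T))"
  have d: "d > 0" "d \<le> 1/2" "2 * d \<le> 1 / T" using T by (auto simp: d_def min_def field_simps)
  define r where "r = min 1 (d^2 / 3)"
  have r: "0 < r" "r \<le> 1" "3 * r \<le> d^2" using d by (auto simp: r_def)
  have lnb: "\<bar>ln (Im w)\<bar> \<le> 1 / T" if w: "w \<in> \<H>" "hyp \<i> w < r" for w
  proof -
    have wb: "w \<in> hball \<i> 1" using w r by (simp add: hball_def)
    note b = hball_1_bounds[OF wb]
    have p: "Im w > 0" using b by linarith
    have "(Im w - 1)^2 \<le> (cmod (w - \<i>))^2" by (simp add: cmod_power2)
    also have "\<dots> = hyp \<i> w * Im w" using hyp_eq[OF w(1) i_in_H] by (simp add: hyp_sym)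
    also have "\<dots> \<le> r * 3" using w b(3) p r by (intro mult_mono) auto
    also have "\<dots> \<le> d^2" using r by simp
    finally have "\<bar>Im w - 1\<bar>^2 \<le> d^2" by simp
    then have v: "\<bar>Im w - 1\<bar> \<le> d" by (rule power2_le_imp_le) (use d in simp)
    have "ln (Im w) \<le> Im w - 1" using p by (rule ln_le_minus_one)
    then have 1: "ln (Im w) \<le> 2 * d" using v d by linarith
    have h: "Im w \<ge> 1/2" using v d by linarith
    have "- ln (Im w) \<le> 1 / Im w - 1" using ln_le_minus_one[of "1 / Im w"] p by (simp add: ln_div)
    also have "\<dots> = (1 - Im w) / Im w" using p by (simp add: field_simps)
    also have "\<dots> \<le> d / (1/2)" using v d h by (intro frac_le) auto
    finally have 2: "- ln (Im w) \<le> 2 * d" by simp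
    show ?thesis using 1 2 d(3) by linarith
  qed
  have cosb: "\<bar>Im s * ln (Im w)\<bar> \<le> 1" if "\<bar>Im s\<bar> < T" "w \<in> \<H>" "hyp \<i> w < r" for s w
  proof -
    have "\<bar>Im s * ln (Im w)\<bar> \<le> T * (1 / T)" unfolding abs_mult
      using that lnb[OF that(2,3)] T by (intro mult_mono) auto
    then show ?thesis using T by simp
  qed
  \<comment> \<open>Small enough for \<i> (1 + 2 \<delta>) to lie in the disc of half the radius, so
    that Z is not empty.\<close>
  define \<delta> where "\<delta> = r / 4"
  have \<delta>: "\<delta> > 0" using r by (simp add: \<delta>_def)
  define Z where "Z = {w \<in> \<H>. hyp \<i> w < r / 2} \<inter> {w. 1 + \<delta> < Im w}"
  have "continuous_on \<H> (hyp \<i>)" using i_in_H by (intro continuous_on_hyp continuous_intros) auto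
  then have "open (hyp \<i> -` {..<r/2} \<inter> \<H>)" using open_H by (simp add: continuous_on_open_vimage)
  moreover have "hyp \<i> -` {..<r/2} \<inter> \<H> = {w \<in> \<H>. hyp \<i> w < r / 2}" by auto
  ultimately have Zo: "open Z" unfolding Z_def by (auto intro!: open_Int open_halfspace_Im_gt)
  have ZH: "Z \<subseteq> \<H>" by (auto simp: Z_def)
  have Zs: "Z \<in> sets hmeas" using Zo ZH open_H by (simp add: sets_hmeas sets_restrict_space_iff)
  have Zne: "Z \<noteq> {}"
  proof -
    let ?w = "Complex 0 (1 + 2 * \<delta>)"
    have "(cmod (\<i> - ?w))^2 = 4 * \<delta>^2" by (simp add: cmod_power2 power_mult_distrib)
    then have "hyp \<i> ?w = 4 * \<delta>^2 / (1 + 2 * \<delta>)" by (simp add: hyp_def)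
    also have "\<dots> \<le> 4 * \<delta>^2" using \<delta> by (simp add: divide_le_eq mult_le_cancel_left1)
    also have "\<dots> = r * (r / 4)" by (simp add: \<delta>_def power2_eq_square)
    also have "\<dots> \<le> 1 * (r / 4)" using r by (intro mult_right_mono) auto
    also have "\<dots> < r / 2" using r by simp
    finally have "?w \<in> Z" using \<delta> by (simp add: Z_def H_iff)
    then show ?thesis by blast
  qed
  have "emeasure hmeas Z \<le> emeasure hmeas (hball \<i> 1)"
    using r by (intro emeasure_mono hball_sets i_in_H) (auto simp: Z_def hball_def)
  then have "emeasure hmeas Z < \<infinity>" using emeasure_hball(2)[OF i_in_H, of 1] by (rule order_le_less_trans)
  then have q: "measure hmeas Z > 0"
    using emeasure_hmeas_open_pos[OF Zo Zne ZH] unfolding measure_def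
    by (simp add: enn2real_positive_iff zero_less_iff_neq_zero)
  have low: "r / 4 * L * measure hmeas Z \<le> cmod (moment r 0 0 s)"
    if "\<bar>Im s\<bar> < T" "L \<ge> 0" "\<And>w. w \<in> Z \<Longrightarrow> L \<le> Im w powr Re s" for s L
    by (rule moment_Re_lower[OF r(1,2) cosb[OF that(1)] Zs _ that(2,3)]) (auto simp: Z_def)
  show ?thesis
  proof (rule that[OF r(1,2)])
    fix c :: real
    have "cmod (moment r 0 0 s) \<ge> r / 4 * exp (- (\<bar>c\<bar> * 3)) * measure hmeas Z" if s: "s \<in> strip c T" for s
    proof (rule low)
      fix w assume w: "w \<in> Z"
      then have wb: "w \<in> hball \<i> 1" using r by (auto simp: Z_def hball_def)
      have p: "Im w > 1" using w \<delta> by (auto simp: Z_def)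
      have l: "0 < ln (Im w)" "ln (Im w) \<le> 3" using p hball_1_bounds(5)[OF wb] by auto
      have "- \<bar>c\<bar> \<le> Re s" using s by (auto simp: strip_def)
      then have "- \<bar>c\<bar> * ln (Im w) \<le> Re s * ln (Im w)" using l by (intro mult_right_mono) auto
      moreover have "\<bar>c\<bar> * ln (Im w) \<le> \<bar>c\<bar> * 3" using l by (intro mult_left_mono) auto
      ultimately show "exp (- (\<bar>c\<bar> * 3)) \<le> Im w powr Re s" using p by (simp add: powr_def)
    qed (use s in \<open>auto simp: strip_def\<close>)
    then show "\<exists>\<eta>>0. \<forall>s\<in>strip c T. cmod (moment r 0 0 s) \<ge> \<eta>"
      using r q by (intro exI[of _ "r / 4 * exp (- (\<bar>c\<bar> * 3)) * measure hmeas Z"]) auto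
  next
    fix c m :: real
    define b where "b = r / 4 * measure hmeas Z"
    have b: "b > 0" using r q by (simp add: b_def)
    obtain n where n: "m / b < (1 + \<delta>) ^ n" using real_arch_pow[of "1 + \<delta>" "m / b"] \<delta> by auto
    \<comment> \<open>A real point of the strip, to the right of c and so far out that b (1 +
      \<delta>)^k exceeds m.\<close>
    define k where "k = n + nat \<lceil>\<bar>c\<bar>\<rceil> + 1"
    have kc: "real k > c" unfolding k_def by linarith
    have "(1 + \<delta>) ^ n \<le> (1 + \<delta>) ^ k" using \<delta> by (intro power_increasing) (auto simp: k_def)
    then have "m / b < (1 + \<delta>) ^ k" using n by linarith
    then have mk: "m < b * (1 + \<delta>) ^ k" using b by (simp add: field_simps)
    have sk: "complex_of_real (real k) \<in> strip c T" using T kc by (rule strip_real)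
    have "r / 4 * (1 + \<delta>) ^ k * measure hmeas Z \<le> cmod (moment r 0 0 (of_real (real k)))"
    proof (rule low)
      fix w assume "w \<in> Z"
      then have "1 + \<delta> \<le> Im w" by (simp add: Z_def)
      then have "(1 + \<delta>) ^ k \<le> Im w ^ k" using \<delta> by (intro power_mono) auto
      then show "(1 + \<delta>) ^ k \<le> Im w powr Re (of_real (real k))"
        using \<open>1 + \<delta> \<le> Im w\<close> \<delta> by (simp add: powr_realpow)
    qed (use T \<delta> in auto)
    then have "b * (1 + \<delta>) ^ k \<le> cmod (moment r 0 0 (of_real (real k)))" by (simp add: b_def mult_ac)
    then show "\<exists>s\<in>strip c T. cmod (moment r 0 0 s) > m" using mk sk by force
  qed
qed

section \<open>Calculus of meromorphic continuations with uniform denominators\<close>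

context hyperbolic_group
begin

text \<open>Continuation to \<open>U\<close> with a denominator independent of \<open>z\<close>.\<close>

definition mero_ext :: "complex set \<Rightarrow> (complex \<Rightarrow> complex \<Rightarrow> complex) \<Rightarrow> bool" where
  "mero_ext U u \<longleftrightarrow> (\<exists>d y. d holomorphic_on U \<and> (\<exists>s\<in>U. d s \<noteq> 0) \<and> autfam U y \<and>
     (\<forall>s\<in>U. Re s > 1 \<longrightarrow> (\<forall>z\<in>\<H>. y s z = d s * u s z)))"

lemma mero_extI:
  assumes "d holomorphic_on U" "s \<in> U" "d s \<noteq> 0" "autfam U y" "\<And>s z. s \<in> U \<Longrightarrow> Re s > 1 \<Longrightarrow> z \<in> \<H> \<Longrightarrow> y s z = d s * u s z"
  shows "mero_ext U u"
  unfolding mero_ext_def using assms by blast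

lemma mero_extE:
  assumes "mero_ext U u"
  obtains d y s0 where "d holomorphic_on U" "s0 \<in> U" "d s0 \<noteq> 0" "autfam U y"
    "\<And>s z. s \<in> U \<Longrightarrow> Re s > 1 \<Longrightarrow> z \<in> \<H> \<Longrightarrow> y s z = d s * u s z"
  using assms unfolding mero_ext_def by blast

lemma mero_ext_autfam: "autfam U u \<Longrightarrow> U \<noteq> {} \<Longrightarrow> mero_ext U u"
  by (metis mero_extI[of "\<lambda>_. 1" U] all_not_in_conv holomorphic_on_const mult_1 one_neq_zero)

lemma mero_ext_add:
  assumes U: "open U" "connected U" and "mero_ext U u" "mero_ext U v"
  shows "mero_ext U (\<lambda>s z. u s z + v s z)"
proof -
  obtain d y s0 where d: "d holomorphic_on U" "s0 \<in> U" "d s0 \<noteq> 0" "autfam U y"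
    "\<And>s z. s \<in> U \<Longrightarrow> Re s > 1 \<Longrightarrow> z \<in> \<H> \<Longrightarrow> y s z = d s * u s z" by (rule mero_extE[OF assms(3)]) blast
  obtain e x s1 where e: "e holomorphic_on U" "s1 \<in> U" "e s1 \<noteq> 0" "autfam U x"
    "\<And>s z. s \<in> U \<Longrightarrow> Re s > 1 \<Longrightarrow> z \<in> \<H> \<Longrightarrow> x s z = e s * v s z" by (rule mero_extE[OF assms(4)]) blast
  obtain s2 where s2: "s2 \<in> U" "d s2 * e s2 \<noteq> 0" using holomorphic_mult_nonzero[OF U d(1) e(1)] d e by blast
  show ?thesis
  proof (rule mero_extI[where d = "\<lambda>s. d s * e s" and s = s2, OF _ s2])
    show "(\<lambda>s. d s * e s) holomorphic_on U" using d e by (intro holomorphic_intros)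
    show "autfam U (\<lambda>s z. e s * y s z + d s * x s z)" using d e by (intro autfam_add autfam_scale)
    show "e s * y s z + d s * x s z = d s * e s * (u s z + v s z)" if "s \<in> U" "Re s > 1" "z \<in> \<H>" for s z
      using d(5)[OF that] e(5)[OF that] by (simp add: algebra_simps)
  qed
qed

lemma mero_ext_scale:
  assumes g: "g holomorphic_on U" and "mero_ext U u"
  shows "mero_ext U (\<lambda>s z. g s * u s z)"
proof -
  obtain d y s0 where d: "d holomorphic_on U" "s0 \<in> U" "d s0 \<noteq> 0" "autfam U y"
    "\<And>s z. s \<in> U \<Longrightarrow> Re s > 1 \<Longrightarrow> z \<in> \<H> \<Longrightarrow> y s z = d s * u s z" by (rule mero_extE[OF assms(2)]) blast
  show ?thesis
    by (rule mero_extI[OF d(1-3) autfam_scale[OF d(4) g]]) (simp add: d(5))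
qed

lemma mero_ext_zero: "U \<noteq> {} \<Longrightarrow> mero_ext U (\<lambda>s z. 0)"
  by (intro mero_ext_autfam autfam_const bdd_inv_zero)

lemma mero_ext_sum:
  assumes U: "open U" "connected U" "U \<noteq> {}"
  shows "finite I \<Longrightarrow> (\<And>i. i \<in> I \<Longrightarrow> mero_ext U (u i)) \<Longrightarrow> mero_ext U (\<lambda>s z. \<Sum>i\<in>I. u i s z)"
proof (induction I rule: finite_induct)
  case empty
  then show ?case using mero_ext_zero[OF U(3)] by simp
next
  case (insert i I)
  then show ?case using mero_ext_add[OF U(1,2), of "u i"] by simp
qed

lemma mero_ext_Lop:
  assumes U: "open U" and k: "good_kernel \<kappa>" and "mero_ext U u"
  shows "mero_ext U (\<lambda>s. Lop \<kappa> (u s))"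
proof -
  obtain d y s0 where d: "d holomorphic_on U" "s0 \<in> U" "d s0 \<noteq> 0" "autfam U y"
    "\<And>s z. s \<in> U \<Longrightarrow> Re s > 1 \<Longrightarrow> z \<in> \<H> \<Longrightarrow> y s z = d s * u s z" by (rule mero_extE[OF assms(3)]) blast
  show ?thesis
  proof (rule mero_extI[OF d(1-3) Lop_autfam[OF U k d(4)]])
    fix s z assume s: "s \<in> U" "Re s > 1" and "z \<in> \<H>"
    have "Lop \<kappa> (y s) z = Lop \<kappa> (\<lambda>w. d s * u s w) z" by (rule Lop_cong) (simp add: d(5)[OF s])
    then show "Lop \<kappa> (y s) z = d s * Lop \<kappa> (u s) z" by (simp add: Lop_scale)
  qed
qed

lemma autfam_shift:
  assumes u: "autfam U u" and V: "\<And>s. s \<in> V \<Longrightarrow> s + k \<in> U"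
  shows "autfam V (\<lambda>s. u (s + k))"
proof (rule autfamI)
  show "(\<lambda>s. u (s + k) z) holomorphic_on V" if z: "z \<in> \<H>" for z
  proof -
    have "(\<lambda>s. u s z) \<circ> (\<lambda>s. s + k) holomorphic_on V"
      by (rule holomorphic_on_compose_gen[OF _ autfam_holomorphic[OF u z]]) (use V in \<open>auto intro!: holomorphic_intros\<close>)
    then show ?thesis by (simp add: o_def)
  qed
  fix K assume K: "compact K" "K \<subseteq> V"
  have "compact ((\<lambda>s. s + k) ` K)" using K by (intro compact_continuous_image continuous_intros)
  moreover have "(\<lambda>s. s + k) ` K \<subseteq> U" using V K by blast
  ultimately obtain B where "\<And>s w. s \<in> (\<lambda>s. s + k) ` K \<Longrightarrow> w \<in> \<H> \<Longrightarrow> cmod (u s w) \<le> B"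
    using autfam_compact_bound[OF u] by metis
  then show "\<exists>B. \<forall>s\<in>K. \<forall>z\<in>\<H>. cmod (u (s + k) z) \<le> B" by blast
qed (use autfam_measurable[OF u] autfam_invariant[OF u] V in auto)

text \<open>The point is that the shifted denominator is not identically zero on the new strip:
  otherwise the old one would vanish on a half-strip, hence everywhere by connectedness.\<close>

lemma mero_ext_shift:
  assumes E: "mero_ext (strip c' T) u" and c: "c' \<le> c + x" and x: "x \<ge> 0" and T: "T > 0"
  shows "mero_ext (strip c T) (\<lambda>s. u (s + of_real x))"
proof -
  obtain d y s0 where d: "d holomorphic_on strip c' T" "s0 \<in> strip c' T" "d s0 \<noteq> 0" "autfam (strip c' T) y"
    "\<And>s z. s \<in> strip c' T \<Longrightarrow> Re s > 1 \<Longrightarrow> z \<in> \<H> \<Longrightarrow> y s z = d s * u s z" by (rule mero_extE[OF E]) blast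
  have V: "s + of_real x \<in> strip c' T" if "s \<in> strip c T" for s using that c by (auto simp: strip_def)
  have "\<exists>s\<in>strip c T. d (s + of_real x) \<noteq> 0"
  proof (rule ccontr)
    assume n: "\<not> ?thesis"
    have z: "d s = 0" if "s \<in> strip (c + x) T" for s
    proof -
      have "s - of_real x \<in> strip c T" using that by (auto simp: strip_def)
      then have "d (s - of_real x + of_real x) = 0" using n by blast
      then show ?thesis by simp
    qed
    have "strip (c + x) T \<subseteq> strip c' T" using c by (auto simp: strip_def)
    moreover have "complex_of_real (c + x + 1) \<in> strip (c + x) T" using T by (intro strip_real) auto
    ultimately have "d s0 = 0"
      using analytic_continuation_open[of "strip (c + x) T" "strip c' T" d "\<lambda>_. 0" s0] z d(1,2) open_strip connected_strip
      by auto
    then show False using d(3) by simp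
  qed
  then obtain s1 where s1: "s1 \<in> strip c T" "d (s1 + of_real x) \<noteq> 0" by blast
  show ?thesis
  proof (rule mero_extI[where d = "\<lambda>s. d (s + of_real x)" and s = s1, OF _ s1 autfam_shift[where V = "strip c T", OF d(4) V]])
    show "(\<lambda>s. d (s + of_real x)) holomorphic_on strip c T"
    proof -
      have "d \<circ> (\<lambda>s. s + of_real x) holomorphic_on strip c T"
        by (rule holomorphic_on_compose_gen[OF _ d(1)]) (use V in \<open>auto intro!: holomorphic_intros\<close>)
      then show ?thesis by (simp add: o_def)
    qed
    show "y (s + of_real x) z = d (s + of_real x) * u (s + of_real x) z" if "s \<in> strip c T" "Re s > 1" "z \<in> \<H>" for s z
      using d(5)[OF V[OF that(1)]] that x by simp
  qed
qed

text \<open>The equation is known only where Re s > 1. Multiplied by the denominator of R its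
  right-hand side becomes holomorphic on U, \<open>fredholm\<close> then provides d and y on all of
  U, and the bounded solution \<open>u\<close> is used only where it exists.\<close>

lemma mero_ext_fredholm:
  assumes U: "open U" "connected U" and k: "good_kernel \<kappa>" and h: "h holomorphic_on U"
    and eta: "\<eta> > 0" "\<And>s. s \<in> U \<Longrightarrow> cmod (h s) \<ge> \<eta>"
    and m: "m \<ge> 0" "\<And>v V z. (\<And>w. w \<in> \<H> \<Longrightarrow> cmod (v w) \<le> V) \<Longrightarrow> V \<ge> 0 \<Longrightarrow> z \<in> \<H> \<Longrightarrow> cmod (Lop \<kappa> v z) \<le> m * V"
    and s0: "s0 \<in> U" "cmod (h s0) > m" and R: "mero_ext U R"
    and u: "\<And>s. s \<in> U \<Longrightarrow> Re s > 1 \<Longrightarrow> bdd_inv (u s)"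
    and eq: "\<And>s z. s \<in> U \<Longrightarrow> Re s > 1 \<Longrightarrow> z \<in> \<H> \<Longrightarrow> h s * u s z - Lop \<kappa> (u s) z = R s z"
  shows "mero_ext U u"
proof -
  obtain d v s1 where d: "d holomorphic_on U" "s1 \<in> U" "d s1 \<noteq> 0" "autfam U v"
    "\<And>s z. s \<in> U \<Longrightarrow> Re s > 1 \<Longrightarrow> z \<in> \<H> \<Longrightarrow> v s z = d s * R s z" by (rule mero_extE[OF R]) blast
  have "\<exists>e y. e holomorphic_on U \<and> e s0 \<noteq> 0 \<and> autfam U y \<and> (\<forall>s\<in>U. \<forall>u. bdd_inv u \<longrightarrow>
      (\<forall>z\<in>\<H>. h s * u z - Lop \<kappa> u z = v s z) \<longrightarrow> (\<forall>z\<in>\<H>. e s * u z = y s z))"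
    by (rule fredholm[of U \<kappa> h \<eta> m s0 v]) (fact U(1) k h eta m s0 d(4) | blast)+
  then obtain e y where e: "e holomorphic_on U" "e s0 \<noteq> 0" "autfam U y"
    "\<And>s u z. s \<in> U \<Longrightarrow> bdd_inv u \<Longrightarrow> (\<And>z. z \<in> \<H> \<Longrightarrow> h s * u z - Lop \<kappa> u z = v s z) \<Longrightarrow> z \<in> \<H> \<Longrightarrow> e s * u z = y s z"
    by blast
  obtain s2 where s2: "s2 \<in> U" "e s2 * d s2 \<noteq> 0" using holomorphic_mult_nonzero[OF U e(1) d(1)] e(2) d(2,3) s0(1) by blast
  show ?thesis
  proof (rule mero_extI[where d = "\<lambda>s. e s * d s" and s = s2, OF _ s2 e(3)])
    show "(\<lambda>s. e s * d s) holomorphic_on U" using d e by (intro holomorphic_intros)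
    fix s z assume s: "s \<in> U" "Re s > 1" and z: "z \<in> \<H>"
    have "h s * (d s * u s w) - Lop \<kappa> (\<lambda>w. d s * u s w) w = v s w" if w: "w \<in> \<H>" for w
      unfolding Lop_scale d(5)[OF s w] eq[OF s w, symmetric] by (simp add: algebra_simps)
    then have "e s * (d s * u s z) = y s z" using e(4)[OF s(1) bdd_inv_scale[OF u[OF s]] _ z] by blast
    then show "y s z = e s * d s * u s z" by (simp add: mult.assoc)
  qed
qed

text \<open>Natural bounds have an exponent that varies with s; on a compact set the smallest real
  part is attained and gives one exponent, because \<open>ht\<close> \<le> 1.\<close>

lemma cylfam_I:
  assumes c: "\<And>s. s \<in> U \<Longrightarrow> continuous_on \<H> (\<psi> s)" and h: "\<And>z. z \<in> \<H> \<Longrightarrow> (\<lambda>s. \<psi> s z) holomorphic_on U"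
    and i: "\<And>s z. s \<in> U \<Longrightarrow> z \<in> \<H> \<Longrightarrow> \<psi> s (of_real \<mu> * z) = \<psi> s z"
    and b: "\<And>s. s \<in> U \<Longrightarrow> Re s + b > 1"
    and B: "\<And>K. compact K \<Longrightarrow> K \<subseteq> U \<Longrightarrow> \<exists>C\<ge>0. \<forall>s\<in>K. \<forall>z\<in>\<H>. cmod (\<psi> s z) \<le> C * ht z powr (Re s + b)"
  shows "cylfam U \<psi>"
  unfolding cylfam_def
proof (intro conjI ballI allI impI)
  fix K assume K: "compact K \<and> K \<subseteq> U"
  show "\<exists>\<sigma>>1. \<exists>B\<ge>0. \<forall>s\<in>K. \<forall>z\<in>\<H>. cmod (\<psi> s z) \<le> B * ht z powr \<sigma>"
  proof (cases "K = {}")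
    case True
    then show ?thesis by (intro exI[of _ 2]) auto
  next
    case False
    have "continuous_on K Re" by (intro continuous_intros)
    then obtain s1 where s1: "s1 \<in> K" "\<And>s. s \<in> K \<Longrightarrow> Re s1 \<le> Re s"
      using continuous_attains_inf[of K Re] K False by blast
    obtain C where C: "C \<ge> 0" "\<forall>s\<in>K. \<forall>z\<in>\<H>. cmod (\<psi> s z) \<le> C * ht z powr (Re s + b)" using B K by blast
    have "cmod (\<psi> s z) \<le> C * ht z powr (Re s1 + b)" if s: "s \<in> K" and z: "z \<in> \<H>" for s z
    proof -
      have "ht z powr (Re s + b) \<le> ht z powr (Re s1 + b)"
        using ht_pos[OF z] ht_le_1[of z] s1(2)[OF s] by (intro powr_mono') auto
      then have "C * ht z powr (Re s + b) \<le> C * ht z powr (Re s1 + b)" using C(1) by (intro mult_left_mono) auto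
      then show ?thesis using C(2) s z order_trans by blast
    qed
    moreover have "Re s1 + b > 1" using b s1 K by blast
    ultimately show ?thesis using C(1) by blast
  qed
qed (use c h i in auto)

lemma cylfam_\<phi>: "cylfam {s. Re s > 1} \<phi>"
proof (rule cylfam_I[where b = 0])
  show "(\<lambda>s. \<phi> s z) holomorphic_on {s. 1 < Re s}" if "z \<in> \<H>" for z
    using ht_pos[OF that] by (intro holomorphic_cpow holomorphic_on_ident)
  show "\<exists>C\<ge>0. \<forall>s\<in>K. \<forall>z\<in>\<H>. cmod (\<phi> s z) \<le> C * ht z powr (Re s + 0)" for K
    using norm_cpow[OF ht_pos] by (intro exI[of _ 1]) auto
qed (auto simp: ht_\<mu> \<phi>_continuous)

lemma poinc_has_sum:
  assumes "cylfam U \<psi>" "s \<in> U" "z \<in> \<H>"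
  shows "((\<lambda>C. \<psi> s (psl2_act (coset_rep C) z)) has_sum poinc (\<psi> s) z) cosets"
    "(\<lambda>C. cmod (\<psi> s (psl2_act (coset_rep C) z))) summable_on cosets"
proof -
  obtain \<sigma> B where b: "\<sigma> > 1" "B \<ge> 0" "\<And>z. z \<in> \<H> \<Longrightarrow> cmod (\<psi> s z) \<le> B * ht z powr \<sigma>"
    using cylfam_bound[OF assms(1,2)] by blast
  show s: "(\<lambda>C. cmod (\<psi> s (psl2_act (coset_rep C) z))) summable_on cosets" by (rule poinc_summable[OF b(3,2,1) assms(3)])
  then have "(\<lambda>C. \<psi> s (psl2_act (coset_rep C) z)) summable_on cosets" by (rule abs_summable_summable)
  then show "((\<lambda>C. \<psi> s (psl2_act (coset_rep C) z)) has_sum poinc (\<psi> s) z) cosets"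
    unfolding poinc_def by (rule has_sum_infsum)
qed

section \<open>The partial series and their averaged equation\<close>

definition E_part :: "(nat \<Rightarrow> complex \<Rightarrow> real) \<Rightarrow> nat set \<Rightarrow> complex \<Rightarrow> complex \<Rightarrow> complex" where
  "E_part A S s = poinc (\<lambda>z. of_real (\<Prod>k\<in>S. A k z) * \<phi> s z)"

lemma E_part_cylfam:
  assumes "finite S" "\<And>k. k \<in> S \<Longrightarrow> additive (A k)"
  shows "cylfam {s. Re s > 1} (\<lambda>s z. of_real (\<Prod>k\<in>S. A k z) * \<phi> s z)"
  by (rule cylfam_mult_additives[OF assms cylfam_\<phi>])

lemma E_part_autfam:
  assumes "finite S" "\<And>k. k \<in> S \<Longrightarrow> additive (A k)"
  shows "autfam {s. Re s > 1} (E_part A S)"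
  unfolding E_part_def by (rule poinc_autfam[OF open_Re_gt E_part_cylfam[OF assms]])

text \<open>Averaging the summands of \<open>E_part A S\<close> over small discs in two ways.\<close>

lemma E_part_functional_equation:
  assumes S: "finite S" "\<And>k. k \<in> S \<Longrightarrow> additive (A k)" and r: "0 < r" "r \<le> 1"
    and s: "Re s > 1" and z: "z \<in> \<H>"
    and rem: "cylfam V (\<lambda>s z. Lop (disc_kernel r) (\<phi> s) z - (\<Sum>j<N. a j s * \<phi> (s + of_nat (2 * j)) z))" "s \<in> V"
  shows "(\<Sum>T\<in>Pow S. Lop (\<lambda>z w. disc_kernel r z w * of_real (\<Prod>k\<in>T. A k z - A k w)) (E_part A (S - T) s) z) =
    (\<Sum>j<N. a j s * E_part A S (s + of_nat (2 * j)) z) +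
    poinc (\<lambda>z. of_real (\<Prod>k\<in>S. A k z) * (Lop (disc_kernel r) (\<phi> s) z - (\<Sum>j<N. a j s * \<phi> (s + of_nat (2 * j)) z))) z"
    (is "?L = ?R")
proof -
  let ?g = "\<lambda>C. psl2_act (coset_rep C)"
  let ?\<kappa> = "\<lambda>T z w. disc_kernel r z w * complex_of_real (\<Prod>k\<in>T. A k z - A k w)"
  let ?\<psi> = "\<lambda>S s z. complex_of_real (\<Prod>k\<in>S. A k z) * \<phi> s z"
  \<comment> \<open>Both sides are evaluations of the sum of these terms over the cosets, in which
    the product of primitives stays outside the average.\<close>
  let ?I = "\<lambda>C. complex_of_real (\<Prod>k\<in>S. A k (?g C z)) * Lop (disc_kernel r) (\<phi> s) (?g C z)"
  have sub: "finite T" "\<And>k. k \<in> T \<Longrightarrow> additive (A k)" "finite (S - T)" "\<And>k. k \<in> S - T \<Longrightarrow> additive (A k)"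
    if "T \<in> Pow S" for T
    using that S finite_subset by auto
  have gk: "good_kernel (?\<kappa> T)" if "T \<in> Pow S" for T
    by (rule good_kernel_mult_additives[OF sub(1,2)[OF that] good_kernel_disc_kernel[OF r]])
  have CFT: "cylfam {s. Re s > 1} (?\<psi> (S - T))" if "T \<in> Pow S" for T by (rule E_part_cylfam[OF sub(3,4)[OF that]])
  have hs: "((\<lambda>C. \<integral>w. ?\<kappa> T z w * ?\<psi> (S - T) s (?g C w) \<partial>hmeas) has_sum Lop (?\<kappa> T) (E_part A (S - T) s) z) cosets"
    if T: "T \<in> Pow S" for T
  proof -
    obtain \<sigma> B where b: "\<sigma> > 1" "B \<ge> 0" "\<And>z. z \<in> \<H> \<Longrightarrow> cmod (?\<psi> (S - T) s z) \<le> B * ht z powr \<sigma>"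
      using cylfam_bound[OF CFT[OF T], of s] s by blast
    have "continuous_on \<H> (?\<psi> (S - T) s)" using CFT[OF T] s by (simp add: cylfam_def)
    from Lop_poinc[OF gk[OF T] b(3,2,1) this z] show ?thesis unfolding E_part_def .
  qed
  \<comment> \<open>Substituting g w for w moves the average back to \<open>z\<close>, so that the
    same kernels in z and w occur for every coset.\<close>
  have IC: "?I C = (\<Sum>T\<in>Pow S. \<integral>w. ?\<kappa> T z w * ?\<psi> (S - T) s (?g C w) \<partial>hmeas)" if C: "C \<in> cosets" for C
  proof -
    have g: "coset_rep C \<in> \<Gamma>" using coset_rep_in[OF C] .
    have gz: "?g C z \<in> \<H>" using act_H[OF g z] .
    have m: "(\<lambda>w. disc_kernel r (?g C z) w * \<phi> s w) \<in> borel_measurable hmeas"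
      by (rule borel_measurable_times[OF good_kernel_measurable[OF good_kernel_disc_kernel[OF r] gz] \<phi>_measurable])
    have "Lop (disc_kernel r) (\<phi> s) (?g C z) = (\<integral>w. disc_kernel r (?g C z) (?g C w) * \<phi> s (?g C w) \<partial>hmeas)"
      unfolding Lop_def using integral_hmeas_comp[OF distr_act[OF g] measurable_act[OF g] m] by simp
    also have "\<dots> = (\<integral>w. disc_kernel r z w * \<phi> s (?g C w) \<partial>hmeas)"
      using hyp_act[OF g z] by (intro Bochner_Integration.integral_cong) (auto simp: disc_kernel_def)
    finally have "?I C = (\<integral>w. complex_of_real (\<Prod>k\<in>S. A k (?g C z)) * (disc_kernel r z w * \<phi> s (?g C w)) \<partial>hmeas)" by simp
    also have "\<dots> = (\<integral>w. (\<Sum>T\<in>Pow S. ?\<kappa> T z w * ?\<psi> (S - T) s (?g C w)) \<partial>hmeas)"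
    proof (rule Bochner_Integration.integral_cong[OF refl])
      fix w assume "w \<in> space hmeas"
      then have w: "w \<in> \<H>" by simp
      \<comment> \<open>Periods cancel in A(g z) = (A z - A w) + A(g w). The first summand is
        independent of the coset and joins the kernel; the second belongs to a partial series at
        w.\<close>
      have "(\<Prod>k\<in>S. A k (?g C z)) = (\<Prod>k\<in>S. (A k z - A k w) + A k (?g C w))"
      proof (rule prod.cong[OF refl])
        fix k assume "k \<in> S"
        then show "A k (?g C z) = (A k z - A k w) + A k (?g C w)" using additive_diff[OF S(2) g z w, of k] by simp
      qed
      also have "\<dots> = (\<Sum>T\<in>Pow S. (\<Prod>k\<in>T. A k z - A k w) * (\<Prod>k\<in>S - T. A k (?g C w)))" by (rule prod_add[OF S(1)])
      finally show "complex_of_real (\<Prod>k\<in>S. A k (?g C z)) * (disc_kernel r z w * \<phi> s (?g C w)) = (\<Sum>T\<in>Pow S. ?\<kappa> T z w * ?\<psi> (S - T) s (?g C w))"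
        by (simp only: of_real_sum of_real_mult sum_distrib_right) (intro sum.cong refl, simp only: mult_ac)
    qed
    also have "\<dots> = (\<Sum>T\<in>Pow S. \<integral>w. ?\<kappa> T z w * ?\<psi> (S - T) s (?g C w) \<partial>hmeas)"
    proof (rule Bochner_Integration.integral_sum)
      fix T assume T: "T \<in> Pow S"
      obtain \<sigma> B where b: "\<sigma> > 1" "B \<ge> 0" "\<And>z. z \<in> \<H> \<Longrightarrow> cmod (?\<psi> (S - T) s z) \<le> B * ht z powr \<sigma>"
        using cylfam_bound[OF CFT[OF T], of s] s by blast
      have "continuous_on \<H> (?\<psi> (S - T) s)" using CFT[OF T] s by (simp add: cylfam_def)
      then have "?\<psi> (S - T) s \<in> borel_measurable hmeas" by (rule borel_measurable_hmeasI)
      from measurable_compose[OF measurable_act[OF g] this]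
      show "integrable hmeas (\<lambda>w. ?\<kappa> T z w * ?\<psi> (S - T) s (?g C w))"
      proof (rule Lop_integrable[OF gk[OF T] z])
        fix w assume w: "w \<in> \<H>"
        have gw: "?g C w \<in> \<H>" using act_H[OF g w] .
        have "ht (?g C w) powr \<sigma> \<le> 1" using ht_pos[OF gw] ht_le_1 b(1) by (intro powr_le1) auto
        then have "B * ht (?g C w) powr \<sigma> \<le> B * 1" using b(2) by (intro mult_left_mono) auto
        then show "cmod (?\<psi> (S - T) s (?g C w)) \<le> B" using b(3)[OF gw] by simp
      qed
    qed
    finally show ?thesis .
  qed
  have "((\<lambda>C. \<Sum>T\<in>Pow S. \<integral>w. ?\<kappa> T z w * ?\<psi> (S - T) s (?g C w) \<partial>hmeas) has_sum ?L) cosets"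
    using S(1) hs by (intro has_sum_finite_sum) auto
  then have 1: "(?I has_sum ?L) cosets" using IC by (subst has_sum_cong) auto
  have CFS: "cylfam {s. Re s > 1} (?\<psi> S)" by (rule E_part_cylfam[OF S])
  have h1: "((\<lambda>C. \<Sum>j<N. a j s * ?\<psi> S (s + of_nat (2 * j)) (?g C z)) has_sum (\<Sum>j<N. a j s * E_part A S (s + of_nat (2 * j)) z)) cosets"
  proof (intro has_sum_finite_sum has_sum_cmult_right finite_lessThan)
    fix j
    have "s + of_nat (2 * j) \<in> {s. Re s > 1}" using s by simp
    from poinc_has_sum(1)[OF CFS this z]
    show "((\<lambda>C. ?\<psi> S (s + of_nat (2 * j)) (?g C z)) has_sum E_part A S (s + of_nat (2 * j)) z) cosets" unfolding E_part_def .
  qed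
  have h2: "((\<lambda>C. of_real (\<Prod>k\<in>S. A k (?g C z)) * (Lop (disc_kernel r) (\<phi> s) (?g C z) - (\<Sum>j<N. a j s * \<phi> (s + of_nat (2 * j)) (?g C z)))) has_sum
     poinc (\<lambda>z. of_real (\<Prod>k\<in>S. A k z) * (Lop (disc_kernel r) (\<phi> s) z - (\<Sum>j<N. a j s * \<phi> (s + of_nat (2 * j)) z))) z) cosets"
    by (rule poinc_has_sum(1)[OF cylfam_mult_additives[OF S rem(1)] rem(2) z])
  \<comment> \<open>The second evaluation inserts the expansion of the averaged power into each
    term.\<close>
  have "(?I has_sum ?R) cosets"
  proof -
    have e: "?I C = (\<Sum>j<N. a j s * ?\<psi> S (s + of_nat (2 * j)) (?g C z)) +
       of_real (\<Prod>k\<in>S. A k (?g C z)) * (Lop (disc_kernel r) (\<phi> s) (?g C z) - (\<Sum>j<N. a j s * \<phi> (s + of_nat (2 * j)) (?g C z)))" for C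
      unfolding right_diff_distrib sum_distrib_left mult.left_commute[of "a _ s"] by simp
    show ?thesis unfolding e by (rule has_sum_add[OF h1 h2])
  qed
  with 1 show ?thesis by (rule has_sum_unique)
qed

text \<open>The gain of n + 1 powers of the height moves the condition Re s > 1 to Re s >
  -n.\<close>

lemma rem_cylfam:
  assumes r: "0 < r" "r \<le> 1" and a: "\<And>j. a j holomorphic_on UNIV"
    and b: "\<And>K. compact K \<Longrightarrow> \<exists>C\<ge>0. \<forall>s\<in>K. \<forall>z\<in>\<H>.
       cmod (Lop (disc_kernel r) (\<phi> s) z - (\<Sum>j<N. a j s * \<phi> (s + of_nat (2 * j)) z)) \<le> C * ht z powr (Re s + Suc n)"
  shows "cylfam {s. Re s > - real n} (\<lambda>s z. Lop (disc_kernel r) (\<phi> s) z - (\<Sum>j<N. a j s * \<phi> (s + of_nat (2 * j)) z))"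
proof (rule cylfam_I[where b = "real (Suc n)"])
  have k: "good_kernel (disc_kernel r)" by (rule good_kernel_disc_kernel[OF r])
  show "continuous_on \<H> (\<lambda>z. Lop (disc_kernel r) (\<phi> s) z - (\<Sum>j<N. a j s * \<phi> (s + of_nat (2 * j)) z))" for s
    by (intro continuous_on_diff continuous_on_sum continuous_on_mult continuous_on_const Lop_\<phi>_continuous[OF k] \<phi>_continuous)
  show "Lop (disc_kernel r) (\<phi> s) (of_real \<mu> * z) - (\<Sum>j<N. a j s * \<phi> (s + of_nat (2 * j)) (of_real \<mu> * z)) =
    Lop (disc_kernel r) (\<phi> s) z - (\<Sum>j<N. a j s * \<phi> (s + of_nat (2 * j)) z)" if "z \<in> \<H>" for s z
    using Lop_\<phi>_invariant[OF k that] by (simp add: ht_\<mu>)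
  show "(\<lambda>s. Lop (disc_kernel r) (\<phi> s) z - (\<Sum>j<N. a j s * \<phi> (s + of_nat (2 * j)) z)) holomorphic_on {s. - real n < Re s}"
    if z: "z \<in> \<H>" for z
    using holomorphic_on_subset[OF Lop_\<phi>_holomorphic[OF r z] subset_UNIV] holomorphic_on_subset[OF a subset_UNIV] ht_pos[OF z]
    by (intro holomorphic_on_diff holomorphic_on_sum holomorphic_on_mult holomorphic_cpow holomorphic_intros) auto
  show "Re s + real (Suc n) > 1" if "s \<in> {s. - real n < Re s}" for s using that by simp
qed (use b in auto)

text \<open>Two nested inductions: the shifted series of the same S are known from the previous
  strip, and the series of proper subsets from the present one. The left-hand side then contains
  E_S(s) only through a_0(s) - L. The statement is for all T, but each T keeps its own disc
  throughout a step.\<close>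

theorem E_part_mero_ext:
  assumes I: "finite I" "\<And>k. k \<in> I \<Longrightarrow> additive (A k)"
  shows "S \<subseteq> I \<Longrightarrow> T > 0 \<Longrightarrow> mero_ext (strip (1 - 2 * real J) T) (E_part A S)"
proof (induction J arbitrary: S T)
  case 0
  have "finite S" "\<And>k. k \<in> S \<Longrightarrow> additive (A k)" using 0 I finite_subset by auto
  then have "autfam {s. Re s > 1} (E_part A S)" by (rule E_part_autfam)
  then have "autfam (strip (1 - 2 * real 0) T) (E_part A S)" by (rule autfam_subset) (auto simp: strip_def)
  moreover have "strip (1 - 2 * real 0) T \<noteq> {}" using strip_real[of T 1 2] 0 by auto
  ultimately show ?case by (rule mero_ext_autfam)
next
  case (Suc J)
  let ?U = "strip (1 - 2 * real (Suc J)) T"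
  have T: "T > 0" by fact
  have U: "open ?U" "connected ?U" "?U \<noteq> {}"
    using open_strip connected_strip strip_real[OF T, of "1 - 2 * real (Suc J)" 2] by auto
  obtain r where r: "0 < r" "r \<le> 1"
    "\<And>c. \<exists>\<eta>>0. \<forall>s\<in>strip c T. cmod (moment r 0 0 s) \<ge> \<eta>"
    "\<And>c m. \<exists>s\<in>strip c T. cmod (moment r 0 0 s) > m" using moment_strip_bound[OF T] by blast
  obtain \<eta> where \<eta>: "\<eta> > 0" "\<And>s. s \<in> ?U \<Longrightarrow> cmod (moment r 0 0 s) \<ge> \<eta>" using r(3) by blast
  \<comment> \<open>The point far to the right at which h - L is invertible for reasons of size; it
    keeps the Fredholm denominator from vanishing identically.\<close>
  obtain s0 where s0: "s0 \<in> ?U" "cmod (moment r 0 0 s0) > disc_mass r" using r(4) by blast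
  have k: "good_kernel (disc_kernel r)" by (rule good_kernel_disc_kernel[OF r(1,2)])
  \<comment> \<open>The new edge 1 - 2 (J + 1) = -2 J - 1 lies to the right of -n, so the remainder
    series converges on the whole new strip.\<close>
  define n where "n = 2 * J + 2"
  have "\<exists>N a. (\<forall>j. a j holomorphic_on UNIV) \<and> a 0 = moment r 0 0 \<and> N > 0 \<and>
      (\<forall>K. compact K \<longrightarrow> (\<exists>C\<ge>0. \<forall>s\<in>K. \<forall>z\<in>\<H>.
       cmod (Lop (disc_kernel r) (\<phi> s) z - (\<Sum>j<N. a j s * \<phi> (s + of_nat (2 * j)) z)) \<le> C * ht z powr (Re s + Suc n)))"
    by (rule Lop_\<phi>_expansion[OF r(1,2), where n = n]) blast
  then obtain N :: nat and a where a: "\<And>j. a j holomorphic_on UNIV" "a 0 = moment r 0 0" "N > 0"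
    "\<And>K. compact K \<Longrightarrow> \<exists>C\<ge>0. \<forall>s\<in>K. \<forall>z\<in>\<H>.
       cmod (Lop (disc_kernel r) (\<phi> s) z - (\<Sum>j<N. a j s * \<phi> (s + of_nat (2 * j)) z)) \<le> C * ht z powr (Re s + Suc n)"
    by blast
  let ?rem = "\<lambda>s z. Lop (disc_kernel r) (\<phi> s) z - (\<Sum>j<N. a j s * \<phi> (s + of_nat (2 * j)) z)"
  have remCF: "cylfam {s. Re s > - real n} ?rem" by (rule rem_cylfam[OF r(1,2) a(1,4)])
  have Un: "?U \<subseteq> {s. Re s > - real n}" by (auto simp: strip_def n_def)
  have ah: "a j holomorphic_on ?U" for j using a(1) holomorphic_on_subset by blast
  have "finite S" using Suc.prems I finite_subset by blast
  then show ?case using Suc.prems(1)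
  proof (induction S rule: finite_psubset_induct)
    case (psubset S)
    have S: "finite S" "\<And>k. k \<in> S \<Longrightarrow> additive (A k)" using psubset I by auto
    let ?\<kappa> = "\<lambda>T z w. disc_kernel r z w * complex_of_real (\<Prod>k\<in>T. A k z - A k w)"
    \<comment> \<open>All of the averaged equation except (h - L) applied to the series itself: the
      nonempty T, the shifts j \<ge> 1, and the remainder.\<close>
    define Rr where "Rr s z = (\<Sum>T\<in>Pow S - {{}}. Lop (?\<kappa> T) (E_part A (S - T) s) z) +
      ((\<Sum>j\<in>{1..<N}. (- a j s) * E_part A S (s + of_nat (2 * j)) z) +
       (-1) * poinc (\<lambda>z. of_real (\<Prod>k\<in>S. A k z) * ?rem s z) z)" for s z
    have ER: "mero_ext ?U Rr"
      unfolding Rr_def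
    proof (intro mero_ext_add[OF U(1,2)] mero_ext_sum[OF U] mero_ext_scale)
      fix T' assume T': "T' \<in> Pow S - {{}}"
      then have "S - T' \<subset> S" "S - T' \<subseteq> I" using psubset.prems by auto
      then have "mero_ext ?U (E_part A (S - T'))" using psubset.IH by blast
      moreover have "good_kernel (?\<kappa> T')"
        using T' S finite_subset by (intro good_kernel_mult_additives k) auto
      ultimately show "mero_ext ?U (\<lambda>s. Lop (?\<kappa> T') (E_part A (S - T') s))" using mero_ext_Lop[OF U(1)] by blast
    next
      fix j assume j: "j \<in> {1..<N}"
      have "mero_ext (strip (1 - 2 * real J) T) (E_part A S)" using Suc.IH psubset.prems T by blast
      \<comment> \<open>As j \<ge> 1, the shift by 2 j \<ge> 2 leads from the new strip into the old
        one.\<close>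
      then have "mero_ext ?U (\<lambda>s. E_part A S (s + of_real (2 * real j)))"
        using j T by (intro mero_ext_shift[where c' = "1 - 2 * real J"]) auto
      then show "mero_ext ?U (\<lambda>s. E_part A S (s + of_nat (2 * j)))" by simp
    next
      show "mero_ext ?U (\<lambda>s. poinc (\<lambda>z. of_real (\<Prod>k\<in>S. A k z) * ?rem s z))"
        using autfam_subset[OF poinc_autfam[OF open_Re_gt cylfam_mult_additives[OF S remCF]] Un] U(3) by (rule mero_ext_autfam)
    qed (rule holomorphic_on_minus ah holomorphic_on_const | simp add: S(1))+
    show "mero_ext ?U (E_part A S)"
    proof (rule mero_ext_fredholm[where h = "moment r 0 0" and \<eta> = \<eta> and m = "disc_mass r" and \<kappa> = "disc_kernel r" and ?s0.0 = s0 and R = Rr, OF U(1,2) k])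
      show "moment r 0 0 holomorphic_on ?U" using holomorphic_moment[OF r(2)] holomorphic_on_subset by blast
      fix s assume s: "s \<in> ?U" "Re s > 1"
      have "autfam {s. Re s > 1} (E_part A S)" using S by (rule E_part_autfam)
      then show "bdd_inv (E_part A S s)" using autfam_bdd_inv s by blast
      fix z assume z: "z \<in> \<H>"
      have "s \<in> {s. Re s > - real n}" using s Un by blast
      note fe = E_part_functional_equation[where A = A and S = S, OF S r(1,2) s(2) z remCF this]
      have L0: "Lop (?\<kappa> {}) (E_part A (S - {}) s) z = Lop (disc_kernel r) (E_part A S s) z" by simp
      \<comment> \<open>The empty T gives the untwisted operator on the full series, which goes to
        the left-hand side.\<close>
      have P: "(\<Sum>T\<in>Pow S. Lop (?\<kappa> T) (E_part A (S - T) s) z) =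
         Lop (disc_kernel r) (E_part A S s) z + (\<Sum>T\<in>Pow S - {{}}. Lop (?\<kappa> T) (E_part A (S - T) s) z)"
        using S(1) L0 by (subst sum.remove[of "Pow S" "{}"]) auto
      have "{..<N} - {0} = {1..<N}" by auto
      then have Q: "(\<Sum>j<N. a j s * E_part A S (s + of_nat (2 * j)) z) =
         moment r 0 0 s * E_part A S s z + (\<Sum>j\<in>{1..<N}. a j s * E_part A S (s + of_nat (2 * j)) z)"
        using a(2,3) by (subst sum.remove[of "{..<N}" 0]) auto
      show "moment r 0 0 s * E_part A S s z - Lop (disc_kernel r) (E_part A S s) z = Rr s z"
        using fe unfolding P Q Rr_def by (simp add: sum_negf algebra_simps)
    next
      fix v V z assume "\<And>w. w \<in> \<H> \<Longrightarrow> cmod (v w) \<le> V" "V \<ge> 0" "z \<in> \<H>"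
      then show "cmod (Lop (disc_kernel r) v z) \<le> disc_mass r * V" by (rule Lop_disc_kernel_bound[OF r(1,2)])
    qed (use ER \<eta> disc_mass_nonneg s0 in auto)
  qed
qed

end

section \<open>Gluing the strips\<close>

lemma UN_strip: "\<exists>J. s \<in> strip (1 - 2 * real J) (real J + 1)"
proof -
  obtain J :: nat where J: "\<bar>Re s\<bar> + \<bar>Im s\<bar> + 1 < real J" using reals_Archimedean2 by blast
  then have "1 - 2 * real J < Re s" "\<bar>Im s\<bar> < real J + 1" by linarith+
  then show ?thesis unfolding strip_def by blast
qed

text \<open>The scalar form of \<open>mero_ext\<close> for fixed z, needed because the coefficients
  of the final expansion depend on z through values A z, which are neither bounded nor
  invariant.\<close>

definition mero_ext_at :: "complex set \<Rightarrow> (complex \<Rightarrow> complex) \<Rightarrow> bool" where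
  "mero_ext_at U g \<longleftrightarrow> (\<exists>d y. d holomorphic_on U \<and> (\<exists>s\<in>U. d s \<noteq> 0) \<and> y holomorphic_on U \<and>
     (\<forall>s\<in>U. Re s > 1 \<longrightarrow> y s = d s * g s))"

lemma mero_ext_at_scale:
  assumes "mero_ext_at U g"
  shows "mero_ext_at U (\<lambda>s. c * g s)"
proof -
  obtain d y where d: "d holomorphic_on U" "\<exists>s\<in>U. d s \<noteq> 0" "y holomorphic_on U" "\<forall>s\<in>U. Re s > 1 \<longrightarrow> y s = d s * g s"
    using assms unfolding mero_ext_at_def by blast
  have "(\<lambda>s. c * y s) holomorphic_on U" using d(3) by (intro holomorphic_intros)
  then show ?thesis unfolding mero_ext_at_def using d by (intro exI[of _ d] exI[of _ "\<lambda>s. c * y s"]) auto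
qed

lemma mero_ext_at_add:
  assumes U: "open U" "connected U" and "mero_ext_at U f" "mero_ext_at U g"
  shows "mero_ext_at U (\<lambda>s. f s + g s)"
proof -
  obtain d y where d: "d holomorphic_on U" "\<exists>s\<in>U. d s \<noteq> 0" "y holomorphic_on U" "\<forall>s\<in>U. Re s > 1 \<longrightarrow> y s = d s * f s"
    using assms(3) unfolding mero_ext_at_def by blast
  obtain e x where e: "e holomorphic_on U" "\<exists>s\<in>U. e s \<noteq> 0" "x holomorphic_on U" "\<forall>s\<in>U. Re s > 1 \<longrightarrow> x s = e s * g s"
    using assms(4) unfolding mero_ext_at_def by blast
  have "(\<lambda>s. d s * e s) holomorphic_on U" "(\<lambda>s. e s * y s + d s * x s) holomorphic_on U"
    using d(1,3) e(1,3) by (auto intro!: holomorphic_intros)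
  moreover have "\<exists>s\<in>U. d s * e s \<noteq> 0" by (rule holomorphic_mult_nonzero[OF U d(1) e(1) d(2) e(2)])
  moreover have "\<forall>s\<in>U. Re s > 1 \<longrightarrow> e s * y s + d s * x s = d s * e s * (f s + g s)"
    using d(4) e(4) by (simp add: algebra_simps)
  ultimately show ?thesis unfolding mero_ext_at_def by blast
qed

lemma mero_ext_at_zero: "U \<noteq> {} \<Longrightarrow> mero_ext_at U (\<lambda>s. 0)"
  unfolding mero_ext_at_def by (intro exI[of _ "\<lambda>_. 1"] exI[of _ "\<lambda>_. 0"]) auto

lemma mero_ext_at_sum:
  assumes U: "open U" "connected U" "U \<noteq> {}"
  shows "finite I \<Longrightarrow> (\<And>i. i \<in> I \<Longrightarrow> mero_ext_at U (f i)) \<Longrightarrow> mero_ext_at U (\<lambda>s. \<Sum>i\<in>I. f i s)"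
  by (induction I rule: finite_induct) (auto intro: mero_ext_at_zero[OF U(3)] mero_ext_at_add[OF U(1,2)])

text \<open>The strips increase to the plane, and every one carries a quotient that equals G for Re
  s > 1. The identity theorem makes the quotients agree where both are defined.\<close>

lemma meromorphic_glue:
  assumes G: "G holomorphic_on {s. Re s > 1}"
    and ext: "\<And>J. mero_ext_at (strip (1 - 2 * real J) (real J + 1)) G"
  obtains F where "F meromorphic_on UNIV" "F analytic_on {s. Re s > 1}" "\<And>s. Re s > 1 \<Longrightarrow> F s = G s"
proof -
  define U where "U J = strip (1 - 2 * real J) (real J + 1)" for J
  have U: "open (U J)" "connected (U J)" for J
    unfolding U_def using open_strip connected_strip by auto
  have mono: "U i \<subseteq> U j" if "i \<le> j" for i j
    unfolding U_def strip_def using that by auto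
  have "\<exists>d y. d holomorphic_on U J \<and> (\<exists>s\<in>U J. d s \<noteq> 0) \<and> y holomorphic_on U J \<and>
     (\<forall>s\<in>U J. Re s > 1 \<longrightarrow> y s = d s * G s)" for J
    using ext[of J] unfolding mero_ext_at_def U_def .
  then obtain d y where d: "\<And>J. d J holomorphic_on U J" "\<And>J. \<exists>s\<in>U J. d J s \<noteq> 0" "\<And>J. y J holomorphic_on U J"
    "\<And>J s. s \<in> U J \<Longrightarrow> Re s > 1 \<Longrightarrow> y J s = d J s * G s" by metis
  \<comment> \<open>The comparison is made after cross-multiplication, so that zeros of the
    denominators are no obstacle. The smaller of two nested strips is connected and meets Re s > 1
    in the point 2.\<close>
  have compat: "y m s * d n s = y n s * d m s" if mn: "s \<in> U m" "s \<in> U n" for m n s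
  proof -
    let ?V = "U (min m n)"
    have V: "?V \<subseteq> U m" "?V \<subseteq> U n" by (auto intro!: mono)
    have s: "s \<in> ?V" using mn by (cases "m \<le> n") (auto simp: min_def)
    show ?thesis
    proof (rule analytic_continuation_open[where s = "?V \<inter> {s. Re s > 1}" and s' = "?V"
          and f = "\<lambda>s. y m s * d n s" and g = "\<lambda>s. y n s * d m s"])
      show "open (?V \<inter> {s. Re s > 1})" using U open_Re_gt by blast
      have "of_real 2 \<in> ?V" unfolding U_def by (rule strip_real) auto
      then show "?V \<inter> {s. Re s > 1} \<noteq> {}" by auto
      show "(\<lambda>s. y m s * d n s) holomorphic_on ?V" "(\<lambda>s. y n s * d m s) holomorphic_on ?V"
        using d(1,3) V holomorphic_on_subset by (blast intro!: holomorphic_on_mult)+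
      show "y m z * d n z = y n z * d m z" if "z \<in> ?V \<inter> {s. Re s > 1}" for z
      proof -
        have "y m z = d m z * G z" "y n z = d n z * G z" using that d(4) V by blast+
        then show ?thesis by simp
      qed
    qed (use U s in auto)
  qed
  \<comment> \<open>Where all denominators vanish the choice is arbitrary and the value meaningless;
    such points are isolated, and meromorphy is insensitive to them.\<close>
  define F where "F s = (if Re s > 1 then G s else
     (let m = (SOME m. s \<in> U m \<and> d m s \<noteq> 0) in y m s / d m s))" for s
  have F: "F s = y n s / d n s" if n: "s \<in> U n" "d n s \<noteq> 0" for n s
  proof (cases "Re s > 1")
    case True
    then show ?thesis using d(4)[OF n(1) True] n(2) by (simp add: F_def)
  next
    case False
    define m where "m = (SOME m. s \<in> U m \<and> d m s \<noteq> 0)"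
    have m: "s \<in> U m \<and> d m s \<noteq> 0" unfolding m_def by (rule someI[of _ n]) (use n in blast)
    have "F s = y m s / d m s" using False by (simp add: F_def Let_def m_def)
    also have "\<dots> = y n s / d n s" using compat[of s m n] m n by (simp add: frac_eq_eq)
    finally show ?thesis .
  qed
  have Fmero: "F meromorphic_on {s}" for s
  proof -
    obtain n where n: "s \<in> U n" using UN_strip[of s] unfolding U_def by blast
    obtain s1 where s1: "s1 \<in> U n" "d n s1 \<noteq> 0" using d(2) by blast
    have "(\<lambda>s. y n s / d n s) meromorphic_on U n"
      using d(1,3) U(1) by (intro meromorphic_on_divide analytic_on_imp_meromorphic_on) (simp_all add: analytic_on_open)
    then have "(\<lambda>s. y n s / d n s) meromorphic_on {s}" by (rule meromorphic_on_subset) (use n in simp)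
    \<comment> \<open>Zeros of \<open>d n\<close> are isolated, so that F agrees with this quotient
      on a punctured neighbourhood, also at a possible pole.\<close>
    moreover have "eventually (\<lambda>w. F w = y n w / d n w) (at s)"
    proof -
      have "eventually (\<lambda>w. d n w \<noteq> 0 \<and> w \<in> U n) (at s)"
        by (rule non_zero_neighbour_alt[OF d(1) U(1,2) n s1])
      then show ?thesis by eventually_elim (use F in blast)
    qed
    ultimately show ?thesis by (subst meromorphic_on_cong[where g = "\<lambda>s. y n s / d n s" and B = "{s}"]) auto
  qed
  have FG: "F s = G s" if "Re s > 1" for s using that by (simp add: F_def)
  have "F holomorphic_on {s. Re s > 1}" using G by (rule holomorphic_transform) (simp add: FG)
  then have "F analytic_on {s. Re s > 1}" by (simp add: analytic_on_open open_Re_gt)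
  moreover have "F meromorphic_on UNIV" using Fmero meromorphic_on_UN[of UNIV F "\<lambda>s. {s}"] by simp
  ultimately show ?thesis using that FG by blast
qed

section \<open>The series with modular symbols\<close>

context hyperbolic_group
begin

lemma mero_ext_mero_ext_at: "mero_ext U u \<Longrightarrow> z \<in> \<H> \<Longrightarrow> mero_ext_at U (\<lambda>s. u s z)"
  unfolding mero_ext_def mero_ext_at_def using autfam_holomorphic by meson

text \<open>Every symbol is a difference A(g z) - A(z). Expanding the product leaves, for each
  subset S, a term of a partial series times a coefficient that depends neither on s nor on the
  coset.\<close>

lemma E_term_expand:
  assumes A: "\<And>k. k \<in> {1..n} \<Longrightarrow> modular_symbol (coset_rep C) (\<alpha> k) =
      - 2 * of_real pi * \<i> * of_real (A k (psl2_act (coset_rep C) z) - A k z)"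
  shows "E_term n \<alpha> z s C = (\<Sum>S\<in>Pow {1..n}.
     ((- 2 * of_real pi * \<i>) ^ n * of_real (\<Prod>k\<in>{1..n} - S. - A k z)) *
     (of_real (\<Prod>k\<in>S. A k (psl2_act (coset_rep C) z)) * \<phi> s (psl2_act (coset_rep C) z)))"
proof -
  have "(\<Prod>k=1..n. modular_symbol (coset_rep C) (\<alpha> k)) =
      (- 2 * of_real pi * \<i>) ^ n * of_real (\<Prod>k=1..n. A k (psl2_act (coset_rep C) z) + - A k z)"
  proof -
    have "(\<Prod>k=1..n. modular_symbol (coset_rep C) (\<alpha> k)) =
        (\<Prod>k=1..n. - 2 * of_real pi * \<i> * of_real (A k (psl2_act (coset_rep C) z) + - A k z))"
      by (rule prod.cong) (use A in simp_all)
    then show ?thesis by (simp only: prod.distrib prod_constant of_real_prod power_mult_distrib card_atLeastAtMost diff_Suc_1)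
  qed
  also have "(\<Prod>k=1..n. A k (psl2_act (coset_rep C) z) + - A k z) =
     (\<Sum>S\<in>Pow {1..n}. (\<Prod>k\<in>S. A k (psl2_act (coset_rep C) z)) * (\<Prod>k\<in>{1..n} - S. - A k z))"
    by (rule prod_add) simp
  finally show ?thesis
    unfolding E_term_def E_summand_def coset_rep_def ht_def
    by (simp add: sum_distrib_left sum_distrib_right mult_ac)
qed

theorem E_series_continuation:
  assumes f: "\<And>k. k \<in> {1..n} \<Longrightarrow> weight2_form \<Gamma> (f k)"
    and \<alpha>: "\<And>k. k \<in> {1..n} \<Longrightarrow> \<alpha> k = Re_form (f k) \<or> \<alpha> k = Im_form (f k)"
    and 0: "\<And>k. k \<in> {1..n} \<Longrightarrow> modular_symbol \<gamma>1 (\<alpha> k) = 0"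
    and z: "z \<in> \<H>"
  shows "\<And>s. Re s > 1 \<Longrightarrow> (\<lambda>C. norm (E_term n \<alpha> z s C)) summable_on cosets"
    "\<exists>F. F meromorphic_on UNIV \<and> F analytic_on {s. Re s > 1} \<and>
         (\<forall>s. Re s > 1 \<longrightarrow> F s = (\<Sum>\<^sub>\<infinity>C\<in>cosets. E_term n \<alpha> z s C))"
proof -
  have "\<exists>B. additive B \<and> (\<forall>g\<in>\<Gamma>. \<forall>z\<in>\<H>. modular_symbol g (\<alpha> k) = - 2 * of_real pi * \<i> * of_real (B (psl2_act g z) - B z))"
    if k: "k \<in> {1..n}" for k
    using weight2_additive[OF f[OF k] \<alpha>[OF k] 0[OF k]] by metis
  then obtain A where A: "\<And>k. k \<in> {1..n} \<Longrightarrow> additive (A k)"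
    "\<And>k g z. k \<in> {1..n} \<Longrightarrow> g \<in> \<Gamma> \<Longrightarrow> z \<in> \<H> \<Longrightarrow> modular_symbol g (\<alpha> k) = - 2 * of_real pi * \<i> * of_real (A k (psl2_act g z) - A k z)"
    by metis
  let ?c = "\<lambda>S. (- 2 * of_real pi * \<i>) ^ n * of_real (\<Prod>k\<in>{1..n} - S. - A k z) :: complex"
  let ?t = "\<lambda>S s C. of_real (\<Prod>k\<in>S. A k (psl2_act (coset_rep C) z)) * \<phi> s (psl2_act (coset_rep C) z)"
  have E: "E_term n \<alpha> z s C = (\<Sum>S\<in>Pow {1..n}. ?c S * ?t S s C)" if "C \<in> cosets" for s C
    using A(2)[OF _ coset_rep_in[OF that] z] by (rule E_term_expand)
  have fin: "finite S" and add: "\<And>k. k \<in> S \<Longrightarrow> additive (A k)" if "S \<in> Pow {1..n}" for S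
    using that finite_subset A(1) by auto
  have CFS: "cylfam {s. Re s > 1} (\<lambda>s z. of_real (\<Prod>k\<in>S. A k z) * \<phi> s z)" if "S \<in> Pow {1..n}" for S
    using fin[OF that] add[OF that] by (rule E_part_cylfam)
  define G where "G s = (\<Sum>S\<in>Pow {1..n}. ?c S * E_part A S s z)" for s
  have has: "((\<lambda>C. E_term n \<alpha> z s C) has_sum G s) cosets" if s: "Re s > 1" for s
  proof -
    have s': "s \<in> {s. Re s > 1}" using s by simp
    have "((\<lambda>C. \<Sum>S\<in>Pow {1..n}. ?c S * ?t S s C) has_sum G s) cosets"
      unfolding G_def E_part_def
      using poinc_has_sum(1)[OF CFS s' z] by (intro has_sum_finite_sum has_sum_cmult_right) auto
    then show ?thesis using E by (subst has_sum_cong[where g = "\<lambda>C. \<Sum>S\<in>Pow {1..n}. ?c S * ?t S s C"]) auto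
  qed
  \<comment> \<open>For complex families, unconditional summability already is absolute
    summability.\<close>
  show "(\<lambda>C. norm (E_term n \<alpha> z s C)) summable_on cosets" if s: "Re s > 1" for s
    using has[OF s] summable_on_iff_abs_summable_on_complex by (auto simp: summable_on_def)
  have hol: "(\<lambda>s. E_part A S s z) holomorphic_on {s. Re s > 1}" if S: "S \<in> Pow {1..n}" for S
  proof -
    have "autfam {s. Re s > 1} (E_part A S)" using fin[OF S] add[OF S] by (rule E_part_autfam)
    then show ?thesis using z by (rule autfam_holomorphic)
  qed
  have G: "G holomorphic_on {s. Re s > 1}"
    unfolding G_def by (intro holomorphic_on_sum holomorphic_on_mult[OF holomorphic_on_const] hol)
  have "mero_ext_at (strip (1 - 2 * real J) (real J + 1)) G" for J
    unfolding G_def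
  proof (intro mero_ext_at_sum mero_ext_at_scale open_strip connected_strip)
    fix S assume "S \<in> Pow {1..n}"
    then have "mero_ext (strip (1 - 2 * real J) (real J + 1)) (E_part A S)"
      by (intro E_part_mero_ext[where I = "{1..n}"] A(1)) auto
    then show "mero_ext_at (strip (1 - 2 * real J) (real J + 1)) (\<lambda>s. E_part A S s z)" using z by (rule mero_ext_mero_ext_at)
  qed (use strip_real[of "real J + 1" "1 - 2 * real J" 2] in auto)
  from meromorphic_glue[OF G this] obtain F where F: "F meromorphic_on UNIV" "F analytic_on {s. Re s > 1}"
    "\<And>s. Re s > 1 \<Longrightarrow> F s = G s" by blast
  show "\<exists>F. F meromorphic_on UNIV \<and> F analytic_on {s. Re s > 1} \<and>
         (\<forall>s. Re s > 1 \<longrightarrow> F s = (\<Sum>\<^sub>\<infinity>C\<in>cosets. E_term n \<alpha> z s C))"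
    using F infsumI[OF has] by metis
qed

end

theorem theorem4p5:
  fixes \<Gamma> \<Gamma>1 :: "(real^2^2) set set" and \<gamma>1 :: "(real^2^2) set" and \<mu> :: real
    and n :: nat and f :: "nat \<Rightarrow> complex \<Rightarrow> complex" and \<alpha> :: "nat \<Rightarrow> one_form"
  assumes "discrete_subgroup \<Gamma>" and "cocompact \<Gamma>"
    and "\<mu> > 1"
    and "\<gamma>1 = psl2_class (vector [vector [sqrt \<mu>, 0], vector [0, inverse (sqrt \<mu>)]])"
    and "\<gamma>1 \<in> \<Gamma>"
    and "\<Gamma>1 = generate PSL2R {\<gamma>1}"
    and "n \<ge> 1"
    and "\<And>k. k \<in> {1..n} \<Longrightarrow> weight2_form \<Gamma> (f k)"
    and "\<And>k. k \<in> {1..n} \<Longrightarrow> \<alpha> k = Re_form (f k) \<or> \<alpha> k = Im_form (f k)"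
    and "\<And>k. k \<in> {1..n} \<Longrightarrow> modular_symbol \<gamma>1 (\<alpha> k) = 0"
  shows "\<exists>\<sigma>0 :: real. \<forall>z\<in>\<H>.
    (\<forall>s. Re s > \<sigma>0 \<longrightarrow> (\<lambda>C. norm (E_term n \<alpha> z s C)) summable_on coset_space \<Gamma>1 \<Gamma>) \<and>
    (\<exists>F. F meromorphic_on UNIV \<and> F analytic_on {s. Re s > 1} \<and>
         (\<forall>s. Re s > \<sigma>0 \<longrightarrow> F s = (\<Sum>\<^sub>\<infinity>C\<in>coset_space \<Gamma>1 \<Gamma>. E_term n \<alpha> z s C)))"
proof -
  interpret hyperbolic_group \<Gamma> \<mu> \<gamma>1
    using assms(1-5) by unfold_locales auto
  have cosets: "coset_space \<Gamma>1 \<Gamma> = cosets" unfolding assms(6) cosets_def \<Gamma>1_def ..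
  note * = E_series_continuation[where f = f and \<alpha> = \<alpha> and n = n, OF assms(8-10)]
  \<comment> \<open>The abscissa is 1 and the same for all z, so that the half-plane of convergence
    coincides with the claimed half-plane of analyticity.\<close>
  show ?thesis
    unfolding cosets by (intro exI[of _ 1] ballI conjI allI impI; rule *)
qed

end
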